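(* Let $K$ be a field and $S=K[x_1,\ldots,x_n]$. Suppose that the following (the Boij–Söderberg conjecture) holds: for every $s$ and any two strictly increasing sequences of integers $m=(m_0,\ldots,m_s)$ and $M=(M_0,\ldots,M_s)$, the set $\bar B_{m,M}$ of normalized Betti diagrams is the convex hull (with rational coefficients) of the set $\Pi_{m,M}$ of pure diagrams. Then for every $s$ and every finitely generated graded Cohen-Macaulay $S$-module $N\neq 0$ of codimension $s$ generated in degree $0$, with minimal shifts $m_1,\ldots,m_s$, maximal shifts $M_1,\ldots,M_s$ and minimal number of generators $\beta_0$, one has $$\beta_0\frac{m_1m_2\cdots m_s}{(s+i)!}h_i(m_1,\ldots,m_s)\le e_i(N)\le \beta_0\frac{M_1M_2\cdots M_s}{(s+i)!}h_i(M_1,\ldots,M_s)\quad\text{for } i=0,1,\ldots,n-s.$$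
   Context: $S$ has the standard grading and $0\le s\le n$; the codimension of $N$ is $n-\dim N$. Hilbert coefficients: for a finitely generated graded $S$-module $N$ of dimension $d$, put $H(N,i)=\sum_{j\le i}\dim_K N_j$. There is a polynomial $P_N(x)\in\mathbb{Q}[x]$ with $H(N,i)=P_N(i)$ for $i\gg0$, uniquely written as $P_N(x)=\sum_{i=0}^{d}(-1)^i e_i(N)\binom{x+d-i}{d-i}$ with integers $e_i(N)$, the Hilbert coefficients of $N$. For integers $d_1,\ldots,d_s$ and $i\ge 0$: $h_i(d_1,\ldots,d_s)=\sum_{1\le j_1\le\cdots\le j_i\le s}\prod_{k=1}^i(d_{j_k}-(j_k+k-1))$, with $h_0=1$. Graded Betti numbers and shifts: $\beta_{i,j}=\beta_{i,j}(N)=\dim_K\mathrm{Tor}_i^S(N,K)_j$; the matrix $(\beta_{i,j})$ is the Betti diagram of $N$; $\beta_0=\sum_j\beta_{0,j}$; the minimal and maximal shifts in homological degree $i$ are $m_i=\min\{j:\beta_{i,j}\ne0\}$ and $M_i=\max\{j:\beta_{i,j}\neq0\}$. Diagrams: for strictly increasing integer sequences $m=(m_0,\ldots,m_s)$, $M=(M_0,\ldots,M_s)$, $V_{m,M}$ is the $\mathbb{Q}$-vector space of all matrices $(\beta_{i,j})$ with rational entries such that (a) $\sum_{i,j}(-1)^i j^{t}\beta_{i,j}=0$ for $t=0,1,\ldots,s-1$ (with $0^0=1$), and (b) $\beta_{i,j}=0$ whenever $j<m_i$ or $j>M_i$ (or $i<0$ or $i>s$). $B_{m,M}\subseteq V_{m,M}$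 is the set of those matrices in $V_{m,M}$ which are Betti diagrams of (nonzero) finitely generated graded Cohen-Macaulay $S$-modules of codimension $s$. The normalized Betti diagram of $(\beta_{i,j})\in B_{m,M}$ is $(\beta_{i,j}/\beta_0)$ with $\beta_0=\sum_j\beta_{0,j}$, and $\bar B_{m,M}$ is the set of all normalized Betti diagrams of elements of $B_{m,M}$. Pure diagrams: for a strictly increasing integer sequence $d=(d_0,\ldots,d_s)$, the pure diagram $\pi(d)$ is the matrix with $\pi(d)_{0,d_0}=1$, $\pi(d)_{i,d_i}=(-1)^{i+1}\prod_{k\ne i,\,k\neq 0}\frac{d_k-d_0}{d_k-d_i}$ for $1\le i\le s$ (product over $1\le k\le s$, $k\ne i$), and $\pi(d)_{i,j}=0$ if $j\ne d_i$. $\Pi_{m,M}$ is the set of all pure diagrams in $V_{m,M}$, equivalently all $\pi(d)$ with $d$ strictly increasing and $m_i\le d_i\le M_i$ for all $i$. The convex hull is taken in the $\mathbb{Q}$-vector space $V_{m,M}$, i.e. it is the set of finite sums $\sum c_\pi\pi$ with $\pi\in\Pi_{m,M}$, $c_\pi\in\mathbb{Q}_{\ge0}$, $\sum c_\pi=1$. *)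

theory Defs
  imports
    "HOL-Algebra.Ideal"
    "HOL-Library.Poly_Mapping"
    "HOL-Library.Extended_Nat"
    "HOL-Computational_Algebra.Polynomial"
    "Jordan_Normal_Form.VS_Connect"
begin

section \<open>The graded polynomial ring\<close>

text \<open>
  A polynomial maps exponent vectors to coefficients. The variables \<open>x\<^sub>1, \<dots>, x\<^sub>n\<close> are numbered
  \<open>0, \<dots>, n - 1\<close>, and \<open>mpoly_ring n\<close> is the subring of the polynomials that only involve them.
\<close>

type_synonym 'k mpol = "(nat \<Rightarrow>\<^sub>0 nat) \<Rightarrow>\<^sub>0 'k"

definition mpoly_ring :: "nat \<Rightarrow> 'k::field mpol ring" where
  "mpoly_ring n =
     \<lparr>carrier = {p. \<forall>u \<in> Poly_Mapping.keys p. Poly_Mapping.keys u \<subseteq> {..<n}},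
      mult = (*), one = 1, zero = 0, add = (+)\<rparr>"

definition const_pol :: "'k::field \<Rightarrow> 'k mpol" where
  "const_pol c = Poly_Mapping.single 0 c"

definition const_coeff :: "'k::field mpol \<Rightarrow> 'k" where
  "const_coeff p = Poly_Mapping.lookup p 0"

definition exp_degree :: "(nat \<Rightarrow>\<^sub>0 nat) \<Rightarrow> nat" where
  "exp_degree u = (\<Sum>i\<in>Poly_Mapping.keys u. Poly_Mapping.lookup u i)"

text \<open>The zero polynomial is homogeneous of every degree, and the only one of negative degree.\<close>

definition homogeneous_of_degree :: "int \<Rightarrow> 'k::field mpol \<Rightarrow> bool" where
  "homogeneous_of_degree a p \<longleftrightarrow> (\<forall>u \<in> Poly_Mapping.keys p. int (exp_degree u) = a)"

definition irrelevant_ideal :: "nat \<Rightarrow> 'k::field mpol set" where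
  "irrelevant_ideal n = {p \<in> carrier (mpoly_ring n). const_coeff p = 0}"


section \<open>Graded modules\<close>

text \<open>\<open>G j\<close> is the homogeneous component \<open>N\<^sub>j\<close>; the last conjunct says that \<open>N\<close> is their direct sum.\<close>

definition graded_module ::
  "nat \<Rightarrow> ('k::field mpol, 'm) module \<Rightarrow> (int \<Rightarrow> 'm set) \<Rightarrow> bool" where
  "graded_module n N G \<longleftrightarrow>
     Module.module (mpoly_ring n) N \<and>
     (\<forall>j. additive_subgroup (G j) N) \<and>
     (\<forall>a j p x. p \<in> carrier (mpoly_ring n) \<longrightarrow> homogeneous_of_degree a p \<longrightarrow> x \<in> G j \<longrightarrow>
        p \<odot>\<^bsub>N\<^esub> x \<in> G (a + j)) \<and>
     (\<forall>x \<in> carrier N. \<exists>!c. (\<forall>j. c j \<in> G j) \<and> finite {j. c j \<noteq> \<zero>\<^bsub>N\<^esub>} \<and>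
        x = (\<Oplus>\<^bsub>N\<^esub>j \<in> {j. c j \<noteq> \<zero>\<^bsub>N\<^esub>}. c j))"

definition finitely_generated :: "('a, 'r) ring_scheme \<Rightarrow> ('a, 'm) module \<Rightarrow> bool" where
  "finitely_generated R N \<longleftrightarrow>
     (\<exists>B. finite B \<and> B \<subseteq> carrier N \<and> LinearCombinations.module.span R N B = carrier N)"

definition generated_in_degree ::
  "nat \<Rightarrow> ('k::field mpol, 'm) module \<Rightarrow> (int \<Rightarrow> 'm set) \<Rightarrow> int \<Rightarrow> bool" where
  "generated_in_degree n N G j \<longleftrightarrow>
     LinearCombinations.module.span (mpoly_ring n) N (G j) = carrier N"


section \<open>Dimension, depth and Cohen-Macaulay modules\<close>

definition annihilator :: "('a, 'r) ring_scheme \<Rightarrow> ('a, 'm) module \<Rightarrow> 'a set" where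
  "annihilator R N = {a \<in> carrier R. \<forall>x \<in> carrier N. a \<odot>\<^bsub>N\<^esub> x = \<zero>\<^bsub>N\<^esub>}"

text \<open>The Krull dimension of \<open>R / Ann N\<close>, via chains of primes of \<open>R\<close> containing \<open>Ann N\<close>.\<close>

definition module_dim :: "('a, 'r) ring_scheme \<Rightarrow> ('a, 'm) module \<Rightarrow> enat" where
  "module_dim R N =
     Sup {enat l | l. \<exists>P. (\<forall>i\<le>l. primeideal (P i) R \<and> annihilator R N \<subseteq> P i) \<and>
                          (\<forall>i<l. P i \<subset> P (Suc i))}"

definition seq_submodule :: "('a, 'm) module \<Rightarrow> 'a list \<Rightarrow> 'm set" where
  "seq_submodule N fs =
     {\<Oplus>\<^bsub>N\<^esub>k \<in> {..<length fs}. fs ! k \<odot>\<^bsub>N\<^esub> y k | y. y \<in> {..<length fs} \<rightarrow> carrier N}"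

text \<open>
  \<open>seq_submodule N fs\<close> is \<open>(f\<^sub>1, \<dots>, f\<^sub>r) N\<close>; the first conjunct says that each \<open>f\<^sub>i\<close> is a
  nonzerodivisor on \<open>N / (f\<^sub>1, \<dots>, f\<^sub>i\<^sub>-\<^sub>1) N\<close>.
\<close>

definition regular_sequence :: "('a, 'm) module \<Rightarrow> 'a list \<Rightarrow> bool" where
  "regular_sequence N fs \<longleftrightarrow>
     (\<forall>i<length fs. \<forall>x \<in> carrier N.
        fs ! i \<odot>\<^bsub>N\<^esub> x \<in> seq_submodule N (take i fs) \<longrightarrow> x \<in> seq_submodule N (take i fs)) \<and>
     seq_submodule N fs \<noteq> carrier N"

definition depth :: "'a set \<Rightarrow> ('a, 'm) module \<Rightarrow> enat" where
  "depth I N = Sup {enat (length fs) | fs. set fs \<subseteq> I \<and> regular_sequence N fs}"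

text \<open>
  For a finitely generated graded module, being Cohen-Macaulay is tested at the graded maximal
  ideal. The zero module is excluded.
\<close>

definition cohen_macaulay :: "nat \<Rightarrow> ('k::field mpol, 'm) module \<Rightarrow> bool" where
  "cohen_macaulay n N \<longleftrightarrow>
     carrier N \<noteq> {\<zero>\<^bsub>N\<^esub>} \<and> depth (irrelevant_ideal n) N = module_dim (mpoly_ring n) N"

definition has_codim :: "nat \<Rightarrow> ('k::field mpol, 'm) module \<Rightarrow> nat \<Rightarrow> bool" where
  "has_codim n N s \<longleftrightarrow> module_dim (mpoly_ring n) N + enat s = enat n"

definition graded_CM_module ::
  "nat \<Rightarrow> nat \<Rightarrow> ('k::field mpol, 'm) module \<Rightarrow> (int \<Rightarrow> 'm set) \<Rightarrow> bool" where
  "graded_CM_module n s N G \<longleftrightarrow>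
     graded_module n N G \<and> finitely_generated (mpoly_ring n) N \<and>
     cohen_macaulay n N \<and> has_codim n N s"


section \<open>Hilbert coefficients\<close>

definition component_space ::
  "('k::field mpol, 'm) module \<Rightarrow> (int \<Rightarrow> 'm set) \<Rightarrow> int \<Rightarrow> ('k, 'm) module" where
  "component_space N G j =
     \<lparr>carrier = G j, mult = mult N, one = one N, zero = zero N, add = add N,
      smult = (\<lambda>c x. const_pol c \<odot>\<^bsub>N\<^esub> x)\<rparr>"

text \<open>
  The sum over all \<open>j \<le> i\<close> is restricted to the nonzero components so that, for finitely generated
  \<open>N\<close>, its index set is finite.
\<close>

definition cumulative_hilbert ::
  "('k::field mpol, 'm) module \<Rightarrow> (int \<Rightarrow> 'm set) \<Rightarrow> int \<Rightarrow> nat" where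
  "cumulative_hilbert N G i =
     (\<Sum>j | j \<le> i \<and> G j \<noteq> {\<zero>\<^bsub>N\<^esub>}. vectorspace.dim class_ring (component_space N G j))"

definition hilbert_poly ::
  "('k::field mpol, 'm) module \<Rightarrow> (int \<Rightarrow> 'm set) \<Rightarrow> rat poly" where
  "hilbert_poly N G =
     (THE P. \<exists>i0. \<forall>i\<ge>i0. poly P (of_int i) = of_nat (cumulative_hilbert N G i))"

definition hilbert_coeff ::
  "nat \<Rightarrow> ('k::field mpol, 'm) module \<Rightarrow> (int \<Rightarrow> 'm set) \<Rightarrow> nat \<Rightarrow> int" where
  "hilbert_coeff n N G =
     (let d = the_enat (module_dim (mpoly_ring n) N) in
      THE e. (\<forall>i>d. e i = 0) \<and>
        (\<forall>x. poly (hilbert_poly N G) x =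
           (\<Sum>i\<le>d. (-1) ^ i * of_int (e i) * ((x + of_nat (d - i)) gchoose (d - i)))))"


section \<open>Graded Betti numbers\<close>

text \<open>The linear map with matrix \<open>A\<close>, from column vectors indexed by \<open>J\<close> to those indexed by \<open>I\<close>.\<close>

definition mat_map ::
  "'i set \<Rightarrow> 'j set \<Rightarrow> ('i \<Rightarrow> 'j \<Rightarrow> 'a::comm_ring_1) \<Rightarrow> ('j \<Rightarrow> 'a) \<Rightarrow> 'i \<Rightarrow> 'a" where
  "mat_map I J A v = (\<lambda>k\<in>I. \<Sum>l\<in>J. A k l * v l)"

text \<open>
  A graded free resolution \<open>\<dots> \<rightarrow> F\<^sub>1 \<rightarrow> F\<^sub>0 \<rightarrow> N \<rightarrow> 0\<close> by free modules of finite rank. \<open>F\<^sub>i\<close> has rank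
  \<open>r i\<close>, its \<open>k\<close>-th basis element has degree \<open>a i k\<close>, so \<open>F\<^sub>i\<close> is the direct sum of the
  \<open>S(- a i k)\<close>, and \<open>A i\<close> is the matrix of \<open>F\<^sub>i\<^sub>+\<^sub>1 \<rightarrow> F\<^sub>i\<close>. The augmentation sends the \<open>k\<close>-th basis
  element of \<open>F\<^sub>0\<close> to \<open>g k\<close>.
\<close>

definition free_vecs :: "nat \<Rightarrow> nat \<Rightarrow> (nat \<Rightarrow> 'k::field mpol) set" where
  "free_vecs n r = {..<r} \<rightarrow>\<^sub>E carrier (mpoly_ring n)"

definition graded_free_resolution ::
  "nat \<Rightarrow> ('k::field mpol, 'm) module \<Rightarrow> (int \<Rightarrow> 'm set) \<Rightarrow>
   (nat \<Rightarrow> nat) \<Rightarrow> (nat \<Rightarrow> nat \<Rightarrow> int) \<Rightarrow> (nat \<Rightarrow> nat \<Rightarrow> nat \<Rightarrow> 'k mpol) \<Rightarrow> bool" where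
  "graded_free_resolution n N G r a A \<longleftrightarrow>
     (\<forall>i. \<forall>k<r i. \<forall>l<r (Suc i).
        A i k l \<in> carrier (mpoly_ring n) \<and>
        homogeneous_of_degree (a (Suc i) l - a i k) (A i k l)) \<and>
     (\<forall>i. {v \<in> free_vecs n (r (Suc i)).
             mat_map {..<r i} {..<r (Suc i)} (A i) v = (\<lambda>k\<in>{..<r i}. 0)} =
          mat_map {..<r (Suc i)} {..<r (Suc (Suc i))} (A (Suc i)) ` free_vecs n (r (Suc (Suc i)))) \<and>
     (\<exists>g. (\<forall>k<r 0. g k \<in> G (a 0 k)) \<and>
          (let aug = (\<lambda>v. \<Oplus>\<^bsub>N\<^esub>k \<in> {..<r 0}. v k \<odot>\<^bsub>N\<^esub> g k) in
             aug ` free_vecs n (r 0) = carrier N \<and>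
             {v \<in> free_vecs n (r 0). aug v = \<zero>\<^bsub>N\<^esub>} =
               mat_map {..<r 0} {..<r 1} (A 0) ` free_vecs n (r 1)))"

text \<open>
  Tensoring with \<open>K = S / (x\<^sub>1, \<dots>, x\<^sub>n)\<close> replaces matrix entries by their constant coefficients, and
  the degree \<open>j\<close> part of \<open>F\<^sub>i \<otimes> K\<close> is the \<open>K\<close>-space on the basis elements of degree \<open>j\<close>.
  So \<open>Tor\<^sub>i(N, K)\<^sub>j\<close> is the homology \<open>tor_cycles / tor_boundaries\<close> of the complex below; its
  dimension is the difference of dimensions since these spaces are finite-dimensional.
\<close>

definition tor_index :: "(nat \<Rightarrow> nat) \<Rightarrow> (nat \<Rightarrow> nat \<Rightarrow> int) \<Rightarrow> nat \<Rightarrow> int \<Rightarrow> nat set" where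
  "tor_index r a i j = {k. k < r i \<and> a i k = j}"

definition tor_diff ::
  "(nat \<Rightarrow> nat) \<Rightarrow> (nat \<Rightarrow> nat \<Rightarrow> int) \<Rightarrow> (nat \<Rightarrow> nat \<Rightarrow> nat \<Rightarrow> 'k::field mpol) \<Rightarrow>
   nat \<Rightarrow> int \<Rightarrow> (nat \<Rightarrow> 'k) \<Rightarrow> nat \<Rightarrow> 'k" where
  "tor_diff r a A i j =
     mat_map (tor_index r a i j) (tor_index r a (Suc i) j) (\<lambda>k l. const_coeff (A i k l))"

definition tor_chains ::
  "'k::field itself \<Rightarrow> (nat \<Rightarrow> nat) \<Rightarrow> (nat \<Rightarrow> nat \<Rightarrow> int) \<Rightarrow> nat \<Rightarrow> int \<Rightarrow> ('k, nat \<Rightarrow> 'k) module" where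
  "tor_chains _ r a i j = ring.func_space class_ring (tor_index r a i j)"

definition tor_cycles ::
  "(nat \<Rightarrow> nat) \<Rightarrow> (nat \<Rightarrow> nat \<Rightarrow> int) \<Rightarrow> (nat \<Rightarrow> nat \<Rightarrow> nat \<Rightarrow> 'k::field mpol) \<Rightarrow>
   nat \<Rightarrow> int \<Rightarrow> (nat \<Rightarrow> 'k) set" where
  "tor_cycles r a A i j =
     (case i of
        0 \<Rightarrow> carrier (tor_chains TYPE('k) r a 0 j)
      | Suc i' \<Rightarrow> {v \<in> carrier (tor_chains TYPE('k) r a (Suc i') j).
                    tor_diff r a A i' j v = \<zero>\<^bsub>tor_chains TYPE('k) r a i' j\<^esub>})"

definition tor_boundaries ::
  "(nat \<Rightarrow> nat) \<Rightarrow> (nat \<Rightarrow> nat \<Rightarrow> int) \<Rightarrow> (nat \<Rightarrow> nat \<Rightarrow> nat \<Rightarrow> 'k::field mpol) \<Rightarrow>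
   nat \<Rightarrow> int \<Rightarrow> (nat \<Rightarrow> 'k) set" where
  "tor_boundaries r a A i j =
     tor_diff r a A i j ` carrier (tor_chains TYPE('k) r a (Suc i) j)"

definition tor_dim ::
  "(nat \<Rightarrow> nat) \<Rightarrow> (nat \<Rightarrow> nat \<Rightarrow> int) \<Rightarrow> (nat \<Rightarrow> nat \<Rightarrow> nat \<Rightarrow> 'k::field mpol) \<Rightarrow>
   nat \<Rightarrow> int \<Rightarrow> nat" where
  "tor_dim r a A i j =
     vectorspace.dim class_ring (tor_chains TYPE('k) r a i j\<lparr>carrier := tor_cycles r a A i j\<rparr>) -
     vectorspace.dim class_ring (tor_chains TYPE('k) r a i j\<lparr>carrier := tor_boundaries r a A i j\<rparr>)"

text \<open>As usual for derived functors, \<open>Tor\<close> is computed from a chosen resolution.\<close>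

definition betti ::
  "nat \<Rightarrow> ('k::field mpol, 'm) module \<Rightarrow> (int \<Rightarrow> 'm set) \<Rightarrow> nat \<Rightarrow> int \<Rightarrow> nat" where
  "betti n N G =
     (let (r, a, A) = (SOME (r, a, A). graded_free_resolution n N G r a A) in tor_dim r a A)"

definition min_shift ::
  "nat \<Rightarrow> ('k::field mpol, 'm) module \<Rightarrow> (int \<Rightarrow> 'm set) \<Rightarrow> nat \<Rightarrow> int" where
  "min_shift n N G i = Min {j. betti n N G i j \<noteq> 0}"

definition max_shift ::
  "nat \<Rightarrow> ('k::field mpol, 'm) module \<Rightarrow> (int \<Rightarrow> 'm set) \<Rightarrow> nat \<Rightarrow> int" where
  "max_shift n N G i = Max {j. betti n N G i j \<noteq> 0}"

definition betti0 :: "nat \<Rightarrow> ('k::field mpol, 'm) module \<Rightarrow> (int \<Rightarrow> 'm set) \<Rightarrow> nat" where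
  "betti0 n N G = (\<Sum>j | betti n N G 0 j \<noteq> 0. betti n N G 0 j)"


section \<open>Diagrams\<close>

text \<open>
  Rows are indexed by natural numbers, so entries with negative homological degree do not occur.
  Only the values on \<open>{0..s}\<close> of the sequences \<open>m\<close>, \<open>M\<close>, \<open>d\<close> matter.
\<close>

type_synonym diagram = "nat \<Rightarrow> int \<Rightarrow> rat"

definition diagram_space :: "nat \<Rightarrow> (nat \<Rightarrow> int) \<Rightarrow> (nat \<Rightarrow> int) \<Rightarrow> diagram set" where
  "diagram_space s m M =
     {D. (\<forall>t<s. (\<Sum>i\<le>s. \<Sum>j=m i..M i. (-1) ^ i * of_int j ^ t * D i j) = 0) \<and>
         (\<forall>i j. i > s \<or> j < m i \<or> j > M i \<longrightarrow> D i j = 0)}"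

text \<open>
  Every finitely generated module over \<open>S = K[x\<^sub>1, \<dots>, x\<^sub>n]\<close> is isomorphic to some \<open>S\<^sup>r / U\<close>. Its elements
  are cosets, that is, sets of vectors over \<open>S\<close>, so it suffices to let \<open>N\<close> range over modules whose
  elements have the type \<open>(nat \<Rightarrow> 'k mpol) set\<close>.
\<close>

definition betti_diagrams ::
  "'k::field itself \<Rightarrow> nat \<Rightarrow> nat \<Rightarrow> (nat \<Rightarrow> int) \<Rightarrow> (nat \<Rightarrow> int) \<Rightarrow> diagram set" where
  "betti_diagrams _ n s m M =
     {D \<in> diagram_space s m M.
        \<exists>(N :: ('k mpol, (nat \<Rightarrow> 'k mpol) set) module) G.
          graded_CM_module n s N G \<and> D = (\<lambda>i j. of_nat (betti n N G i j))}"

definition normalize_diagram :: "diagram \<Rightarrow> diagram" where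
  "normalize_diagram D = (\<lambda>i j. D i j / (\<Sum>j' | D 0 j' \<noteq> 0. D 0 j'))"

definition normalized_betti_diagrams ::
  "'k::field itself \<Rightarrow> nat \<Rightarrow> nat \<Rightarrow> (nat \<Rightarrow> int) \<Rightarrow> (nat \<Rightarrow> int) \<Rightarrow> diagram set" where
  "normalized_betti_diagrams K n s m M = normalize_diagram ` betti_diagrams K n s m M"

definition pure_diagram :: "nat \<Rightarrow> (nat \<Rightarrow> int) \<Rightarrow> diagram" where
  "pure_diagram s d i j =
     (if i > s \<or> j \<noteq> d i then 0
      else if i = 0 then 1
      else (-1) ^ (i + 1) * (\<Prod>k\<in>{1..s} - {i}. of_int (d k - d 0) / of_int (d k - d i)))"

definition pure_diagrams :: "nat \<Rightarrow> (nat \<Rightarrow> int) \<Rightarrow> (nat \<Rightarrow> int) \<Rightarrow> diagram set" where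
  "pure_diagrams s m M =
     {pure_diagram s d | d. strict_mono_on {0..s} d} \<inter> diagram_space s m M"

definition rat_convex_hull :: "diagram set \<Rightarrow> diagram set" where
  "rat_convex_hull X =
     {D. \<exists>F c. finite F \<and> F \<subseteq> X \<and> (\<forall>p\<in>F. c p \<ge> (0::rat)) \<and> (\<Sum>p\<in>F. c p) = 1 \<and>
         D = (\<lambda>i j. \<Sum>p\<in>F. c p * p i j)}"

text \<open>
  The list \<open>js\<close> is \<open>j\<^sub>1 \<le> \<dots> \<le> j\<^sub>i\<close>. Its positions are counted from \<open>0\<close>, so \<open>js ! k\<close> is
  \<open>j\<^sub>k\<^sub>+\<^sub>1\<close> and the factor \<open>d(j\<^sub>k) - (j\<^sub>k + k - 1)\<close> loses its \<open>- 1\<close>.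
\<close>

definition h_poly :: "nat \<Rightarrow> (nat \<Rightarrow> int) \<Rightarrow> nat \<Rightarrow> int" where
  "h_poly s d i =
     (\<Sum>js | length js = i \<and> sorted js \<and> set js \<subseteq> {1..s}.
        \<Prod>k<i. d (js ! k) - (int (js ! k) + int k))"

end

theory Submission
  imports Defs
    "HOL-Computational_Algebra.Formal_Power_Series"
    "HOL-Library.Function_Algebras"
begin

text \<open>
  Divided by \<open>\<beta>\<^sub>0\<close>, the bounds are values of a function of the shifts that increases with them, and
  \<open>e\<^sub>i(N)\<close> is a weighted mean of such values.

  Let \<open>\<beta>\<close> be the Betti diagram of \<open>N\<close> and \<open>E\<^sub>k = \<Sum>\<^sub>i\<^sub>j (- 1)\<^sup>i \<beta>\<^sub>i\<^sub>j (j choose k)\<close>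
  (\<open>binomial_moment\<close>). A graded free resolution writes the cumulative Hilbert function of \<open>N\<close> as an
  alternating sum of the functions \<open>T \<mapsto> (T - j + n choose n)\<close>, and Vandermonde's convolution turns it into
  \<open>\<Sum>\<^sub>k (- 1)\<^sup>k E\<^sub>k (T + n - k choose n - k)\<close> for large \<open>T\<close>. Its growth exponent is at most
  \<open>dim N = n - s\<close>, hence \<open>E\<^sub>k = 0\<close> for \<open>k < s\<close> and \<open>e\<^sub>i(N) = (- 1)\<^sup>s E\<^sub>s\<^sub>+\<^sub>i\<close>
  (\<open>hilbert_coeff_moment\<close>). For a pure diagram with shifts \<open>d\<close> the entries are, up to sign and a common
  factor, the weights of a divided difference with the nodes \<open>d\<^sub>0, \<dots>, d\<^sub>s\<close>, so that \<open>E\<^sub>s\<^sub>+\<^sub>i\<close> is a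
  divided difference of a falling factorial; it equals
  \<open>(- 1)\<^sup>s (d\<^sub>1 \<cdots> d\<^sub>s / (s + i)!) h\<^sub>i(d)\<close> by the common recursion of both sides
  (\<open>binomial_moment_pure\<close>).

  The vanishing of the \<open>E\<^sub>k\<close> puts \<open>\<beta>\<close> into a space of diagrams, for any window that contains its
  shifts, and the hypothesis makes \<open>\<beta> / \<beta>\<^sub>0\<close> a convex combination of pure diagrams. Pure diagrams have
  nonnegative entries, so the shifts of every pure diagram that occurs belong to the support of \<open>\<beta>\<close> and lie
  between the minimal and the maximal shifts. As \<open>E\<^sub>s\<^sub>+\<^sub>i\<close> is linear, the bounds follow from the
  monotonicity of \<open>d \<mapsto> d\<^sub>1 \<cdots> d\<^sub>s h\<^sub>i(d)\<close> on strictly increasing sequences with \<open>d\<^sub>0 = 0\<close>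
  (\<open>shift_bound_mono\<close>, \<open>convex_combination_bounds\<close>).

  Three facts of commutative algebra are behind this. First, finitely generated graded modules have graded
  free resolutions, by Dickson's lemma and division with remainder
  (\<open>homogeneous_submodule_finitely_generated\<close>). Second, \<open>Tor\<^sub>i(N, K)\<close> vanishes for \<open>i > s\<close>, and the image
  of \<open>F\<^sub>s\<^sub>+\<^sub>1 \<rightarrow> F\<^sub>s\<close> is free: a resolution stays exact modulo the variables from position \<open>n - r\<close> on if
  there is a regular sequence of length \<open>r\<close>, because each of its elements can be traded for one position by
  passing to a mapping cone (\<open>regular_sequence_exactness\<close>, \<open>free_syzygies\<close>). Third, the cumulative
  Hilbert function of \<open>S / I\<close> grows at most like the power of \<open>T\<close> given by the length of the chains of primes
  above \<open>I\<close>: an ideal maximal among those of too large growth is prime, and enlarging a prime by a form lowers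
  the exponent by at most one (\<open>prime_chain_of_large_growth\<close>).
\<close>

section \<open>Binomial polynomials and divided differences\<close>

definition binom_poly :: "nat \<Rightarrow> rat poly" where
  "binom_poly m = Polynomial.smult (1 / fact m) (\<Prod>i<m. [:of_nat (Suc i), 1:])"

lemma poly_binom_poly: "poly (binom_poly m) x = (x + of_nat m) gchoose m"
proof -
  have "(\<Prod>i<m. of_nat (Suc i) + x) = (\<Prod>i=0..<m. x + of_nat m - of_nat i)"
    by (rule prod.reindex_bij_witness[of _ "\<lambda>i. m - 1 - i" "\<lambda>i. m - 1 - i"])
       (auto simp: of_nat_diff)
  then show ?thesis
    by (simp add: binom_poly_def poly_prod gbinomial_prod_rev)
qed

lemma degree_binom_poly: "degree (binom_poly m) = m"
proof -
  have "degree (\<Prod>i<m. [:of_nat (Suc i), 1::rat:]) = (\<Sum>i<m. degree [:of_nat (Suc i), 1::rat:])"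
    by (rule degree_prod_eq_sum_degree) auto
  then show ?thesis by (simp add: binom_poly_def)
qed

lemma binom_poly_nonzero: "binom_poly m \<noteq> 0"
proof -
  have "(\<Prod>i<m. [:of_nat (Suc i), 1::rat:]) \<noteq> 0" by (subst prod_zero_iff) auto
  then show ?thesis by (simp add: binom_poly_def)
qed

text \<open>The summands have the distinct degrees \<open>n - k\<close>, so the coefficients are determined from the top degree
  downwards.\<close>

lemma binom_poly_sum_high_coeffs_zero:
  assumes "Q = (\<Sum>k\<le>n. Polynomial.smult (c k) (binom_poly (n - k)))"
    and high: "\<forall>m\<ge>N. coeff Q m = 0"
    and "k \<le> n" "N \<le> n - k"
  shows "c k = 0"
  using assms(3,4)
proof (induction k rule: less_induct)
  case (less k)
  have *: "c l * coeff (binom_poly (n - l)) (n - k) = 0" if "l \<le> n" "l \<noteq> k" for l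
  proof (cases "l < k")
    case True
    then show ?thesis using less.IH[of l] less.prems that by auto
  next
    case False
    then have "n - l < n - k" using that less.prems by auto
    then show ?thesis by (simp add: coeff_eq_0 degree_binom_poly)
  qed
  have "coeff Q (n - k) = (\<Sum>l\<le>n. c l * coeff (binom_poly (n - l)) (n - k))"
    using assms(1) by (simp add: coeff_sum)
  also have "\<dots> = (\<Sum>l\<in>{k}. c l * coeff (binom_poly (n - l)) (n - k))"
    by (rule sum.mono_neutral_right) (use less.prems * in auto)
  also have "\<dots> = c k * lead_coeff (binom_poly (n - k))"
    by (simp add: degree_binom_poly)
  finally show ?case
    using high less.prems binom_poly_nonzero[of "n - k"] by auto
qed

lemma poly_eventually_ge_lead_coeff:
  fixes p :: "rat poly"
  assumes "lead_coeff p > 0"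
  shows "\<exists>n. \<forall>x\<ge>n. poly p x \<ge> lead_coeff p"
  using assms
proof (induct p)
  case 0
  then show ?case by auto
next
  case (pCons a p)
  from this(1) consider "a \<noteq> 0" "p = 0" | "p \<noteq> 0" by auto
  then show ?case
  proof cases
    case 1
    then show ?thesis by auto
  next
    case 2
    have gt_0: "lead_coeff p > 0" using pCons(3) \<open>p \<noteq> 0\<close> by (simp split: if_splits)
    then obtain n1 where n1: "\<forall>x\<ge>n1. lead_coeff p \<le> poly p x" using pCons(2) by blast
    define n where "n = max n1 (1 + \<bar>a\<bar> / lead_coeff p)"
    have "lead_coeff (pCons a p) \<le> poly (pCons a p) x" if "n \<le> x" for x
    proof -
      have x: "lead_coeff p \<le> poly p x" "1 + \<bar>a\<bar> / lead_coeff p \<le> x"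
        using that n1 by (auto simp: n_def)
      then have "x \<ge> 0" using gt_0
        by (meson add_nonneg_nonneg divide_nonneg_pos abs_ge_zero order_trans zero_le_one)
      have "lead_coeff p + \<bar>a\<bar> = (1 + \<bar>a\<bar> / lead_coeff p) * lead_coeff p"
        using gt_0 \<open>p \<noteq> 0\<close> by (simp add: distrib_right)
      also have "\<dots> \<le> x * poly p x"
        using x gt_0 \<open>x \<ge> 0\<close> by (intro mult_mono) auto
      finally show ?thesis using 2 by (simp add: abs_if split: if_splits)
    qed
    then show ?thesis by blast
  qed
qed

text \<open>Were the degree larger than \<open>d\<close>, the sign of the leading coefficient of \<open>Q\<close> would violate
  one of the two inequalities for large arguments.\<close>

lemma degree_le_if_growth:
  fixes Q :: "rat poly"
  assumes nonneg: "\<And>T::nat. T \<ge> T0 \<Longrightarrow> 0 \<le> poly Q (of_nat T)"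
    and bound: "\<And>T::nat. T \<ge> T0 \<Longrightarrow> poly Q (of_nat T) \<le> C * (of_nat T + 1) ^ d"
  shows "degree Q \<le> d"
proof (rule ccontr)
  assume "\<not> degree Q \<le> d"
  then have deg: "d < degree Q" by simp
  then have Q0: "Q \<noteq> 0" by auto
  define R where "R = Polynomial.smult C ([:1, 1:] ^ d)"
  have Rd: "degree R < degree Q"
    using deg degree_smult_le[of C "[:1,1:]^d"] degree_power_eq[of "[:1,1::rat:]" d]
    by (simp add: R_def)
  have contra: False if lc: "lead_coeff P > 0" and le: "\<And>T. T \<ge> T0 \<Longrightarrow> poly P (of_nat T) \<le> 0"
    for P :: "rat poly"
  proof -
    obtain x0 where x0: "\<And>x. x \<ge> x0 \<Longrightarrow> lead_coeff P \<le> poly P x"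
      using poly_eventually_ge_lead_coeff[OF lc] by blast
    obtain T1 :: nat where T1: "x0 \<le> of_nat T1" by (meson reals_Archimedean2 less_imp_le)
    have "x0 \<le> of_nat (max T0 T1)" using T1 by (simp add: of_nat_max)
    with x0[of "of_nat (max T0 T1)"] le[of "max T0 T1"] lc show False by simp
  qed
  show False
  proof (cases "lead_coeff Q > 0")
    case True
    have "degree (Q - R) = degree Q"
      by (metis Rd degree_add_eq_left degree_minus diff_conv_add_uminus)
    then have "lead_coeff (Q - R) = lead_coeff Q"
      using Rd by (simp add: coeff_eq_0)
    then show False using contra[of "Q - R"] bound True
      by (auto simp: R_def poly_power algebra_simps)
  next
    case False
    then have "lead_coeff (- Q) > 0"
      using Q0 by (metis degree_minus coeff_minus leading_coeff_0_iff neg_0_less_iff_less not_less_iff_gr_or_eq)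
    then show False using contra[of "- Q"] nonneg by auto
  qed
qed

text \<open>Vandermonde's convolution for \<open>y + (- x - 1)\<close>, after negating upper indices.\<close>

lemma gchoose_shift_expansion:
  fixes x y :: rat
  shows "(x - y + of_nat n) gchoose n =
    (\<Sum>k\<le>n. (- 1) ^ k * (y gchoose k) * ((x + of_nat (n - k)) gchoose (n - k)))"
proof -
  have neg: "(x + of_nat (n - k)) gchoose (n - k) = (- 1) ^ (n - k) * ((- x - 1) gchoose (n - k))" for k
    using gbinomial_negated_upper[of "x + of_nat (n - k)" "n - k"] by simp
  have "(\<Sum>k\<le>n. (- 1) ^ k * (y gchoose k) * ((x + of_nat (n - k)) gchoose (n - k))) =
        (\<Sum>k\<le>n. (- 1) ^ n * ((y gchoose k) * ((- x - 1) gchoose (n - k))))"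
  proof (rule sum.cong[OF refl])
    fix k assume "k \<in> {..n}"
    then have "(- 1 :: rat) ^ n = (- 1) ^ k * (- 1) ^ (n - k)"
      by (metis atMost_iff le_add_diff_inverse power_add)
    then show "(- 1) ^ k * (y gchoose k) * ((x + of_nat (n - k)) gchoose (n - k)) =
       (- 1) ^ n * ((y gchoose k) * ((- x - 1) gchoose (n - k)))"
      by (simp add: neg)
  qed
  also have "\<dots> = (- 1) ^ n * ((y + (- x - 1)) gchoose n)"
    by (simp add: sum_distrib_left[symmetric] gbinomial_Vandermonde[unfolded atLeast0AtMost])
  also have "\<dots> = (x - y + of_nat n) gchoose n"
    using gbinomial_negated_upper[of "x - y + of_nat n" n] by (simp add: algebra_simps)
  finally show ?thesis by simp
qed

definition falling :: "nat \<Rightarrow> rat \<Rightarrow> rat" where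
  "falling m x = (\<Prod>j<m. x - of_nat j)"

lemma gchoose_eq_falling: "x gchoose k = falling k x / fact k"
  by (simp add: falling_def gbinomial_prod_rev atLeast0LessThan)

lemma falling_Suc: "falling (Suc m) x = falling m x * (x - of_nat m)"
  by (simp add: falling_def)

definition node_weight :: "(nat \<Rightarrow> rat) \<Rightarrow> nat set \<Rightarrow> nat \<Rightarrow> rat" where
  "node_weight d A l = (\<Prod>k\<in>A - {l}. d l - d k)"

text \<open>The classical divided difference of \<open>f\<close> at the nodes \<open>d l\<close>, in Lagrange form.\<close>

definition divided_difference :: "(nat \<Rightarrow> rat) \<Rightarrow> nat set \<Rightarrow> (rat \<Rightarrow> rat) \<Rightarrow> rat" where
  "divided_difference d A f = (\<Sum>l\<in>A. f (d l) / node_weight d A l)"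

lemma node_weight_remove:
  assumes "finite A" "inj_on d A" "l \<in> A" "p \<in> A" "p \<noteq> l"
  shows "(d l - d p) / node_weight d A l = 1 / node_weight d (A - {p}) l"
proof -
  have "A - {l} = insert p (A - {p} - {l})" using assms by auto
  then have "node_weight d A l = (d l - d p) * node_weight d (A - {p}) l"
    using assms by (simp add: node_weight_def)
  moreover have "d l - d p \<noteq> 0" using assms by (auto dest: inj_onD)
  ultimately show ?thesis by simp
qed

text \<open>Multiplying the terms by \<open>d l - d r\<close> removes the node \<open>r\<close>. The sums for two nodes \<open>p\<close> and \<open>q\<close> differ by
  \<open>d p - d q\<close> times the divided difference, and they agree by induction.\<close>

lemma divided_difference_one:
  assumes "finite A" "inj_on d A" "A \<noteq> {}"
  shows "divided_difference d A (\<lambda>_. 1) = (if card A = 1 then 1 else 0)"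
  using assms
proof (induction "card A" arbitrary: A rule: less_induct)
  case less
  show ?case
  proof (cases "card A = 1")
    case True
    then obtain a where "A = {a}" by (auto simp: card_1_singleton_iff)
    then show ?thesis by (simp add: divided_difference_def node_weight_def)
  next
    case False
    obtain p where p: "p \<in> A" using less.prems by auto
    have "A \<noteq> {p}" using False by auto
    with p obtain q where q: "q \<in> A" "q \<noteq> p" by auto
    have pq: "d p \<noteq> d q" using p q less.prems by (auto dest: inj_onD)
    have IH: "divided_difference d (A - {r}) (\<lambda>_. 1) = (if card A - 1 = 1 then 1 else 0)"
      if "r \<in> A" for r
    proof -
      have "A - {r} \<noteq> {}" using p q that by auto
      moreover have "card (A - {r}) < card A" using that less.prems(1) by (meson card_Diff1_less)
      moreover have "inj_on d (A - {r})" using less.prems(2) by (auto intro: inj_on_subset)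
      ultimately show ?thesis using less.hyps[of "A - {r}"] less.prems(1) that by simp
    qed
    have full: "divided_difference d (A - {r}) (\<lambda>_. 1) = (\<Sum>l\<in>A. (d l - d r) / node_weight d A l)"
      if "r \<in> A" for r
    proof -
      have "(\<Sum>l\<in>A. (d l - d r) / node_weight d A l) = (\<Sum>l\<in>A - {r}. (d l - d r) / node_weight d A l)"
        using less.prems(1) by (intro sum.mono_neutral_right) auto
      also have "\<dots> = divided_difference d (A - {r}) (\<lambda>_. 1)"
        unfolding divided_difference_def
        by (rule sum.cong) (use node_weight_remove less.prems that in auto)
      finally show ?thesis by simp
    qed
    have "(d p - d q) * divided_difference d A (\<lambda>_. 1) =
        (\<Sum>l\<in>A. (d l - d q) / node_weight d A l) - (\<Sum>l\<in>A. (d l - d p) / node_weight d A l)"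
      by (simp add: divided_difference_def sum_distrib_left sum_subtractf[symmetric] diff_divide_distrib)
    also have "\<dots> = 0"
      using full[symmetric] IH p q by simp
    finally show ?thesis using pq False by simp
  qed
qed

lemma divided_difference_Leibniz:
  fixes s :: nat
  assumes "inj_on d {..Suc s}"
  shows "divided_difference d {..Suc s} (\<lambda>x. f x * (x - c)) =
    (d (Suc s) - c) * divided_difference d {..Suc s} f + divided_difference d {..s} f"
proof -
  have "divided_difference d {..Suc s} (\<lambda>x. f x * (x - c)) =
     (\<Sum>l\<le>Suc s. (d (Suc s) - c) * (f (d l) / node_weight d {..Suc s} l)
        + f (d l) * ((d l - d (Suc s)) / node_weight d {..Suc s} l))"
    unfolding divided_difference_def
    by (rule sum.cong[OF refl]) (simp add: field_simps add_divide_distrib diff_divide_distrib)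
  also have "\<dots> = (d (Suc s) - c) * divided_difference d {..Suc s} f +
     (\<Sum>l\<le>Suc s. f (d l) * ((d l - d (Suc s)) / node_weight d {..Suc s} l))"
    by (simp only: sum.distrib divided_difference_def sum_distrib_left)
  also have "(\<Sum>l\<le>Suc s. f (d l) * ((d l - d (Suc s)) / node_weight d {..Suc s} l)) =
      (\<Sum>l\<le>s. f (d l) * ((d l - d (Suc s)) / node_weight d {..Suc s} l))"
    by simp
  also have "\<dots> = divided_difference d {..s} f"
    unfolding divided_difference_def
  proof (rule sum.cong[OF refl])
    fix l assume "l \<in> {..s}"
    moreover have "{..Suc s} - {Suc s} = {..s}" by auto
    ultimately have "(d l - d (Suc s)) / node_weight d {..Suc s} l = 1 / node_weight d {..s} l"
      using node_weight_remove[OF _ assms, of l "Suc s"] by auto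
    then show "f (d l) * ((d l - d (Suc s)) / node_weight d {..Suc s} l) = f (d l) / node_weight d {..s} l"
      by simp
  qed
  finally show ?thesis .
qed

lemma divided_difference_falling_low:
  assumes "inj_on d {..s}" "m < s"
  shows "divided_difference d {..s} (falling m) = 0"
  using assms
proof (induction m arbitrary: s)
  case 0
  have "falling 0 = (\<lambda>_. 1)" by (auto simp: falling_def)
  then show ?case using divided_difference_one[of "{..s}" d] 0 by auto
next
  case (Suc m)
  then obtain s' where s': "s = Suc s'" by (cases s) auto
  have "falling (Suc m) = (\<lambda>x. falling m x * (x - of_nat m))" by (auto simp: falling_Suc)
  moreover have "inj_on d {..s'}" using Suc.prems s' by (auto intro: inj_on_subset)
  ultimately show ?case
    using divided_difference_Leibniz[of d s' "falling m" "of_nat m"] Suc s' by simp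
qed

lemma h_poly_0: "h_poly s d 0 = 1"
proof -
  have "{js. length js = 0 \<and> sorted js \<and> set js \<subseteq> {1..s}} = {[]}" by auto
  then show ?thesis by (simp add: h_poly_def)
qed

lemma h_poly_no_nodes: "h_poly 0 d (Suc i) = 0"
proof -
  have "{js. length js = Suc i \<and> sorted js \<and> set js \<subseteq> {1..0::nat}} = {}" by auto
  then show ?thesis by (simp only: h_poly_def sum.empty)
qed

lemma finite_h_index: "finite {js. length js = i \<and> sorted js \<and> set js \<subseteq> {1..s::nat}}"
  by (rule finite_subset[OF _ finite_lists_length_eq[of "{1..s}" i]]) auto

text \<open>The index lists with last entry \<open>s + 1\<close> and those without it.\<close>

lemma h_poly_Suc:
  "h_poly (Suc s) d (Suc i) =
     h_poly s d (Suc i) + (d (Suc s) - (int (Suc s) + int i)) * h_poly (Suc s) d i"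
proof -
  define W where "W s i = {js. length js = i \<and> sorted js \<and> set js \<subseteq> {1..s::nat}}" for s i
  define P where "P i js = (\<Prod>k<i. d (js ! k) - (int (js ! k) + int k))" for i js
  have split: "W (Suc s) (Suc i) = W s (Suc i) \<union> (\<lambda>ys. ys @ [Suc s]) ` W (Suc s) i"
  proof (intro Set.set_eqI iffI)
    fix js assume js: "js \<in> W (Suc s) (Suc i)"
    then obtain ys y where y: "js = ys @ [y]" by (cases js rule: rev_cases) (auto simp: W_def)
    show "js \<in> W s (Suc i) \<union> (\<lambda>ys. ys @ [Suc s]) ` W (Suc s) i"
    proof (cases "y = Suc s")
      case True
      then show ?thesis using js y by (auto simp: W_def sorted_append)
    next
      case False
      then have "y \<le> s" using js y by (auto simp: W_def)
      moreover have "z \<le> y" if "z \<in> set js" for z using js y that by (auto simp: W_def sorted_append)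
      ultimately have "set js \<subseteq> {1..s}" using js by (fastforce simp: W_def)
      then show ?thesis using js by (auto simp: W_def)
    qed
  next
    fix js assume "js \<in> W s (Suc i) \<union> (\<lambda>ys. ys @ [Suc s]) ` W (Suc s) i"
    then show "js \<in> W (Suc s) (Suc i)" by (fastforce simp: W_def sorted_append)
  qed
  have disj: "W s (Suc i) \<inter> (\<lambda>ys. ys @ [Suc s]) ` W (Suc s) i = {}" by (auto simp: W_def)
  have "h_poly (Suc s) d (Suc i) =
     h_poly s d (Suc i) + (\<Sum>js\<in>(\<lambda>ys. ys @ [Suc s]) ` W (Suc s) i. P (Suc i) js)"
    unfolding h_poly_def W_def[symmetric] P_def[symmetric] split
    by (rule sum.union_disjoint) (use disj finite_h_index W_def in auto)
  also have "(\<Sum>js\<in>(\<lambda>ys. ys @ [Suc s]) ` W (Suc s) i. P (Suc i) js) =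
      (\<Sum>ys\<in>W (Suc s) i. P (Suc i) (ys @ [Suc s]))"
    by (subst sum.reindex) (auto simp: inj_on_def)
  also have "\<dots> = (\<Sum>ys\<in>W (Suc s) i. (d (Suc s) - (int (Suc s) + int i)) * P i ys)"
    by (rule sum.cong[OF refl]) (auto simp: P_def W_def nth_append)
  also have "\<dots> = (d (Suc s) - (int (Suc s) + int i)) * h_poly (Suc s) d i"
    unfolding h_poly_def W_def[symmetric] P_def[symmetric] by (simp add: sum_distrib_left)
  finally show ?thesis .
qed

text \<open>Both sides satisfy the recursion of \<open>h_poly_Suc\<close>: on the left it is the Leibniz rule for the
  last factor of the falling factorial.\<close>

lemma divided_difference_falling:
  assumes "inj_on d {..s}" "d 0 = (0::int)"
  shows "divided_difference (\<lambda>k. of_int (d k)) {..s} (falling (s + i)) = of_int (h_poly s d i)"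
  using assms
proof (induction "s + i" arbitrary: s i)
  case 0
  then show ?case
    by (simp add: h_poly_0 divided_difference_def node_weight_def falling_def)
next
  case (Suc m)
  let ?d = "\<lambda>k. of_int (d k) :: rat"
  have inj: "inj_on ?d {..s}" using Suc.prems by (auto simp: inj_on_def)
  show ?case
  proof (cases s)
    case 0
    then obtain i' where i': "i = Suc i'" using Suc.hyps(2) by (cases i) auto
    have "falling (Suc i') 0 = 0"
      unfolding falling_def by (rule prod_zero) auto
    then show ?thesis using 0 i' Suc.prems
      by (simp add: h_poly_no_nodes divided_difference_def node_weight_def)
  next
    case s: (Suc s')
    have m: "m = s' + i" using Suc.hyps(2) s by simp
    have f: "falling (s + i) = (\<lambda>x. falling m x * (x - of_nat m))"
      using m s by (auto simp: falling_Suc)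
    have inj': "inj_on d {..s'}" using Suc.prems s by (auto intro: inj_on_subset)
    have L: "divided_difference ?d {..s} (falling (s + i)) =
       (?d s - of_nat m) * divided_difference ?d {..s} (falling m) + divided_difference ?d {..s'} (falling m)"
      unfolding f unfolding s by (rule divided_difference_Leibniz) (use inj s in auto)
    have D': "divided_difference ?d {..s'} (falling m) = of_int (h_poly s' d i)"
      using Suc.hyps(1)[of s' i] m inj' Suc.prems by simp
    show ?thesis
    proof (cases i)
      case 0
      then have "divided_difference ?d {..s} (falling m) = 0"
        using divided_difference_falling_low[OF inj] m s by simp
      then show ?thesis using L D' 0 by (simp add: h_poly_0)
    next
      case i: (Suc i')
      have "divided_difference ?d {..s} (falling m) = of_int (h_poly s d i')"
        using Suc.hyps(1)[of s i'] m i s Suc.prems by simp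
      then have "divided_difference ?d {..s} (falling (s + i)) =
          of_int ((d (Suc s') - (int (Suc s') + int i')) * h_poly (Suc s') d i' + h_poly s' d (Suc i'))"
        using L D' i s m by simp
      then show ?thesis using h_poly_Suc[of s' d i'] i s by (simp add: add.commute)
    qed
  qed
qed

section \<open>Monotonicity of the bounds\<close>

lemma strict_mono_on_index_le:
  fixes d :: "nat \<Rightarrow> int"
  assumes "strict_mono_on {0..s} d" "j \<le> k" "k \<le> s"
  shows "d j + int (k - j) \<le> d k"
  using assms(2,3)
proof (induction k)
  case (Suc k)
  show ?case
  proof (cases "j = Suc k")
    case False
    then have "d j + int (k - j) \<le> d k" using Suc by auto
    moreover have "d k < d (Suc k)" using assms(1) Suc.prems by (auto simp: strict_mono_on_def)
    ultimately show ?thesis using False Suc.prems by (simp add: Suc_diff_le)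
  qed simp
qed simp

text \<open>Along a sorted index list the numbers \<open>d\<^sub>j - j\<close> are non-negative and weakly increasing, so the
  factors \<open>d\<^sub>j - j - k\<close> cannot become negative without passing through \<open>0\<close>.\<close>

lemma h_factors:
  fixes d :: "nat \<Rightarrow> int"
  assumes d: "strict_mono_on {0..s} d" "d 0 = 0"
    and js: "sorted js" "set js \<subseteq> {1..s}"
  shows "(\<exists>k<length js. d (js ! k) - (int (js ! k) + int k) = 0) \<or>
         (\<forall>k<length js. d (js ! k) - (int (js ! k) + int k) > 0)"
proof (rule ccontr)
  let ?f = "\<lambda>k. d (js ! k) - (int (js ! k) + int k)"
  assume neg: "\<not> ?thesis"
  define k where "k = (LEAST k. k < length js \<and> ?f k \<le> 0)"
  have ex: "\<exists>k. k < length js \<and> ?f k \<le> 0" using neg by force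
  have k: "k < length js" "?f k \<le> 0" using LeastI_ex[OF ex] unfolding k_def by auto
  have least: "?f l > 0" if "l < k" for l
    using not_less_Least[of l "\<lambda>k. k < length js \<and> ?f k \<le> 0"] that k(1) unfolding k_def[symmetric]
    by force
  have in_range: "js ! l \<in> {1..s}" if "l < length js" for l using js(2) that nth_mem by blast
  have "?f k \<ge> 0"
  proof (cases k)
    case 0
    have "d 0 + int (js ! k - 0) \<le> d (js ! k)"
      by (rule strict_mono_on_index_le[OF d(1)]) (use in_range[OF k(1)] in auto)
    then show ?thesis using d(2) 0 by simp
  next
    case (Suc l)
    have "js ! l \<le> js ! k" using js(1) k(1) Suc by (simp add: sorted_iff_nth_mono)
    then have "d (js ! l) + int (js ! k - js ! l) \<le> d (js ! k)"
      by (intro strict_mono_on_index_le[OF d(1)]) (use in_range[OF k(1)] in auto)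
    then show ?thesis using least[of l] Suc \<open>js ! l \<le> js ! k\<close> by simp
  qed
  then show False using k neg by auto
qed

text \<open>By \<open>h_factors\<close> a product in \<open>h_poly s d i\<close> contains the factor \<open>0\<close> or has positive factors only, and
  factors increase with \<open>d\<close>.\<close>

lemma h_poly_mono:
  fixes d d' :: "nat \<Rightarrow> int"
  assumes d: "strict_mono_on {0..s} d" "d 0 = 0"
    and d': "strict_mono_on {0..s} d'" "d' 0 = 0"
    and le: "\<And>j. j \<in> {1..s} \<Longrightarrow> d j \<le> d' j"
  shows "0 \<le> h_poly s d i" "h_poly s d i \<le> h_poly s d' i"
proof -
  let ?f = "\<lambda>d js k. d (js ! k) - (int (js ! k) + int k)"
  have nonneg: "0 \<le> (\<Prod>k<length js. ?f e js k)"
    if "strict_mono_on {0..s} e" "e 0 = 0" "sorted js" "set js \<subseteq> {1..s}" for e js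
    using h_factors[OF that]
  proof
    assume "\<exists>k<length js. ?f e js k = 0"
    then have "(\<Prod>k<length js. ?f e js k) = 0" by (intro prod_zero) auto
    then show ?thesis by (simp only: order_refl)
  next
    assume "\<forall>k<length js. ?f e js k > 0"
    then show ?thesis by (intro prod_nonneg) (auto intro: less_imp_le)
  qed
  show "0 \<le> h_poly s d i"
    unfolding h_poly_def by (rule sum_nonneg) (use nonneg[OF d] in auto)
  show "h_poly s d i \<le> h_poly s d' i"
    unfolding h_poly_def
  proof (rule sum_mono)
    fix js assume js: "js \<in> {js. length js = i \<and> sorted js \<and> set js \<subseteq> {1..s}}"
    show "(\<Prod>k<i. ?f d js k) \<le> (\<Prod>k<i. ?f d' js k)"
    proof (cases "\<exists>k<length js. ?f d js k = 0")
      case True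
      then have zero: "(\<Prod>k<i. ?f d js k) = 0" using js by (intro prod_zero) auto
      have "0 \<le> (\<Prod>k<i. ?f d' js k)" using nonneg[OF d', of js] js by auto
      then show ?thesis by (simp only: zero)
    next
      case False
      then have "\<forall>k<length js. ?f d js k > 0" using h_factors[OF d, of js] js by auto
      moreover have "d (js ! k) \<le> d' (js ! k)" if "k < i" for k
        by (rule le) (use js that nth_mem in blast)
      ultimately show ?thesis using js by (intro prod_mono) (auto intro: less_imp_le)
    qed
  qed
qed

lemma shift_bound_mono:
  fixes d d' :: "nat \<Rightarrow> int"
  assumes d: "strict_mono_on {0..s} d" "d 0 = 0"
    and d': "strict_mono_on {0..s} d'" "d' 0 = 0"
    and le: "\<And>j. j \<in> {1..s} \<Longrightarrow> d j \<le> d' j"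
  shows "(\<Prod>k=1..s. of_int (d k)) / fact (s + i) * of_int (h_poly s d i)
    \<le> (\<Prod>k=1..s. of_int (d' k)) / fact (s + i) * (of_int (h_poly s d' i) :: rat)"
proof -
  have pos: "0 \<le> d j" if "j \<in> {1..s}" for j
    using strict_mono_on_index_le[OF d(1), of 0 j] d(2) that by simp
  have 1: "(\<Prod>k=1..s. of_int (d k) :: rat) \<le> (\<Prod>k=1..s. of_int (d' k))"
    by (rule prod_mono) (use pos le in auto)
  have 2: "(0::rat) \<le> (\<Prod>k=1..s. of_int (d k))" by (rule prod_nonneg) (use pos in auto)
  show ?thesis
    using h_poly_mono[OF assms, of i] 1 2
    by (intro mult_mono divide_right_mono) auto
qed

section \<open>Pure diagrams\<close>

text \<open>The factors with \<open>k < i\<close> are negative, and there are \<open>i - 1\<close> of them.\<close>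

lemma pure_diagram_pos:
  assumes d: "strict_mono_on {0..s} d" and "i \<le> s"
  shows "pure_diagram s d i (d i) > 0"
proof (cases "i = 0")
  case True
  then show ?thesis by (simp add: pure_diagram_def)
next
  case False
  have lt: "d j < d k" if "j < k" "k \<le> s" for j k
    using d that by (auto simp: strict_mono_on_def)
  let ?g = "\<lambda>k. of_int (d k - d 0) / of_int (d k - d i) :: rat"
  have split: "{1..s} - {i} = {1..<i} \<union> {i<..s}" using False assms(2) by auto
  have "(\<Prod>k\<in>{1..s} - {i}. ?g k) = (\<Prod>k\<in>{1..<i}. ?g k) * (\<Prod>k\<in>{i<..s}. ?g k)"
    unfolding split by (rule prod.union_disjoint) auto
  also have "(\<Prod>k\<in>{1..<i}. ?g k) = (- 1) ^ (i - 1) * (\<Prod>k\<in>{1..<i}. - ?g k)"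
    using prod_uminus[of "\<lambda>k. - ?g k" "{1..<i}"] by simp
  finally have "(- 1) ^ (i + 1) * (\<Prod>k\<in>{1..s} - {i}. ?g k) =
      ((- 1) ^ (i + 1) * (- 1) ^ (i - 1)) * ((\<Prod>k\<in>{1..<i}. - ?g k) * (\<Prod>k\<in>{i<..s}. ?g k))"
    by (simp only: mult_ac)
  also have "(- 1) ^ (i + 1) * (- 1) ^ (i - 1) = (1::rat)"
    using False by (cases i) auto
  finally have eq: "pure_diagram s d i (d i) = (\<Prod>k\<in>{1..<i}. - ?g k) * (\<Prod>k\<in>{i<..s}. ?g k)"
    using False assms(2) by (simp add: pure_diagram_def)
  have "(\<Prod>k\<in>{1..<i}. - ?g k) > 0"
  proof (rule prod_pos)
    fix k assume "k \<in> {1..<i}"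
    then have "(of_int (d k - d 0) :: rat) > 0" "(of_int (d k - d i) :: rat) < 0"
      using lt[of 0 k] lt[of k i] assms(2) by (auto simp del: of_int_diff)
    then show "- ?g k > 0" by (simp add: divide_pos_neg del: of_int_diff)
  qed
  moreover have "(\<Prod>k\<in>{i<..s}. ?g k) > 0"
  proof (rule prod_pos)
    fix k assume "k \<in> {i<..s}"
    then have "(of_int (d k - d 0) :: rat) > 0" "(of_int (d k - d i) :: rat) > 0"
      using lt[of 0 k] lt[of i k] by (auto simp del: of_int_diff)
    then show "?g k > 0" by (simp del: of_int_diff)
  qed
  ultimately show ?thesis using eq by simp
qed

text \<open>This identifies the moments of a pure diagram with divided differences.\<close>

lemma pure_diagram_weight:
  assumes d: "strict_mono_on {0..s} d" "d 0 = 0" and l: "l \<le> s"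
  shows "(- 1) ^ l * pure_diagram s d l (d l) =
     (- 1) ^ s * (\<Prod>k=1..s. of_int (d k)) / node_weight (\<lambda>k. of_int (d k)) {..s} l"
proof -
  have neq: "d j \<noteq> d k" if "j \<noteq> k" "j \<le> s" "k \<le> s" for j k
    using d(1) that by (metis atLeastAtMost_iff le0 linorder_neqE_nat order_less_irrefl strict_mono_onD)
  show ?thesis
  proof (cases "l = 0")
    case True
    have "{..s} - {0} = {1..s}" by auto
    then have "node_weight (\<lambda>k. of_int (d k)) {..s} 0 = (\<Prod>k=1..s. (-1) * (of_int (d k) :: rat))"
      by (simp add: node_weight_def d(2))
    also have "\<dots> = (- 1) ^ s * (\<Prod>k=1..s. of_int (d k))"
      by (simp only: prod.distrib prod_constant card_atLeastAtMost) simp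
    moreover have "(\<Prod>k=1..s. (of_int (d k) :: rat)) \<noteq> 0"
      using neq[of _ 0] d(2) by auto
    ultimately show ?thesis using True by (simp add: pure_diagram_def)
  next
    case False
    let ?e = "\<lambda>k. of_int (d k) :: rat"
    have e: "{..s} - {l} = insert 0 ({1..s} - {l})" using False by auto
    have p: "{1..s} = insert l ({1..s} - {l})" using False l by auto
    have w: "node_weight ?e {..s} l = ?e l * (\<Prod>k\<in>{1..s} - {l}. ?e l - ?e k)"
      unfolding node_weight_def e by (subst prod.insert) (auto simp: d(2))
    have "(\<Prod>k\<in>{1..s} - {l}. ?e l - ?e k) = (\<Prod>k\<in>{1..s} - {l}. (- 1) * (?e k - ?e l))" by simp
    also have "\<dots> = (- 1) ^ (s - 1) * (\<Prod>k\<in>{1..s} - {l}. ?e k - ?e l)"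
      using False l by (simp only: prod.distrib prod_constant) simp
    finally have w': "node_weight ?e {..s} l = ?e l * ((- 1) ^ (s - 1) * (\<Prod>k\<in>{1..s} - {l}. ?e k - ?e l))"
      using w by simp
    have P: "(\<Prod>k=1..s. ?e k) = ?e l * (\<Prod>k\<in>{1..s} - {l}. ?e k)"
      by (subst p, subst prod.insert) auto
    have l0: "?e l \<noteq> 0" using neq[of l 0] False l d(2) by auto
    have nz: "(\<Prod>k\<in>{1..s} - {l}. ?e k - ?e l) \<noteq> 0"
      using neq l by auto
    have sg: "(- 1) ^ s = - ((- 1 :: rat) ^ (s - 1))" using False l by (cases s) auto
    have sq: "(- 1 :: rat) ^ l * (- 1) ^ (l + 1) = - 1"
      by (simp add: power_add[symmetric] flip: mult_2)
    have "(- 1) ^ l * pure_diagram s d l (d l) =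
       ((- 1) ^ l * (- 1) ^ (l + 1)) * (\<Prod>k\<in>{1..s} - {l}. ?e k / (?e k - ?e l))"
      using False l by (simp add: pure_diagram_def d(2))
    also have "\<dots> = - ((\<Prod>k\<in>{1..s} - {l}. ?e k) / (\<Prod>k\<in>{1..s} - {l}. ?e k - ?e l))"
      by (simp only: sq prod_dividef mult_minus1)
    also have "\<dots> = (- 1) ^ s * (\<Prod>k=1..s. ?e k) / node_weight ?e {..s} l"
      unfolding w' P sg using l0 nz by (simp add: field_simps)
    finally show ?thesis .
  qed
qed

text \<open>For \<open>k = s + i\<close> these alternating sums become, up to sign, the Hilbert coefficients.\<close>

definition binomial_moment :: "nat \<Rightarrow> diagram \<Rightarrow> int set \<Rightarrow> nat \<Rightarrow> rat" where
  "binomial_moment s D J k = (\<Sum>i\<le>s. \<Sum>j\<in>J. (- 1) ^ i * D i j * (of_int j gchoose k))"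

lemma binomial_moment_pure:
  assumes d: "strict_mono_on {0..s} d" "d 0 = 0" and J: "finite J" "d ` {..s} \<subseteq> J"
  shows "binomial_moment s (pure_diagram s d) J (s + i) =
    (- 1) ^ s * ((\<Prod>k=1..s. of_int (d k)) / fact (s + i) * of_int (h_poly s d i))"
proof -
  let ?e = "\<lambda>k. of_int (d k) :: rat"
  have inj: "inj_on d {..s}"
    using d(1) by (auto simp: atMost_atLeast0 dest: strict_mono_on_imp_inj_on)
  have "binomial_moment s (pure_diagram s d) J (s + i) =
     (\<Sum>l\<le>s. (- 1) ^ l * pure_diagram s d l (d l) * (?e l gchoose (s + i)))"
    unfolding binomial_moment_def
  proof (rule sum.cong[OF refl])
    fix l assume l: "l \<in> {..s}"
    have "(\<Sum>j\<in>J. (- 1) ^ l * pure_diagram s d l j * (of_int j gchoose (s + i))) =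
        (\<Sum>j\<in>{d l}. (- 1) ^ l * pure_diagram s d l j * (of_int j gchoose (s + i)))"
      by (rule sum.mono_neutral_right) (use J l in \<open>auto simp: pure_diagram_def\<close>)
    then show "(\<Sum>j\<in>J. (- 1) ^ l * pure_diagram s d l j * (of_int j gchoose (s + i))) =
        (- 1) ^ l * pure_diagram s d l (d l) * (?e l gchoose (s + i))" by simp
  qed
  also have "\<dots> = (\<Sum>l\<le>s. (- 1) ^ s * (\<Prod>k=1..s. ?e k) / fact (s + i) *
      (falling (s + i) (?e l) / node_weight ?e {..s} l))"
    by (rule sum.cong[OF refl]) (simp add: pure_diagram_weight[OF d] gchoose_eq_falling)
  also have "\<dots> = (- 1) ^ s * (\<Prod>k=1..s. ?e k) / fact (s + i) *
      divided_difference ?e {..s} (falling (s + i))"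
    by (simp only: divided_difference_def sum_distrib_left)
  finally show ?thesis
    using divided_difference_falling[OF inj d(2)] by simp
qed

text \<open>Multiplication by \<open>x\<close> sends \<open>x gchoose k\<close> to a combination of itself and \<open>x gchoose Suc k\<close>.\<close>

lemma power_eq_gchoose_combination:
  "\<exists>c. \<forall>x::rat. x ^ t = (\<Sum>k\<le>t. c k * (x gchoose k))"
proof (induction t)
  case 0
  show ?case by (intro exI[of _ "\<lambda>_. 1"]) simp
next
  case (Suc t)
  then obtain c where c: "\<And>x::rat. x ^ t = (\<Sum>k\<le>t. c k * (x gchoose k))" by blast
  define c' where "c' k = (if k \<le> t then of_nat k * c k else 0) +
     (if k = 0 then 0 else of_nat k * c (k - 1))" for k
  have "x ^ Suc t = (\<Sum>k\<le>Suc t. c' k * (x gchoose k))" for x :: rat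
  proof -
    have "x ^ Suc t = (\<Sum>k\<le>t. c k * (x * (x gchoose k)))"
      by (simp add: c sum_distrib_left mult_ac)
    also have "\<dots> = (\<Sum>k\<le>t. of_nat k * c k * (x gchoose k) + of_nat (Suc k) * c k * (x gchoose Suc k))"
      by (rule sum.cong[OF refl]) (simp add: gbinomial_absorb_comp gbinomial_mult_1 algebra_simps)
    also have "\<dots> = (\<Sum>k\<le>t. of_nat k * c k * (x gchoose k)) +
        (\<Sum>k\<le>t. of_nat (Suc k) * c k * (x gchoose Suc k))"
      by (simp add: sum.distrib)
    also have "(\<Sum>k\<le>t. of_nat k * c k * (x gchoose k)) =
        (\<Sum>k\<le>Suc t. (if k \<le> t then of_nat k * c k else 0) * (x gchoose k))" by simp
    also have "(\<Sum>k\<le>t. of_nat (Suc k) * c k * (x gchoose Suc k)) =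
        (\<Sum>k\<le>Suc t. (if k = 0 then 0 else of_nat k * c (k - 1)) * (x gchoose k))"
      by (simp add: sum.atMost_Suc_shift del: sum.atMost_Suc)
    also have "(\<Sum>k\<le>Suc t. (if k \<le> t then of_nat k * c k else 0) * (x gchoose k)) +
        (\<Sum>k\<le>Suc t. (if k = 0 then 0 else of_nat k * c (k - 1)) * (x gchoose k)) =
        (\<Sum>k\<le>Suc t. c' k * (x gchoose k))"
      by (simp only: c'_def sum.distrib[symmetric] distrib_right)
    finally show ?thesis .
  qed
  then show ?case by blast
qed

text \<open>The power moments are those in the definition of the space of diagrams.\<close>

lemma power_moment_zero:
  assumes zero: "\<And>k. k < s \<Longrightarrow> binomial_moment s' D J k = 0" and "t < s"
  shows "(\<Sum>i\<le>s'. \<Sum>j\<in>J. (- 1) ^ i * of_int j ^ t * D i j) = 0"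
proof -
  obtain c where c: "\<And>x::rat. x ^ t = (\<Sum>k\<le>t. c k * (x gchoose k))"
    using power_eq_gchoose_combination by blast
  have "(\<Sum>i\<le>s'. \<Sum>j\<in>J. (- 1) ^ i * of_int j ^ t * D i j) =
     (\<Sum>i\<le>s'. \<Sum>j\<in>J. \<Sum>k\<le>t. c k * ((- 1) ^ i * D i j * (of_int j gchoose k)))"
    unfolding c by (simp add: sum_distrib_left sum_distrib_right mult_ac)
  also have "\<dots> = (\<Sum>i\<le>s'. \<Sum>k\<le>t. \<Sum>j\<in>J. c k * ((- 1) ^ i * D i j * (of_int j gchoose k)))"
    by (rule sum.cong[OF refl], rule sum.swap)
  also have "\<dots> = (\<Sum>k\<le>t. \<Sum>i\<le>s'. \<Sum>j\<in>J. c k * ((- 1) ^ i * D i j * (of_int j gchoose k)))"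
    by (rule sum.swap)
  also have "\<dots> = (\<Sum>k\<le>t. c k * binomial_moment s' D J k)"
    by (simp add: binomial_moment_def sum_distrib_left)
  also have "\<dots> = 0" using zero assms(2) by (intro sum.neutral) auto
  finally show ?thesis .
qed

section \<open>Dimension counts\<close>

lemma linear_map_class_ringI:
  fixes V :: "('k::field, 'v) module" and W :: "('k, 'w) module"
  assumes "vectorspace class_ring V" "vectorspace class_ring W"
    and "\<And>v. v \<in> carrier V \<Longrightarrow> T v \<in> carrier W"
    and "\<And>v w. v \<in> carrier V \<Longrightarrow> w \<in> carrier V \<Longrightarrow> T (v \<oplus>\<^bsub>V\<^esub> w) = T v \<oplus>\<^bsub>W\<^esub> T w"
    and "\<And>c v. v \<in> carrier V \<Longrightarrow> T (c \<odot>\<^bsub>V\<^esub> v) = c \<odot>\<^bsub>W\<^esub> T v"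
  shows "linear_map class_ring V W T"
  using assms
  by (auto simp: linear_map_def mod_hom_def mod_hom_axioms_def module_hom_def vectorspace_def)

lemma rank_nullity_dim:
  fixes V :: "('k::field, 'v) module" and W :: "('k, 'w) module"
  assumes lin: "linear_map class_ring V W T" and fd: "vectorspace.fin_dim class_ring V"
  shows "vectorspace.dim class_ring (W\<lparr>carrier := T ` carrier V\<rparr>) +
     vectorspace.dim class_ring (V\<lparr>carrier := {v \<in> carrier V. T v = \<zero>\<^bsub>W\<^esub>}\<rparr>) =
     vectorspace.dim class_ring V"
proof -
  interpret linear_map class_ring V W T by (rule lin)
  show ?thesis using rank_nullity[OF fd] by (simp add: im_def ker_def)
qed

lemma subspace_fin_dim:
  assumes V: "vectorspace K V" and fd: "vectorspace.fin_dim K V" and W: "VectorSpace.subspace K W V"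
  shows "vectorspace.fin_dim K (V\<lparr>carrier := W\<rparr>)"
proof -
  interpret vectorspace K V by (rule V)
  interpret W: vectorspace K "V\<lparr>carrier := W\<rparr>" using W by (rule subspace_is_vs)
  have sub: "submodule K W V" using W by (rule is_module)
  then have WV: "W \<subseteq> carrier V" by (simp add: submodule_def)
  have eq: "W.lin_dep A = lin_dep A" if "A \<subseteq> W" for A
    using span_li_not_depend(2)[OF that sub] by simp
  have "\<exists>A. finite A \<and> maximal A (\<lambda>A. A \<subseteq> W \<and> lin_indpt A)"
  proof (rule maximal_exists)
    show "finite A \<and> card A \<le> dim" if "A \<subseteq> W \<and> lin_indpt A" for A
      using li_le_dim[OF fd] that WV by blast
    show "{} \<subseteq> W \<and> lin_indpt {}" by (auto simp: lin_dep_def)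
  qed
  then obtain A where A: "finite A" "maximal A (\<lambda>A. A \<subseteq> W \<and> lin_indpt A)" by blast
  then have "maximal A (\<lambda>S. S \<subseteq> carrier (V\<lparr>carrier := W\<rparr>) \<and> W.lin_indpt S)"
    using eq by (auto simp: maximal_def)
  then have "W.gen_set A" by (rule W.max_li_is_gen)
  then show ?thesis using A unfolding W.fin_dim_def maximal_def by auto
qed

lemma subspace_dim_le:
  assumes V: "vectorspace K V" and fd: "vectorspace.fin_dim K V" and W: "VectorSpace.subspace K W V"
  shows "vectorspace.dim K (V\<lparr>carrier := W\<rparr>) \<le> vectorspace.dim K V"
proof -
  interpret vectorspace K V by (rule V)
  interpret W: vectorspace K "V\<lparr>carrier := W\<rparr>" using W by (rule subspace_is_vs)
  have sub: "submodule K W V" using W by (rule is_module)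
  then have WV: "W \<subseteq> carrier V" by (simp add: submodule_def)
  obtain B where B: "finite B" "W.basis B"
    using W.finite_basis_exists[OF subspace_fin_dim[OF assms]] by blast
  then have BW: "B \<subseteq> W" "W.lin_indpt B" by (auto simp: W.basis_def)
  then have "lin_indpt B" using span_li_not_depend(2)[OF _ sub] by simp
  then have "card B \<le> dim" using li_le_dim(2)[OF fd] BW WV by blast
  then show ?thesis using W.dim_basis[OF B] by simp
qed

subsection \<open>Function spaces\<close>

abbreviation fspace :: "'z set \<Rightarrow> ('k::field, 'z \<Rightarrow> 'k) module" where
  "fspace X \<equiv> LinearCombinations.ring.func_space class_ring X"

lemma fspace_simps:
  "carrier (fspace X) = X \<rightarrow>\<^sub>E UNIV"
  "f \<oplus>\<^bsub>fspace X\<^esub> g = (\<lambda>x\<in>X. f x + g x)"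
  "c \<odot>\<^bsub>fspace X\<^esub> f = (\<lambda>x\<in>X. c * f x)"
  "\<zero>\<^bsub>fspace X\<^esub> = (\<lambda>x\<in>X. 0)"
  by (simp_all add: class_ring.func_space_def)

lemma fspace_vectorspace: "vectorspace class_ring (fspace X :: ('k::field, 'z \<Rightarrow> 'k) module)"
proof -
  have "Module.module class_ring (fspace X :: ('k::field, 'z \<Rightarrow> 'k) module)"
    by (rule class_cring.func_space_is_module)
  then show ?thesis by (simp add: vectorspace_def class_field)
qed

lemma fspace_finsum:
  assumes "finite A" "\<And>a. a \<in> A \<Longrightarrow> f a \<in> X \<rightarrow>\<^sub>E UNIV"
  shows "finsum (fspace X :: ('k::field, 'z \<Rightarrow> 'k) module) f A = (\<lambda>x\<in>X. \<Sum>a\<in>A. f a x)"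
proof -
  interpret vectorspace class_ring "fspace X :: ('k, 'z \<Rightarrow> 'k) module" by (rule fspace_vectorspace)
  show ?thesis using assms
  proof (induction A rule: finite_induct)
    case empty
    then show ?case by (simp add: fspace_simps)
  next
    case (insert a A)
    have "finsum (fspace X) f (insert a A) = f a \<oplus>\<^bsub>fspace X\<^esub> finsum (fspace X) f A"
      by (rule M.finsum_insert) (use insert in \<open>auto simp: fspace_simps(1)\<close>)
    then show ?case using insert by (auto simp: fspace_simps restrict_def fun_eq_iff)
  qed
qed

lemma fspace_dim:
  assumes X: "finite X"
  shows "vectorspace.fin_dim class_ring (fspace X :: ('k::field, 'z \<Rightarrow> 'k) module)"
    and "vectorspace.dim class_ring (fspace X :: ('k::field, 'z \<Rightarrow> 'k) module) = card X"
proof -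
  interpret vectorspace class_ring "fspace X :: ('k, 'z \<Rightarrow> 'k) module" by (rule fspace_vectorspace)
  define \<delta> where "\<delta> x = (\<lambda>y\<in>X. if y = x then 1 else (0::'k))" for x
  have inj: "inj_on \<delta> X"
  proof (rule inj_onI)
    fix x y assume "x \<in> X" "y \<in> X" "\<delta> x = \<delta> y"
    then have "\<delta> x x = \<delta> y x" by simp
    then show "x = y" using \<open>x \<in> X\<close> by (simp add: \<delta>_def split: if_splits)
  qed
  have car: "\<delta> ` X \<subseteq> carrier (fspace X)" by (auto simp: \<delta>_def fspace_simps(1))
  have comb: "lincomb a (\<delta> ` X) = (\<lambda>x\<in>X. a (\<delta> x))" for a
  proof -
    have "lincomb a (\<delta> ` X) = (\<lambda>x\<in>X. \<Sum>v\<in>\<delta> ` X. (a v \<odot>\<^bsub>fspace X\<^esub> v) x)"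
      unfolding lincomb_def by (rule fspace_finsum) (use X in \<open>auto simp: fspace_simps\<close>)
    also have "\<dots> = (\<lambda>x\<in>X. \<Sum>y\<in>X. a (\<delta> y) * \<delta> y x)"
      by (rule restrict_ext) (simp add: sum.reindex[OF inj] fspace_simps)
    also have "\<dots> = (\<lambda>x\<in>X. a (\<delta> x))"
    proof (rule restrict_ext)
      fix x assume x: "x \<in> X"
      have "(\<Sum>y\<in>X. a (\<delta> y) * \<delta> y x) = (\<Sum>y\<in>X. if y = x then a (\<delta> y) else 0)"
        by (rule sum.cong) (auto simp: \<delta>_def x)
      then show "(\<Sum>y\<in>X. a (\<delta> y) * \<delta> y x) = a (\<delta> x)" using X x by simp
    qed
    finally show ?thesis .
  qed
  have fin: "finite (\<delta> ` X)" using X by simp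
  have "lin_indpt (\<delta> ` X)"
  proof (rule finite_lin_indpt2[OF fin car])
    fix a assume "lincomb a (\<delta> ` X) = \<zero>\<^bsub>fspace X\<^esub>"
    then have "(\<lambda>x\<in>X. a (\<delta> x)) = (\<lambda>x\<in>X. 0)" by (simp add: comb fspace_simps)
    then show "\<forall>v\<in>\<delta> ` X. a v = \<zero>\<^bsub>class_ring\<^esub>" by (auto simp: restrict_def fun_eq_iff) metis
  qed
  moreover have "gen_set (\<delta> ` X)"
  proof
    show "span (\<delta> ` X) \<subseteq> carrier (fspace X)" using car by (rule span_is_subset2)
    show "carrier (fspace X) \<subseteq> span (\<delta> ` X)"
    proof
      fix f :: "'z \<Rightarrow> 'k" assume f: "f \<in> carrier (fspace X)"
      have "lincomb (\<lambda>v. f (the_inv_into X \<delta> v)) (\<delta> ` X) = f"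
        using f by (auto simp: comb fspace_simps the_inv_into_f_f[OF inj] PiE_def extensional_def)
      then show "f \<in> span (\<delta> ` X)" unfolding finite_span[OF fin car] by (intro CollectI exI[of _ "\<lambda>v. f (the_inv_into X \<delta> v)"]) auto
    qed
  qed
  ultimately have b: "basis (\<delta> ` X)" using car by (simp add: basis_def)
  show "fin_dim" using b fin unfolding fin_dim_def basis_def by blast
  show "dim = card X" using dim_basis[OF fin b] card_image[OF inj] by simp
qed

lemma dim_coordinates:
  fixes V :: "('k::field, 'v) module"
  assumes V: "vectorspace class_ring V" and X: "finite X"
    and bij: "bij_betw S (carrier V) (X \<rightarrow>\<^sub>E UNIV)"
    and add: "\<And>v w x. v \<in> carrier V \<Longrightarrow> w \<in> carrier V \<Longrightarrow> x \<in> X \<Longrightarrow> S (v \<oplus>\<^bsub>V\<^esub> w) x = S v x + S w x"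
    and smult: "\<And>c v x. v \<in> carrier V \<Longrightarrow> x \<in> X \<Longrightarrow> S (c \<odot>\<^bsub>V\<^esub> v) x = c * S v x"
  shows "vectorspace.fin_dim class_ring V" "vectorspace.dim class_ring V = card X"
proof -
  interpret V: vectorspace class_ring V by (rule V)
  define T where "T = the_inv_into (carrier V) S"
  have inj: "inj_on S (carrier V)" and im: "S ` carrier V = X \<rightarrow>\<^sub>E UNIV"
    using bij by (auto simp: bij_betw_def)
  have T: "T f \<in> carrier V" "S (T f) = f" if "f \<in> X \<rightarrow>\<^sub>E UNIV" for f
    using that inj im by (auto simp: T_def the_inv_into_into f_the_inv_into_f)
  have TS: "T (S v) = v" if "v \<in> carrier V" for v
    using that inj by (simp add: T_def the_inv_into_f_f)
  have TI: "T f = v" if "v \<in> carrier V" "f \<in> X \<rightarrow>\<^sub>E UNIV" "\<And>x. x \<in> X \<Longrightarrow> S v x = f x" for v f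
  proof -
    have "S v \<in> X \<rightarrow>\<^sub>E UNIV" using im that(1) by blast
    then have "S v = f" using that(2,3) by (metis PiE_ext)
    then show ?thesis using TS that by blast
  qed
  have lin: "linear_map class_ring (fspace X) V T"
  proof (rule linear_map_class_ringI[OF fspace_vectorspace V])
    show "T v \<in> carrier V" if "v \<in> carrier (fspace X)" for v using that T by (simp add: fspace_simps)
    show "T (f \<oplus>\<^bsub>fspace X\<^esub> g) = T f \<oplus>\<^bsub>V\<^esub> T g" if "f \<in> carrier (fspace X)" "g \<in> carrier (fspace X)" for f g
      by (rule TI) (use that in \<open>auto simp: fspace_simps T add\<close>)
    show "T (c \<odot>\<^bsub>fspace X\<^esub> f) = c \<odot>\<^bsub>V\<^esub> T f" if "f \<in> carrier (fspace X)" for c f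
      by (rule TI) (use that in \<open>auto simp: fspace_simps T smult\<close>)
  qed
  interpret T: linear_map class_ring "fspace X" V T by (rule lin)
  have injT: "inj_on T (carrier (fspace X))" by (rule inj_onI) (metis T(2) fspace_simps(1))
  have surj: "T ` carrier (fspace X) = carrier V"
    using TS T(1) im by (auto simp: fspace_simps(1) image_iff) (metis image_eqI)
  show "vectorspace.fin_dim class_ring V"
    using T.surj_fin_dim[OF fspace_dim(1)[OF X] surj] .
  show "vectorspace.dim class_ring V = card X"
    using T.dim_eq[OF fspace_dim(1)[OF X] injT surj] fspace_dim(2)[OF X, where 'k='k] by simp
qed

lemma mat_map_linear:
  "linear_map class_ring (fspace X) (fspace Y) (mat_map Y X (A :: 'y \<Rightarrow> 'x \<Rightarrow> 'k::field))"
  by (rule linear_map_class_ringI[OF fspace_vectorspace fspace_vectorspace])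
     (auto simp: mat_map_def fspace_simps sum.distrib distrib_left sum_distrib_left mult_ac
        intro!: restrict_ext sum.cong)

text \<open>A maximal linearly independent set of columns is a basis of the column space.\<close>

lemma column_basis_exists:
  fixes A :: "'y \<Rightarrow> 'x \<Rightarrow> 'k::field"
  assumes X: "finite X"
  obtains L where "L \<subseteq> X"
    and "card L = vectorspace.dim class_ring (fspace Y\<lparr>carrier := mat_map Y X A ` carrier (fspace X)\<rparr>)"
    and "\<And>c. (\<And>k. k \<in> Y \<Longrightarrow> (\<Sum>x\<in>L. A k x * c x) = 0) \<Longrightarrow> (\<And>x. x \<in> L \<Longrightarrow> c x = 0)"
    and "\<And>x. x \<in> X \<Longrightarrow> \<exists>c. \<forall>k\<in>Y. A k x = (\<Sum>y\<in>L. A k y * c y)"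
proof -
  define indep where "indep L \<longleftrightarrow>
    (\<forall>c. (\<forall>k\<in>Y. (\<Sum>x\<in>L. A k x * c x) = 0) \<longrightarrow> (\<forall>x\<in>L. c x = 0))" for L
  have "\<exists>L. (L \<subseteq> X \<and> indep L) \<and> (\<forall>L'. L' \<subseteq> X \<and> indep L' \<longrightarrow> card L' \<le> card L)"
    by (rule ex_has_greatest_nat[of _ "{}" card "Suc (card X)"])
       (use X in \<open>auto simp: indep_def card_mono less_Suc_eq_le\<close>)
  then obtain L where L: "L \<subseteq> X" "indep L"
    and max: "\<And>L'. L' \<subseteq> X \<Longrightarrow> indep L' \<Longrightarrow> card L' \<le> card L" by blast
  have finL: "finite L" using L X by (meson finite_subset)
  have span: "\<exists>c. \<forall>k\<in>Y. A k x = (\<Sum>y\<in>L. A k y * c y)" if x: "x \<in> X" for x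
  proof (cases "x \<in> L")
    case True
    then show ?thesis using finL
      by (intro exI[of _ "\<lambda>y. if y = x then 1 else 0"]) (simp add: if_distrib cong: if_cong)
  next
    case False
    then have "\<not> indep (insert x L)" using max[of "insert x L"] x L finL by auto
    then obtain c where c: "\<And>k. k \<in> Y \<Longrightarrow> A k x * c x + (\<Sum>y\<in>L. A k y * c y) = 0"
      and nz: "\<exists>y\<in>insert x L. c y \<noteq> 0"
      using False finL by (auto simp: indep_def)
    have "c x \<noteq> 0"
    proof
      assume "c x = 0"
      then have "\<forall>y\<in>L. c y = 0" using L(2) c by (auto simp: indep_def)
      then show False using nz \<open>c x = 0\<close> by auto
    qed
    have "A k x = (\<Sum>y\<in>L. A k y * (- c y / c x))" if "k \<in> Y" for k
    proof -
      have "(\<Sum>y\<in>L. A k y * (- c y / c x)) = - (\<Sum>y\<in>L. A k y * c y) / c x"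
        by (simp add: sum_divide_distrib sum_negf)
      also have "(\<Sum>y\<in>L. A k y * c y) = - (A k x * c x)"
        using c[OF that] by (simp add: eq_neg_iff_add_eq_0 add.commute)
      finally show ?thesis using \<open>c x \<noteq> 0\<close> by simp
    qed
    then show ?thesis by (intro exI[of _ "\<lambda>y. - c y / c x"]) blast
  qed
  let ?I = "mat_map Y X A ` carrier (fspace X)"
  let ?J = "mat_map Y L A"
  have lin: "linear_map class_ring (fspace L) (fspace Y) ?J" by (rule mat_map_linear)
  have im: "?J ` carrier (fspace L) = ?I"
  proof (intro Set.set_eqI iffI)
    fix g assume "g \<in> ?J ` carrier (fspace L)"
    then obtain f where f: "g = ?J f" by blast
    have "mat_map Y X A (\<lambda>x\<in>X. if x \<in> L then f x else 0) = g"
      unfolding f mat_map_def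
      by (rule restrict_ext, rule sum.mono_neutral_cong_right) (use X L in auto)
    then show "g \<in> ?I" by (auto simp: fspace_simps(1) intro!: image_eqI[of _ _ "\<lambda>x\<in>X. if x \<in> L then f x else 0"])
  next
    fix g assume "g \<in> ?I"
    then obtain f where f: "g = mat_map Y X A f" by blast
    obtain c where c: "\<And>x k. x \<in> X \<Longrightarrow> k \<in> Y \<Longrightarrow> A k x = (\<Sum>y\<in>L. A k y * c x y)"
      using span by metis
    have "?J (\<lambda>y\<in>L. \<Sum>x\<in>X. f x * c x y) = g"
      unfolding f mat_map_def
    proof (rule restrict_ext)
      fix k assume k: "k \<in> Y"
      have "(\<Sum>l\<in>L. A k l * (\<lambda>y\<in>L. \<Sum>x\<in>X. f x * c x y) l) = (\<Sum>l\<in>L. \<Sum>x\<in>X. A k l * c x l * f x)"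
        by (simp add: sum_distrib_left mult_ac)
      also have "\<dots> = (\<Sum>x\<in>X. \<Sum>l\<in>L. A k l * c x l * f x)" by (rule sum.swap)
      also have "\<dots> = (\<Sum>x\<in>X. A k x * f x)"
        by (rule sum.cong[OF refl]) (simp add: c[OF _ k] sum_distrib_right)
      finally show "(\<Sum>l\<in>L. A k l * (\<lambda>y\<in>L. \<Sum>x\<in>X. f x * c x y) l) = (\<Sum>l\<in>X. A k l * f l)" .
    qed
    then show "g \<in> ?J ` carrier (fspace L)"
      by (auto simp: fspace_simps(1) intro!: image_eqI[of _ _ "\<lambda>y\<in>L. \<Sum>x\<in>X. f x * c x y"])
  qed
  have ker: "{v \<in> carrier (fspace L). ?J v = \<zero>\<^bsub>fspace Y\<^esub>} = {\<zero>\<^bsub>fspace L\<^esub>}"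
  proof -
    have "v = (\<lambda>x\<in>L. 0)" if v: "v \<in> L \<rightarrow>\<^sub>E UNIV" "?J v = (\<lambda>k\<in>Y. 0)" for v
    proof -
      have "(\<Sum>x\<in>L. A k x * v x) = 0" if "k \<in> Y" for k
        using fun_cong[OF v(2), of k] that by (simp add: mat_map_def)
      then have "\<forall>x\<in>L. v x = 0" using L(2) by (auto simp: indep_def)
      then show ?thesis using v(1) by (auto simp: PiE_def extensional_def)
    qed
    then show ?thesis by (auto simp: fspace_simps mat_map_def)
  qed
  interpret J: linear_map class_ring "fspace L" "fspace Y" ?J by (rule lin)
  have "vectorspace.dim class_ring (fspace L\<lparr>carrier := {\<zero>\<^bsub>fspace L\<^esub>}\<rparr> :: ('k, 'x \<Rightarrow> 'k) module) = 0"
    using J.inj_imp_dim_ker0[OF J.Ke0_imp_inj] ker by (simp add: J.ker_def)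
  then have "vectorspace.dim class_ring (fspace Y\<lparr>carrier := ?I\<rparr>) = card L"
    using rank_nullity_dim[OF lin fspace_dim(1)[OF finL]] fspace_dim(2)[OF finL, where 'k='k] im ker by simp
  then show thesis
    using that[OF L(1) _ _ span] L(2) unfolding indep_def by metis
qed

text \<open>The two equations determine the dimension of the homology of a complex of function spaces at
  its middle term.\<close>

lemma mat_map_rank_nullity:
  fixes A :: "'y \<Rightarrow> 'x \<Rightarrow> 'k::field"
  assumes "finite X"
  shows "vectorspace.dim class_ring (fspace Y\<lparr>carrier := mat_map Y X A ` carrier (fspace X)\<rparr>) +
     vectorspace.dim class_ring (fspace X\<lparr>carrier := {v \<in> carrier (fspace X). mat_map Y X A v = \<zero>\<^bsub>fspace Y\<^esub>}\<rparr>)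
     = card X"
  using rank_nullity_dim[OF mat_map_linear fspace_dim(1)[OF assms], of Y A]
    fspace_dim(2)[OF assms, where 'k='k] by simp

lemma image_dim_le_kernel_dim:
  fixes A :: "'y \<Rightarrow> 'x \<Rightarrow> 'k::field" and B :: "'x \<Rightarrow> 'z \<Rightarrow> 'k"
  assumes X: "finite X"
    and AB: "\<And>v. v \<in> carrier (fspace Z) \<Longrightarrow> mat_map Y X A (mat_map X Z B v) = \<zero>\<^bsub>fspace Y\<^esub>"
  shows "vectorspace.dim class_ring (fspace X\<lparr>carrier := mat_map X Z B ` carrier (fspace Z)\<rparr>) \<le>
     vectorspace.dim class_ring (fspace X\<lparr>carrier := {v \<in> carrier (fspace X). mat_map Y X A v = \<zero>\<^bsub>fspace Y\<^esub>}\<rparr>)"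
proof -
  let ?I = "mat_map X Z B ` carrier (fspace Z)"
  let ?C = "{v \<in> carrier (fspace X). mat_map Y X A v = \<zero>\<^bsub>fspace Y\<^esub>}"
  interpret A: linear_map class_ring "fspace X" "fspace Y" "mat_map Y X A" by (rule mat_map_linear)
  interpret B: linear_map class_ring "fspace Z" "fspace X" "mat_map X Z B" by (rule mat_map_linear)
  have C: "VectorSpace.subspace class_ring ?C (fspace X)"
    using A.kerT_is_subspace by (simp add: A.ker_def)
  have I: "VectorSpace.subspace class_ring ?I (fspace X)"
    using B.imT_is_subspace by (simp add: B.im_def)
  have vsC: "vectorspace class_ring (fspace X\<lparr>carrier := ?C\<rparr>)"
    by (rule A.V.subspace_is_vs[OF C])
  have fdC: "vectorspace.fin_dim class_ring (fspace X\<lparr>carrier := ?C\<rparr>)"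
    by (rule subspace_fin_dim[OF fspace_vectorspace fspace_dim(1)[OF X] C])
  have IC: "?I \<subseteq> ?C" using AB B.T_im by auto
  have "submodule class_ring ?I (fspace X\<lparr>carrier := ?C\<rparr>)"
    using I IC vsC unfolding VectorSpace.subspace_def submodule_def vectorspace_def by simp
  then have "VectorSpace.subspace class_ring ?I (fspace X\<lparr>carrier := ?C\<rparr>)"
    using vsC by (simp add: VectorSpace.subspace_def)
  from subspace_dim_le[OF vsC fdC this] show ?thesis by simp
qed

section \<open>Polynomials and their homogeneous parts\<close>

abbreviation coef :: "('a \<Rightarrow>\<^sub>0 'b::zero) \<Rightarrow> 'a \<Rightarrow> 'b" where "coef \<equiv> Poly_Mapping.lookup"
abbreviation supp :: "('a \<Rightarrow>\<^sub>0 'b::zero) \<Rightarrow> 'a set" where "supp \<equiv> Poly_Mapping.keys"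
abbreviation monom_of :: "'a \<Rightarrow> 'b \<Rightarrow> 'a \<Rightarrow>\<^sub>0 'b::zero" where "monom_of \<equiv> Poly_Mapping.single"

definition pols :: "nat \<Rightarrow> 'k::field mpol set" where
  "pols n = {p. \<forall>u\<in>supp p. supp u \<subseteq> {..<n}}"

lemma carrier_mpoly_ring: "carrier (mpoly_ring n) = pols n"
  by (simp add: mpoly_ring_def pols_def)

lemma mpoly_ring_simps [simp]:
  "monoid.mult (mpoly_ring n) = (*)" "one (mpoly_ring n) = 1"
  "zero (mpoly_ring n) = 0" "add (mpoly_ring n) = (+)"
  by (simp_all add: mpoly_ring_def)

lemma supp_exp_add: "supp (u + v) = supp u \<union> supp (v :: nat \<Rightarrow>\<^sub>0 nat)"
  by (auto simp: in_keys_iff lookup_add)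

lemma pols_zero [simp]: "0 \<in> pols n" and pols_one [simp]: "1 \<in> pols n"
  by (auto simp: pols_def)

lemma pols_add [intro]: "p \<in> pols n \<Longrightarrow> q \<in> pols n \<Longrightarrow> p + q \<in> pols n"
  using keys_add[of p q] by (fastforce simp: pols_def)

lemma pols_uminus [intro]: "p \<in> pols n \<Longrightarrow> - p \<in> pols n"
  by (auto simp: pols_def)

lemma pols_diff [intro]: "p \<in> pols n \<Longrightarrow> q \<in> pols n \<Longrightarrow> p - q \<in> pols n"
  using pols_add[of p n "- q"] by auto

lemma pols_mult [intro]: "p \<in> pols n \<Longrightarrow> q \<in> pols n \<Longrightarrow> p * q \<in> pols n"
  using keys_mult[of p q] by (fastforce simp: pols_def supp_exp_add)

lemma pols_sum [intro]: "(\<And>x. x \<in> A \<Longrightarrow> f x \<in> pols n) \<Longrightarrow> sum f A \<in> pols n"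
  by (induction A rule: infinite_finite_induct) auto

lemma pols_monom [intro]: "supp u \<subseteq> {..<n} \<Longrightarrow> monom_of u c \<in> pols n"
  by (auto simp: pols_def)

lemma pols_const [simp]: "const_pol c \<in> pols n"
  by (auto simp: const_pol_def pols_def)

lemma mpoly_cring: "cring (mpoly_ring n :: 'k::field mpol ring)"
proof (rule cringI)
  show "abelian_group (mpoly_ring n :: 'k mpol ring)"
  proof (rule abelian_groupI)
    fix p :: "'k mpol" assume "p \<in> carrier (mpoly_ring n)"
    then show "\<exists>q\<in>carrier (mpoly_ring n). q \<oplus>\<^bsub>mpoly_ring n\<^esub> p = \<zero>\<^bsub>mpoly_ring n\<^esub>"
      by (auto simp: carrier_mpoly_ring intro!: bexI[of _ "- p"])
  qed (auto simp: carrier_mpoly_ring algebra_simps)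
  show "Group.comm_monoid (mpoly_ring n :: 'k mpol ring)"
    by (rule comm_monoidI) (auto simp: carrier_mpoly_ring algebra_simps)
qed (auto simp: carrier_mpoly_ring algebra_simps)

lemma exp_degree_eq_sum:
  "finite A \<Longrightarrow> supp u \<subseteq> A \<Longrightarrow> exp_degree u = (\<Sum>i\<in>A. coef u i)"
  unfolding exp_degree_def by (rule sum.mono_neutral_left) (auto simp: in_keys_iff)

lemma exp_degree_add: "exp_degree (u + v) = exp_degree u + exp_degree v"
proof -
  have "finite (supp u \<union> supp v)" by simp
  then show ?thesis
    by (simp add: exp_degree_eq_sum[of "supp u \<union> supp v"] supp_exp_add lookup_add sum.distrib)
qed

lemma exp_degree_zero [simp]: "exp_degree 0 = 0"
  by (simp add: exp_degree_def)

lemma exp_degree_single [simp]: "exp_degree (monom_of i m) = m"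
  by (cases "m = 0") (auto simp: exp_degree_def)

lemma exp_degree_eq_0_iff [simp]: "exp_degree u = 0 \<longleftrightarrow> u = 0"
  by (auto simp: exp_degree_def in_keys_iff intro!: poly_mapping_eqI)

lemma exp_add_eq_0_iff [simp]: "u + v = 0 \<longleftrightarrow> u = 0 \<and> v = (0 :: nat \<Rightarrow>\<^sub>0 nat)"
  by (metis add_is_0 exp_degree_add exp_degree_eq_0_iff)

lemma coef_const_mult [simp]: "coef (const_pol c * p) u = c * coef p u"
proof -
  have "const_pol c * p = Poly_Mapping.map ((*) c) p"
    by (simp add: const_pol_def mult_map_scale_conv_mult)
  then show ?thesis by (simp add: Poly_Mapping.map.rep_eq when_def)
qed

lemma coef_monom_mult: "coef (monom_of e c * p) (e + u) = c * coef (p :: 'k::field mpol) u"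
proof -
  have "coef (monom_of e c * p) (e + u) =
      (\<Sum>l. coef (monom_of e c) l * (\<Sum>q. coef p q when e + u = l + q))"
    by (simp add: lookup_mult)
  also have "\<dots> = (\<Sum>l. (c * (\<Sum>q. coef p q when e + u = l + q)) when l = e)"
    by (rule Sum_any.cong) (simp add: lookup_single when_def)
  also have "\<dots> = c * (\<Sum>q. coef p q when q = u)"
    by (simp only: Sum_any_when_equal add_left_cancel) (simp add: eq_commute)
  finally show ?thesis by simp
qed

lemma poly_eq_sum_monoms: "p = (\<Sum>u\<in>supp p. monom_of u (coef p u))"
proof (rule poly_mapping_eqI)
  fix v
  have "coef (\<Sum>u\<in>supp p. monom_of u (coef p u)) v = (\<Sum>u\<in>supp p. if u = v then coef p u else 0)"
    by (simp add: lookup_sum lookup_single when_def)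
  also have "\<dots> = coef p v" by (simp add: in_keys_iff)
  finally show "coef p v = coef (\<Sum>u\<in>supp p. monom_of u (coef p u)) v" by simp
qed

lemma const_coeff_add [simp]: "const_coeff (p + q) = const_coeff p + const_coeff q"
  and const_coeff_zero [simp]: "const_coeff 0 = 0"
  and const_coeff_one [simp]: "const_coeff 1 = 1"
  and const_coeff_uminus [simp]: "const_coeff (- p) = - const_coeff p"
  and const_coeff_diff [simp]: "const_coeff (p - q) = const_coeff p - const_coeff q"
  and const_coeff_const [simp]: "const_coeff (const_pol c) = c"
  by (simp_all add: const_coeff_def lookup_add lookup_minus const_pol_def)

lemma const_coeff_sum [simp]: "const_coeff (sum f A) = (\<Sum>x\<in>A. const_coeff (f x))"
  by (simp add: const_coeff_def lookup_sum)

lemma const_coeff_mult [simp]: "const_coeff (p * q) = const_coeff p * const_coeff q"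
proof -
  have *: "const_coeff (r * q) = 0" if "const_coeff r = 0" for r
  proof (rule ccontr)
    assume "const_coeff (r * q) \<noteq> 0"
    then have "0 \<in> supp (r * q)" by (simp add: const_coeff_def in_keys_iff)
    then obtain a b where "a \<in> supp r" "0 = a + b" using keys_mult[of r q] by blast
    then have "0 \<in> supp r" by (metis exp_add_eq_0_iff)
    then show False using that by (simp add: const_coeff_def in_keys_iff)
  qed
  have "p * q = const_pol (const_coeff p) * q + (p - const_pol (const_coeff p)) * q"
    by (simp add: algebra_simps)
  then have "const_coeff (p * q) =
      const_coeff (const_pol (const_coeff p) * q) + const_coeff ((p - const_pol (const_coeff p)) * q)"
    by (metis const_coeff_add)
  also have "const_coeff ((p - const_pol (const_coeff p)) * q) = 0" by (rule *) simp
  finally show ?thesis by (simp add: const_coeff_def)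
qed

lemma const_pol_add: "const_pol (c + d) = const_pol c + const_pol d"
  and const_pol_mult: "const_pol (c * d) = const_pol c * const_pol d"
  and const_pol_zero [simp]: "const_pol 0 = 0"
  and const_pol_one [simp]: "const_pol 1 = 1"
  by (simp_all add: const_pol_def single_add mult_single)

subsection \<open>Homogeneous parts\<close>

definition restrict_supp :: "(nat \<Rightarrow>\<^sub>0 nat) set \<Rightarrow> 'k::field mpol \<Rightarrow> 'k mpol" where
  "restrict_supp U p = Poly_Mapping.mapp (\<lambda>u c. if u \<in> U then c else 0) p"

lemma coef_restrict_supp: "coef (restrict_supp U p) u = (if u \<in> U then coef p u else 0)"
  by (auto simp: restrict_supp_def lookup_mapp when_def in_keys_iff)

lemma supp_restrict_supp: "supp (restrict_supp U p) = supp p \<inter> U"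
  by (auto simp: in_keys_iff coef_restrict_supp split: if_splits)

lemma restrict_supp_pols [intro]: "p \<in> pols n \<Longrightarrow> restrict_supp U p \<in> pols n"
  by (auto simp: pols_def supp_restrict_supp)

definition hom_part :: "int \<Rightarrow> 'k::field mpol \<Rightarrow> 'k mpol" where
  "hom_part a = restrict_supp {u. int (exp_degree u) = a}"

lemma coef_hom_part: "coef (hom_part a p) u = (if int (exp_degree u) = a then coef p u else 0)"
  by (simp add: hom_part_def coef_restrict_supp)

lemma hom_part_pols [intro]: "p \<in> pols n \<Longrightarrow> hom_part a p \<in> pols n"
  by (auto simp: hom_part_def)

lemma hom_part_add: "hom_part a (p + q) = hom_part a p + hom_part a q"
  and hom_part_diff: "hom_part a (p - q) = hom_part a p - hom_part a q"
  and hom_part_zero [simp]: "hom_part a 0 = 0"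
  by (rule poly_mapping_eqI, simp add: coef_hom_part lookup_add lookup_minus)+

lemma hom_part_sum: "hom_part a (sum f A) = (\<Sum>x\<in>A. hom_part a (f x))"
  by (induction A rule: infinite_finite_induct) (auto simp: hom_part_add)

lemma homogeneous_hom_part [simp]: "homogeneous_of_degree a (hom_part a p)"
  by (auto simp: homogeneous_of_degree_def hom_part_def supp_restrict_supp)

lemma hom_part_homogeneous:
  "homogeneous_of_degree b p \<Longrightarrow> hom_part a p = (if a = b then p else 0)"
  by (rule poly_mapping_eqI)
     (auto simp: coef_hom_part homogeneous_of_degree_def in_keys_iff)

lemma homogeneous_zero [simp]: "homogeneous_of_degree a 0"
  by (simp add: homogeneous_of_degree_def)

lemma homogeneous_add:
  "homogeneous_of_degree a p \<Longrightarrow> homogeneous_of_degree a q \<Longrightarrow> homogeneous_of_degree a (p + q)"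
  using keys_add[of p q] by (fastforce simp: homogeneous_of_degree_def)

lemma homogeneous_uminus: "homogeneous_of_degree a p \<Longrightarrow> homogeneous_of_degree a (- p)"
  by (auto simp: homogeneous_of_degree_def)

lemma homogeneous_diff:
  "homogeneous_of_degree a p \<Longrightarrow> homogeneous_of_degree a q \<Longrightarrow> homogeneous_of_degree a (p - q)"
  using homogeneous_add[of a p "- q"] homogeneous_uminus by auto

lemma homogeneous_sum:
  "(\<And>x. x \<in> A \<Longrightarrow> homogeneous_of_degree a (f x)) \<Longrightarrow> homogeneous_of_degree a (sum f A)"
  by (induction A rule: infinite_finite_induct) (auto intro: homogeneous_add)

lemma homogeneous_mult:
  assumes "homogeneous_of_degree a p" "homogeneous_of_degree b q"
  shows "homogeneous_of_degree (a + b) (p * q)"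
  unfolding homogeneous_of_degree_def
proof
  fix u assume "u \<in> supp (p * q)"
  then obtain v w where "v \<in> supp p" "w \<in> supp q" "u = v + w" using keys_mult[of p q] by blast
  then show "int (exp_degree u) = a + b"
    using assms by (simp add: homogeneous_of_degree_def exp_degree_add)
qed

lemma homogeneous_const [simp]: "homogeneous_of_degree 0 (const_pol c)"
  by (auto simp: homogeneous_of_degree_def const_pol_def)

lemma homogeneous_one [simp]: "homogeneous_of_degree 0 1"
  by (auto simp: homogeneous_of_degree_def)

lemma homogeneous_monom: "homogeneous_of_degree (int (exp_degree u)) (monom_of u c)"
  by (auto simp: homogeneous_of_degree_def)

lemma homogeneous_negative: "homogeneous_of_degree a p \<Longrightarrow> a < 0 \<Longrightarrow> p = 0"
  by (rule poly_mapping_eqI) (force simp: homogeneous_of_degree_def in_keys_iff)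

lemma homogeneous_const_coeff: "homogeneous_of_degree a p \<Longrightarrow> a \<noteq> 0 \<Longrightarrow> const_coeff p = 0"
  by (force simp: homogeneous_of_degree_def in_keys_iff const_coeff_def)

lemma homogeneous_degree_0:
  assumes "homogeneous_of_degree 0 p" shows "p = const_pol (const_coeff p)"
proof (rule poly_mapping_eqI)
  fix u show "coef p u = coef (const_pol (const_coeff p)) u"
    using assms by (cases "u = 0")
      (auto simp: homogeneous_of_degree_def const_pol_def const_coeff_def in_keys_iff lookup_single when_def)
qed

lemma sum_hom_parts:
  assumes "finite A" "(\<lambda>u. int (exp_degree u)) ` supp p \<subseteq> A"
  shows "(\<Sum>a\<in>A. hom_part a p) = p"
proof (rule poly_mapping_eqI)
  fix u
  have "coef (\<Sum>a\<in>A. hom_part a p) u = (\<Sum>a\<in>A. if a = int (exp_degree u) then coef p u else 0)"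
    by (auto simp: lookup_sum coef_hom_part intro!: sum.cong)
  also have "\<dots> = coef p u"
    using assms by (auto simp: image_subset_iff in_keys_iff)
  finally show "coef (\<Sum>a\<in>A. hom_part a p) u = coef p u" .
qed

lemma hom_part_mult:
  assumes q: "homogeneous_of_degree b q"
  shows "hom_part a (q * p) = q * hom_part (a - b) p"
proof -
  let ?A = "insert (a - b) ((\<lambda>u. int (exp_degree u)) ` supp p)"
  have "q * p = (\<Sum>c\<in>?A. q * hom_part c p)"
    by (subst sum_distrib_left[symmetric], subst sum_hom_parts) auto
  then have "hom_part a (q * p) = (\<Sum>c\<in>?A. hom_part a (q * hom_part c p))"
    by (simp add: hom_part_sum)
  also have "\<dots> = (\<Sum>c\<in>?A. if c = a - b then q * hom_part c p else 0)"
  proof (rule sum.cong[OF refl])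
    fix c
    have "homogeneous_of_degree (b + c) (q * hom_part c p)" by (rule homogeneous_mult[OF q]) simp
    then show "hom_part a (q * hom_part c p) = (if c = a - b then q * hom_part c p else 0)"
      by (auto simp: hom_part_homogeneous)
  qed
  also have "\<dots> = q * hom_part (a - b) p" by simp
  finally show ?thesis .
qed

section \<open>Exactness modulo the variables\<close>

text \<open>Vectors with coordinates in \<open>J\<close> are total functions that vanish off \<open>J\<close>, so that the pointwise operations
  on functions make them a module.\<close>

definition vecs :: "nat \<Rightarrow> nat set \<Rightarrow> (nat \<Rightarrow> 'k::field mpol) set" where
  "vecs n J = {v. (\<forall>l. v l \<in> pols n) \<and> (\<forall>l. l \<notin> J \<longrightarrow> v l = 0)}"

definition smul :: "'k::field mpol \<Rightarrow> (nat \<Rightarrow> 'k mpol) \<Rightarrow> nat \<Rightarrow> 'k mpol" where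
  "smul p v = (\<lambda>l. p * v l)"

lemma vecs_zero [simp]: "0 \<in> vecs n J"
  and vecs_add [intro]: "v \<in> vecs n J \<Longrightarrow> w \<in> vecs n J \<Longrightarrow> v + w \<in> vecs n J"
  and vecs_diff [intro]: "v \<in> vecs n J \<Longrightarrow> w \<in> vecs n J \<Longrightarrow> v - w \<in> vecs n J"
  and vecs_uminus [intro]: "v \<in> vecs n J \<Longrightarrow> - v \<in> vecs n J"
  and vecs_smul [intro]: "p \<in> pols n \<Longrightarrow> v \<in> vecs n J \<Longrightarrow> smul p v \<in> vecs n J"
  by (auto simp: vecs_def smul_def)

lemma smul_add: "smul p (v + w) = smul p v + smul p w"
  and smul_diff: "smul p (v - w) = smul p v - smul p w"
  and smul_uminus: "smul p (- v) = - smul p v"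
  and smul_zero [simp]: "smul p 0 = 0"
  and smul_smul: "smul p (smul q v) = smul (p * q) v"
  and smul_one [simp]: "smul 1 v = v"
  and zero_smul [simp]: "smul 0 v = 0"
  and add_smul: "smul (p + q) v = smul p v + smul q v"
  and uminus_smul: "smul (- p) v = - smul p v"
  by (rule ext, simp add: smul_def distrib_left distrib_right left_diff_distrib right_diff_distrib mult.assoc)+

lemmas fun_ops_apply = zero_fun_apply plus_fun_apply minus_apply uminus_apply

text \<open>Instantiated rules contain eta-expanded vectors, which pointwise evaluation would turn into a
  different normal form.\<close>

declare fun_ops_apply [simp del]

text \<open>A free resolution of the cokernel of \<open>D 0\<close>, with \<open>F\<^sub>i\<close> free on the index set \<open>J i\<close>.\<close>

locale free_resolution =
  fixes n :: nat and J :: "nat \<Rightarrow> nat set"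
    and D :: "nat \<Rightarrow> (nat \<Rightarrow> 'k::field mpol) \<Rightarrow> nat \<Rightarrow> 'k mpol"
  assumes D_vecs: "v \<in> vecs n (J (Suc i)) \<Longrightarrow> D i v \<in> vecs n (J i)"
    and D_add: "v \<in> vecs n (J (Suc i)) \<Longrightarrow> w \<in> vecs n (J (Suc i)) \<Longrightarrow> D i (v + w) = D i v + D i w"
    and D_smul: "p \<in> pols n \<Longrightarrow> v \<in> vecs n (J (Suc i)) \<Longrightarrow> D i (smul p v) = smul p (D i v)"
    and DD: "v \<in> vecs n (J (Suc (Suc i))) \<Longrightarrow> D i (D (Suc i) v) = 0"
    and exact: "v \<in> vecs n (J (Suc i)) \<Longrightarrow> D i v = 0 \<Longrightarrow>
       \<exists>w\<in>vecs n (J (Suc (Suc i))). D (Suc i) w = v"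
begin

lemma D_zero [simp]: "D i 0 = 0"
  using D_smul[of 0 0 i] by simp

lemma D_uminus: "v \<in> vecs n (J (Suc i)) \<Longrightarrow> D i (- v) = - D i v"
  using D_smul[of "- 1" v i] by (simp add: uminus_smul pols_uminus)

lemma D_diff: "v \<in> vecs n (J (Suc i)) \<Longrightarrow> w \<in> vecs n (J (Suc i)) \<Longrightarrow> D i (v - w) = D i v - D i w"
  using D_add[of v i "- w"] D_uminus[of w i] vecs_uminus[of w] by simp

end

text \<open>\<open>xvecs n k J\<close> is \<open>(x\<^sub>1, \<dots>, x\<^sub>k) F\<close> for the free module \<open>F\<close> with basis \<open>J\<close>.\<close>

definition xpols :: "nat \<Rightarrow> nat \<Rightarrow> 'k::field mpol set" where
  "xpols n k = {p \<in> pols n. \<forall>u\<in>supp p. \<exists>i<k. i \<in> supp u}"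

definition xvecs :: "nat \<Rightarrow> nat \<Rightarrow> nat set \<Rightarrow> (nat \<Rightarrow> 'k::field mpol) set" where
  "xvecs n k J = {v \<in> vecs n J. \<forall>l. v l \<in> xpols n k}"

lemma xpols_add: "p \<in> xpols n k \<Longrightarrow> q \<in> xpols n k \<Longrightarrow> p + q \<in> xpols n k"
  using keys_add[of p q] by (fastforce simp: xpols_def)

lemma xpols_uminus: "p \<in> xpols n k \<Longrightarrow> - p \<in> xpols n k"
  by (auto simp: xpols_def)

lemma xvecs_add: "v \<in> xvecs n k J \<Longrightarrow> w \<in> xvecs n k J \<Longrightarrow> v + w \<in> xvecs n k J"
  by (auto simp: xvecs_def xpols_add fun_ops_apply)

lemma xvecs_uminus: "v \<in> xvecs n k J \<Longrightarrow> - v \<in> xvecs n k J"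
  by (auto simp: xvecs_def xpols_uminus fun_ops_apply)

lemma xvecs_vecs: "v \<in> xvecs n k J \<Longrightarrow> v \<in> vecs n J"
  by (simp add: xvecs_def)

lemma xvecs_0: "xvecs n 0 J = {0}"
proof -
  have "p \<in> xpols n 0 \<longleftrightarrow> p = 0" for p :: "'a mpol"
    by (auto simp: xpols_def in_keys_iff intro!: poly_mapping_eqI)
  then have "xvecs n 0 J = {v \<in> vecs n J. \<forall>l. v l = (0 :: 'a mpol)}" by (simp add: xvecs_def)
  also have "\<dots> = {0}" by (auto simp: vecs_def fun_ops_apply)
  finally show ?thesis .
qed

lemma xvecs_all: "xvecs n n J = {v \<in> vecs n J. \<forall>l. const_coeff (v l) = 0}"
proof -
  have "p \<in> xpols n n \<longleftrightarrow> p \<in> pols n \<and> const_coeff p = 0" for p :: "'a mpol"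
  proof
    assume "p \<in> xpols n n"
    then show "p \<in> pols n \<and> const_coeff p = 0"
      by (force simp: xpols_def const_coeff_def in_keys_iff)
  next
    assume p: "p \<in> pols n \<and> const_coeff p = 0"
    have "\<exists>i<n. i \<in> supp u" if u: "u \<in> supp p" for u
    proof -
      have "u \<noteq> 0" using u p by (auto simp: const_coeff_def in_keys_iff)
      then obtain i where "i \<in> supp u" by (metis in_keys_iff lookup_zero poly_mapping_eqI)
      then show ?thesis using u p by (auto simp: pols_def)
    qed
    then show "p \<in> xpols n n" using p by (auto simp: xpols_def)
  qed
  then show ?thesis by (auto simp: xvecs_def vecs_def)
qed

abbreviation var :: "nat \<Rightarrow> 'k::field mpol" where
  "var k \<equiv> monom_of (monom_of k (Suc 0)) 1"

lemma var_pols [intro]: "k < n \<Longrightarrow> var k \<in> pols n"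
  by (rule pols_monom) auto

lemma xvecs_Suc_mono: "v \<in> xvecs n k J \<Longrightarrow> v \<in> xvecs n (Suc k) J"
  unfolding xvecs_def xpols_def using less_SucI by blast

lemma smul_var_xvecs: "k < n \<Longrightarrow> v \<in> vecs n J \<Longrightarrow> smul (var k) v \<in> xvecs n (Suc k) J"
proof -
  assume k: "k < n" and v: "v \<in> vecs n J"
  have "var k * p \<in> xpols n (Suc k)" if p: "p \<in> pols n" for p :: "'a mpol"
  proof -
    have "k \<in> supp u" if "u \<in> supp (var k * p)" for u
      using keys_mult[of "var k" p] that by (auto simp: supp_exp_add)
    then show ?thesis using p k by (auto simp: xpols_def intro!: pols_mult)
  qed
  then show ?thesis using k v by (auto simp: xvecs_def vecs_def smul_def intro!: pols_mult)
qed

lemma xpols_split: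
  assumes p: "p \<in> xpols n (Suc k)" and k: "k < n"
  shows "\<exists>a b. a \<in> xpols n k \<and> b \<in> pols n \<and> p = a + var k * b"
proof -
  define U where "U = {u. \<exists>i<k. i \<in> supp (u :: nat \<Rightarrow>\<^sub>0 nat)}"
  define b where "b = (\<Sum>u\<in>supp p - U. monom_of (u - monom_of k (Suc 0)) (coef p u))"
  have sh: "monom_of k (Suc 0) + (u - monom_of k (Suc 0)) = u" if "k \<in> supp u" for u :: "nat \<Rightarrow>\<^sub>0 nat"
    by (rule poly_mapping_eqI)
       (use that in \<open>auto simp: lookup_add lookup_minus lookup_single when_def in_keys_iff\<close>)
  have kU: "k \<in> supp u" if "u \<in> supp p - U" for u
    using p that by (auto simp: xpols_def U_def less_Suc_eq)
  have supp_sub: "supp (u - monom_of k (Suc 0)) \<subseteq> supp u" for u :: "nat \<Rightarrow>\<^sub>0 nat"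
    by (auto simp: in_keys_iff lookup_minus)
  have "b \<in> pols n" unfolding b_def
    by (rule pols_sum, rule pols_monom) (use p supp_sub in \<open>force simp: xpols_def pols_def\<close>)
  moreover have "restrict_supp U p \<in> xpols n k"
    using p by (auto simp: xpols_def supp_restrict_supp U_def)
  moreover have "p = restrict_supp U p + var k * b"
  proof -
    have "var k * b = (\<Sum>u\<in>supp p - U. monom_of u (coef p u))"
      unfolding b_def sum_distrib_left
      by (rule sum.cong[OF refl]) (simp add: mult_single sh[OF kU])
    also have "\<dots> = (\<Sum>u\<in>supp (restrict_supp (- U) p). monom_of u (coef (restrict_supp (- U) p) u))"
      by (rule sum.cong) (auto simp: supp_restrict_supp coef_restrict_supp)
    also have "\<dots> = restrict_supp (- U) p" by (rule poly_eq_sum_monoms[symmetric])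
    finally have "var k * b = restrict_supp (- U) p" .
    then show ?thesis by (auto intro!: poly_mapping_eqI simp: lookup_add coef_restrict_supp)
  qed
  ultimately show ?thesis by blast
qed

lemma xvecs_split:
  assumes v: "v \<in> xvecs n (Suc k) J" and k: "k < n"
  obtains a b where "a \<in> xvecs n k J" "b \<in> vecs n J" "v = a + smul (var k) b"
proof -
  have "\<exists>a b. a \<in> xpols n k \<and> b \<in> pols n \<and> v l = a + var k * b \<and> (l \<notin> J \<longrightarrow> a = 0 \<and> b = 0)" for l
  proof (cases "l \<in> J")
    case True
    then show ?thesis using xpols_split[OF _ k, of "v l"] v by (auto simp: xvecs_def)
  next
    case False
    then show ?thesis using v by (intro exI[of _ 0]) (auto simp: xvecs_def vecs_def xpols_def)
  qed
  then obtain a b where "\<And>l. a l \<in> xpols n k \<and> b l \<in> pols n \<and> v l = a l + var k * b l \<and>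
      (l \<notin> J \<longrightarrow> a l = 0 \<and> b l = 0)" by metis
  then show thesis
    by (intro that[of a b]) (auto simp: xvecs_def vecs_def smul_def xpols_def fun_eq_iff fun_ops_apply)
qed

text \<open>\<open>x\<^sub>k\<close> is a nonzerodivisor modulo the earlier variables.\<close>

lemma xvecs_cancel_var:
  assumes v: "v \<in> vecs n J" and xv: "smul (var k) v \<in> xvecs n k J"
  shows "v \<in> xvecs n k J"
proof -
  have "\<exists>i<k. i \<in> supp u" if u: "u \<in> supp (v l)" for l u
  proof -
    have "coef (var k * v l) (monom_of k (Suc 0) + u) \<noteq> 0"
      using u by (simp add: coef_monom_mult in_keys_iff)
    then have "monom_of k (Suc 0) + u \<in> supp (var k * v l)" by (simp add: in_keys_iff)
    then obtain i where "i < k" "i \<in> supp (monom_of k (Suc 0) + u)"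
      using xv by (auto simp: xvecs_def xpols_def smul_def)
    then show ?thesis by (auto simp: supp_exp_add)
  qed
  then show ?thesis using v by (auto simp: xvecs_def xpols_def vecs_def)
qed

context free_resolution
begin

lemma D_add_smul:
  "a \<in> vecs n (J (Suc i)) \<Longrightarrow> b \<in> vecs n (J (Suc i)) \<Longrightarrow> p \<in> pols n \<Longrightarrow>
    D i (a + smul p b) = D i a + smul p (D i b)"
  by (metis D_add D_smul vecs_smul)

lemma D_diff_smul:
  "a \<in> vecs n (J (Suc i)) \<Longrightarrow> b \<in> vecs n (J (Suc i)) \<Longrightarrow> p \<in> pols n \<Longrightarrow>
    D i (a - smul p b) = D i a - smul p (D i b)"
  by (metis D_diff D_smul vecs_smul)

lemma D_xvecs: "k \<le> n \<Longrightarrow> v \<in> xvecs n k (J (Suc i)) \<Longrightarrow> D i v \<in> xvecs n k (J i)"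
proof (induction k arbitrary: v)
  case 0
  then have "v = 0" using xvecs_0 by blast
  then show ?case using xvecs_0 D_zero by blast
next
  case (Suc k)
  then obtain a b where ab: "a \<in> xvecs n k (J (Suc i))" "b \<in> vecs n (J (Suc i))" "v = a + smul (var k) b"
    by (meson xvecs_split Suc_le_lessD)
  have kn: "k < n" and k: "var k \<in> pols n" using Suc.prems by auto
  have "D i v = D i a + smul (var k) (D i b)"
    unfolding ab(3) by (rule D_add_smul[OF xvecs_vecs[OF ab(1)] ab(2) k])
  moreover have "D i a \<in> xvecs n (Suc k) (J i)"
    by (rule xvecs_Suc_mono[OF Suc.IH[OF less_imp_le[OF kn] ab(1)]])
  moreover have "smul (var k) (D i b) \<in> xvecs n (Suc k) (J i)"
    by (rule smul_var_xvecs[OF kn D_vecs[OF ab(2)]])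
  ultimately show ?case by (metis xvecs_add)
qed

text \<open>Killing one more variable shifts the range of exactness by one: this is the long exact sequence
  of \<open>0 \<rightarrow> F/(x\<^sub>1, \<dots>, x\<^sub>k)F \<rightarrow> F/(x\<^sub>1, \<dots>, x\<^sub>k)F \<rightarrow> F/(x\<^sub>1, \<dots>, x\<^sub>k\<^sub>+\<^sub>1)F \<rightarrow> 0\<close>.\<close>

lemma exact_modulo_variables:
  "k \<le> n \<Longrightarrow> k \<le> i \<Longrightarrow> v \<in> vecs n (J (Suc i)) \<Longrightarrow> D i v \<in> xvecs n k (J i) \<Longrightarrow>
    \<exists>w\<in>vecs n (J (Suc (Suc i))). v - D (Suc i) w \<in> xvecs n k (J (Suc i))"
proof (induction k arbitrary: i v)
  case 0
  then have "D i v = 0" using xvecs_0 by blast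
  then obtain w where w: "w \<in> vecs n (J (Suc (Suc i)))" "D (Suc i) w = v" using exact 0 by blast
  then have "v - D (Suc i) w = 0" by (metis diff_self)
  then show ?case using w xvecs_0 by (metis singletonI)
next
  case (Suc k)
  obtain i' where i: "i = Suc i'" using Suc.prems(2) by (metis Suc_le_D)
  have kn: "k < n" and kn': "k \<le> n" and xk: "var k \<in> pols n" and ki': "k \<le> i'" and ki: "k \<le> i"
    using Suc.prems i by auto
  obtain a u where au: "a \<in> xvecs n k (J i)" "u \<in> vecs n (J i)" "D i v = a + smul (var k) u"
    using xvecs_split[OF Suc.prems(4) kn] by blast
  have "0 = D i' (D i v)" using DD[of v i'] Suc.prems(3) i by metis
  also have "\<dots> = D i' a + smul (var k) (D i' u)"
    unfolding au(3) by (rule D_add_smul) (use au i xk xvecs_vecs in blast)+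
  finally have "smul (var k) (D i' u) = - D i' a" by (metis add.commute eq_neg_iff_add_eq_0)
  then have "smul (var k) (D i' u) \<in> xvecs n k (J i')"
    using D_xvecs[OF kn', of a i'] au(1) i xvecs_uminus by metis
  then have "D i' u \<in> xvecs n k (J i')"
    using xvecs_cancel_var D_vecs[of u i'] au(2) i by blast
  then obtain w' where w': "w' \<in> vecs n (J (Suc i))" "u - D i w' \<in> xvecs n k (J i)"
    using Suc.IH[OF kn' ki', of u] au(2) i by blast
  have "D i (v - smul (var k) w') = D i v - smul (var k) (D i w')"
    by (rule D_diff_smul[OF Suc.prems(3) w'(1) xk])
  then have "D i (v - smul (var k) w') = a + smul (var k) (u - D i w')"
    unfolding au(3) smul_diff by (metis add_diff_eq)
  moreover have "smul (var k) (u - D i w') \<in> xvecs n k (J i)"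
  proof -
    have "var k * p \<in> xpols n k" if "p \<in> xpols n k" for p :: "'k mpol"
      using that xk keys_mult[of "var k" p] by (fastforce simp: xpols_def supp_exp_add)
    then show ?thesis using w'(2) xk by (auto simp: xvecs_def smul_def vecs_def)
  qed
  ultimately have "D i (v - smul (var k) w') \<in> xvecs n k (J i)"
    using au(1) by (metis xvecs_add)
  moreover have "v - smul (var k) w' \<in> vecs n (J (Suc i))"
    using Suc.prems(3) w'(1) xk by blast
  ultimately obtain w where w: "w \<in> vecs n (J (Suc (Suc i)))"
      "v - smul (var k) w' - D (Suc i) w \<in> xvecs n k (J (Suc i))"
    using Suc.IH[OF kn' ki] by blast
  have "v - D (Suc i) w = (v - smul (var k) w' - D (Suc i) w) + smul (var k) w'"
    by (rule ext) (simp add: fun_ops_apply)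
  then have "v - D (Suc i) w \<in> xvecs n (Suc k) (J (Suc i))"
    using w(2) smul_var_xvecs[OF kn w'(1)] by (metis xvecs_add xvecs_Suc_mono)
  then show ?case using w(1) by blast
qed

end

section \<open>Depth and the vanishing of Tor\<close>

text \<open>Regular sequences on \<open>F\<^sub>0 / B\<close>, formulated in the free module \<open>F\<^sub>0\<close>.\<close>

fun weakly_regular ::
  "nat \<Rightarrow> nat set \<Rightarrow> (nat \<Rightarrow> 'k::field mpol) set \<Rightarrow> 'k mpol list \<Rightarrow> bool" where
  "weakly_regular n J0 B [] \<longleftrightarrow> True"
| "weakly_regular n J0 B (f # fs) \<longleftrightarrow> (\<forall>v\<in>vecs n J0. smul f v \<in> B \<longrightarrow> v \<in> B) \<and>
     weakly_regular n J0 {b + smul f v | b v. b \<in> B \<and> v \<in> vecs n J0} fs"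

text \<open>A pair of vectors is stored as one vector, on the even and the odd indices.\<close>

definition interleave :: "(nat \<Rightarrow> 'k::field mpol) \<Rightarrow> (nat \<Rightarrow> 'k mpol) \<Rightarrow> nat \<Rightarrow> 'k mpol" where
  "interleave v w = (\<lambda>l. if even l then v (l div 2) else w (l div 2))"

definition evens :: "(nat \<Rightarrow> 'k::field mpol) \<Rightarrow> nat \<Rightarrow> 'k mpol" where "evens v = (\<lambda>l. v (2 * l))"
definition odds :: "(nat \<Rightarrow> 'k::field mpol) \<Rightarrow> nat \<Rightarrow> 'k mpol" where "odds v = (\<lambda>l. v (2 * l + 1))"

definition interleave_index :: "nat set \<Rightarrow> nat set \<Rightarrow> nat set" where
  "interleave_index I J = (\<lambda>l. 2 * l) ` I \<union> (\<lambda>l. 2 * l + 1) ` J"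

lemma interleave_simps [simp]:
  "evens (interleave v w) = v" "odds (interleave v w) = w" "interleave (evens x) (odds x) = x"
  by (rule ext, simp add: interleave_def evens_def odds_def fun_ops_apply)+

lemma interleave_eq_iff: "interleave v w = interleave v' w' \<longleftrightarrow> v = v' \<and> w = w'"
  by (metis interleave_simps(1,2))

lemma interleave_ops:
  "interleave v w + interleave v' w' = interleave (v + v') (w + w')"
  "interleave v w - interleave v' w' = interleave (v - v') (w - w')"
  "smul p (interleave v w) = interleave (smul p v) (smul p w)"
  by (rule ext, simp add: interleave_def smul_def fun_ops_apply)+

lemma interleave_zero: "interleave 0 0 = 0"
  by (rule ext) (simp add: interleave_def fun_ops_apply)

lemma evens_odds_ops:
  "evens (x + y) = evens x + evens y" "odds (x + y) = odds x + odds y"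
  "evens (x - y) = evens x - evens y" "odds (x - y) = odds x - odds y"
  "evens (smul p x) = smul p (evens x)" "odds (smul p x) = smul p (odds x)"
  by (rule ext, simp add: evens_def odds_def smul_def fun_ops_apply)+

lemma mem_interleave_index:
  "2 * l \<in> interleave_index I J \<longleftrightarrow> l \<in> I" "Suc (2 * l) \<in> interleave_index I J \<longleftrightarrow> l \<in> J"
  by (simp_all add: interleave_index_def image_iff double_not_eq_Suc_double Suc_double_not_eq_double)

lemma interleave_vecs:
  "interleave v w \<in> vecs n (interleave_index I J) \<longleftrightarrow> v \<in> vecs n I \<and> w \<in> vecs n J"
proof
  assume x: "interleave v w \<in> vecs n (interleave_index I J)"
  have c: "interleave v w k \<in> pols n" "k \<notin> interleave_index I J \<Longrightarrow> interleave v w k = 0" for k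
    using x unfolding vecs_def by blast+
  have e: "interleave v w (2 * l) = v l" and o: "interleave v w (Suc (2 * l)) = w l" for l
    by (simp_all add: interleave_def)
  have "v l \<in> pols n \<and> (l \<notin> I \<longrightarrow> v l = 0)" for l
    using c[of "2 * l", unfolded e mem_interleave_index] by blast
  moreover have "w l \<in> pols n \<and> (l \<notin> J \<longrightarrow> w l = 0)" for l
    using c[of "Suc (2 * l)", unfolded o mem_interleave_index] by blast
  ultimately show "v \<in> vecs n I \<and> w \<in> vecs n J" unfolding vecs_def by blast
next
  assume vw: "v \<in> vecs n I \<and> w \<in> vecs n J"
  have "interleave v w l \<in> pols n \<and> (l \<notin> interleave_index I J \<longrightarrow> interleave v w l = 0)" for l
  proof (cases "even l")
    case True
    then obtain k where "l = 2 * k" by (elim evenE)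
    then show ?thesis using vw mem_interleave_index(1)[of k I J] by (simp add: interleave_def vecs_def)
  next
    case False
    then obtain k where "l = Suc (2 * k)" by (metis oddE Suc_eq_plus1)
    then show ?thesis using vw mem_interleave_index(2)[of k I J] by (simp add: interleave_def vecs_def)
  qed
  then show "interleave v w \<in> vecs n (interleave_index I J)" unfolding vecs_def by blast
qed

lemma evens_odds_vecs:
  "x \<in> vecs n (interleave_index I J) \<Longrightarrow> evens x \<in> vecs n I"
  "x \<in> vecs n (interleave_index I J) \<Longrightarrow> odds x \<in> vecs n J"
  using interleave_vecs[of "evens x" "odds x"] by auto

text \<open>Position \<open>0\<close> of the cone below is \<open>F\<^sub>0 \<oplus> 0\<close>, so regularity has to be carried over to padded pairs.\<close>

lemma weakly_regular_interleave:
  fixes B :: "(nat \<Rightarrow> 'k::field mpol) set"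
  shows "weakly_regular n J0 B fs \<Longrightarrow> B \<subseteq> vecs n J0 \<Longrightarrow> set fs \<subseteq> pols n \<Longrightarrow>
    weakly_regular n (interleave_index J0 {}) ((\<lambda>v. interleave v 0) ` B) fs"
proof (induction fs arbitrary: B)
  case Nil
  then show ?case by simp
next
  case (Cons f fs)
  have V: "(vecs n (interleave_index J0 {}) :: (nat \<Rightarrow> 'k mpol) set) = (\<lambda>v. interleave v 0) ` vecs n J0" (is "?V = ?W")
  proof (intro Set.equalityI subsetI)
    fix x :: "nat \<Rightarrow> 'k mpol" assume x: "x \<in> ?V"
    have "odds x \<in> vecs n {}" using x by (rule evens_odds_vecs)
    then have "odds x = 0" by (auto simp: vecs_def fun_ops_apply)
    then have "x = interleave (evens x) 0" by (metis interleave_simps(3))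
    then show "x \<in> ?W" using evens_odds_vecs(1)[OF x] by blast
  next
    fix x :: "nat \<Rightarrow> 'k mpol" assume "x \<in> ?W"
    then show "x \<in> ?V" by (auto simp: interleave_vecs)
  qed
  let ?B' = "{b + smul f v | b v. b \<in> B \<and> v \<in> vecs n J0}"
  have B': "(\<lambda>v. interleave v 0) ` ?B' =
      {b + smul f v | b v. b \<in> (\<lambda>v. interleave v 0) ` B \<and> v \<in> ?V}" (is "?L = ?R")
  proof (intro Set.equalityI subsetI)
    fix x assume "x \<in> ?L"
    then obtain b v where "x = interleave (b + smul f v) 0" "b \<in> B" "v \<in> vecs n J0" by blast
    moreover then have "x = interleave b 0 + smul f (interleave v 0)"
      by (simp add: interleave_ops)
    ultimately show "x \<in> ?R" using V by blast
  next
    fix x assume "x \<in> ?R"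
    then obtain b v where "x = interleave b 0 + smul f (interleave v 0)" "b \<in> B" "v \<in> vecs n J0"
      unfolding V by blast
    moreover then have "x = interleave (b + smul f v) 0"
      by (simp add: interleave_ops)
    ultimately show "x \<in> ?L" by blast
  qed
  have "?B' \<subseteq> vecs n J0" using Cons.prems by auto
  then have "weakly_regular n (interleave_index J0 {}) ((\<lambda>v. interleave v 0) ` ?B') fs"
    using Cons by simp
  moreover have "v \<in> (\<lambda>v. interleave v 0) ` B"
    if v: "v \<in> ?V" "smul f v \<in> (\<lambda>v. interleave v 0) ` B" for v
  proof -
    obtain u where u: "v = interleave u 0" "u \<in> vecs n J0" using v V by auto
    then have "smul f u \<in> B" using v(2) by (auto simp: interleave_ops interleave_eq_iff)
    then show ?thesis using u Cons.prems(1) by auto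
  qed
  ultimately show ?case using B' by simp
qed

context free_resolution
begin

definition cone_index :: "nat \<Rightarrow> nat set" where
  "cone_index i = interleave_index (J i) (case i of 0 \<Rightarrow> {} | Suc i' \<Rightarrow> J i')"

text \<open>The mapping cone of multiplication by \<open>f\<close>, with \<open>F\<^sub>i \<oplus> F\<^sub>i\<^sub>-\<^sub>1\<close> at position \<open>i\<close>.\<close>

definition cone_map :: "'k mpol \<Rightarrow> nat \<Rightarrow> (nat \<Rightarrow> 'k mpol) \<Rightarrow> nat \<Rightarrow> 'k mpol" where
  "cone_map f i x = interleave (D i (evens x) + smul f (odds x))
     (case i of 0 \<Rightarrow> 0 | Suc i' \<Rightarrow> - D i' (odds x))"

text \<open>A cycle of the cone has a cycle of the resolution as its second part, which is a boundary except at
  \<open>F\<^sub>0\<close>; there \<open>f\<close> is a nonzerodivisor on the cokernel.\<close>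

lemma cone_free_resolution:
  assumes f: "f \<in> pols n"
    and reg: "\<And>v. v \<in> vecs n (J 0) \<Longrightarrow> smul f v \<in> D 0 ` vecs n (J 1) \<Longrightarrow> v \<in> D 0 ` vecs n (J 1)"
  shows "free_resolution n cone_index (cone_map f)"
proof
  fix i and x :: "nat \<Rightarrow> 'k mpol" assume x: "x \<in> vecs n (cone_index (Suc i))"
  then have eo: "evens x \<in> vecs n (J (Suc i))" "odds x \<in> vecs n (J i)"
    using evens_odds_vecs by (auto simp: cone_index_def)
  show "cone_map f i x \<in> vecs n (cone_index i)"
    using eo f D_vecs by (auto simp: cone_map_def cone_index_def interleave_vecs split: nat.split)
  show "cone_map f i (smul p x) = smul p (cone_map f i x)" if p: "p \<in> pols n" for p
  proof -
    have "D i (smul p (evens x)) + smul f (smul p (odds x)) = smul p (D i (evens x) + smul f (odds x))"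
      unfolding D_smul[OF p eo(1)] smul_add smul_smul mult.commute[of f p] ..
    moreover have "(case i of 0 \<Rightarrow> 0 | Suc i' \<Rightarrow> - D i' (smul p (odds x))) =
        smul p (case i of 0 \<Rightarrow> 0 | Suc i' \<Rightarrow> - D i' (odds x))"
    proof (cases i)
      case (Suc i')
      then have "D i' (smul p (odds x)) = smul p (D i' (odds x))" using D_smul[OF p] eo(2) by blast
      then show ?thesis using Suc smul_uminus by (metis nat.case(2))
    qed simp
    ultimately show ?thesis unfolding cone_map_def evens_odds_ops interleave_ops by metis
  qed
  fix y :: "nat \<Rightarrow> 'k mpol" assume y: "y \<in> vecs n (cone_index (Suc i))"
  then have eo': "evens y \<in> vecs n (J (Suc i))" "odds y \<in> vecs n (J i)"
    using evens_odds_vecs by (auto simp: cone_index_def)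
  have "D i (evens x + evens y) + smul f (odds x + odds y) =
      (D i (evens x) + smul f (odds x)) + (D i (evens y) + smul f (odds y))"
    unfolding D_add[OF eo(1) eo'(1)] smul_add by (simp only: ac_simps)
  moreover have "(case i of 0 \<Rightarrow> 0 | Suc i' \<Rightarrow> - D i' (odds x + odds y)) =
      (case i of 0 \<Rightarrow> 0 | Suc i' \<Rightarrow> - D i' (odds x)) + (case i of 0 \<Rightarrow> 0 | Suc i' \<Rightarrow> - D i' (odds y))"
  proof (cases i)
    case (Suc i')
    then have "D i' (odds x + odds y) = D i' (odds x) + D i' (odds y)"
      using D_add eo(2) eo'(2) by blast
    then show ?thesis using Suc minus_add_distrib by (metis nat.case(2))
  qed simp
  ultimately show "cone_map f i (x + y) = cone_map f i x + cone_map f i y"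
    unfolding cone_map_def evens_odds_ops interleave_ops by metis
next
  fix i and x :: "nat \<Rightarrow> 'k mpol" assume x: "x \<in> vecs n (cone_index (Suc (Suc i)))"
  then have eo: "evens x \<in> vecs n (J (Suc (Suc i)))" "odds x \<in> vecs n (J (Suc i))"
    using evens_odds_vecs by (auto simp: cone_index_def)
  let ?a = "D (Suc i) (evens x) + smul f (odds x)"
  have "D i ?a = smul f (D i (odds x))"
    using D_add_smul[OF D_vecs[OF eo(1)] eo(2) f] DD[OF eo(1)] by simp
  then have 1: "D i ?a + smul f (- D i (odds x)) = 0"
    by (simp only: smul_uminus right_minus)
  have 2: "(case i of 0 \<Rightarrow> 0 | Suc i' \<Rightarrow> - D i' (- D i (odds x))) = (0 :: nat \<Rightarrow> 'k mpol)"
  proof (cases i)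
    case (Suc i')
    then have "D i' (- D i (odds x)) = 0"
      using D_uminus[of "D i (odds x)" i'] DD[of "odds x" i'] D_vecs[OF eo(2)] eo(2) by simp
    then show ?thesis using Suc by simp
  qed simp
  have "cone_map f (Suc i) x = interleave ?a (- D i (odds x))" by (simp only: cone_map_def nat.case)
  then have "cone_map f i (cone_map f (Suc i) x) = interleave (D i ?a + smul f (- D i (odds x)))
      (case i of 0 \<Rightarrow> 0 | Suc i' \<Rightarrow> - D i' (- D i (odds x)))"
    by (simp only: cone_map_def interleave_simps)
  then show "cone_map f i (cone_map f (Suc i) x) = 0"
    by (simp only: 1 2 interleave_zero)
next
  fix i and x :: "nat \<Rightarrow> 'k mpol" assume x: "x \<in> vecs n (cone_index (Suc i))" and zero: "cone_map f i x = 0"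
  then have eo: "evens x \<in> vecs n (J (Suc i))" "odds x \<in> vecs n (J i)"
    using evens_odds_vecs by (auto simp: cone_index_def)
  have 1: "D i (evens x) + smul f (odds x) = 0"
    and 2: "(case i of 0 \<Rightarrow> 0 | Suc i' \<Rightarrow> - D i' (odds x)) = 0"
    using zero interleave_eq_iff unfolding cone_map_def by (metis interleave_zero)+
  have "\<exists>w\<in>vecs n (J (Suc i)). D i w = odds x"
  proof (cases i)
    case 0
    have "smul f (odds x) = D i (- evens x)"
      using 1 D_uminus[OF eo(1)] by (metis add.commute eq_neg_iff_add_eq_0)
    then have "odds x \<in> D 0 ` vecs n (J 1)"
      using reg[of "odds x"] eo 0 by auto
    then show ?thesis using 0 by auto
  next
    case (Suc i')
    then have "- D i' (odds x) = 0" using 2 by (metis nat.case(2))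
    then show ?thesis using exact[of "odds x" i'] eo(2) Suc by (metis neg_equal_0_iff_equal)
  qed
  then obtain w where w: "w \<in> vecs n (J (Suc i))" "D i w = odds x" by blast
  have "D i (evens x + smul f w) = 0" using D_add_smul[OF eo(1) w(1) f] w(2) 1 by simp
  then obtain v where v: "v \<in> vecs n (J (Suc (Suc i)))" "D (Suc i) v = evens x + smul f w"
    using exact[of "evens x + smul f w" i] eo(1) w(1) f by blast
  have "cone_map f (Suc i) (interleave v (- w)) =
      interleave (evens x + smul f w + smul f (- w)) (- D i (- w))"
    by (simp only: cone_map_def interleave_simps v nat.case)
  also have "evens x + smul f w + smul f (- w) = evens x"
    by (simp only: smul_uminus add.assoc right_minus add_0_right)
  also have "- D i (- w) = odds x" using D_uminus[OF w(1)] w(2) by simp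
  finally have "cone_map f (Suc i) (interleave v (- w)) = x" by simp
  moreover have "interleave v (- w) \<in> vecs n (cone_index (Suc (Suc i)))"
    using v(1) w(1) by (auto simp: cone_index_def interleave_vecs)
  ultimately show "\<exists>w\<in>vecs n (cone_index (Suc (Suc i))). cone_map f (Suc i) w = x" by blast
qed

end

text \<open>The cone of multiplication by \<open>f\<^sub>1\<close> resolves \<open>N / f\<^sub>1 N\<close>. Since \<open>f\<^sub>1\<close> has no constant term, the cone
  splits modulo the variables, so that its homology in degree \<open>i + 1\<close> contains the homology of the
  given resolution in degree \<open>i\<close>.\<close>

theorem regular_sequence_exactness:
  fixes D :: "nat \<Rightarrow> (nat \<Rightarrow> 'k::field mpol) \<Rightarrow> nat \<Rightarrow> 'k mpol"
  assumes "free_resolution n J D"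
    and "weakly_regular n (J 0) (D 0 ` vecs n (J 1)) fs"
    and "set fs \<subseteq> pols n" "\<And>f. f \<in> set fs \<Longrightarrow> const_coeff f = 0"
    and "n \<le> i + length fs" "v \<in> vecs n (J (Suc i))" "D i v \<in> xvecs n n (J i)"
  shows "\<exists>w\<in>vecs n (J (Suc (Suc i))). v - D (Suc i) w \<in> xvecs n n (J (Suc i))"
  using assms
proof (induction fs arbitrary: J D i v)
  case Nil
  then have "n \<le> i" by simp
  then show ?case
    by (rule free_resolution.exact_modulo_variables[OF Nil.prems(1) order_refl _ Nil.prems(6,7)])
next
  case (Cons f fs)
  interpret free_resolution n J D by (rule Cons.prems(1))
  have f: "f \<in> pols n" "const_coeff f = 0" using Cons.prems by auto
  have reg: "\<And>v. v \<in> vecs n (J 0) \<Longrightarrow> smul f v \<in> D 0 ` vecs n (J 1) \<Longrightarrow> v \<in> D 0 ` vecs n (J 1)"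
    and wr: "weakly_regular n (J 0)
        {b + smul f v | b v. b \<in> D 0 ` vecs n (J 1) \<and> v \<in> vecs n (J 0)} fs"
    using Cons.prems(2) by auto
  have res: "free_resolution n cone_index (cone_map f)"
    by (rule cone_free_resolution[OF f(1) reg])
  have c0: "cone_index 0 = interleave_index (J 0) {}"
    and c1: "cone_index 1 = interleave_index (J 1) (J 0)" by (simp_all add: cone_index_def)
  have B: "cone_map f 0 ` vecs n (cone_index 1) =
      (\<lambda>v. interleave v 0) ` {b + smul f v | b v. b \<in> D 0 ` vecs n (J 1) \<and> v \<in> vecs n (J 0)}" (is "?L = ?R")
  proof (intro Set.equalityI subsetI)
    fix y assume "y \<in> ?L"
    then obtain x where x: "x \<in> vecs n (cone_index 1)" "y = cone_map f 0 x" by blast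
    then show "y \<in> ?R" using evens_odds_vecs[of x n "J 1" "J 0"] unfolding c1 cone_map_def by auto
  next
    fix y assume "y \<in> ?R"
    then obtain u v where uv: "y = interleave (D 0 u + smul f v) 0" "u \<in> vecs n (J 1)" "v \<in> vecs n (J 0)"
      by blast
    then have "y = cone_map f 0 (interleave u v)" by (simp add: cone_map_def)
    moreover have "interleave u v \<in> vecs n (cone_index 1)" using uv(2,3) unfolding c1 interleave_vecs by blast
    ultimately show "y \<in> ?L" by blast
  qed
  have sub: "{b + smul f v | b v. b \<in> D 0 ` vecs n (J 1) \<and> v \<in> vecs n (J 0)} \<subseteq> vecs n (J 0)"
    using D_vecs f(1) by auto
  have wr': "weakly_regular n (cone_index 0) (cone_map f 0 ` vecs n (cone_index 1)) fs"
    unfolding B c0 by (rule weakly_regular_interleave[OF wr sub]) (use Cons.prems in auto)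
  have v: "v \<in> vecs n (J (Suc i))" "D i v \<in> xvecs n n (J i)" using Cons.prems by auto
  \<comment> \<open>One position higher in the cone, \<open>v\<close> sits in the second summand; its image \<open>(f v, - D v)\<close> has no
    constant coefficients.\<close>
  let ?x = "interleave 0 v :: nat \<Rightarrow> 'k mpol"
  have x: "?x \<in> vecs n (cone_index (Suc (Suc i)))" using v by (simp add: cone_index_def interleave_vecs)
  have "cone_map f (Suc i) ?x = interleave (smul f v) (- D i v)"
    by (simp add: cone_map_def)
  moreover have "interleave (smul f v) (- D i v) \<in> xvecs n n (cone_index (Suc i))"
    using v f D_vecs[OF v(1)]
    by (auto simp: xvecs_all cone_index_def interleave_vecs) (auto simp: interleave_def smul_def fun_ops_apply)
  ultimately have "cone_map f (Suc i) ?x \<in> xvecs n n (cone_index (Suc i))" by metis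
  moreover have "n \<le> Suc i + length fs" using Cons.prems(5) by simp
  ultimately obtain y where y: "y \<in> vecs n (cone_index (Suc (Suc (Suc i))))"
      "?x - cone_map f (Suc (Suc i)) y \<in> xvecs n n (cone_index (Suc (Suc i)))"
    using Cons.IH[OF res wr' _ _ _ x] Cons.prems(3,4) by auto
  have oy: "odds y \<in> vecs n (J (Suc (Suc i)))"
    using y(1) evens_odds_vecs by (auto simp: cone_index_def)
  have "odds (?x - cone_map f (Suc (Suc i)) y) = v - (- D (Suc i) (odds y))"
    by (simp only: evens_odds_ops cone_map_def interleave_simps nat.case)
  then have "v - D (Suc i) (- odds y) = odds (?x - cone_map f (Suc (Suc i)) y)"
    using D_uminus[OF oy] by metis
  moreover have "odds (?x - cone_map f (Suc (Suc i)) y) \<in> xvecs n n (J (Suc i))"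
  proof -
    let ?z = "?x - cone_map f (Suc (Suc i)) y"
    have "odds ?z \<in> vecs n (J (Suc i))"
      by (rule evens_odds_vecs(2)[of _ n "J (Suc (Suc i))"])
         (use y(2) in \<open>simp add: xvecs_all cone_index_def\<close>)
    moreover have "const_coeff (odds ?z l) = 0" for l
      using y(2) by (simp add: xvecs_all odds_def)
    ultimately show ?thesis by (simp add: xvecs_all)
  qed
  ultimately show ?case using oy vecs_uminus by metis
qed

section \<open>Homogeneous submodules of free modules are finitely generated\<close>

lemma incseq_subsequence:
  fixes h :: "nat \<Rightarrow> nat"
  shows "\<exists>\<phi>. strict_mono \<phi> \<and> incseq (h \<circ> \<phi>)"
proof -
  obtain \<phi> :: "nat \<Rightarrow> nat" where \<phi>: "strict_mono \<phi>" "monoseq (\<lambda>k. h (\<phi> k))"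
    using seq_monosub[of h] by blast
  show ?thesis
  proof (cases "incseq (h \<circ> \<phi>)")
    case True
    then show ?thesis using \<phi>(1) by blast
  next
    case False
    then have dec: "decseq (h \<circ> \<phi>)" using \<phi>(2) by (auto simp: monoseq_iff comp_def)
    define m where "m = (LEAST m. m \<in> range (h \<circ> \<phi>))"
    have "m \<in> range (h \<circ> \<phi>)" unfolding m_def by (rule LeastI_ex) auto
    then obtain k0 where k0: "m = h (\<phi> k0)" by auto
    have eq: "h (\<phi> (k0 + k)) = m" for k
    proof (rule antisym)
      show "h (\<phi> (k0 + k)) \<le> m" using dec k0 by (auto simp: decseq_def)
      show "m \<le> h (\<phi> (k0 + k))" unfolding m_def by (rule Least_le) auto
    qed
    have "strict_mono (\<lambda>k. \<phi> (k0 + k))" using \<phi>(1) by (auto simp: strict_mono_def)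
    moreover have "incseq (h \<circ> (\<lambda>k. \<phi> (k0 + k)))" using eq by (auto simp: incseq_def)
    ultimately show ?thesis by blast
  qed
qed

lemma incseq_subsequence_coordinates:
  fixes f :: "nat \<Rightarrow> nat \<Rightarrow> nat"
  shows "\<exists>\<phi>. strict_mono \<phi> \<and> (\<forall>i<n. incseq (\<lambda>k. f (\<phi> k) i))"
proof (induction n)
  case 0
  show ?case by (auto intro!: exI[of _ id] strict_monoI)
next
  case (Suc n)
  then obtain \<phi> where \<phi>: "strict_mono \<phi>" "\<And>i. i < n \<Longrightarrow> incseq (\<lambda>k. f (\<phi> k) i)" by blast
  obtain \<psi> where \<psi>: "strict_mono \<psi>" "incseq ((\<lambda>k. f (\<phi> k) n) \<circ> \<psi>)"
    using incseq_subsequence by blast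
  have "incseq (\<lambda>k. f (\<phi> (\<psi> k)) i)" if "i < Suc n" for i
  proof (cases "i = n")
    case True
    then show ?thesis using \<psi>(2) by (simp add: comp_def)
  next
    case False
    then have "incseq (\<lambda>k. f (\<phi> k) i)" using \<phi>(2) that by simp
    then show ?thesis using \<psi>(1) by (auto simp: incseq_def strict_mono_less_eq)
  qed
  moreover have "strict_mono (\<phi> \<circ> \<psi>)" using \<phi>(1) \<psi>(1) by (rule strict_mono_o)
  ultimately show ?case by (auto simp: comp_def)
qed

text \<open>Dickson's lemma: a set of monomials has only finitely many elements that are minimal for
  divisibility, since an infinite sequence of exponent vectors has a subsequence along which every
  coordinate increases.\<close>

lemma Dickson:
  fixes T :: "(nat \<Rightarrow>\<^sub>0 nat) set"
  assumes T: "\<And>u. u \<in> T \<Longrightarrow> supp u \<subseteq> {..<n}"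
  shows "\<exists>T0. finite T0 \<and> T0 \<subseteq> T \<and> (\<forall>u\<in>T. \<exists>u0\<in>T0. \<exists>e. u = u0 + e)"
proof -
  define T0 where "T0 = {u \<in> T. \<forall>u'\<in>T. \<forall>e. u = u' + e \<longrightarrow> u' = u}"
  have below: "\<exists>u0\<in>T0. \<exists>e. u = u0 + e" if "u \<in> T" for u
    using that
  proof (induction "exp_degree u" arbitrary: u rule: less_induct)
    case less
    show ?case
    proof (cases "u \<in> T0")
      case True
      then show ?thesis by (intro bexI[of _ u] exI[of _ 0]) auto
    next
      case False
      then obtain u' e where u': "u' \<in> T" "u = u' + e" "u' \<noteq> u"
        using less.prems unfolding T0_def by blast
      then have "e \<noteq> 0" by auto
      then have "exp_degree u' < exp_degree u"
        using u'(2) exp_degree_eq_0_iff[of e] by (simp add: exp_degree_add del: exp_degree_eq_0_iff)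
      then obtain u0 e0 where "u0 \<in> T0" "u' = u0 + e0" using less.hyps u'(1) by blast
      then show ?thesis using u'(2) by (metis add.assoc)
    qed
  qed
  have "finite T0"
  proof (rule ccontr)
    assume "infinite T0"
    then obtain f :: "nat \<Rightarrow> nat \<Rightarrow>\<^sub>0 nat" where f: "inj f" "range f \<subseteq> T0"
      using infinite_countable_subset by blast
    obtain \<phi> where \<phi>: "strict_mono \<phi>" "\<And>i. i < n \<Longrightarrow> incseq (\<lambda>k. coef (f (\<phi> k)) i)"
      using incseq_subsequence_coordinates[of n "\<lambda>k. coef (f k)"] by blast
    let ?u = "f (\<phi> 0)" and ?v = "f (\<phi> 1)"
    have uv: "?u \<in> T0" "?v \<in> T0" using f by auto
    have "?v = ?u + (?v - ?u)"
    proof (rule poly_mapping_eqI)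
      fix i
      have "coef ?u i \<le> coef ?v i"
      proof (cases "i < n")
        case True
        then show ?thesis using \<phi>(2) by (auto simp: incseq_def)
      next
        case False
        then have "i \<notin> supp ?u" using uv T by (force simp: T0_def)
        then show ?thesis by (simp add: in_keys_iff)
      qed
      then show "coef ?v i = coef (?u + (?v - ?u)) i" by (simp add: lookup_add lookup_minus)
    qed
    then have "?u = ?v" using uv unfolding T0_def by blast
    then have "\<phi> 0 = \<phi> 1" using f(1) by (auto dest: injD)
    then show False using \<phi>(1) by (simp add: strict_mono_eq)
  qed
  moreover have "T0 \<subseteq> T" by (auto simp: T0_def)
  ultimately show ?thesis using below by blast
qed

lemma finite_exponents: "finite {u. supp u \<subseteq> {..<n} \<and> exp_degree u = d}"
proof -
  have *: "coef u \<in> {f. \<forall>i. (i \<in> {..<n} \<longrightarrow> f i \<in> {..d}) \<and> (i \<notin> {..<n} \<longrightarrow> f i = 0)}"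
    if "supp u \<subseteq> {..<n}" "exp_degree u = d" for u
  proof -
    have "coef u i \<le> d" for i
    proof (cases "i \<in> supp u")
      case True
      then show ?thesis using that(2) unfolding exp_degree_def
        by (metis finite_keys member_le_sum zero_le)
    qed (simp add: in_keys_iff)
    then show ?thesis using that(1) by (auto simp: in_keys_iff subset_iff)
  qed
  have "coef ` {u. supp u \<subseteq> {..<n} \<and> exp_degree u = d} \<subseteq>
      {f. \<forall>i. (i \<in> {..<n} \<longrightarrow> f i \<in> {..d}) \<and> (i \<notin> {..<n} \<longrightarrow> f i = 0)}"
    by (rule image_subsetI, elim CollectE conjE, rule *)
  moreover have "finite {f :: nat \<Rightarrow> nat. \<forall>i. (i \<in> {..<n} \<longrightarrow> f i \<in> {..d}) \<and> (i \<notin> {..<n} \<longrightarrow> f i = 0)}"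
    by (rule finite_set_of_finite_funs) auto
  ultimately have "finite (coef ` {u. supp u \<subseteq> {..<n} \<and> exp_degree u = d})" by (rule finite_subset)
  then show ?thesis by (rule finite_imageD) (auto simp: inj_on_def intro: poly_mapping_eqI)
qed

text \<open>The family of the homogeneous parts \<open>H d\<close> of a homogeneous ideal.\<close>

definition homogeneous_ideal_family :: "nat \<Rightarrow> (int \<Rightarrow> 'k::field mpol set) \<Rightarrow> bool" where
  "homogeneous_ideal_family n H \<longleftrightarrow>
     (\<forall>d. H d \<subseteq> {p \<in> pols n. homogeneous_of_degree d p}) \<and>
     (\<forall>d. \<forall>p\<in>H d. \<forall>q\<in>H d. p - q \<in> H d) \<and>
     (\<forall>d e. \<forall>p\<in>H d. \<forall>c\<in>pols n. homogeneous_of_degree e c \<longrightarrow> c * p \<in> H (e + d))"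

text \<open>Division by polynomials whose leading monomials are the minimal ones of the ideal; it ends because
  there are finitely many monomials of each degree.\<close>

lemma homogeneous_ideal_finitely_generated:
  assumes H: "homogeneous_ideal_family n (H :: int \<Rightarrow> 'k::field mpol set)"
  shows "\<exists>m b q. (\<forall>k<m::nat. q k \<in> H (b k)) \<and>
    (\<forall>d. \<forall>p\<in>H d. \<exists>c. (\<forall>k<m. c k \<in> pols n \<and> homogeneous_of_degree (d - b k) (c k)) \<and>
       p = (\<Sum>k<m. c k * q k))"
proof -
  have Hp: "p \<in> pols n" "homogeneous_of_degree d p" if "p \<in> H d" for p d
    using H that by (auto simp: homogeneous_ideal_family_def)
  have Hdiff: "p - q \<in> H d" if "p \<in> H d" "q \<in> H d" for p q d
    using H that by (auto simp: homogeneous_ideal_family_def)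
  have Hmult: "c * p \<in> H (e + d)" if "p \<in> H d" "c \<in> pols n" "homogeneous_of_degree e c" for p c d e
    using H that by (auto simp: homogeneous_ideal_family_def)
  define lm where "lm p = Max (supp (p :: 'k mpol))" for p
  have lm: "lm p \<in> supp p" "\<And>u. u \<in> supp p \<Longrightarrow> u \<le> lm p" if "p \<noteq> 0" for p
    using that Max_in[of "supp p"] by (auto simp: lm_def)
  define T where "T = {lm p | p d. p \<in> H d \<and> p \<noteq> 0}"
  have Tn: "supp u \<subseteq> {..<n}" if "u \<in> T" for u
    using that lm(1) Hp(1) by (fastforce simp: T_def pols_def)
  have "\<exists>T0. finite T0 \<and> T0 \<subseteq> T \<and> (\<forall>u\<in>T. \<exists>u0\<in>T0. \<exists>e. u = u0 + e)"
    by (rule Dickson[of T n]) (rule Tn)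
  then obtain T0 where T0: "finite T0" "T0 \<subseteq> T" "\<forall>u\<in>T. \<exists>u0\<in>T0. \<exists>e. u = u0 + e"
    by (elim exE conjE) (rule that)
  have "\<exists>p d. p \<in> H d \<and> p \<noteq> 0 \<and> lm p = u" if "u \<in> T0" for u
    using T0(2) that unfolding T_def by blast
  then obtain q b where qb: "\<And>u. u \<in> T0 \<Longrightarrow> q u \<in> H (b u) \<and> q u \<noteq> 0 \<and> lm (q u) = u" by metis
  have gen: "\<exists>c. (\<forall>u\<in>T0. c u \<in> pols n \<and> homogeneous_of_degree (d - b u) (c u)) \<and>
      p = (\<Sum>u\<in>T0. c u * q u)" if "p \<in> H d" for p d
    using that
  proof (induction "card {u. supp u \<subseteq> {..<n} \<and> int (exp_degree u) = d \<and> p \<noteq> 0 \<and> u \<le> lm p}"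
      arbitrary: p rule: less_induct)
    case less
    show ?case
    proof (cases "p = 0")
      case True
      then show ?thesis by (intro exI[of _ "\<lambda>_. 0"]) simp
    next
      case False
      then have "lm p \<in> T" using less.prems unfolding T_def by blast
      then obtain u0 e where u0: "u0 \<in> T0" "lm p = u0 + e" using T0(3) by blast
      have q0: "q u0 \<in> H (b u0)" "q u0 \<noteq> 0" "lm (q u0) = u0" using qb[OF u0(1)] by auto
      have c0: "coef (q u0) u0 \<noteq> 0" using lm(1)[OF q0(2)] q0(3) by (simp add: in_keys_iff)
      define c where "c = monom_of e (coef p (lm p) / coef (q u0) u0)"
      have "supp (lm p) \<subseteq> {..<n}" using Hp(1)[OF less.prems] lm(1)[OF False] by (auto simp: pols_def)
      then have cn: "c \<in> pols n" unfolding c_def u0(2) by (intro pols_monom) (auto simp: supp_exp_add)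
      have "int (exp_degree (lm p)) = d"
        using Hp(2)[OF less.prems] lm(1)[OF False] by (simp add: homogeneous_of_degree_def)
      moreover have "int (exp_degree u0) = b u0"
        using Hp(2)[OF q0(1)] lm(1)[OF q0(2)] q0(3) by (simp add: homogeneous_of_degree_def)
      ultimately have ed: "int (exp_degree e) = d - b u0" using u0(2) by (simp add: exp_degree_add)
      have ch: "homogeneous_of_degree (d - b u0) c"
        unfolding c_def ed[symmetric] by (rule homogeneous_monom)
      have cq: "c * q u0 \<in> H d" using Hmult[OF q0(1) cn ch] by simp
      define p' where "p' = p - c * q u0"
      have p': "p' \<in> H d" using Hdiff[OF less.prems cq] by (simp add: p'_def)
      have "coef (c * q u0) (e + u0) = coef p (lm p)"
        using c0 by (simp add: c_def coef_monom_mult)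
      then have "lm p \<notin> supp p'" using u0(2) by (simp add: p'_def in_keys_iff lookup_minus add.commute)
      moreover have "u \<le> lm p" if "u \<in> supp p'" for u
      proof -
        have "u \<in> supp p \<or> u \<in> supp (c * q u0)"
          using that by (auto simp: p'_def in_keys_iff lookup_minus)
        then show ?thesis
        proof
          assume "u \<in> supp (c * q u0)"
          then obtain x y where "x \<in> supp c" "y \<in> supp (q u0)" "u = x + y"
            using keys_mult[of c "q u0"] by blast
          then have "x = e" "y \<le> u0" using lm(2)[OF q0(2), of y] q0(3)
            by (simp_all add: c_def split: if_splits)
          then show ?thesis unfolding u0(2) \<open>u = x + y\<close> by (simp only: add.commute[of u0] add_left_mono)
        qed (use lm(2)[OF False] in blast)
      qed
      ultimately have less_lm: "u < lm p" if "u \<in> supp p'" for u using that by (metis order_le_less)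
      have "card {u. supp u \<subseteq> {..<n} \<and> int (exp_degree u) = d \<and> p' \<noteq> 0 \<and> u \<le> lm p'} <
          card {u. supp u \<subseteq> {..<n} \<and> int (exp_degree u) = d \<and> p \<noteq> 0 \<and> u \<le> lm p}" (is "card ?A < card ?B")
      proof (rule psubset_card_mono)
        show "finite ?B" by (rule finite_subset[OF _ finite_exponents[of n "nat d"]]) auto
        have "lm p \<in> ?B"
          using \<open>supp (lm p) \<subseteq> {..<n}\<close> \<open>int (exp_degree (lm p)) = d\<close> False by simp
        moreover have "lm p \<notin> ?A" using less_lm lm(1)[of p'] by (auto simp: not_le)
        moreover have "?A \<subseteq> ?B"
        proof
          fix u assume u: "u \<in> ?A"
          then have "lm p' < lm p" using less_lm lm(1)[of p'] by blast
          then have "u \<le> lm p" using u by (metis (mono_tags, lifting) mem_Collect_eq less_imp_le order_trans)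
          then show "u \<in> ?B" using u False by blast
        qed
        ultimately show "?A \<subset> ?B" by blast
      qed
      then obtain c' where c': "\<And>u. u \<in> T0 \<Longrightarrow> c' u \<in> pols n \<and> homogeneous_of_degree (d - b u) (c' u)"
          "p' = (\<Sum>u\<in>T0. c' u * q u)"
        using less.hyps p' by blast
      have "p = c * q u0 + p'" by (simp add: p'_def)
      also have "\<dots> = (\<Sum>u\<in>T0. (if u = u0 then c else 0) * q u) + (\<Sum>u\<in>T0. c' u * q u)"
      proof -
        have "(\<Sum>u\<in>T0. (if u = u0 then c else 0) * q u) = (\<Sum>u\<in>{u0}. (if u = u0 then c else 0) * q u)"
          by (rule sum.mono_neutral_right) (use u0(1) T0(1) in auto)
        then show ?thesis using c'(2) by simp
      qed
      also have "\<dots> = (\<Sum>u\<in>T0. ((if u = u0 then c else 0) + c' u) * q u)"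
        by (simp add: sum.distrib distrib_right)
      finally show ?thesis
        by (intro exI[of _ "\<lambda>u. (if u = u0 then c else 0) + c' u"])
           (use c' cn ch in \<open>auto intro: homogeneous_add\<close>)
    qed
  qed
  obtain h where h: "bij_betw h {0..<card T0} T0" using ex_bij_betw_nat_finite[OF T0(1)] by blast
  have hT: "h k \<in> T0" if "k < card T0" for k using h that by (auto simp: bij_betw_def)
  show ?thesis
  proof (rule exI[of _ "card T0"], rule exI[of _ "b \<circ> h"], rule exI[of _ "q \<circ> h"],
      intro conjI allI impI ballI)
    fix k assume "k < card T0"
    then show "(q \<circ> h) k \<in> H ((b \<circ> h) k)" using qb hT by simp
  next
    fix d p assume "p \<in> H d"
    then obtain c where c: "\<And>u. u \<in> T0 \<Longrightarrow> c u \<in> pols n \<and> homogeneous_of_degree (d - b u) (c u)"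
        "p = (\<Sum>u\<in>T0. c u * q u)" using gen by blast
    have "(\<Sum>u\<in>T0. c u * q u) = (\<Sum>k<card T0. c (h k) * q (h k))"
      using sum.reindex_bij_betw[OF h, of "\<lambda>u. c u * q u"] by (simp add: atLeast0LessThan)
    then show "\<exists>c. (\<forall>k<card T0. c k \<in> pols n \<and> homogeneous_of_degree (d - (b \<circ> h) k) (c k)) \<and>
        p = (\<Sum>k<card T0. c k * (q \<circ> h) k)"
      by (intro exI[of _ "c \<circ> h"]) (use c hT in auto)
  qed
qed

definition gvecs :: "nat \<Rightarrow> nat set \<Rightarrow> (nat \<Rightarrow> int) \<Rightarrow> int \<Rightarrow> (nat \<Rightarrow> 'k::field mpol) set" where
  "gvecs n J a t = {v \<in> vecs n J. \<forall>l. homogeneous_of_degree (t - a l) (v l)}"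

lemma gvecs_vecs: "v \<in> gvecs n J a t \<Longrightarrow> v \<in> vecs n J"
  by (simp add: gvecs_def)

lemma gvecs_zero [simp]: "0 \<in> gvecs n J a t"
  by (auto simp: gvecs_def fun_ops_apply)

lemma gvecs_add: "v \<in> gvecs n J a t \<Longrightarrow> w \<in> gvecs n J a t \<Longrightarrow> v + w \<in> gvecs n J a t"
  by (auto simp: gvecs_def fun_ops_apply homogeneous_add)

lemma gvecs_diff: "v \<in> gvecs n J a t \<Longrightarrow> w \<in> gvecs n J a t \<Longrightarrow> v - w \<in> gvecs n J a t"
  by (auto simp: gvecs_def fun_ops_apply homogeneous_diff)

lemma gvecs_smul:
  assumes "v \<in> gvecs n J a t" "p \<in> pols n" "homogeneous_of_degree e p"
  shows "smul p v \<in> gvecs n J a (e + t)"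
proof -
  have "homogeneous_of_degree (e + t - a l) (p * v l)" for l
    using homogeneous_mult[OF assms(3), of "t - a l" "v l"] assms(1)
    by (simp add: gvecs_def add_diff_eq)
  then show ?thesis using assms(1,2) by (auto simp: gvecs_def smul_def[of p v] vecs_smul[unfolded smul_def])
qed

lemma sum_vecs_apply: "(\<Sum>k\<in>A. f k) l = (\<Sum>k\<in>A. f k l :: 'k::field mpol)"
  by (induction A rule: infinite_finite_induct) (auto simp: fun_ops_apply)

lemma vecs_sum: "(\<And>k. k \<in> A \<Longrightarrow> f k \<in> vecs n J) \<Longrightarrow> sum f A \<in> vecs n J"
  by (induction A rule: infinite_finite_induct) auto

text \<open>The family of the homogeneous parts \<open>U t\<close> of a graded submodule of \<open>\<Oplus> S(- a l)\<close>.\<close>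

definition homogeneous_submodule ::
  "nat \<Rightarrow> nat \<Rightarrow> (nat \<Rightarrow> int) \<Rightarrow> (int \<Rightarrow> (nat \<Rightarrow> 'k::field mpol) set) \<Rightarrow> bool" where
  "homogeneous_submodule n r a U \<longleftrightarrow>
     (\<forall>t. U t \<subseteq> gvecs n {..<r} a t) \<and> (\<forall>t. \<forall>v\<in>U t. \<forall>w\<in>U t. v - w \<in> U t) \<and> (\<forall>t. 0 \<in> U t) \<and>
     (\<forall>t e. \<forall>v\<in>U t. \<forall>p\<in>pols n. homogeneous_of_degree e p \<longrightarrow> smul p v \<in> U (e + t))"

text \<open>Induction on the rank: the last coordinates form an ideal, and the elements with last coordinate
  \<open>0\<close> lie in a free module of smaller rank.\<close>

lemma homogeneous_submodule_finitely_generated: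
  assumes "homogeneous_submodule n r a (U :: int \<Rightarrow> (nat \<Rightarrow> 'k::field mpol) set)"
  shows "\<exists>m b g. (\<forall>k<m::nat. g k \<in> U (b k)) \<and>
    (\<forall>t. \<forall>v\<in>U t. \<exists>c. (\<forall>k<m. c k \<in> pols n \<and> homogeneous_of_degree (t - b k) (c k)) \<and>
       v = (\<Sum>k<m. smul (c k) (g k)))"
  using assms
proof (induction r arbitrary: U)
  case 0
  have "v = 0" if "v \<in> U t" for v t
  proof
    fix l show "v l = 0 l" using that 0 by (auto simp: homogeneous_submodule_def gvecs_def vecs_def fun_ops_apply)
  qed
  then show ?case by (intro exI[of _ "0::nat"]) fastforce
next
  case (Suc r)
  have Ug: "v \<in> gvecs n {..<Suc r} a t" if "v \<in> U t" for v t
    using Suc.prems that unfolding homogeneous_submodule_def by blast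
  have Ud: "v - w \<in> U t" if "v \<in> U t" "w \<in> U t" for v w t
    using Suc.prems that unfolding homogeneous_submodule_def by blast
  have U0: "0 \<in> U t" for t
    using Suc.prems unfolding homogeneous_submodule_def by blast
  have Us: "smul p v \<in> U (e + t)" if "v \<in> U t" "p \<in> pols n" "homogeneous_of_degree e p" for p v e t
    using Suc.prems that unfolding homogeneous_submodule_def by blast
  have Ua: "v + w \<in> U t" if "v \<in> U t" "w \<in> U t" for v w t
    using Ud[OF that(1) Ud[OF U0 that(2)]] by simp
  define H where "H d = (\<lambda>v. v r) ` U (d + a r)" for d
  have "homogeneous_ideal_family n H"
    unfolding homogeneous_ideal_family_def
  proof (intro conjI allI ballI impI)
    fix d show "H d \<subseteq> {p \<in> pols n. homogeneous_of_degree d p}"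
    proof
      fix p assume "p \<in> H d"
      then obtain v where v: "v \<in> U (d + a r)" "p = v r" by (auto simp: H_def)
      have "v r \<in> pols n" "homogeneous_of_degree (d + a r - a r) (v r)"
        using Ug[OF v(1)] unfolding gvecs_def vecs_def by blast+
      then show "p \<in> {p \<in> pols n. homogeneous_of_degree d p}" using v(2) by simp
    qed
  next
    fix d p q assume "p \<in> H d" "q \<in> H d"
    then obtain v w where "v \<in> U (d + a r)" "p = v r" "w \<in> U (d + a r)" "q = w r" by (auto simp: H_def)
    then show "p - q \<in> H d"
      unfolding H_def by (intro image_eqI[of _ _ "v - w"] Ud) (auto simp: fun_ops_apply)
  next
    fix d e p and c :: "'k mpol" assume "p \<in> H d" and c: "c \<in> pols n" "homogeneous_of_degree e c"
    then obtain v where v: "v \<in> U (d + a r)" "p = v r" by (auto simp: H_def)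
    then show "c * p \<in> H (e + d)"
      using Us[OF v(1) c] unfolding H_def
      by (intro image_eqI[of _ _ "smul c v"]) (auto simp: smul_def add.assoc)
  qed
  from homogeneous_ideal_finitely_generated[OF this] obtain m b q where mbq:
    "(\<forall>k<m::nat. q k \<in> H (b k)) \<and>
     (\<forall>d. \<forall>p\<in>H d. \<exists>c. (\<forall>k<m. c k \<in> pols n \<and> homogeneous_of_degree (d - b k) (c k)) \<and>
       p = (\<Sum>k<m. c k * q k))"
    by (elim exE) (rule that)
  then have q: "\<And>k. k < m \<Longrightarrow> q k \<in> H (b k)"
    and qgen: "\<And>d p. p \<in> H d \<Longrightarrow> \<exists>c. (\<forall>k<m. c k \<in> pols n \<and> homogeneous_of_degree (d - b k) (c k)) \<and>
       p = (\<Sum>k<m. c k * q k)" by blast+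
  have "\<forall>k. \<exists>v. k < m \<longrightarrow> v \<in> U (b k + a r) \<and> q k = v r" using q unfolding H_def by blast
  then obtain g where g: "\<And>k. k < m \<Longrightarrow> g k \<in> U (b k + a r) \<and> q k = g k r" by metis
  define U' where "U' t = {v \<in> U t. v r = 0}" for t
  have "homogeneous_submodule n r a U'"
    unfolding homogeneous_submodule_def
  proof (intro conjI allI ballI impI)
    fix t show "U' t \<subseteq> gvecs n {..<r} a t"
    proof
      fix v assume v: "v \<in> U' t"
      have "v l = 0" if "l \<notin> {..<r}" for l
        using v Ug[of v t] that by (cases "l = r") (auto simp: U'_def gvecs_def vecs_def)
      then show "v \<in> gvecs n {..<r} a t" using v Ug[of v t] by (simp add: U'_def gvecs_def vecs_def)
    qed
  next
    fix t v w assume "v \<in> U' t" "w \<in> U' t"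
    then show "v - w \<in> U' t" using Ud[of v t w] by (simp add: U'_def fun_ops_apply)
  next
    fix t show "0 \<in> U' t" using U0[of t] by (simp add: U'_def fun_ops_apply)
  next
    fix t e v and p :: "'k mpol" assume "v \<in> U' t" "p \<in> pols n" "homogeneous_of_degree e p"
    then show "smul p v \<in> U' (e + t)" using Us[of v t p e] by (simp add: U'_def smul_def)
  qed
  from Suc.IH[OF this] obtain m' b' g' where mbg:
    "(\<forall>k<m'::nat. g' k \<in> U' (b' k)) \<and>
     (\<forall>t. \<forall>v\<in>U' t. \<exists>c. (\<forall>k<m'. c k \<in> pols n \<and> homogeneous_of_degree (t - b' k) (c k)) \<and>
       v = (\<Sum>k<m'. smul (c k) (g' k)))"
    by (elim exE) (rule that)
  then have g': "\<And>k. k < m' \<Longrightarrow> g' k \<in> U' (b' k)"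
    and gen': "\<And>t v. v \<in> U' t \<Longrightarrow> \<exists>c. (\<forall>k<m'. c k \<in> pols n \<and> homogeneous_of_degree (t - b' k) (c k)) \<and>
       v = (\<Sum>k<m'. smul (c k) (g' k))" by blast+
  define gg where "gg k = (if k < m then g k else g' (k - m))" for k
  define bb where "bb k = (if k < m then b k + a r else b' (k - m))" for k
  have sum_split: "(\<Sum>k<m + m'. f k) = (\<Sum>k<m. f k) + (\<Sum>k<m'. f (m + k))"
    for f :: "nat \<Rightarrow> nat \<Rightarrow> 'k mpol"
    by (induction m') (simp_all add: add.assoc)
  show ?case
  proof (rule exI[of _ "m + m'"], rule exI[of _ bb], rule exI[of _ gg], intro conjI allI impI ballI)
    fix k assume "k < m + m'"
    then show "gg k \<in> U (bb k)" using g g'[of "k - m"] by (auto simp: gg_def bb_def U'_def)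
  next
    fix t v assume v: "v \<in> U t"
    then have "v r \<in> H (t - a r)" by (auto simp: H_def)
    then obtain c where c: "\<And>k. k < m \<Longrightarrow> c k \<in> pols n \<and> homogeneous_of_degree (t - a r - b k) (c k)"
        "v r = (\<Sum>k<m. c k * q k)" using qgen by blast
    have part: "(\<Sum>k\<in>A. smul (c k) (g k)) \<in> U t" if "A \<subseteq> {..<m}" for A
      using finite_subset[OF that finite_lessThan] that
    proof (induction A rule: finite_induct)
      case empty
      then show ?case by (simp add: U0)
    next
      case (insert k A)
      then have "smul (c k) (g k) \<in> U ((t - a r - b k) + (b k + a r))"
        using g c(1) by (intro Us) auto
      then show ?case using insert Ua by simp
    qed
    define v' where "v' = v - (\<Sum>k<m. smul (c k) (g k))"
    have "v' r = v r - (\<Sum>k<m. c k * g k r)"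
      unfolding v'_def by (simp add: fun_ops_apply sum_vecs_apply smul_def)
    also have "(\<Sum>k<m. c k * g k r) = (\<Sum>k<m. c k * q k)"
      by (rule sum.cong) (use g in auto)
    finally have "v' r = 0" using c(2) by simp
    then have "v' \<in> U' t" using Ud[OF v part[OF subset_refl]] by (simp add: U'_def v'_def)
    then obtain c' where c': "\<And>k. k < m' \<Longrightarrow> c' k \<in> pols n \<and> homogeneous_of_degree (t - b' k) (c' k)"
        "v' = (\<Sum>k<m'. smul (c' k) (g' k))" using gen' by blast
    define cc where "cc k = (if k < m then c k else c' (k - m))" for k
    have "(\<Sum>k<m + m'. smul (cc k) (gg k)) = (\<Sum>k<m. smul (c k) (g k)) + v'"
      unfolding sum_split c'(2) by (simp add: cc_def gg_def)
    then have "v = (\<Sum>k<m + m'. smul (cc k) (gg k))" by (simp add: v'_def)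
    moreover have "cc k \<in> pols n \<and> homogeneous_of_degree (t - bb k) (cc k)" if "k < m + m'" for k
    proof (cases "k < m")
      case True
      then have "t - bb k = t - a r - b k" by (simp add: bb_def)
      then show ?thesis unfolding cc_def using True c(1) by metis
    next
      case False
      then show ?thesis using that c'(1)[of "k - m"] by (simp add: cc_def bb_def)
    qed
    ultimately show "\<exists>c. (\<forall>k<m + m'. c k \<in> pols n \<and> homogeneous_of_degree (t - bb k) (c k)) \<and>
        v = (\<Sum>k<m + m'. smul (c k) (gg k))" by blast
  qed
qed

section \<open>Matrices and free modules\<close>

text \<open>The counterpart of \<open>mat_map\<close> for vectors that are padded with zeros.\<close>

definition mmul ::
  "nat \<Rightarrow> nat \<Rightarrow> (nat \<Rightarrow> nat \<Rightarrow> 'k::field mpol) \<Rightarrow> (nat \<Rightarrow> 'k mpol) \<Rightarrow> nat \<Rightarrow> 'k mpol" where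
  "mmul r0 r1 A v = (\<lambda>k. if k < r0 then \<Sum>l<r1. A k l * v l else 0)"

definition graded_matrix ::
  "nat \<Rightarrow> nat \<Rightarrow> (nat \<Rightarrow> int) \<Rightarrow> nat \<Rightarrow> (nat \<Rightarrow> int) \<Rightarrow> (nat \<Rightarrow> nat \<Rightarrow> 'k::field mpol) \<Rightarrow> bool" where
  "graded_matrix n r0 a0 r1 a1 A \<longleftrightarrow>
     (\<forall>k<r0. \<forall>l<r1. A k l \<in> pols n \<and> homogeneous_of_degree (a1 l - a0 k) (A k l))"

lemma mmul_add: "mmul r0 r1 A (v + w) = mmul r0 r1 A v + mmul r0 r1 A w"
  by (rule ext) (simp add: mmul_def fun_ops_apply distrib_left sum.distrib)

lemma mmul_diff: "mmul r0 r1 A (v - w) = mmul r0 r1 A v - mmul r0 r1 A w"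
  by (rule ext) (simp add: mmul_def fun_ops_apply right_diff_distrib sum_subtractf)

lemma mmul_zero [simp]: "mmul r0 r1 A 0 = 0"
  by (rule ext) (simp add: mmul_def fun_ops_apply)

lemma mmul_sum: "mmul r0 r1 A (sum f T) = (\<Sum>t\<in>T. mmul r0 r1 A (f t))"
  by (induction T rule: infinite_finite_induct) (simp_all add: mmul_add)

lemma mmul_smul: "mmul r0 r1 A (smul p v) = smul p (mmul r0 r1 A v)"
  by (rule ext) (simp add: mmul_def smul_def sum_distrib_left mult_ac)

lemma mmul_vecs:
  "graded_matrix n r0 a0 r1 a1 A \<Longrightarrow> v \<in> vecs n J \<Longrightarrow> mmul r0 r1 A v \<in> vecs n {..<r0}"
  by (auto simp: vecs_def mmul_def graded_matrix_def intro!: pols_sum pols_mult)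

lemma mmul_gvecs:
  assumes A: "graded_matrix n r0 a0 r1 a1 A" and v: "v \<in> gvecs n J a1 t"
  shows "mmul r0 r1 A v \<in> gvecs n {..<r0} a0 t"
proof -
  have "homogeneous_of_degree (t - a0 k) (A k l * v l)" if "k < r0" "l < r1" for k l
  proof -
    have "homogeneous_of_degree ((a1 l - a0 k) + (t - a1 l)) (A k l * v l)"
      by (rule homogeneous_mult) (use A v that in \<open>auto simp: graded_matrix_def gvecs_def\<close>)
    then show ?thesis by simp
  qed
  then have "homogeneous_of_degree (t - a0 k) (mmul r0 r1 A v k)" for k
    by (auto simp: mmul_def intro!: homogeneous_sum)
  then show ?thesis using mmul_vecs[OF A gvecs_vecs[OF v]] by (simp add: gvecs_def)
qed

text \<open>The homogeneous part of degree \<open>t\<close> in \<open>\<Oplus> S(- a l)\<close>.\<close>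

definition hvec :: "(nat \<Rightarrow> int) \<Rightarrow> int \<Rightarrow> (nat \<Rightarrow> 'k::field mpol) \<Rightarrow> nat \<Rightarrow> 'k mpol" where
  "hvec a t v = (\<lambda>l. hom_part (t - a l) (v l))"

lemma hvec_gvecs: "v \<in> vecs n J \<Longrightarrow> hvec a t v \<in> gvecs n J a t"
  by (auto simp: hvec_def gvecs_def vecs_def)

lemma hvec_add: "hvec a t (v + w) = hvec a t v + hvec a t w"
  and hvec_diff: "hvec a t (v - w) = hvec a t v - hvec a t w"
  and hvec_zero [simp]: "hvec a t 0 = 0"
  by (rule ext, simp add: hvec_def fun_ops_apply hom_part_add hom_part_diff)+

lemma hvec_sum: "hvec a t (sum f T) = (\<Sum>x\<in>T. hvec a t (f x))"
  by (induction T rule: infinite_finite_induct) (simp_all add: hvec_add)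

lemma hvec_homogeneous: "v \<in> gvecs n J a t \<Longrightarrow> hvec a t' v = (if t' = t then v else 0)"
proof (rule ext)
  fix l
  assume "v \<in> gvecs n J a t"
  then have "homogeneous_of_degree (t - a l) (v l)" by (simp add: gvecs_def)
  from hom_part_homogeneous[OF this, of "t' - a l"]
  show "hvec a t' v l = (if t' = t then v else 0) l"
    by (simp add: hvec_def fun_ops_apply)
qed

lemma sum_hvecs:
  assumes v: "v \<in> vecs n {..<r}"
  shows "\<exists>T. finite T \<and> v = (\<Sum>t\<in>T. hvec a t v)"
proof -
  define T where "T = (\<Union>l<r. (\<lambda>u. int (exp_degree u) + a l) ` supp (v l))"
  have fin: "finite T" by (simp add: T_def)
  have "v l = (\<Sum>t\<in>T. hom_part (t - a l) (v l))" for l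
  proof (cases "l < r")
    case True
    have "(\<Sum>t\<in>T. hom_part (t - a l) (v l)) = (\<Sum>d\<in>(\<lambda>t. t - a l) ` T. hom_part d (v l))"
      by (subst sum.reindex) (auto simp: inj_on_def)
    also have "\<dots> = v l"
    proof (rule sum_hom_parts)
      show "(\<lambda>u. int (exp_degree u)) ` supp (v l) \<subseteq> (\<lambda>t. t - a l) ` T"
      proof (rule image_subsetI)
        fix u assume "u \<in> supp (v l)"
        then have "int (exp_degree u) + a l \<in> T" using True by (auto simp: T_def)
        then show "int (exp_degree u) \<in> (\<lambda>t. t - a l) ` T" by (rule rev_image_eqI) simp
      qed
    qed (use fin in simp)
    finally show ?thesis by simp
  next
    case False
    then have "v l = 0" using v by (simp add: vecs_def)
    then show ?thesis by simp
  qed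
  then have "v = (\<Sum>t\<in>T. hvec a t v)" by (intro ext) (simp add: sum_vecs_apply hvec_def)
  then show ?thesis using fin by blast
qed

lemma hvec_mmul:
  assumes A: "graded_matrix n r0 a0 r1 a1 A" and v: "v \<in> vecs n {..<r1}"
  shows "hvec a0 t (mmul r0 r1 A v) = mmul r0 r1 A (hvec a1 t v)"
proof -
  obtain T where T: "finite T" "v = (\<Sum>s\<in>T. hvec a1 s v)" using sum_hvecs[OF v] by blast
  have g: "hvec a1 s v \<in> gvecs n {..<r1} a1 s" for s using v by (rule hvec_gvecs)
  have "hvec a0 t (mmul r0 r1 A w) = mmul r0 r1 A (hvec a1 t w)" if "w = (\<Sum>s\<in>T. hvec a1 s v)" for w
    unfolding that mmul_sum hvec_sum
    by (rule sum.cong[OF refl])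
       (simp add: hvec_homogeneous[OF mmul_gvecs[OF A g]] hvec_homogeneous[OF g])
  then show ?thesis using T(2) by blast
qed

text \<open>The columns of the matrix are homogeneous generators of the submodule with the homogeneous parts
  \<open>U t\<close>.\<close>

lemma graded_generators:
  fixes U :: "int \<Rightarrow> (nat \<Rightarrow> 'k::field mpol) set"
  assumes U: "homogeneous_submodule n r a U"
  shows "\<exists>r' a' B. graded_matrix n r a r' a' B \<and>
    {v \<in> vecs n {..<r}. \<forall>t. hvec a t v \<in> U t} = mmul r r' B ` vecs n {..<r'}"
proof -
  from homogeneous_submodule_finitely_generated[OF U] obtain m b g where mbg:
    "(\<forall>k<m::nat. g k \<in> U (b k)) \<and>
     (\<forall>t. \<forall>v\<in>U t. \<exists>c. (\<forall>k<m. c k \<in> pols n \<and> homogeneous_of_degree (t - b k) (c k)) \<and>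
       v = (\<Sum>k<m. smul (c k) (g k)))"
    by (elim exE) (rule that)
  have Ug: "v \<in> gvecs n {..<r} a t" if "v \<in> U t" for v t
    using U that unfolding homogeneous_submodule_def by blast
  have Ud: "v - w \<in> U t" if "v \<in> U t" "w \<in> U t" for v w t
    using U that unfolding homogeneous_submodule_def by blast
  have U0: "0 \<in> U t" for t
    using U unfolding homogeneous_submodule_def by blast
  have Us: "smul p v \<in> U (e + t)" if "v \<in> U t" "p \<in> pols n" "homogeneous_of_degree e p" for p v e t
    using U that unfolding homogeneous_submodule_def by blast
  have Ua: "v + w \<in> U t" if "v \<in> U t" "w \<in> U t" for v w t
    using Ud[OF that(1) Ud[OF U0 that(2)]] by simp
  have Usum: "sum f T \<in> U t" if "\<And>x. x \<in> T \<Longrightarrow> f x \<in> U t" for f :: "nat \<Rightarrow> _" and T t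
    using that by (induction T rule: infinite_finite_induct) (auto intro: U0 Ua)
  have gU: "g k \<in> U (b k)" if "k < m" for k using mbg that by blast
  define B where "B k l = g l k" for k l
  have gr: "graded_matrix n r a m b B"
    using gU Ug by (fastforce simp: graded_matrix_def B_def gvecs_def vecs_def)
  have comb: "mmul r m B c = (\<Sum>k<m. smul (c k) (g k))" for c
  proof (rule ext)
    fix k
    have "g l k = 0" if "l < m" "\<not> k < r" for l
      using Ug[OF gU[OF that(1)]] that(2) by (simp add: gvecs_def vecs_def)
    then show "mmul r m B c k = (\<Sum>k<m. smul (c k) (g k)) k"
      by (auto simp: mmul_def sum_vecs_apply smul_def B_def mult.commute intro!: sum.neutral)
  qed
  have "{v \<in> vecs n {..<r}. \<forall>t. hvec a t v \<in> U t} = mmul r m B ` vecs n {..<m}" (is "?L = ?R")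
  proof (intro Set.equalityI subsetI)
    fix v assume v: "v \<in> ?L"
    then obtain T where T: "finite T" "v = (\<Sum>t\<in>T. hvec a t v)" using sum_hvecs by blast
    have "\<forall>t. \<exists>c. (\<forall>k<m. c k \<in> pols n) \<and> hvec a t v = (\<Sum>k<m. smul (c k) (g k))"
      using mbg v by blast
    from choice[OF this] obtain c where c: "\<And>t k. k < m \<Longrightarrow> c t k \<in> pols n"
      "\<And>t. hvec a t v = (\<Sum>k<m. smul (c t k) (g k))" by blast
    define c' where "c' t = (\<lambda>k. if k < m then c t k else 0)" for t
    have c': "c' t \<in> vecs n {..<m}" "hvec a t v = mmul r m B (c' t)" for t
      using c(1) by (auto simp: c'_def vecs_def comb c(2))
    have "mmul r m B (\<Sum>t\<in>T. c' t) = v"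
      unfolding mmul_sum c'(2)[symmetric] using T(2) by simp
    then show "v \<in> ?R" using vecs_sum[of T c' n "{..<m}"] c'(1) by blast
  next
    fix v assume "v \<in> ?R"
    then obtain c where c: "c \<in> vecs n {..<m}" "v = mmul r m B c" by blast
    have "hvec a t v \<in> U t" for t
    proof -
      have "hvec a t v = mmul r m B (hvec b t c)"
        unfolding c(2) by (rule hvec_mmul[OF gr c(1)])
      also have "\<dots> = (\<Sum>k<m. smul (hom_part (t - b k) (c k)) (g k))"
        by (simp add: comb hvec_def)
      also have "\<dots> \<in> U t"
      proof (rule Usum)
        fix k assume "k \<in> {..<m}"
        then have "smul (hom_part (t - b k) (c k)) (g k) \<in> U ((t - b k) + b k)"
          using gU c(1) by (intro Us) (auto simp: vecs_def)
        then show "smul (hom_part (t - b k) (c k)) (g k) \<in> U t" by simp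
      qed
      finally show ?thesis .
    qed
    then show "v \<in> ?L" using c mmul_vecs[OF gr] by blast
  qed
  then show ?thesis using gr by blast
qed

lemma graded_matrix_kernel:
  assumes A: "graded_matrix n r0 a0 r1 a1 (A :: nat \<Rightarrow> nat \<Rightarrow> 'k::field mpol)"
  shows "\<exists>r2 a2 B. graded_matrix n r1 a1 r2 a2 B \<and>
    {v \<in> vecs n {..<r1}. mmul r0 r1 A v = 0} = mmul r1 r2 B ` vecs n {..<r2}"
proof -
  define U where "U t = {v \<in> gvecs n {..<r1} a1 t. mmul r0 r1 A v = 0}" for t
  have "homogeneous_submodule n r1 a1 U"
    by (auto simp: homogeneous_submodule_def U_def mmul_diff mmul_smul gvecs_diff intro: gvecs_smul)
  moreover have "{v \<in> vecs n {..<r1}. \<forall>t. hvec a1 t v \<in> U t} = {v \<in> vecs n {..<r1}. mmul r0 r1 A v = 0}"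
  proof (intro Collect_cong conj_cong refl)
    fix v :: "nat \<Rightarrow> 'k mpol" assume v: "v \<in> vecs n {..<r1}"
    obtain T where T: "finite T" "v = (\<Sum>t\<in>T. hvec a1 t v)" using sum_hvecs[OF v] by blast
    show "(\<forall>t. hvec a1 t v \<in> U t) \<longleftrightarrow> mmul r0 r1 A v = 0"
    proof
      assume "\<forall>t. hvec a1 t v \<in> U t"
      then have "mmul r0 r1 A (\<Sum>t\<in>T. hvec a1 t v) = 0" by (simp add: mmul_sum U_def)
      then show "mmul r0 r1 A v = 0" using T(2) by metis
    next
      assume "mmul r0 r1 A v = 0"
      then have "mmul r0 r1 A (hvec a1 t v) = 0" for t
        using hvec_mmul[OF A v, of t] by simp
      then show "\<forall>t. hvec a1 t v \<in> U t" using hvec_gvecs[OF v] by (simp add: U_def)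
    qed
  qed
  ultimately show ?thesis using graded_generators[of n r1 a1 U] by metis
qed

section \<open>Graded modules and their resolutions\<close>

locale graded_mod =
  fixes n :: nat and N :: "('k::field mpol, 'm) module" and G :: "int \<Rightarrow> 'm set"
  assumes graded: "graded_module n N G"
begin

sublocale N: Module.module "mpoly_ring n :: 'k mpol ring" N
  using graded by (simp add: graded_module_def)

lemma act_closed: "p \<in> pols n \<Longrightarrow> x \<in> carrier N \<Longrightarrow> p \<odot>\<^bsub>N\<^esub> x \<in> carrier N"
  using N.smult_closed by (simp add: carrier_mpoly_ring)

lemma act_add_left: "p \<in> pols n \<Longrightarrow> q \<in> pols n \<Longrightarrow> x \<in> carrier N \<Longrightarrow>
    (p + q) \<odot>\<^bsub>N\<^esub> x = p \<odot>\<^bsub>N\<^esub> x \<oplus>\<^bsub>N\<^esub> q \<odot>\<^bsub>N\<^esub> x"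
  using N.smult_l_distr[of p q x] by (simp add: carrier_mpoly_ring)

lemma act_add_right: "p \<in> pols n \<Longrightarrow> x \<in> carrier N \<Longrightarrow> y \<in> carrier N \<Longrightarrow>
    p \<odot>\<^bsub>N\<^esub> (x \<oplus>\<^bsub>N\<^esub> y) = p \<odot>\<^bsub>N\<^esub> x \<oplus>\<^bsub>N\<^esub> p \<odot>\<^bsub>N\<^esub> y"
  using N.smult_r_distr[of p x y] by (simp add: carrier_mpoly_ring)

lemma act_mult: "p \<in> pols n \<Longrightarrow> q \<in> pols n \<Longrightarrow> x \<in> carrier N \<Longrightarrow>
    (p * q) \<odot>\<^bsub>N\<^esub> x = p \<odot>\<^bsub>N\<^esub> (q \<odot>\<^bsub>N\<^esub> x)"
  using N.smult_assoc1[of p q x] by (simp add: carrier_mpoly_ring)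

lemma act_one: "x \<in> carrier N \<Longrightarrow> 1 \<odot>\<^bsub>N\<^esub> x = x"
  using N.smult_one[of x] by simp

lemma act_zero_left: "x \<in> carrier N \<Longrightarrow> 0 \<odot>\<^bsub>N\<^esub> x = \<zero>\<^bsub>N\<^esub>"
  using N.smult_l_null[of x] by simp

lemma act_zero_right: "p \<in> pols n \<Longrightarrow> p \<odot>\<^bsub>N\<^esub> \<zero>\<^bsub>N\<^esub> = \<zero>\<^bsub>N\<^esub>"
  using N.smult_r_null[of p] by (simp add: carrier_mpoly_ring)

lemma G_subgroup: "additive_subgroup (G j) N"
  using graded by (simp add: graded_module_def)

lemma G_carrier: "x \<in> G j \<Longrightarrow> x \<in> carrier N"
  using additive_subgroup.a_Hcarr[OF G_subgroup] by blast

lemma G_add: "x \<in> G j \<Longrightarrow> y \<in> G j \<Longrightarrow> x \<oplus>\<^bsub>N\<^esub> y \<in> G j"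
  using additive_subgroup.a_closed[OF G_subgroup] by blast

lemma G_zero: "\<zero>\<^bsub>N\<^esub> \<in> G j"
  using additive_subgroup.zero_closed[OF G_subgroup] by blast

lemma G_act: "p \<in> pols n \<Longrightarrow> homogeneous_of_degree e p \<Longrightarrow> x \<in> G j \<Longrightarrow> p \<odot>\<^bsub>N\<^esub> x \<in> G (e + j)"
  using graded unfolding graded_module_def carrier_mpoly_ring by blast

lemma G_finsum: "(\<And>x. x \<in> A \<Longrightarrow> f x \<in> G j) \<Longrightarrow> finsum N f A \<in> G j"
proof (induction A rule: infinite_finite_induct)
  case (insert x A)
  have "finsum N f (insert x A) = f x \<oplus>\<^bsub>N\<^esub> finsum N f A"
    by (rule N.finsum_insert) (use insert G_carrier in auto)
  then show ?case using insert G_add by simp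
qed (auto simp: G_zero N.finsum_infinite)

text \<open>Uniqueness of the homogeneous decomposition of zero.\<close>

lemma homogeneous_sum_zero:
  assumes A: "finite A" and c: "\<And>j. j \<in> A \<Longrightarrow> c j \<in> G j" and zero: "finsum N c A = \<zero>\<^bsub>N\<^esub>" and j: "j \<in> A"
  shows "c j = \<zero>\<^bsub>N\<^esub>"
proof -
  define P where "P c \<longleftrightarrow> (\<forall>j. c j \<in> G j) \<and> finite {j. c j \<noteq> \<zero>\<^bsub>N\<^esub>} \<and>
      \<zero>\<^bsub>N\<^esub> = finsum N c {j. c j \<noteq> \<zero>\<^bsub>N\<^esub>}" for c
  have ex1: "\<exists>!c. P c"
    using graded N.zero_closed unfolding graded_module_def P_def by blast
  define c' where "c' j = (if j \<in> A then c j else \<zero>\<^bsub>N\<^esub>)" for j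
  have sub: "{j. c' j \<noteq> \<zero>\<^bsub>N\<^esub>} \<subseteq> A" by (auto simp: c'_def)
  have "finsum N c' {j. c' j \<noteq> \<zero>\<^bsub>N\<^esub>} = finsum N c A"
    by (rule N.add.finprod_mono_neutral_cong_left[OF A sub])
       (use c G_carrier sub in \<open>auto simp: c'_def\<close>)
  then have "P c'" using zero c sub A G_zero by (auto simp: P_def c'_def intro: finite_subset)
  moreover have "P (\<lambda>_. \<zero>\<^bsub>N\<^esub>)" using G_zero by (auto simp: P_def)
  ultimately have "c' = (\<lambda>_. \<zero>\<^bsub>N\<^esub>)" using ex1 by blast
  then have "c' j = \<zero>\<^bsub>N\<^esub>" by simp
  then show ?thesis using j by (simp add: c'_def)
qed

definition aug :: "nat \<Rightarrow> (nat \<Rightarrow> 'm) \<Rightarrow> (nat \<Rightarrow> 'k mpol) \<Rightarrow> 'm" where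
  "aug r g v = finsum N (\<lambda>k. v k \<odot>\<^bsub>N\<^esub> g k) {..<r}"

context
  fixes r :: nat and g
  assumes g: "\<And>k. k < r \<Longrightarrow> g k \<in> carrier N"
begin

lemma aug_closed: "v \<in> vecs n J \<Longrightarrow> aug r g v \<in> carrier N"
  unfolding aug_def by (rule N.finsum_closed) (use g act_closed in \<open>auto simp: vecs_def\<close>)

lemma aug_add:
  assumes "v \<in> vecs n J" "w \<in> vecs n J"
  shows "aug r g (v + w) = aug r g v \<oplus>\<^bsub>N\<^esub> aug r g w"
proof -
  have "aug r g (v + w) = finsum N (\<lambda>k. v k \<odot>\<^bsub>N\<^esub> g k \<oplus>\<^bsub>N\<^esub> w k \<odot>\<^bsub>N\<^esub> g k) {..<r}"
    unfolding aug_def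
    by (rule N.finsum_cong') (use assms g act_closed act_add_left in \<open>auto simp: vecs_def fun_ops_apply\<close>)
  also have "\<dots> = aug r g v \<oplus>\<^bsub>N\<^esub> aug r g w"
    unfolding aug_def by (rule N.finsum_addf) (use assms g act_closed in \<open>auto simp: vecs_def\<close>)
  finally show ?thesis .
qed

lemma aug_smul:
  assumes p: "p \<in> pols n" and v: "v \<in> vecs n J"
  shows "aug r g (smul p v) = p \<odot>\<^bsub>N\<^esub> aug r g v"
proof -
  have "p \<odot>\<^bsub>N\<^esub> aug r g v = finsum N (\<lambda>k. p \<odot>\<^bsub>N\<^esub> (v k \<odot>\<^bsub>N\<^esub> g k)) {..<r}"
    unfolding aug_def
    by (rule N.finsum_smult_ldistr) (use p v g act_closed in \<open>auto simp: vecs_def carrier_mpoly_ring\<close>)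
  also have "\<dots> = aug r g (smul p v)"
    unfolding aug_def
    by (rule N.finsum_cong') (use p v g act_closed act_mult in \<open>auto simp: vecs_def smul_def pols_mult\<close>)
  finally show ?thesis by simp
qed

lemma aug_zero: "aug r g 0 = \<zero>\<^bsub>N\<^esub>"
  using aug_smul[of 0 0 UNIV] aug_closed[of 0 UNIV] act_zero_left by simp

lemma aug_diff_zero:
  assumes "v \<in> vecs n J" "w \<in> vecs n J" "aug r g v = \<zero>\<^bsub>N\<^esub>" "aug r g w = \<zero>\<^bsub>N\<^esub>"
  shows "aug r g (v - w) = \<zero>\<^bsub>N\<^esub>"
proof -
  have "aug r g ((v - w) + w) = aug r g (v - w) \<oplus>\<^bsub>N\<^esub> aug r g w"
    by (rule aug_add) (use assms in auto)
  then have "aug r g (v - w) \<oplus>\<^bsub>N\<^esub> \<zero>\<^bsub>N\<^esub> = \<zero>\<^bsub>N\<^esub>" using assms by simp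
  moreover have "v - w \<in> vecs n J" using assms by blast
  ultimately show ?thesis using N.r_zero[OF aug_closed] by metis
qed

lemma aug_eq_imp_diff_zero:
  assumes "v \<in> vecs n J" "w \<in> vecs n J" "aug r g v = aug r g w"
  shows "aug r g (v - w) = \<zero>\<^bsub>N\<^esub>"
proof -
  have "aug r g ((v - w) + w) = aug r g (v - w) \<oplus>\<^bsub>N\<^esub> aug r g w"
    by (rule aug_add) (use assms in auto)
  then have "aug r g (v - w) \<oplus>\<^bsub>N\<^esub> aug r g w = \<zero>\<^bsub>N\<^esub> \<oplus>\<^bsub>N\<^esub> aug r g w"
    using assms aug_closed[of w J] by simp
  then show ?thesis
    using aug_closed[of w J] aug_closed[of "v - w" J] assms(1,2) vecs_diff
    by (metis N.add.right_cancel N.zero_closed)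
qed

lemma aug_sum:
  "finite T \<Longrightarrow> (\<And>t. t \<in> T \<Longrightarrow> f t \<in> vecs n J) \<Longrightarrow>
    aug r g (sum f T) = finsum N (\<lambda>t. aug r g (f t)) T"
proof (induction T rule: finite_induct)
  case empty
  then show ?case by (simp add: aug_zero)
next
  case (insert t T)
  have "aug r g (f t + sum f T) = aug r g (f t) \<oplus>\<^bsub>N\<^esub> aug r g (sum f T)"
  proof (rule aug_add[of _ J])
    show "f t \<in> vecs n J" using insert.prems by blast
    show "sum f T \<in> vecs n J" by (rule vecs_sum) (use insert.prems in blast)
  qed
  moreover have "finsum N (\<lambda>t. aug r g (f t)) (insert t T) =
      aug r g (f t) \<oplus>\<^bsub>N\<^esub> finsum N (\<lambda>t. aug r g (f t)) T"
    by (rule N.finsum_insert) (use insert aug_closed in auto)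
  ultimately show ?case using insert by simp
qed

end

lemma aug_homogeneous:
  assumes "\<And>k. k < r \<Longrightarrow> g k \<in> G (a k)" "v \<in> gvecs n J a t"
  shows "aug r g v \<in> G t"
  unfolding aug_def
proof (rule G_finsum)
  fix k assume k: "k \<in> {..<r}"
  have "v k \<odot>\<^bsub>N\<^esub> g k \<in> G ((t - a k) + a k)"
    by (rule G_act) (use assms k in \<open>auto simp: gvecs_def vecs_def\<close>)
  then show "v k \<odot>\<^bsub>N\<^esub> g k \<in> G t" by simp
qed

lemma aug_hvec_zero:
  assumes g: "\<And>k. k < r \<Longrightarrow> g k \<in> G (a k)" and v: "v \<in> vecs n {..<r}"
    and zero: "aug r g v = \<zero>\<^bsub>N\<^esub>"
  shows "aug r g (hvec a t v) = \<zero>\<^bsub>N\<^esub>"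
proof -
  have gc: "\<And>k. k < r \<Longrightarrow> g k \<in> carrier N" using g G_carrier by blast
  obtain T where T: "finite T" "v = (\<Sum>t\<in>T. hvec a t v)" using sum_hvecs[OF v] by blast
  show ?thesis
  proof (cases "t \<in> T")
    case True
    have "finsum N (\<lambda>t. aug r g (hvec a t v)) T = aug r g (\<Sum>t\<in>T. hvec a t v)"
      by (rule aug_sum[OF gc T(1), symmetric]) (use hvec_gvecs[OF v] gvecs_vecs in blast)+
    also have "\<dots> = \<zero>\<^bsub>N\<^esub>" using T(2) zero by metis
    finally show ?thesis
      using homogeneous_sum_zero[OF T(1), of "\<lambda>t. aug r g (hvec a t v)", OF _ _ True]
        aug_homogeneous[of r g a, OF g hvec_gvecs[OF v]] by blast
  next
    case False
    have "hvec a t w = 0" if "w = (\<Sum>t\<in>T. hvec a t v)" for w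
      unfolding that hvec_sum
      by (rule sum.neutral) (use False in \<open>auto simp: hvec_homogeneous[OF hvec_gvecs[OF v]]\<close>)
    then have "hvec a t v = 0" using T(2) by blast
    then show ?thesis using aug_zero[OF gc] by simp
  qed
qed

lemma aug_kernel:
  assumes g: "\<And>k. k < r \<Longrightarrow> g k \<in> G (a k)"
  shows "\<exists>r1 a1 B. graded_matrix n r a r1 a1 B \<and>
    {v \<in> vecs n {..<r}. aug r g v = \<zero>\<^bsub>N\<^esub>} = mmul r r1 B ` vecs n {..<r1}"
proof -
  have gc: "\<And>k. k < r \<Longrightarrow> g k \<in> carrier N" using g G_carrier by blast
  define U where "U t = {v \<in> gvecs n {..<r} a t. aug r g v = \<zero>\<^bsub>N\<^esub>}" for t
  have "homogeneous_submodule n r a U"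
    unfolding homogeneous_submodule_def
  proof (intro conjI allI ballI impI)
    fix t show "U t \<subseteq> gvecs n {..<r} a t" by (auto simp: U_def)
    show "0 \<in> U t" using aug_zero[OF gc] by (simp add: U_def)
    show "v - w \<in> U t" if "v \<in> U t" "w \<in> U t" for v w
      using that aug_diff_zero[OF gc gvecs_vecs gvecs_vecs] by (auto simp: U_def gvecs_diff)
    show "smul p v \<in> U (e + t)" if "v \<in> U t" "p \<in> pols n" "homogeneous_of_degree e p" for e v p
      using that aug_smul[OF gc that(2) gvecs_vecs] act_zero_right by (auto simp: U_def intro: gvecs_smul)
  qed
  moreover have "{v \<in> vecs n {..<r}. \<forall>t. hvec a t v \<in> U t} = {v \<in> vecs n {..<r}. aug r g v = \<zero>\<^bsub>N\<^esub>}"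
  proof (intro Collect_cong conj_cong refl)
    fix v :: "nat \<Rightarrow> 'k mpol" assume v: "v \<in> vecs n {..<r}"
    obtain T where T: "finite T" "v = (\<Sum>t\<in>T. hvec a t v)" using sum_hvecs[OF v] by blast
    show "(\<forall>t. hvec a t v \<in> U t) \<longleftrightarrow> aug r g v = \<zero>\<^bsub>N\<^esub>"
    proof
      assume *: "\<forall>t. hvec a t v \<in> U t"
      have "aug r g (\<Sum>t\<in>T. hvec a t v) = finsum N (\<lambda>t. aug r g (hvec a t v)) T"
        by (rule aug_sum[OF gc T(1)]) (use hvec_gvecs[OF v] gvecs_vecs in blast)+
      also have "\<dots> = finsum N (\<lambda>t. \<zero>\<^bsub>N\<^esub>) T"
        by (rule N.finsum_cong') (use * in \<open>auto simp: U_def\<close>)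
      also have "\<dots> = \<zero>\<^bsub>N\<^esub>" by simp
      finally show "aug r g v = \<zero>\<^bsub>N\<^esub>" using T(2) by metis
    next
      assume "aug r g v = \<zero>\<^bsub>N\<^esub>"
      then show "\<forall>t. hvec a t v \<in> U t"
        using aug_hvec_zero[OF g v] hvec_gvecs[OF v] by (simp add: U_def)
    qed
  qed
  ultimately show ?thesis using graded_generators[of n r a U] by metis
qed

end

subsection \<open>Resolutions in terms of vectors with zero padding\<close>

lemma restrict_vecs: "(\<lambda>v. restrict v {..<r}) ` vecs n {..<r} = free_vecs n r"
proof (intro Set.equalityI subsetI)
  fix w :: "nat \<Rightarrow> 'a mpol" assume w: "w \<in> free_vecs n r"
  have "w = restrict (\<lambda>l. if l < r then w l else 0) {..<r}"
    using w by (auto simp: free_vecs_def PiE_def extensional_def restrict_def)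
  moreover have "(\<lambda>l. if l < r then w l else 0) \<in> vecs n {..<r}"
    using w by (auto simp: free_vecs_def vecs_def carrier_mpoly_ring)
  ultimately show "w \<in> (\<lambda>v. restrict v {..<r}) ` vecs n {..<r}" by blast
next
  fix w :: "nat \<Rightarrow> 'a mpol" assume "w \<in> (\<lambda>v. restrict v {..<r}) ` vecs n {..<r}"
  then show "w \<in> free_vecs n r"
    by (auto simp only: free_vecs_def vecs_def carrier_mpoly_ring intro!: restrict_PiE_iff[THEN iffD2])
qed

lemma restrict_vecs_inj:
  assumes "v \<in> vecs n {..<r}" "w \<in> vecs n {..<r}" "restrict v {..<r} = restrict w {..<r}"
  shows "v = w"
proof (rule ext)
  fix l
  show "v l = w l"
  proof (cases "l < r")
    case True
    then show ?thesis using fun_cong[OF assms(3), of l] by simp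
  qed (use assms(1,2) in \<open>simp add: vecs_def\<close>)
qed

lemma mat_map_restrict:
  "mat_map {..<r0} {..<r1} A (restrict v {..<r1}) = restrict (mmul r0 r1 A v) {..<r0}"
  by (auto simp: mat_map_def mmul_def restrict_def fun_eq_iff intro!: sum.cong)

lemma restrict_kernel_eq_iff:
  assumes K: "K \<subseteq> vecs n {..<r}" and L: "L \<subseteq> vecs n {..<r}"
  shows "(\<lambda>v. restrict v {..<r}) ` K = (\<lambda>v. restrict v {..<r}) ` L \<longleftrightarrow> K = L"
  by (rule inj_on_image_eq_iff[OF _ K L]) (auto intro!: inj_onI elim: restrict_vecs_inj)

lemma mmul_image_restrict:
  "mat_map {..<r0} {..<r1} A ` free_vecs n r1 =
     (\<lambda>v. restrict v {..<r0}) ` (mmul r0 r1 A ` vecs n {..<r1})"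
  unfolding restrict_vecs[symmetric] image_image mat_map_restrict ..

lemma mmul_kernel_restrict:
  assumes "graded_matrix n r0 a0 r1 a1 A"
  shows "{v \<in> free_vecs n r1. mat_map {..<r0} {..<r1} A v = (\<lambda>k\<in>{..<r0}. 0)} =
     (\<lambda>v. restrict v {..<r1}) ` {v \<in> vecs n {..<r1}. mmul r0 r1 A v = 0}"
proof -
  have "restrict (mmul r0 r1 A v) {..<r0} = (\<lambda>k\<in>{..<r0}. 0) \<longleftrightarrow> mmul r0 r1 A v = 0"
    if "v \<in> vecs n {..<r1}" for v
  proof
    assume *: "restrict (mmul r0 r1 A v) {..<r0} = (\<lambda>k\<in>{..<r0}. 0)"
    have "restrict (mmul r0 r1 A v) {..<r0} = restrict 0 {..<r0}"
      unfolding * by (rule restrict_ext) (simp add: fun_ops_apply)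
    then show "mmul r0 r1 A v = 0"
      by (rule restrict_vecs_inj[rotated 2]) (use mmul_vecs[OF assms that] in auto)
  qed (auto simp: fun_ops_apply)
  then show ?thesis
    unfolding restrict_vecs[symmetric] by (fastforce simp: mat_map_restrict)
qed

context graded_mod
begin

lemma aug_restrict: "finsum N (\<lambda>k. restrict v {..<r} k \<odot>\<^bsub>N\<^esub> g k) {..<r} = aug r g v"
  if "\<And>k. k < r \<Longrightarrow> g k \<in> carrier N" "v \<in> vecs n {..<r}"
  unfolding aug_def by (rule N.finsum_cong') (use that act_closed in \<open>auto simp: vecs_def\<close>)

text \<open>Restriction to \<open>{..<r}\<close> is a bijection from padded vectors to \<open>free_vecs n r\<close> that respects matrices and
  the augmentation.\<close>

lemma graded_free_resolution_iff:
  "graded_free_resolution n N G r a A \<longleftrightarrow>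
     (\<forall>i. graded_matrix n (r i) (a i) (r (Suc i)) (a (Suc i)) (A i)) \<and>
     (\<forall>i. {v \<in> vecs n {..<r (Suc i)}. mmul (r i) (r (Suc i)) (A i) v = 0} =
        mmul (r (Suc i)) (r (Suc (Suc i))) (A (Suc i)) ` vecs n {..<r (Suc (Suc i))}) \<and>
     (\<exists>g. (\<forall>k<r 0. g k \<in> G (a 0 k)) \<and> aug (r 0) g ` vecs n {..<r 0} = carrier N \<and>
        {v \<in> vecs n {..<r 0}. aug (r 0) g v = \<zero>\<^bsub>N\<^esub>} = mmul (r 0) (r 1) (A 0) ` vecs n {..<r 1})"
proof (cases "\<forall>i. graded_matrix n (r i) (a i) (r (Suc i)) (a (Suc i)) (A i)")
  case False
  then show ?thesis
    unfolding graded_free_resolution_def graded_matrix_def carrier_mpoly_ring by blast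
next
  case gr: True
  have sub: "mmul r0 r1 B ` vecs n {..<r1} \<subseteq> vecs n {..<r0}" if "graded_matrix n r0 a0 r1 a1 B"
    for r0 r1 a0 a1 and B :: "nat \<Rightarrow> nat \<Rightarrow> 'k mpol" using mmul_vecs[OF that] by blast
  have exact: "{v \<in> free_vecs n (r (Suc i)). mat_map {..<r i} {..<r (Suc i)} (A i) v = (\<lambda>k\<in>{..<r i}. 0)} =
        mat_map {..<r (Suc i)} {..<r (Suc (Suc i))} (A (Suc i)) ` free_vecs n (r (Suc (Suc i))) \<longleftrightarrow>
      {v \<in> vecs n {..<r (Suc i)}. mmul (r i) (r (Suc i)) (A i) v = 0} =
        mmul (r (Suc i)) (r (Suc (Suc i))) (A (Suc i)) ` vecs n {..<r (Suc (Suc i))}" for i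
    unfolding mmul_kernel_restrict[OF gr[rule_format, of i]] mmul_image_restrict
    by (rule restrict_kernel_eq_iff) (use sub[OF gr[rule_format, of "Suc i"]] in auto)
  have augm: "(let f = (\<lambda>v. finsum N (\<lambda>k. v k \<odot>\<^bsub>N\<^esub> g k) {..<r 0}) in
             f ` free_vecs n (r 0) = carrier N \<and>
             {v \<in> free_vecs n (r 0). f v = \<zero>\<^bsub>N\<^esub>} = mat_map {..<r 0} {..<r 1} (A 0) ` free_vecs n (r 1)) \<longleftrightarrow>
      aug (r 0) g ` vecs n {..<r 0} = carrier N \<and>
        {v \<in> vecs n {..<r 0}. aug (r 0) g v = \<zero>\<^bsub>N\<^esub>} = mmul (r 0) (r 1) (A 0) ` vecs n {..<r 1}"
    if g: "\<forall>k<r 0. g k \<in> G (a 0 k)" for g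
  proof -
    have gc: "\<And>k. k < r 0 \<Longrightarrow> g k \<in> carrier N" using g G_carrier by blast
    let ?f = "\<lambda>v. finsum N (\<lambda>k. v k \<odot>\<^bsub>N\<^esub> g k) {..<r 0}"
    have f: "?f (restrict v {..<r 0}) = aug (r 0) g v" if "v \<in> vecs n {..<r 0}" for v
      using aug_restrict[OF gc that] .
    have im: "?f ` free_vecs n (r 0) = aug (r 0) g ` vecs n {..<r 0}"
      unfolding restrict_vecs[symmetric] image_image by (rule image_cong[OF refl f])
    have ker: "{v \<in> free_vecs n (r 0). ?f v = \<zero>\<^bsub>N\<^esub>} =
        (\<lambda>v. restrict v {..<r 0}) ` {v \<in> vecs n {..<r 0}. aug (r 0) g v = \<zero>\<^bsub>N\<^esub>}"
      unfolding restrict_vecs[symmetric] using f by auto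
    have "{v \<in> free_vecs n (r 0). ?f v = \<zero>\<^bsub>N\<^esub>} = mat_map {..<r 0} {..<r 1} (A 0) ` free_vecs n (r 1) \<longleftrightarrow>
        {v \<in> vecs n {..<r 0}. aug (r 0) g v = \<zero>\<^bsub>N\<^esub>} = mmul (r 0) (r 1) (A 0) ` vecs n {..<r 1}"
      unfolding ker mmul_image_restrict
      by (rule restrict_kernel_eq_iff) (use sub[OF gr[rule_format, of 0]] in auto)
    then show ?thesis unfolding Let_def im by blast
  qed
  show ?thesis
    using gr augm unfolding graded_free_resolution_def exact
    by (auto simp: graded_matrix_def carrier_mpoly_ring cong: conj_cong)
qed

text \<open>The syzygy modules are chosen one after the other.\<close>

lemma graded_free_resolution_exists:
  assumes g: "\<And>k. k < r0 \<Longrightarrow> g k \<in> G (a0 k)" and surj: "aug r0 g ` vecs n {..<r0} = carrier N"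
  shows "\<exists>r a A. graded_free_resolution n N G r a A"
proof -
  define P where "P x \<longleftrightarrow> (case x of (r0, a0, r1, a1, A) \<Rightarrow> graded_matrix n r0 a0 r1 a1 A)"
    for x :: "nat \<times> (nat \<Rightarrow> int) \<times> nat \<times> (nat \<Rightarrow> int) \<times> (nat \<Rightarrow> nat \<Rightarrow> 'k mpol)"
  define Q where "Q x y \<longleftrightarrow> (case x of (r0, a0, r1, a1, A) \<Rightarrow> case y of (r1', a1', r2, a2, B) \<Rightarrow>
      r1' = r1 \<and> a1' = a1 \<and> {v \<in> vecs n {..<r1}. mmul r0 r1 A v = 0} = mmul r1 r2 B ` vecs n {..<r2})"
    for x y :: "nat \<times> (nat \<Rightarrow> int) \<times> nat \<times> (nat \<Rightarrow> int) \<times> (nat \<Rightarrow> nat \<Rightarrow> 'k mpol)"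
  have "\<exists>r1 a1 B. graded_matrix n r0 a0 r1 a1 B \<and>
      {v \<in> vecs n {..<r0}. aug r0 g v = \<zero>\<^bsub>N\<^esub>} = mmul r0 r1 B ` vecs n {..<r1}"
    by (rule aug_kernel) (rule g)
  then obtain r1 a1 B where B: "graded_matrix n r0 a0 r1 a1 B"
      "{v \<in> vecs n {..<r0}. aug r0 g v = \<zero>\<^bsub>N\<^esub>} = mmul r0 r1 B ` vecs n {..<r1}"
    by (elim exE conjE) (rule that)
  have "\<exists>f. \<forall>i. (P (f i) \<and> (i = 0 \<longrightarrow> f i = (r0, a0, r1, a1, B))) \<and> Q (f i) (f (Suc i))"
  proof (rule dependent_nat_choice)
    show "\<exists>x. P x \<and> ((0::nat) = 0 \<longrightarrow> x = (r0, a0, r1, a1, B))" using B by (auto simp: P_def)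
    fix x and i :: nat assume x: "P x \<and> (i = 0 \<longrightarrow> x = (r0, a0, r1, a1, B))"
    obtain s0 b0 s1 b1 C where x': "x = (s0, b0, s1, b1, C)" by (cases x) auto
    then have "graded_matrix n s0 b0 s1 b1 C" using x by (simp add: P_def)
    then obtain s2 b2 C' where "graded_matrix n s1 b1 s2 b2 C'"
        "{v \<in> vecs n {..<s1}. mmul s0 s1 C v = 0} = mmul s1 s2 C' ` vecs n {..<s2}"
      using graded_matrix_kernel by blast
    then show "\<exists>y. (P y \<and> (Suc i = 0 \<longrightarrow> y = (r0, a0, r1, a1, B))) \<and> Q x y"
      by (intro exI[of _ "(s1, b1, s2, b2, C')"]) (simp add: P_def Q_def x')
  qed
  then obtain f where f: "\<And>i. P (f i)" "f 0 = (r0, a0, r1, a1, B)" "\<And>i. Q (f i) (f (Suc i))" by blast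
  define r where "r i = fst (f i)" for i
  define a where "a i = fst (snd (f i))" for i
  define A where "A i = snd (snd (snd (snd (f i))))" for i
  have fi: "f i = (r i, a i, r (Suc i), a (Suc i), A i)" for i
    using f(3)[of i] by (cases "f i"; cases "f (Suc i)") (simp add: Q_def r_def a_def A_def)
  have f0: "r 0 = r0" "a 0 = a0" "r (Suc 0) = r1" "A 0 = B" using f(2) fi[of 0] by auto
  have "graded_free_resolution n N G r a A"
    unfolding graded_free_resolution_iff
  proof (intro conjI allI exI[of _ g] impI)
    fix i
    show "graded_matrix n (r i) (a i) (r (Suc i)) (a (Suc i)) (A i)"
      using f(1)[of i] by (simp add: fi P_def)
    show "{v \<in> vecs n {..<r (Suc i)}. mmul (r i) (r (Suc i)) (A i) v = 0} =
        mmul (r (Suc i)) (r (Suc (Suc i))) (A (Suc i)) ` vecs n {..<r (Suc (Suc i))}"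
      using f(3)[of i] unfolding fi[of i] fi[of "Suc i"] by (simp add: Q_def)
  next
    fix k assume "k < r 0"
    then show "g k \<in> G (a 0 k)" using g f0 by simp
  next
    show "aug (r 0) g ` vecs n {..<r 0} = carrier N" using surj f0 by simp
    show "{v \<in> vecs n {..<r 0}. aug (r 0) g v = \<zero>\<^bsub>N\<^esub>} = mmul (r 0) (r 1) (A 0) ` vecs n {..<r 1}"
      using B(2) f0 by simp
  qed
  then show ?thesis by blast
qed

text \<open>The finitely many generators are combinations of finitely many elements of degree \<open>0\<close>.\<close>

lemma degree_0_generators:
  assumes fg: "finitely_generated (mpoly_ring n) N" and g0: "generated_in_degree n N G 0"
  shows "\<exists>r g. (\<forall>k<r. g k \<in> G 0) \<and> aug r g ` vecs n {..<r} = carrier N"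
proof -
  obtain B where B: "finite B" "B \<subseteq> carrier N" "N.span B = carrier N"
    using fg by (auto simp: finitely_generated_def)
  have G0: "G 0 \<subseteq> carrier N" using G_carrier by blast
  have "\<forall>b\<in>B. \<exists>X. finite X \<and> X \<subseteq> G 0 \<and> b \<in> N.span X"
  proof
    fix b assume "b \<in> B"
    then have "b \<in> N.span (G 0)" using B(2) g0 by (auto simp: generated_in_degree_def)
    then obtain c X where "finite X" "X \<subseteq> G 0" "c \<in> X \<rightarrow> carrier (mpoly_ring n)" "b = N.lincomb c X"
      unfolding N.span_def by blast
    then show "\<exists>X. finite X \<and> X \<subseteq> G 0 \<and> b \<in> N.span X" unfolding N.span_def by blast
  qed
  then obtain X where X: "\<And>b. b \<in> B \<Longrightarrow> finite (X b) \<and> X b \<subseteq> G 0 \<and> b \<in> N.span (X b)" by metis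
  define Y where "Y = (\<Union>b\<in>B. X b)"
  have Y: "finite Y" "Y \<subseteq> G 0" using X B(1) by (auto simp: Y_def)
  then have YN: "Y \<subseteq> carrier N" using G0 by blast
  have BY: "B \<subseteq> N.span Y"
  proof
    fix b assume "b \<in> B"
    then have "N.span (X b) \<subseteq> N.span Y" using N.span_is_monotone[of "X b" Y] by (auto simp: Y_def)
    then show "b \<in> N.span Y" using X \<open>b \<in> B\<close> by blast
  qed
  have spanY: "N.span Y = carrier N"
    using N.span_is_subset[OF BY N.span_is_submodule[OF YN]] N.span_is_subset2[OF YN] B(3) by blast
  obtain h where h: "bij_betw h {0..<card Y} Y" using ex_bij_betw_nat_finite[OF Y(1)] by blast
  have hY: "h ` {..<card Y} = Y" and inj: "inj_on h {..<card Y}"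
    using h by (auto simp: bij_betw_def atLeast0LessThan)
  have hG: "\<forall>k<card Y. h k \<in> G 0" using hY Y(2) by blast
  then have hc: "\<And>k. k < card Y \<Longrightarrow> h k \<in> carrier N" using G0 by blast
  have "carrier N \<subseteq> aug (card Y) h ` vecs n {..<card Y}"
  proof
    fix x assume "x \<in> carrier N"
    then obtain c where c: "c \<in> Y \<rightarrow> carrier (mpoly_ring n)" "x = N.lincomb c Y"
      using N.finite_in_span[OF Y(1) YN, of x] spanY by blast
    define v where "v = (\<lambda>k. if k < card Y then c (h k) else 0)"
    have v: "v \<in> vecs n {..<card Y}" using c(1) hY by (auto simp: v_def vecs_def carrier_mpoly_ring)
    have "x = finsum N (\<lambda>y. c y \<odot>\<^bsub>N\<^esub> y) (h ` {..<card Y})" using c(2) hY by (simp add: N.lincomb_def)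
    also have "\<dots> = finsum N (\<lambda>k. c (h k) \<odot>\<^bsub>N\<^esub> h k) {..<card Y}"
      by (rule N.finsum_reindex[OF _ inj]) (use c(1) hY YN N.smult_closed in auto)
    also have "\<dots> = aug (card Y) h v"
      unfolding aug_def by (rule N.finsum_cong') (use v hc act_closed in \<open>auto simp: v_def vecs_def split: if_splits\<close>)
    finally show "x \<in> aug (card Y) h ` vecs n {..<card Y}" using v by blast
  qed
  moreover have "aug (card Y) h ` vecs n {..<card Y} \<subseteq> carrier N"
    by (rule image_subsetI, rule aug_closed[OF hc])
  ultimately have "aug (card Y) h ` vecs n {..<card Y} = carrier N" by (rule Set.equalityI[rotated])
  with hG show ?thesis by (intro exI conjI)
qed

end

section \<open>Transport of structure\<close>

text \<open>Diagrams in \<open>betti_diagrams\<close> come from modules whose elements have one fixed type. A module on another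
  type is moved there along an injection.\<close>

definition transported :: "('m \<Rightarrow> 'n) \<Rightarrow> ('a, 'm) module \<Rightarrow> ('a, 'n) module" where
  "transported \<phi> N = (let \<psi> = inv_into (carrier N) \<phi> in
     \<lparr>carrier = \<phi> ` carrier N, monoid.mult = (\<lambda>x y. \<phi> (\<psi> x \<otimes>\<^bsub>N\<^esub> \<psi> y)), one = \<phi> \<one>\<^bsub>N\<^esub>,
      zero = \<phi> \<zero>\<^bsub>N\<^esub>, add = (\<lambda>x y. \<phi> (\<psi> x \<oplus>\<^bsub>N\<^esub> \<psi> y)), smult = (\<lambda>p x. \<phi> (p \<odot>\<^bsub>N\<^esub> \<psi> x))\<rparr>)"

locale transport = N: Module.module R N for R and N :: "('a, 'm) module" +
  fixes \<phi> :: "'m \<Rightarrow> 'n"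
  assumes inj: "inj_on \<phi> (carrier N)"
begin

abbreviation N' where "N' \<equiv> transported \<phi> N"

lemma N'_carrier: "carrier N' = \<phi> ` carrier N"
  by (simp add: transported_def Let_def)

lemma N'_zero: "\<zero>\<^bsub>N'\<^esub> = \<phi> \<zero>\<^bsub>N\<^esub>"
  by (simp add: transported_def Let_def)

lemma N'_add: "x \<in> carrier N \<Longrightarrow> y \<in> carrier N \<Longrightarrow> \<phi> x \<oplus>\<^bsub>N'\<^esub> \<phi> y = \<phi> (x \<oplus>\<^bsub>N\<^esub> y)"
  by (simp add: transported_def Let_def inv_into_f_f[OF inj])

lemma N'_smult: "x \<in> carrier N \<Longrightarrow> p \<odot>\<^bsub>N'\<^esub> \<phi> x = \<phi> (p \<odot>\<^bsub>N\<^esub> x)"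
  by (simp add: transported_def Let_def inv_into_f_f[OF inj])

lemma \<phi>_eq_iff: "x \<in> carrier N \<Longrightarrow> y \<in> carrier N \<Longrightarrow> \<phi> x = \<phi> y \<longleftrightarrow> x = y"
  using inj by (auto dest: inj_onD)

lemma \<phi>_mem_iff: "x \<in> carrier N \<Longrightarrow> Y \<subseteq> carrier N \<Longrightarrow> \<phi> x \<in> \<phi> ` Y \<longleftrightarrow> x \<in> Y"
  using inj by (auto dest: inj_onD)

lemma N'_module: "Module.module R N'"
proof (rule moduleI)
  show "cring R" by (rule N.R.is_cring)
  show "abelian_group N'"
  proof (rule abelian_groupI)
    fix x y z assume "x \<in> carrier N'" "y \<in> carrier N'" "z \<in> carrier N'"
    then obtain a b c where a: "x = \<phi> a" "a \<in> carrier N" and b: "y = \<phi> b" "b \<in> carrier N"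
      and c: "z = \<phi> c" "c \<in> carrier N" by (auto simp: N'_carrier)
    show "x \<oplus>\<^bsub>N'\<^esub> y \<in> carrier N'" using a b by (simp add: N'_add N'_carrier)
    show "x \<oplus>\<^bsub>N'\<^esub> y \<oplus>\<^bsub>N'\<^esub> z = x \<oplus>\<^bsub>N'\<^esub> (y \<oplus>\<^bsub>N'\<^esub> z)"
      using a b c by (simp add: N'_add N.M.a_assoc)
    show "x \<oplus>\<^bsub>N'\<^esub> y = y \<oplus>\<^bsub>N'\<^esub> x" using a b by (simp add: N'_add N.M.a_comm)
    show "\<zero>\<^bsub>N'\<^esub> \<oplus>\<^bsub>N'\<^esub> x = x" using a by (simp add: N'_add N'_zero)
    show "\<exists>y\<in>carrier N'. y \<oplus>\<^bsub>N'\<^esub> x = \<zero>\<^bsub>N'\<^esub>"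
      using a by (intro bexI[of _ "\<phi> (\<ominus>\<^bsub>N\<^esub> a)"]) (auto simp: N'_add N'_zero N'_carrier N.M.l_neg)
  next
    show "\<zero>\<^bsub>N'\<^esub> \<in> carrier N'" by (simp add: N'_zero N'_carrier)
  qed
  fix p q x y assume p: "p \<in> carrier R" and "x \<in> carrier N'"
  then obtain a where a: "x = \<phi> a" "a \<in> carrier N" by (auto simp: N'_carrier)
  show "p \<odot>\<^bsub>N'\<^esub> x \<in> carrier N'" using a p by (simp add: N'_smult N'_carrier)
  show "p \<odot>\<^bsub>N'\<^esub> (x \<oplus>\<^bsub>N'\<^esub> y) = p \<odot>\<^bsub>N'\<^esub> x \<oplus>\<^bsub>N'\<^esub> p \<odot>\<^bsub>N'\<^esub> y" if "y \<in> carrier N'"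
    using a p that by (auto simp: N'_smult N'_add N'_carrier N.smult_r_distr)
  assume q: "q \<in> carrier R"
  show "(p \<oplus>\<^bsub>R\<^esub> q) \<odot>\<^bsub>N'\<^esub> x = p \<odot>\<^bsub>N'\<^esub> x \<oplus>\<^bsub>N'\<^esub> q \<odot>\<^bsub>N'\<^esub> x"
    using a p q by (simp add: N'_smult N'_add N.smult_l_distr)
  show "(p \<otimes>\<^bsub>R\<^esub> q) \<odot>\<^bsub>N'\<^esub> x = p \<odot>\<^bsub>N'\<^esub> (q \<odot>\<^bsub>N'\<^esub> x)"
    using a p q by (simp add: N'_smult N.smult_assoc1)
next
  fix x assume "x \<in> carrier N'"
  then show "\<one>\<^bsub>R\<^esub> \<odot>\<^bsub>N'\<^esub> x = x" by (auto simp: N'_carrier N'_smult)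
qed

sublocale N': Module.module R N' by (rule N'_module)

lemma N'_finsum:
  "(\<And>x. x \<in> A \<Longrightarrow> f x \<in> carrier N) \<Longrightarrow> finsum N' (\<lambda>x. \<phi> (f x)) A = \<phi> (finsum N f A)"
proof (induction A rule: infinite_finite_induct)
  case (infinite A)
  then show ?case by (simp add: N.M.finsum_infinite N'.M.finsum_infinite N'_zero)
next
  case empty
  then show ?case by (simp add: N'_zero)
next
  case (insert x A)
  have "finsum N' (\<lambda>x. \<phi> (f x)) (insert x A) = \<phi> (f x) \<oplus>\<^bsub>N'\<^esub> finsum N' (\<lambda>x. \<phi> (f x)) A"
    by (rule N'.M.finsum_insert) (use insert in \<open>auto simp: N'_carrier\<close>)
  also have "\<dots> = \<phi> (f x \<oplus>\<^bsub>N\<^esub> finsum N f A)"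
    using insert by (simp add: N'_add N.M.finsum_closed Pi_def)
  also have "f x \<oplus>\<^bsub>N\<^esub> finsum N f A = finsum N f (insert x A)"
    by (rule N.M.finsum_insert[symmetric]) (use insert in auto)
  finally show ?case .
qed

lemma N'_finsum':
  assumes "\<And>x. x \<in> A \<Longrightarrow> f x \<in> carrier N" "\<And>x. x \<in> A \<Longrightarrow> h x = \<phi> (f x)"
  shows "finsum N' h A = \<phi> (finsum N f A)"
proof -
  have "finsum N' h A = finsum N' (\<lambda>x. \<phi> (f x)) A"
    by (rule N'.M.finsum_cong') (use assms in \<open>auto simp: N'_carrier\<close>)
  then show ?thesis using N'_finsum[of A f] assms(1) by simp
qed

lemma N'_annihilator: "annihilator R N' = annihilator R N"
proof -
  have "p \<odot>\<^bsub>N'\<^esub> \<phi> x = \<zero>\<^bsub>N'\<^esub> \<longleftrightarrow> p \<odot>\<^bsub>N\<^esub> x = \<zero>\<^bsub>N\<^esub>" if "p \<in> carrier R" "x \<in> carrier N" for p x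
    using that by (simp add: N'_smult N'_zero \<phi>_eq_iff)
  then show ?thesis by (auto simp: annihilator_def N'_carrier)
qed

lemma N'_module_dim: "module_dim R N' = module_dim R N"
  by (simp add: module_dim_def N'_annihilator)

lemma seq_submodule_carrier: "set fs \<subseteq> carrier R \<Longrightarrow> seq_submodule N fs \<subseteq> carrier N"
  unfolding seq_submodule_def
  by (auto intro!: N.M.finsum_closed N.smult_closed simp: subset_iff)

lemma N'_seq_submodule:
  assumes fs: "set fs \<subseteq> carrier R"
  shows "seq_submodule N' fs = \<phi> ` seq_submodule N fs"
proof -
  have eq: "finsum N' (\<lambda>k. fs ! k \<odot>\<^bsub>N'\<^esub> \<phi> (y k)) {..<length fs} =
      \<phi> (finsum N (\<lambda>k. fs ! k \<odot>\<^bsub>N\<^esub> y k) {..<length fs})" if y: "y \<in> {..<length fs} \<rightarrow> carrier N" for y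
  proof (rule N'_finsum')
    fix k assume k: "k \<in> {..<length fs}"
    then have "fs ! k \<in> carrier R" "y k \<in> carrier N" using fs y nth_mem[of k fs] by auto
    then show "fs ! k \<odot>\<^bsub>N\<^esub> y k \<in> carrier N" "fs ! k \<odot>\<^bsub>N'\<^esub> \<phi> (y k) = \<phi> (fs ! k \<odot>\<^bsub>N\<^esub> y k)"
      by (auto simp: N'_smult)
  qed
  show ?thesis
  proof (intro Set.equalityI subsetI)
    fix x assume "x \<in> seq_submodule N' fs"
    then obtain y where y: "y \<in> {..<length fs} \<rightarrow> carrier N'"
      "x = finsum N' (\<lambda>k. fs ! k \<odot>\<^bsub>N'\<^esub> y k) {..<length fs}" by (auto simp: seq_submodule_def)
    define z where "z k = inv_into (carrier N) \<phi> (y k)" for k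
    have z: "z k \<in> carrier N" "\<phi> (z k) = y k" if "k < length fs" for k
      using y(1) that by (auto simp: z_def N'_carrier Pi_iff inv_into_into f_inv_into_f)
    have "x = finsum N' (\<lambda>k. fs ! k \<odot>\<^bsub>N'\<^esub> \<phi> (z k)) {..<length fs}"
      unfolding y(2) by (rule N'.M.finsum_cong') (use z fs nth_mem y(1) in \<open>auto intro!: N'.smult_closed\<close>)
    also have "\<dots> = \<phi> (finsum N (\<lambda>k. fs ! k \<odot>\<^bsub>N\<^esub> z k) {..<length fs})"
      by (rule eq) (use z in auto)
    finally show "x \<in> \<phi> ` seq_submodule N fs" using z by (auto simp: seq_submodule_def)
  next
    fix x assume "x \<in> \<phi> ` seq_submodule N fs"
    then obtain y where y: "y \<in> {..<length fs} \<rightarrow> carrier N"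
      "x = \<phi> (finsum N (\<lambda>k. fs ! k \<odot>\<^bsub>N\<^esub> y k) {..<length fs})" by (auto simp: seq_submodule_def)
    have "(\<lambda>k. \<phi> (y k)) \<in> {..<length fs} \<rightarrow> carrier N'" using y(1) by (auto simp: N'_carrier)
    then show "x \<in> seq_submodule N' fs"
      unfolding seq_submodule_def y(2) eq[OF y(1), symmetric]
      by (intro CollectI exI[of _ "\<lambda>k. \<phi> (y k)"] conjI refl)
  qed
qed

lemma N'_regular_sequence:
  assumes fs: "set fs \<subseteq> carrier R"
  shows "regular_sequence N' fs \<longleftrightarrow> regular_sequence N fs"
proof -
  have tk: "set (take i fs) \<subseteq> carrier R" for i using fs set_take_subset by fastforce
  have "(fs ! i \<odot>\<^bsub>N'\<^esub> \<phi> x \<in> seq_submodule N' (take i fs) \<longrightarrow> \<phi> x \<in> seq_submodule N' (take i fs)) \<longleftrightarrow>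
      (fs ! i \<odot>\<^bsub>N\<^esub> x \<in> seq_submodule N (take i fs) \<longrightarrow> x \<in> seq_submodule N (take i fs))"
    if "i < length fs" "x \<in> carrier N" for i x
  proof -
    have "fs ! i \<odot>\<^bsub>N\<^esub> x \<in> carrier N" using fs that by (intro N.smult_closed) auto
    then show ?thesis
      using that seq_submodule_carrier[OF tk]
      by (simp add: N'_smult N'_seq_submodule[OF tk] \<phi>_mem_iff)
  qed
  moreover have "seq_submodule N' fs \<noteq> carrier N' \<longleftrightarrow> seq_submodule N fs \<noteq> carrier N"
    unfolding N'_seq_submodule[OF fs] N'_carrier
    using inj_on_image_eq_iff[OF inj seq_submodule_carrier[OF fs] subset_refl] by simp
  ultimately show ?thesis unfolding regular_sequence_def N'_carrier by auto
qed

lemma N'_depth: "I \<subseteq> carrier R \<Longrightarrow> depth I N' = depth I N"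
  unfolding depth_def using N'_regular_sequence by (metis (no_types, opaque_lifting) subset_trans)

lemma N'_lincomb:
  assumes "A \<subseteq> carrier N" "a \<in> A \<rightarrow> carrier R"
  shows "N'.lincomb (\<lambda>y. a (inv_into (carrier N) \<phi> y)) (\<phi> ` A) = \<phi> (N.lincomb a A)"
proof -
  have inv: "inv_into (carrier N) \<phi> (\<phi> x) = x" if "x \<in> A" for x
    using that assms(1) inj by (auto simp: inv_into_f_f)
  have "finsum N' (\<lambda>y. a (inv_into (carrier N) \<phi> y) \<odot>\<^bsub>N'\<^esub> y) (\<phi> ` A) =
      finsum N' (\<lambda>x. a (inv_into (carrier N) \<phi> (\<phi> x)) \<odot>\<^bsub>N'\<^esub> \<phi> x) A"
  proof (rule N'.M.finsum_reindex)
    show "inj_on \<phi> A" using inj assms(1) by (rule inj_on_subset)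
    show "(\<lambda>y. a (inv_into (carrier N) \<phi> y) \<odot>\<^bsub>N'\<^esub> y) \<in> \<phi> ` A \<rightarrow> carrier N'"
    proof (rule Pi_I)
      fix y assume "y \<in> \<phi> ` A"
      then obtain x where "y = \<phi> x" "x \<in> A" by blast
      then show "a (inv_into (carrier N) \<phi> y) \<odot>\<^bsub>N'\<^esub> y \<in> carrier N'"
        using assms inv by (intro N'.smult_closed) (auto simp: N'_carrier)
    qed
  qed
  also have "\<dots> = \<phi> (finsum N (\<lambda>x. a x \<odot>\<^bsub>N\<^esub> x) A)"
    by (rule N'_finsum') (use assms inv in \<open>auto simp: N'_smult subset_iff\<close>)
  finally show ?thesis by (simp add: N.lincomb_def N'.lincomb_def)
qed

lemma span_transported:
  assumes B: "B \<subseteq> carrier N"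
  shows "\<phi> ` N.span B \<subseteq> N'.span (\<phi> ` B)"
proof
  fix x assume "x \<in> \<phi> ` N.span B"
  then obtain a A where A: "finite A" "A \<subseteq> B" "a \<in> A \<rightarrow> carrier R" "x = \<phi> (N.lincomb a A)"
    by (auto simp: N.span_def)
  have "x = N'.lincomb (\<lambda>y. a (inv_into (carrier N) \<phi> y)) (\<phi> ` A)"
    using N'_lincomb[of A a] A B by auto
  moreover have "(\<lambda>y. a (inv_into (carrier N) \<phi> y)) \<in> \<phi> ` A \<rightarrow> carrier R"
    using A B inj by (auto simp: inv_into_f_f subset_iff)
  ultimately show "x \<in> N'.span (\<phi> ` B)" using A unfolding N'.span_def by blast
qed

lemma N'_finitely_generated: "finitely_generated R N \<Longrightarrow> finitely_generated R N'"
proof -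
  assume "finitely_generated R N"
  then obtain B where B: "finite B" "B \<subseteq> carrier N" "N.span B = carrier N"
    by (auto simp: finitely_generated_def)
  have "carrier N' \<subseteq> N'.span (\<phi> ` B)" using span_transported[OF B(2)] B(3) by (simp add: N'_carrier)
  moreover have "N'.span (\<phi> ` B) \<subseteq> carrier N'"
    by (rule N'.span_is_subset2) (use B(2) in \<open>auto simp: N'_carrier\<close>)
  ultimately show ?thesis
    unfolding finitely_generated_def using B(1,2) by (intro exI[of _ "\<phi> ` B"]) (auto simp: N'_carrier)
qed

lemma N'_additive_subgroup:
  assumes "additive_subgroup H N"
  shows "additive_subgroup (\<phi> ` H) N'"
proof -
  interpret additive_subgroup H N by (rule assms)
  have HN: "x \<in> carrier N" if "x \<in> H" for x using that by (rule a_Hcarr)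
  have "subgroup (\<phi> ` H) (add_monoid N')"
  proof (rule N'.M.add.subgroupI)
    show "\<phi> ` H \<subseteq> carrier N'" using HN by (auto simp: N'_carrier)
    show "\<phi> ` H \<noteq> {}" using zero_closed by blast
    fix x assume "x \<in> \<phi> ` H"
    then obtain a where a: "x = \<phi> a" "a \<in> H" by blast
    have "\<ominus>\<^bsub>N'\<^esub> x = \<phi> (\<ominus>\<^bsub>N\<^esub> a)"
      by (rule N'.M.minus_equality) (use a HN in \<open>auto simp: N'_add N'_zero N'_carrier N.M.l_neg\<close>)
    then show "\<ominus>\<^bsub>N'\<^esub> x \<in> \<phi> ` H" using a a_inv_closed by auto
    fix y assume "y \<in> \<phi> ` H"
    then show "x \<oplus>\<^bsub>N'\<^esub> y \<in> \<phi> ` H" using a HN a_closed by (auto simp: N'_add)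
  qed
  then show ?thesis by (rule additive_subgroupI)
qed

end

lemma transported_graded_module:
  fixes N :: "('k::field mpol, 'm) module" and \<phi> :: "'m \<Rightarrow> 'n"
  assumes "graded_module n N G" and inj: "inj_on \<phi> (carrier N)"
  shows "graded_module n (transported \<phi> N) (\<lambda>j. \<phi> ` G j)"
proof -
  interpret gm: graded_mod n N G by standard (rule assms)
  interpret transport "mpoly_ring n" N \<phi> by unfold_locales (rule inj)
  have act: "p \<odot>\<^bsub>N'\<^esub> x \<in> \<phi> ` G (a + j)"
    if "p \<in> carrier (mpoly_ring n)" "homogeneous_of_degree a p" "x \<in> \<phi> ` G j" for a j p x
    using that gm.G_act gm.G_carrier by (auto simp: N'_smult carrier_mpoly_ring)
  have dec: "\<exists>!c. (\<forall>j. c j \<in> \<phi> ` G j) \<and> finite {j. c j \<noteq> \<zero>\<^bsub>N'\<^esub>} \<and>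
        x = finsum N' c {j. c j \<noteq> \<zero>\<^bsub>N'\<^esub>}" if x: "x \<in> carrier N'" for x
  proof -
    obtain y where y: "y \<in> carrier N" "x = \<phi> y" using x by (auto simp: N'_carrier)
    define P where "P c \<longleftrightarrow> (\<forall>j. c j \<in> G j) \<and> finite {j. c j \<noteq> \<zero>\<^bsub>N\<^esub>} \<and>
        y = finsum N c {j. c j \<noteq> \<zero>\<^bsub>N\<^esub>}" for c
    define P' where "P' c \<longleftrightarrow> (\<forall>j. c j \<in> \<phi> ` G j) \<and> finite {j. c j \<noteq> \<zero>\<^bsub>N'\<^esub>} \<and>
        x = finsum N' c {j. c j \<noteq> \<zero>\<^bsub>N'\<^esub>}" for c
    have PP': "P' (\<lambda>j. \<phi> (c j)) \<longleftrightarrow> P c" if c: "\<And>j. c j \<in> G j" for c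
    proof -
      have cc: "c j \<in> carrier N" for j using c gm.G_carrier by blast
      have supp: "{j. \<phi> (c j) \<noteq> \<zero>\<^bsub>N'\<^esub>} = {j. c j \<noteq> \<zero>\<^bsub>N\<^esub>}" using cc by (auto simp: N'_zero \<phi>_eq_iff)
      have "finsum N' (\<lambda>j. \<phi> (c j)) {j. c j \<noteq> \<zero>\<^bsub>N\<^esub>} = \<phi> (finsum N c {j. c j \<noteq> \<zero>\<^bsub>N\<^esub>})"
        by (rule N'_finsum) (rule cc)
      moreover have "finsum N c {j. c j \<noteq> \<zero>\<^bsub>N\<^esub>} \<in> carrier N"
        by (rule gm.N.finsum_closed) (use cc in auto)
      ultimately show ?thesis unfolding P_def P'_def supp using c y by (auto simp: \<phi>_eq_iff)
    qed
    have ex1: "\<exists>!c. P c" using assms(1) y(1) unfolding graded_module_def P_def by blast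
    then obtain c where c: "P c" by blast
    have "P' (\<lambda>j. \<phi> (c j))" using PP'[of c] c by (simp add: P_def)
    moreover have "c' = (\<lambda>j. \<phi> (c j))" if c': "P' c'" for c'
    proof -
      have "\<forall>j. \<exists>d. d \<in> G j \<and> c' j = \<phi> d" using c' unfolding P'_def by blast
      from choice[OF this] obtain d where d: "\<And>j. d j \<in> G j" "c' = (\<lambda>j. \<phi> (d j))" by fastforce
      then have "P d" using PP'[of d] c' by simp
      then have "d = c" using ex1 c by blast
      then show ?thesis using d(2) by simp
    qed
    ultimately have "\<exists>!c. P' c" by blast
    then show ?thesis by (simp add: P'_def)
  qed
  show ?thesis
    unfolding graded_module_def
    using N'_module N'_additive_subgroup[OF gm.G_subgroup] act dec by blast
qed

lemma transported_graded_CM_module: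
  fixes N :: "('k::field mpol, 'm) module"
  assumes CM: "graded_CM_module n s N G" and inj: "inj_on \<phi> (carrier N)"
  shows "graded_CM_module n s (transported \<phi> N) (\<lambda>j. \<phi> ` G j)"
proof -
  have g: "graded_module n N G" using CM by (simp add: graded_CM_module_def)
  interpret gm: graded_mod n N G by standard (rule g)
  interpret transport "mpoly_ring n" N \<phi> by unfold_locales (rule inj)
  have "irrelevant_ideal n \<subseteq> carrier (mpoly_ring n :: 'k mpol ring)" by (auto simp: irrelevant_ideal_def)
  moreover have "carrier N' = {\<zero>\<^bsub>N'\<^esub>} \<longleftrightarrow> carrier N = {\<zero>\<^bsub>N\<^esub>}"
    using inj_on_image_eq_iff[OF inj subset_refl, of "{\<zero>\<^bsub>N\<^esub>}"] by (simp add: N'_carrier N'_zero)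
  ultimately show ?thesis
    using CM transported_graded_module[OF g inj] N'_finitely_generated
    by (simp add: graded_CM_module_def cohen_macaulay_def has_codim_def N'_module_dim N'_depth)
qed

lemma transported_resolution:
  fixes N :: "('k::field mpol, 'm) module"
  assumes g: "graded_module n N G" and inj: "inj_on \<phi> (carrier N)"
  shows "graded_free_resolution n (transported \<phi> N) (\<lambda>j. \<phi> ` G j) r a A \<longleftrightarrow>
    graded_free_resolution n N G r a A"
proof -
  interpret gm: graded_mod n N G by standard (rule g)
  interpret transport "mpoly_ring n" N \<phi> by unfold_locales (rule inj)
  interpret gm': graded_mod n N' "\<lambda>j. \<phi> ` G j" by standard (rule transported_graded_module[OF g inj])
  have aug: "gm'.aug r0 (\<lambda>k. \<phi> (h k)) v = \<phi> (gm.aug r0 h v)"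
    if h: "\<And>k. k < r0 \<Longrightarrow> h k \<in> carrier N" and v: "v \<in> vecs n J" for r0 h v J
    unfolding gm'.aug_def gm.aug_def
    by (rule N'_finsum') (use h v gm.act_closed in \<open>auto simp: N'_smult vecs_def\<close>)
  have eq: "(gm'.aug (r 0) (\<lambda>k. \<phi> (h k)) ` vecs n {..<r 0} = carrier N' \<and>
        {v \<in> vecs n {..<r 0}. gm'.aug (r 0) (\<lambda>k. \<phi> (h k)) v = \<zero>\<^bsub>N'\<^esub>} = K) \<longleftrightarrow>
      (gm.aug (r 0) h ` vecs n {..<r 0} = carrier N \<and>
        {v \<in> vecs n {..<r 0}. gm.aug (r 0) h v = \<zero>\<^bsub>N\<^esub>} = K)"
    if h: "\<And>k. k < r 0 \<Longrightarrow> h k \<in> carrier N" for h K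
  proof -
    have sub: "gm.aug (r 0) h ` vecs n {..<r 0} \<subseteq> carrier N"
      by (rule image_subsetI, rule gm.aug_closed, rule h)
    have "gm'.aug (r 0) (\<lambda>k. \<phi> (h k)) ` vecs n {..<r 0} = \<phi> ` (gm.aug (r 0) h ` vecs n {..<r 0})"
      unfolding image_image by (rule image_cong[OF refl aug[OF h]])
    then have 1: "gm'.aug (r 0) (\<lambda>k. \<phi> (h k)) ` vecs n {..<r 0} = carrier N' \<longleftrightarrow>
        gm.aug (r 0) h ` vecs n {..<r 0} = carrier N"
      using inj_on_image_eq_iff[OF inj sub subset_refl] by (simp add: N'_carrier)
    have "gm'.aug (r 0) (\<lambda>k. \<phi> (h k)) v = \<zero>\<^bsub>N'\<^esub> \<longleftrightarrow> gm.aug (r 0) h v = \<zero>\<^bsub>N\<^esub>"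
      if "v \<in> vecs n {..<r 0}" for v
      using aug[OF h that] gm.aug_closed[OF h that] by (simp add: N'_zero \<phi>_eq_iff)
    then have 2: "{v \<in> vecs n {..<r 0}. gm'.aug (r 0) (\<lambda>k. \<phi> (h k)) v = \<zero>\<^bsub>N'\<^esub>} =
        {v \<in> vecs n {..<r 0}. gm.aug (r 0) h v = \<zero>\<^bsub>N\<^esub>}" by blast
    show ?thesis unfolding 1 2 ..
  qed
  let ?K = "mmul (r 0) (r 1) (A 0) ` vecs n {..<r 1}"
  have "(\<exists>h. (\<forall>k<r 0. h k \<in> \<phi> ` G (a 0 k)) \<and> gm'.aug (r 0) h ` vecs n {..<r 0} = carrier N' \<and>
        {v \<in> vecs n {..<r 0}. gm'.aug (r 0) h v = \<zero>\<^bsub>N'\<^esub>} = ?K) \<longleftrightarrow>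
      (\<exists>h. (\<forall>k<r 0. h k \<in> G (a 0 k)) \<and> gm.aug (r 0) h ` vecs n {..<r 0} = carrier N \<and>
        {v \<in> vecs n {..<r 0}. gm.aug (r 0) h v = \<zero>\<^bsub>N\<^esub>} = ?K)" (is "?L \<longleftrightarrow> ?R")
  proof
    assume ?L
    then obtain h where h: "\<forall>k<r 0. h k \<in> \<phi> ` G (a 0 k)"
      "gm'.aug (r 0) h ` vecs n {..<r 0} = carrier N' \<and>
        {v \<in> vecs n {..<r 0}. gm'.aug (r 0) h v = \<zero>\<^bsub>N'\<^esub>} = ?K" by blast
    define h' where "h' k = inv_into (carrier N) \<phi> (h k)" for k
    have h': "h' k \<in> G (a 0 k) \<and> \<phi> (h' k) = h k" if "k < r 0" for k
      using h(1) that gm.G_carrier inj by (auto simp: h'_def image_iff inv_into_f_f)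
    have hc: "\<And>k. k < r 0 \<Longrightarrow> h' k \<in> carrier N" using h' gm.G_carrier by blast
    have augeq: "gm'.aug (r 0) (\<lambda>k. \<phi> (h' k)) v = gm'.aug (r 0) h v" if v: "v \<in> vecs n {..<r 0}" for v
      unfolding gm'.aug_def
    proof (rule N'.M.finsum_cong'[OF refl])
      show "(\<lambda>k. v k \<odot>\<^bsub>N'\<^esub> h k) \<in> {..<r 0} \<rightarrow> carrier N'"
      proof (rule Pi_I)
        fix k assume "k \<in> {..<r 0}"
        then have "v k \<in> pols n" "h k \<in> carrier N'"
          using v h' hc by (auto simp: vecs_def N'_carrier) (metis image_eqI)
        then show "v k \<odot>\<^bsub>N'\<^esub> h k \<in> carrier N'" by (rule gm'.act_closed)
      qed
    qed (use h' in auto)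
    have im: "gm'.aug (r 0) (\<lambda>k. \<phi> (h' k)) ` vecs n {..<r 0} = gm'.aug (r 0) h ` vecs n {..<r 0}"
      by (rule image_cong[OF refl augeq])
    have ker: "{v \<in> vecs n {..<r 0}. gm'.aug (r 0) (\<lambda>k. \<phi> (h' k)) v = \<zero>\<^bsub>N'\<^esub>} =
        {v \<in> vecs n {..<r 0}. gm'.aug (r 0) h v = \<zero>\<^bsub>N'\<^esub>}"
      using augeq by auto
    have "gm.aug (r 0) h' ` vecs n {..<r 0} = carrier N \<and>
        {v \<in> vecs n {..<r 0}. gm.aug (r 0) h' v = \<zero>\<^bsub>N\<^esub>} = ?K"
      using eq[of h' ?K, OF hc] h(2) unfolding im ker by blast
    then show ?R using h' by blast
  next
    assume ?R
    then obtain h where h: "\<forall>k<r 0. h k \<in> G (a 0 k)"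
      "gm.aug (r 0) h ` vecs n {..<r 0} = carrier N \<and>
        {v \<in> vecs n {..<r 0}. gm.aug (r 0) h v = \<zero>\<^bsub>N\<^esub>} = ?K" by blast
    then have hc: "\<And>k. k < r 0 \<Longrightarrow> h k \<in> carrier N" using gm.G_carrier by blast
    have "gm'.aug (r 0) (\<lambda>k. \<phi> (h k)) ` vecs n {..<r 0} = carrier N' \<and>
        {v \<in> vecs n {..<r 0}. gm'.aug (r 0) (\<lambda>k. \<phi> (h k)) v = \<zero>\<^bsub>N'\<^esub>} = ?K"
      by (rule iffD2[OF eq[of h ?K, OF hc]]) (use h(2) in auto)
    from conjI[OF _ this] show ?L
      by (rule exI[of _ "\<lambda>k. \<phi> (h k)"]) (use h(1) in blast)
  qed
  then show ?thesis
    unfolding gm'.graded_free_resolution_iff gm.graded_free_resolution_iff by simp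
qed

text \<open>Both modules have the same resolutions, and hence the same chosen one.\<close>

lemma transported_betti:
  assumes "graded_module n N G" "inj_on \<phi> (carrier N)"
  shows "betti n (transported \<phi> N) (\<lambda>j. \<phi> ` G j) = betti n N G"
  unfolding betti_def transported_resolution[OF assms] ..

section \<open>Growth and chains of primes\<close>

definition homogeneous_ideal :: "nat \<Rightarrow> 'k::field mpol set \<Rightarrow> bool" where
  "homogeneous_ideal n I \<longleftrightarrow> I \<subseteq> pols n \<and> 0 \<in> I \<and> (\<forall>p\<in>I. \<forall>q\<in>I. p + q \<in> I) \<and>
     (\<forall>p\<in>I. \<forall>c\<in>pols n. c * p \<in> I) \<and> (\<forall>p\<in>I. \<forall>a. hom_part a p \<in> I)"

lemma homogeneous_idealD:
  assumes "homogeneous_ideal n I"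
  shows "p \<in> I \<Longrightarrow> p \<in> pols n" "0 \<in> I" "p \<in> I \<Longrightarrow> q \<in> I \<Longrightarrow> p + q \<in> I"
    "p \<in> I \<Longrightarrow> c \<in> pols n \<Longrightarrow> c * p \<in> I" "p \<in> I \<Longrightarrow> hom_part a p \<in> I"
    "p \<in> I \<Longrightarrow> - p \<in> I" "p \<in> I \<Longrightarrow> q \<in> I \<Longrightarrow> p - q \<in> I"
proof -
  show "p \<in> I \<Longrightarrow> p \<in> pols n" "0 \<in> I" and add: "\<And>p q. p \<in> I \<Longrightarrow> q \<in> I \<Longrightarrow> p + q \<in> I"
    and mult: "\<And>p c. p \<in> I \<Longrightarrow> c \<in> pols n \<Longrightarrow> c * p \<in> I" and "p \<in> I \<Longrightarrow> hom_part a p \<in> I"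
    using assms unfolding homogeneous_ideal_def by blast+
  show neg: "- p \<in> I" if "p \<in> I" for p
    proof -
    have "- 1 \<in> pols n" by (rule pols_uminus) simp
    then show ?thesis using mult[OF that, of "- 1"] by simp
  qed
  show "p \<in> I \<Longrightarrow> q \<in> I \<Longrightarrow> p - q \<in> I" using add[of p "- q"] neg[of q] by simp
qed

lemma homogeneous_ideal_sum:
  "homogeneous_ideal n I \<Longrightarrow> (\<And>x. x \<in> A \<Longrightarrow> f x \<in> I) \<Longrightarrow> sum f A \<in> I"
  by (induction A rule: infinite_finite_induct) (auto intro: homogeneous_idealD)

definition adjoin :: "nat \<Rightarrow> 'k::field mpol set \<Rightarrow> 'k mpol \<Rightarrow> 'k mpol set" where
  "adjoin n I f = {p + f * q | p q. p \<in> I \<and> q \<in> pols n}"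

lemma adjoin_homogeneous_ideal:
  fixes I :: "'k::field mpol set"
  assumes I: "homogeneous_ideal n I" and f: "f \<in> pols n" "homogeneous_of_degree a f"
  shows "homogeneous_ideal n (adjoin n I f)"
  unfolding homogeneous_ideal_def
proof (intro conjI ballI allI)
  show "adjoin n I f \<subseteq> pols n" using f homogeneous_idealD(1)[OF I] by (auto simp: adjoin_def)
  show "0 \<in> adjoin n I f"
    unfolding adjoin_def by (intro CollectI exI[of _ 0]) (simp add: homogeneous_idealD[OF I])
next
  fix p q :: "'k mpol" assume "p \<in> adjoin n I f" "q \<in> adjoin n I f"
  then obtain p1 p2 q1 q2 where "p = p1 + f * p2" "q = q1 + f * q2" "p1 \<in> I" "q1 \<in> I"
    "p2 \<in> pols n" "q2 \<in> pols n" by (auto simp: adjoin_def)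
  then show "p + q \<in> adjoin n I f"
    unfolding adjoin_def
    by (intro CollectI exI[of _ "p1 + q1"] exI[of _ "p2 + q2"])
       (auto simp: algebra_simps intro: homogeneous_idealD[OF I])
next
  fix p c :: "'k mpol" assume "p \<in> adjoin n I f" and c: "c \<in> pols n"
  then obtain p1 p2 where "p = p1 + f * p2" "p1 \<in> I" "p2 \<in> pols n" by (auto simp: adjoin_def)
  then show "c * p \<in> adjoin n I f"
    unfolding adjoin_def using c
    by (intro CollectI exI[of _ "c * p1"] exI[of _ "c * p2"])
       (auto simp: algebra_simps intro: homogeneous_idealD[OF I])
next
  fix p :: "'k mpol" and b assume "p \<in> adjoin n I f"
  then obtain p1 p2 where "p = p1 + f * p2" "p1 \<in> I" "p2 \<in> pols n" by (auto simp: adjoin_def)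
  then show "hom_part b p \<in> adjoin n I f"
    unfolding adjoin_def
    by (intro CollectI exI[of _ "hom_part b p1"] exI[of _ "hom_part (b - a) p2"])
       (auto simp: hom_part_add hom_part_mult[OF f(2)] intro: homogeneous_idealD[OF I])
qed

lemma adjoin_subset: "I \<subseteq> adjoin n I f"
proof
  fix p assume "p \<in> I"
  then show "p \<in> adjoin n I f" unfolding adjoin_def by (intro CollectI exI[of _ p] exI[of _ 0]) simp
qed

lemma adjoin_mem: "0 \<in> I \<Longrightarrow> f \<in> adjoin n I f"
  unfolding adjoin_def by (intro CollectI exI[of _ 0] exI[of _ 1]) simp

subsection \<open>Counting generators degree by degree\<close>

definition forms :: "nat \<Rightarrow> int \<Rightarrow> 'k::field mpol set" where
  "forms n t = {p \<in> pols n. homogeneous_of_degree t p}"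

text \<open>\<open>spans_mod n I t m b\<close> says that the classes of \<open>b\<^sub>0, \<dots>, b\<^sub>m\<^sub>-\<^sub>1\<close> span the degree \<open>t\<close> part
  of \<open>S / I\<close>; \<open>quotient_dim\<close> is the dimension of that part.\<close>

definition spans_mod :: "nat \<Rightarrow> 'k::field mpol set \<Rightarrow> int \<Rightarrow> nat \<Rightarrow> (nat \<Rightarrow> 'k mpol) \<Rightarrow> bool" where
  "spans_mod n I t m b \<longleftrightarrow> (\<forall>k<m. b k \<in> forms n t) \<and>
     (\<forall>p\<in>forms n t. \<exists>c. p - (\<Sum>k<m. const_pol (c k) * b k) \<in> I)"

definition quotient_dim :: "nat \<Rightarrow> 'k::field mpol set \<Rightarrow> int \<Rightarrow> nat" where
  "quotient_dim n I t = (LEAST m. \<exists>b. spans_mod n I t m b)"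

lemma spans_mod_exists:
  assumes "0 \<in> I"
  shows "\<exists>m b. spans_mod n I (int t) m b"
proof -
  let ?U = "{u. supp u \<subseteq> {..<n} \<and> exp_degree u = t}"
  obtain h where h: "bij_betw h {0..<card ?U} ?U" using ex_bij_betw_nat_finite[OF finite_exponents] by blast
  then have hU: "h k \<in> ?U" if "k < card ?U" for k using that by (auto simp: bij_betw_def)
  have "spans_mod n I (int t) (card ?U) (\<lambda>k. monom_of (h k) 1)"
    unfolding spans_mod_def
  proof (intro conjI allI impI ballI)
    fix k assume "k < card ?U"
    then show "monom_of (h k) 1 \<in> forms n (int t)"
      using hU[of k] homogeneous_monom[of "h k" 1] by (auto simp: forms_def)
  next
    fix p :: "'a mpol" assume p: "p \<in> forms n (int t)"
    have sub: "supp p \<subseteq> ?U" using p by (auto simp: forms_def pols_def homogeneous_of_degree_def)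
    have "(\<Sum>k<card ?U. const_pol (coef p (h k)) * monom_of (h k) 1) =
        (\<Sum>u\<in>?U. const_pol (coef p u) * monom_of u 1)"
      using sum.reindex_bij_betw[OF h, of "\<lambda>u. const_pol (coef p u) * monom_of u 1"]
      by (simp add: atLeast0LessThan)
    also have "\<dots> = (\<Sum>u\<in>?U. monom_of u (coef p u))"
      by (simp add: const_pol_def mult_single)
    also have "\<dots> = (\<Sum>u\<in>supp p. monom_of u (coef p u))"
      by (rule sum.mono_neutral_right) (use sub finite_exponents in \<open>auto simp: in_keys_iff\<close>)
    also have "\<dots> = p" by (rule poly_eq_sum_monoms[symmetric])
    finally show "\<exists>c. p - (\<Sum>k<card ?U. const_pol (c k) * monom_of (h k) 1) \<in> I"
      using assms by (intro exI[of _ "\<lambda>k. coef p (h k)"]) simp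
  qed
  then show ?thesis by blast
qed

lemma quotient_dim_spans:
  assumes "0 \<in> I" obtains b where "spans_mod n I (int t) (quotient_dim n I (int t)) b"
proof -
  have "\<exists>b. spans_mod n I (int t) (quotient_dim n I (int t)) b"
    unfolding quotient_dim_def by (rule LeastI_ex) (rule spans_mod_exists[OF assms])
  then show thesis using that by blast
qed

lemma quotient_dim_le: "spans_mod n I t m b \<Longrightarrow> quotient_dim n I t \<le> m"
  unfolding quotient_dim_def by (rule Least_le) blast

text \<open>Subadditivity along \<open>S/J(- \<delta>) \<rightarrow> S/I \<rightarrow> S/(I + (f)) \<rightarrow> 0\<close>, where the first map is multiplication by
  \<open>f\<close> and is well defined if \<open>f J \<subseteq> I\<close>.\<close>

lemma quotient_dim_subadditive:
  assumes I: "homogeneous_ideal n I" and J: "0 \<in> J" "\<And>q. q \<in> J \<Longrightarrow> f * q \<in> I"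
    and f: "f \<in> forms n (int \<delta>)"
  shows "quotient_dim n I (int t) \<le>
     (if \<delta> \<le> t then quotient_dim n J (int (t - \<delta>)) else 0) + quotient_dim n (adjoin n I f) (int t)"
proof -
  have f': "f \<in> pols n" "homogeneous_of_degree (int \<delta>) f" using f by (auto simp: forms_def)
  define m1 where "m1 = (if \<delta> \<le> t then quotient_dim n J (int (t - \<delta>)) else 0)"
  define m2 where "m2 = quotient_dim n (adjoin n I f) (int t)"
  have "0 \<in> adjoin n I f" using adjoin_subset homogeneous_idealD(2)[OF I] by blast
  then obtain b2 where b2: "spans_mod n (adjoin n I f) (int t) m2 b2"
    unfolding m2_def by (rule quotient_dim_spans)
  obtain b where "spans_mod n J (int (t - \<delta>)) (quotient_dim n J (int (t - \<delta>))) b"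
    by (rule quotient_dim_spans[OF J(1)])
  then have "\<exists>b1. \<delta> \<le> t \<longrightarrow> spans_mod n J (int (t - \<delta>)) m1 b1" by (auto simp: m1_def)
  then obtain b1 where b1: "\<delta> \<le> t \<Longrightarrow> spans_mod n J (int (t - \<delta>)) m1 b1" by blast
  define b where "b k = (if k < m1 then f * b1 k else b2 (k - m1))" for k
  have split: "(\<Sum>k<m1 + m2. g k) = (\<Sum>k<m1. g k) + (\<Sum>k<m2. g (m1 + k))" for g :: "nat \<Rightarrow> 'a mpol"
    by (induction m2) (simp_all add: add.assoc)
  have "spans_mod n I (int t) (m1 + m2) b"
    unfolding spans_mod_def
  proof (intro conjI allI impI ballI)
    fix k assume k: "k < m1 + m2"
    show "b k \<in> forms n (int t)"
    proof (cases "k < m1")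
      case True
      then have dt: "\<delta> \<le> t" by (auto simp: m1_def split: if_splits)
      then have "b1 k \<in> forms n (int (t - \<delta>))" using b1 True by (simp add: spans_mod_def)
      then have "homogeneous_of_degree (int \<delta> + int (t - \<delta>)) (f * b1 k)"
        using f'(2) by (intro homogeneous_mult) (auto simp: forms_def)
      then show ?thesis using True dt f' \<open>b1 k \<in> forms n (int (t - \<delta>))\<close>
        by (auto simp: b_def forms_def of_nat_diff)
    next
      case False
      then show ?thesis using b2 k by (simp add: b_def spans_mod_def)
    qed
  next
    fix p :: "'a mpol" assume p: "p \<in> forms n (int t)"
    then obtain c2 where c2: "p - (\<Sum>k<m2. const_pol (c2 k) * b2 k) \<in> adjoin n I f"
      using b2 unfolding spans_mod_def by blast
    let ?e = "p - (\<Sum>k<m2. const_pol (c2 k) * b2 k)"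
    obtain i q where iq: "?e = i + f * q" "i \<in> I" "q \<in> pols n" using c2 by (auto simp: adjoin_def)
    have "homogeneous_of_degree (int t) (const_pol (c2 k) * b2 k)" if "k < m2" for k
      using homogeneous_mult[OF homogeneous_const, of "int t" "b2 k" "c2 k"] b2 that
      by (simp add: spans_mod_def forms_def)
    then have "homogeneous_of_degree (int t) ?e"
      using p by (intro homogeneous_diff homogeneous_sum) (auto simp: forms_def)
    then have "?e = hom_part (int t) ?e" by (simp add: hom_part_homogeneous)
    also have "\<dots> = hom_part (int t) i + f * hom_part (int t - int \<delta>) q"
      unfolding iq(1) by (simp add: hom_part_add hom_part_mult[OF f'(2)])
    finally have e: "?e = hom_part (int t) i + f * hom_part (int t - int \<delta>) q" .
    have "\<exists>c1. f * (hom_part (int t - int \<delta>) q - (\<Sum>k<m1. const_pol (c1 k) * b1 k)) \<in> I"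
    proof (cases "\<delta> \<le> t")
      case True
      then have "hom_part (int t - int \<delta>) q \<in> forms n (int (t - \<delta>))"
        using iq(3) by (auto simp: forms_def of_nat_diff)
      then show ?thesis using b1[OF True] J(2) unfolding spans_mod_def by blast
    next
      case False
      have "hom_part (int t - int \<delta>) q = 0"
        by (rule homogeneous_negative[OF homogeneous_hom_part]) (use False in simp)
      then show ?thesis using False homogeneous_idealD(2)[OF I] by (simp add: m1_def)
    qed
    then obtain c1 where c1: "f * (hom_part (int t - int \<delta>) q - (\<Sum>k<m1. const_pol (c1 k) * b1 k)) \<in> I" by blast
    define c where "c k = (if k < m1 then c1 k else c2 (k - m1))" for k
    have "(\<Sum>k<m1 + m2. const_pol (c k) * b k) =
        f * (\<Sum>k<m1. const_pol (c1 k) * b1 k) + (\<Sum>k<m2. const_pol (c2 k) * b2 k)"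
      unfolding split by (simp add: c_def b_def sum_distrib_left mult_ac)
    then have "p - (\<Sum>k<m1 + m2. const_pol (c k) * b k) =
        ?e - f * (\<Sum>k<m1. const_pol (c1 k) * b1 k)" by (simp add: algebra_simps)
    also have "\<dots> = hom_part (int t) i + f * (hom_part (int t - int \<delta>) q - (\<Sum>k<m1. const_pol (c1 k) * b1 k))"
      unfolding e by (simp add: algebra_simps)
    also have "\<dots> \<in> I" using iq(2) c1 by (intro homogeneous_idealD(3)[OF I] homogeneous_idealD(5)[OF I])
    finally show "\<exists>c. p - (\<Sum>k<m1 + m2. const_pol (c k) * b k) \<in> I" by blast
  qed
  then show ?thesis using quotient_dim_le unfolding m1_def m2_def by blast
qed

definition cumulative_dim :: "nat \<Rightarrow> 'k::field mpol set \<Rightarrow> nat \<Rightarrow> nat" where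
  "cumulative_dim n I T = (\<Sum>t\<le>T. quotient_dim n I (int t))"

definition growth_at_most :: "nat \<Rightarrow> 'k::field mpol set \<Rightarrow> nat \<Rightarrow> bool" where
  "growth_at_most n I e \<longleftrightarrow> (\<exists>C. \<forall>T. cumulative_dim n I T \<le> C * (T + 1) ^ e)"

lemma growth_mono: "growth_at_most n I e \<Longrightarrow> e \<le> e' \<Longrightarrow> growth_at_most n I e'"
proof -
  assume "growth_at_most n I e" and e: "e \<le> e'"
  then obtain C where C: "\<And>T. cumulative_dim n I T \<le> C * (T + 1) ^ e" by (auto simp: growth_at_most_def)
  have "C * (T + 1) ^ e \<le> C * (T + 1) ^ e'" for T using e by (intro mult_left_mono power_increasing) auto
  then show ?thesis unfolding growth_at_most_def using C order_trans by blast
qed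

lemma shifted_sum:
  fixes h :: "nat \<Rightarrow> nat"
  shows "(\<Sum>t\<le>T. if \<delta> \<le> t then h (t - \<delta>) else 0) = (if \<delta> \<le> T then \<Sum>t\<le>T - \<delta>. h t else 0)"
proof (induction T)
  case (Suc T)
  then show ?case by (cases "\<delta> = Suc T") (auto simp: Suc_diff_le)
qed simp

lemma cumulative_dim_subadditive:
  assumes "homogeneous_ideal n I" "0 \<in> J" "\<And>q. q \<in> J \<Longrightarrow> f * q \<in> I" "f \<in> forms n (int \<delta>)"
  shows "cumulative_dim n I T \<le>
    (if \<delta> \<le> T then cumulative_dim n J (T - \<delta>) else 0) + cumulative_dim n (adjoin n I f) T"
proof -
  have "cumulative_dim n I T \<le> (\<Sum>t\<le>T. (if \<delta> \<le> t then quotient_dim n J (int (t - \<delta>)) else 0) +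
      quotient_dim n (adjoin n I f) (int t))"
    unfolding cumulative_dim_def by (rule sum_mono) (rule quotient_dim_subadditive[OF assms])
  then show ?thesis
    unfolding sum.distrib shifted_sum[of \<delta> "\<lambda>t. quotient_dim n J (int t)"]
    by (simp only: cumulative_dim_def)
qed

lemma cumulative_dim_mono: "T \<le> T' \<Longrightarrow> cumulative_dim n I T \<le> cumulative_dim n I T'"
  unfolding cumulative_dim_def by (rule sum_mono2) auto

text \<open>Subadditivity with \<open>J = I + (g)\<close>, which multiplication by \<open>f\<close> sends into \<open>I\<close>.\<close>

lemma growth_product:
  assumes I: "homogeneous_ideal n I" and f: "f \<in> forms n (int \<delta>)" and g: "g \<in> pols n" and fg: "f * g \<in> I"
    and gf: "growth_at_most n (adjoin n I f) e" and gg: "growth_at_most n (adjoin n I g) e"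
  shows "growth_at_most n I e"
proof -
  obtain C where C: "\<And>T. cumulative_dim n (adjoin n I f) T \<le> C * (T + 1) ^ e"
    using gf by (auto simp: growth_at_most_def)
  obtain C' where C': "\<And>T. cumulative_dim n (adjoin n I g) T \<le> C' * (T + 1) ^ e"
    using gg by (auto simp: growth_at_most_def)
  have f': "f \<in> pols n" using f by (simp add: forms_def)
  have mult: "f * q \<in> I" if "q \<in> adjoin n I g" for q
  proof -
    from that obtain p r where "q = p + g * r" "p \<in> I" "r \<in> pols n" by (auto simp: adjoin_def)
    moreover from this have "f * q = f * p + r * (f * g)" by (simp add: algebra_simps)
    ultimately show ?thesis using f' fg by (auto intro!: homogeneous_idealD(3,4)[OF I])
  qed
  have zero: "0 \<in> adjoin n I g" using adjoin_subset homogeneous_idealD(2)[OF I] by blast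
  have "cumulative_dim n I T \<le> (C' + C) * (T + 1) ^ e" for T
  proof -
    have "cumulative_dim n I T \<le>
        (if \<delta> \<le> T then cumulative_dim n (adjoin n I g) (T - \<delta>) else 0) + cumulative_dim n (adjoin n I f) T"
      by (rule cumulative_dim_subadditive[OF I zero mult f])
    also have "(if \<delta> \<le> T then cumulative_dim n (adjoin n I g) (T - \<delta>) else 0) \<le> cumulative_dim n (adjoin n I g) T"
      by (auto intro: cumulative_dim_mono)
    finally show ?thesis using C[of T] C'[of T] by (simp add: distrib_right)
  qed
  then show ?thesis unfolding growth_at_most_def by blast
qed

text \<open>Subadditivity with \<open>J = I\<close> bounds the increase from \<open>T - \<delta>\<close> to \<open>T\<close> by the growth of \<open>S/(I + (f))\<close>;
  summing raises the exponent by one.\<close>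

lemma growth_adjoin_form:
  assumes I: "homogeneous_ideal n I" and f: "f \<in> forms n (int \<delta>)" and \<delta>: "\<delta> \<ge> 1"
    and gf: "growth_at_most n (adjoin n I f) e"
  shows "growth_at_most n I (Suc e)"
proof -
  obtain C where C: "\<And>T. cumulative_dim n (adjoin n I f) T \<le> C * (T + 1) ^ e"
    using gf by (auto simp: growth_at_most_def)
  have mult: "f * q \<in> I" if "q \<in> I" for q
    using that f homogeneous_idealD(4)[OF I] by (simp add: forms_def)
  have "cumulative_dim n I T \<le> C * (T + 1) ^ Suc e" for T
  proof (induction T rule: less_induct)
    case (less T)
    have "cumulative_dim n I T \<le>
        (if \<delta> \<le> T then cumulative_dim n I (T - \<delta>) else 0) + cumulative_dim n (adjoin n I f) T"
      by (rule cumulative_dim_subadditive[OF I homogeneous_idealD(2)[OF I] mult f])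
    also have "(if \<delta> \<le> T then cumulative_dim n I (T - \<delta>) else 0) \<le> C * (T * (T + 1) ^ e)"
    proof (cases "\<delta> \<le> T")
      case True
      then have "cumulative_dim n I (T - \<delta>) \<le> C * ((T - \<delta> + 1) * (T - \<delta> + 1) ^ e)"
        using less.IH[of "T - \<delta>"] \<delta> by simp
      also have "\<dots> \<le> C * (T * (T + 1) ^ e)"
        using \<delta> True by (intro mult_left_mono mult_mono power_mono) auto
      finally show ?thesis using True by simp
    qed simp
    also have "cumulative_dim n (adjoin n I f) T \<le> C * (T + 1) ^ e" by (rule C)
    finally show ?case by (simp add: algebra_simps)
  qed
  then show ?thesis unfolding growth_at_most_def by blast
qed

lemma growth_trivial:
  assumes "0 \<in> I" and pos: "\<And>\<delta> f. \<delta> \<ge> 1 \<Longrightarrow> f \<in> forms n (int \<delta>) \<Longrightarrow> f \<in> I"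
  shows "growth_at_most n I e"
proof -
  have "quotient_dim n I (int t) \<le> 0" if "t \<ge> 1" for t
    by (rule quotient_dim_le[of _ _ _ _ "\<lambda>_. 0"]) (use pos that in \<open>auto simp: spans_mod_def\<close>)
  then have "cumulative_dim n I T = (\<Sum>t\<in>{0}. quotient_dim n I (int t))" for T
    unfolding cumulative_dim_def by (intro sum.mono_neutral_right) (auto simp: Suc_le_eq)
  then have "growth_at_most n I 0" unfolding growth_at_most_def by auto
  then show ?thesis by (rule growth_mono) simp
qed

subsection \<open>Prime ideals of maximal growth\<close>

lemma homogeneous_ideal_eqI:
  assumes I: "homogeneous_ideal n I" and J: "homogeneous_ideal n J"
    and le: "\<And>p a. p \<in> I \<Longrightarrow> homogeneous_of_degree a p \<Longrightarrow> p \<in> J"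
  shows "I \<subseteq> J"
proof
  fix p :: "'a mpol" assume p: "p \<in> I"
  let ?A = "(\<lambda>u. int (exp_degree u)) ` supp p"
  have "(\<Sum>a\<in>?A. hom_part a p) \<in> J"
    by (rule homogeneous_ideal_sum[OF J], rule le[OF homogeneous_idealD(5)[OF I p] homogeneous_hom_part])
  then show "p \<in> J" by (simp add: sum_hom_parts)
qed

text \<open>The union of a chain of homogeneous ideals is reached by a member, which is the member that
  contains the finitely many generators of the union.\<close>

lemma homogeneous_ideal_chain:
  assumes ne: "\<C> \<noteq> {}" and chain: "\<And>I J. I \<in> \<C> \<Longrightarrow> J \<in> \<C> \<Longrightarrow> I \<subseteq> J \<or> J \<subseteq> I"
    and hom: "\<And>I. I \<in> \<C> \<Longrightarrow> homogeneous_ideal n (I :: 'k::field mpol set)"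
  shows "\<Union>\<C> \<in> \<C>"
proof -
  have pair: "\<exists>I\<in>\<C>. p \<in> I \<and> q \<in> I" if "p \<in> \<Union>\<C>" "q \<in> \<Union>\<C>" for p q
    using that chain by blast
  have U: "homogeneous_ideal n (\<Union>\<C>)"
    unfolding homogeneous_ideal_def
  proof (intro conjI ballI allI)
    show "\<Union>\<C> \<subseteq> pols n" using homogeneous_idealD(1)[OF hom] by blast
    show "0 \<in> \<Union>\<C>" using ne homogeneous_idealD(2)[OF hom] by blast
    show "p + q \<in> \<Union>\<C>" if "p \<in> \<Union>\<C>" "q \<in> \<Union>\<C>" for p q
      using pair[OF that] homogeneous_idealD(3)[OF hom] by blast
    show "c * p \<in> \<Union>\<C>" if "p \<in> \<Union>\<C>" "c \<in> pols n" for p c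
      using that homogeneous_idealD(4)[OF hom] by blast
    show "hom_part a p \<in> \<Union>\<C>" if "p \<in> \<Union>\<C>" for p a
      using that homogeneous_idealD(5)[OF hom] by blast
  qed
  define H where "H d = {p \<in> \<Union>\<C>. homogeneous_of_degree d p}" for d
  have "homogeneous_ideal_family n H"
    unfolding homogeneous_ideal_family_def H_def
    using homogeneous_idealD[OF U] by (auto intro: homogeneous_diff homogeneous_mult)
  from homogeneous_ideal_finitely_generated[OF this] obtain m b q where mbq:
    "(\<forall>k<m::nat. q k \<in> H (b k)) \<and>
     (\<forall>d. \<forall>p\<in>H d. \<exists>c. (\<forall>k<m. c k \<in> pols n \<and> homogeneous_of_degree (d - b k) (c k)) \<and>
       p = (\<Sum>k<m. c k * q k))"
    by (elim exE) (rule that)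
  have "\<exists>I\<in>\<C>. \<forall>k<m'. q k \<in> I" if "m' \<le> m" for m'
    using that
  proof (induction m')
    case 0
    then show ?case using ne by blast
  next
    case (Suc m')
    then obtain I where I: "I \<in> \<C>" "\<forall>k<m'. q k \<in> I" by auto
    have "q m' \<in> \<Union>\<C>" using mbq Suc.prems by (auto simp: H_def)
    then obtain J where J: "J \<in> \<C>" "q m' \<in> J" by blast
    show ?case
    proof (cases "I \<subseteq> J")
      case True
      then show ?thesis using I J by (intro bexI[of _ J]) (auto simp: less_Suc_eq)
    next
      case False
      then have "J \<subseteq> I" using chain I J by blast
      then show ?thesis using I J by (intro bexI[of _ I]) (auto simp: less_Suc_eq)
    qed
  qed
  then obtain I where I: "I \<in> \<C>" "\<And>k. k < m \<Longrightarrow> q k \<in> I" by blast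
  have "\<Union>\<C> \<subseteq> I"
  proof (rule homogeneous_ideal_eqI[OF U hom[OF I(1)]])
    fix p a assume "p \<in> \<Union>\<C>" "homogeneous_of_degree a p"
    then have "p \<in> H a" by (simp add: H_def)
    then obtain c where c: "\<And>k. k < m \<Longrightarrow> c k \<in> pols n" "p = (\<Sum>k<m. c k * q k)" using mbq by blast
    show "p \<in> I"
      unfolding c(2)
      by (rule homogeneous_ideal_sum[OF hom[OF I(1)]])
         (use c(1) I(2) homogeneous_idealD(4)[OF hom[OF I(1)]] in auto)
  qed
  then have "\<Union>\<C> = I" using I(1) by blast
  then show ?thesis using I(1) by simp
qed

text \<open>Primality can be tested on homogeneous elements.\<close>

lemma homogeneous_prime:
  assumes P: "homogeneous_ideal n P" and one: "1 \<notin> P"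
    and prime: "\<And>a b f g. f \<in> pols n \<Longrightarrow> g \<in> pols n \<Longrightarrow> homogeneous_of_degree a f \<Longrightarrow>
      homogeneous_of_degree b g \<Longrightarrow> f * g \<in> P \<Longrightarrow> f \<in> P \<or> g \<in> P"
  shows "primeideal P (mpoly_ring n)"
proof -
  interpret R: cring "mpoly_ring n :: 'a mpol ring" by (rule mpoly_cring)
  have "subgroup P (add_monoid (mpoly_ring n))"
  proof (rule R.add.subgroupI)
    show "P \<subseteq> carrier (mpoly_ring n)" using homogeneous_idealD(1)[OF P] by (auto simp: carrier_mpoly_ring)
    show "P \<noteq> {}" using homogeneous_idealD(2)[OF P] by blast
    fix p assume p: "p \<in> P"
    have "\<ominus>\<^bsub>mpoly_ring n\<^esub> p = - p"
      by (rule R.minus_equality)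
         (use p homogeneous_idealD(1)[OF P] in \<open>auto simp: carrier_mpoly_ring\<close>)
    then show "\<ominus>\<^bsub>mpoly_ring n\<^esub> p \<in> P" using homogeneous_idealD(6)[OF P p] by simp
    show "p \<oplus>\<^bsub>mpoly_ring n\<^esub> q \<in> P" if "q \<in> P" for q using homogeneous_idealD(3)[OF P p that] by simp
  qed
  then have ideal: "ideal P (mpoly_ring n)"
  proof (rule idealI[OF R.ring_axioms])
    fix a x assume "a \<in> P" "x \<in> carrier (mpoly_ring n :: 'a mpol ring)"
    then have "x * a \<in> P" using homogeneous_idealD(4)[OF P] by (simp add: carrier_mpoly_ring)
    then show "x \<otimes>\<^bsub>mpoly_ring n\<^esub> a \<in> P" "a \<otimes>\<^bsub>mpoly_ring n\<^esub> x \<in> P" by (simp_all add: mult.commute)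
  qed
  text \<open>The top degree parts outside \<open>P\<close> of two elements outside \<open>P\<close> have a product outside \<open>P\<close>.\<close>
  have "p \<in> P \<or> q \<in> P" if p: "p \<in> pols n" and q: "q \<in> pols n" and pq: "p * q \<in> P" for p q :: "'a mpol"
  proof (rule ccontr)
    assume neg: "\<not> (p \<in> P \<or> q \<in> P)"
    have top: "\<exists>i. hom_part i r \<notin> P \<and> (\<forall>k>i. hom_part k r \<in> P)" if r: "r \<in> pols n" "r \<notin> P" for r :: "'a mpol"
    proof -
      let ?A = "(\<lambda>u. int (exp_degree u)) ` supp r"
      let ?B = "{a \<in> ?A. hom_part a r \<notin> P}"
      have out: "hom_part a r = 0" if "a \<notin> ?A" for a
        by (rule poly_mapping_eqI) (use that in \<open>auto simp: coef_hom_part in_keys_iff\<close>)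
      have "?B \<noteq> {}"
      proof
        assume "?B = {}"
        then have "(\<Sum>a\<in>?A. hom_part a r) \<in> P" by (intro homogeneous_ideal_sum[OF P]) blast
        then show False using r(2) by (simp add: sum_hom_parts)
      qed
      then have "Max ?B \<in> ?B" by (intro Max_in) auto
      moreover have "hom_part k r \<in> P" if "k > Max ?B" for k
      proof (rule ccontr)
        assume "hom_part k r \<notin> P"
        moreover from this have "k \<in> ?A" using out[of k] homogeneous_idealD(2)[OF P] by fastforce
        ultimately have "k \<le> Max ?B" by (intro Max_ge) auto
        then show False using that by simp
      qed
      ultimately show ?thesis by blast
    qed
    obtain i where i: "hom_part i p \<notin> P" "\<And>k. k > i \<Longrightarrow> hom_part k p \<in> P" using top[OF p] neg by blast
    obtain j where j: "hom_part j q \<notin> P" "\<And>k. k > j \<Longrightarrow> hom_part k q \<in> P" using top[OF q] neg by blast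
    let ?A = "insert i ((\<lambda>u. int (exp_degree u)) ` supp p)"
    have "hom_part (i + j) (p * q) = (\<Sum>k\<in>?A. hom_part k p * hom_part (i + j - k) q)"
    proof -
      have "p * q = (\<Sum>k\<in>?A. hom_part k p * q)"
        by (subst sum_distrib_right[symmetric], subst sum_hom_parts) auto
      then show ?thesis
        by (simp only: hom_part_sum) (simp add: hom_part_mult[OF homogeneous_hom_part])
    qed
    also have "\<dots> = hom_part i p * hom_part j q + (\<Sum>k\<in>?A - {i}. hom_part k p * hom_part (i + j - k) q)"
      by (subst sum.remove[of _ i]) auto
    finally have "hom_part i p * hom_part j q =
        hom_part (i + j) (p * q) - (\<Sum>k\<in>?A - {i}. hom_part k p * hom_part (i + j - k) q)" by simp
    moreover have "(\<Sum>k\<in>?A - {i}. hom_part k p * hom_part (i + j - k) q) \<in> P"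
    proof (rule homogeneous_ideal_sum[OF P])
      fix k assume "k \<in> ?A - {i}"
      then consider "k > i" | "i + j - k > j" by fastforce
      then show "hom_part k p * hom_part (i + j - k) q \<in> P"
      proof cases
        case 1
        then have "hom_part (i + j - k) q * hom_part k p \<in> P"
          using i(2) q by (intro homogeneous_idealD(4)[OF P]) auto
        then show ?thesis by (simp only: mult.commute)
      next
        case 2
        then show ?thesis using j(2) p by (intro homogeneous_idealD(4)[OF P]) auto
      qed
    qed
    ultimately have "hom_part i p * hom_part j q \<in> P"
      by (simp only:) (intro homogeneous_idealD(7)[OF P] homogeneous_idealD(5)[OF P pq])
    then show False
      using prime[OF hom_part_pols[OF p] hom_part_pols[OF q] homogeneous_hom_part homogeneous_hom_part] i(1) j(1)
      by blast
  qed
  then show ?thesis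
    by (intro primeidealI[OF ideal mpoly_cring])
       (use one in \<open>auto simp: carrier_mpoly_ring\<close>)
qed

lemma irrelevant_ideal_prime: "primeideal (irrelevant_ideal n) (mpoly_ring n :: 'k::field mpol ring)"
proof (rule homogeneous_prime)
  have "const_coeff (hom_part a p) = 0" if "const_coeff p = 0" for a and p :: "'k mpol"
    using that by (simp add: const_coeff_def coef_hom_part)
  then show "homogeneous_ideal n (irrelevant_ideal n :: 'k mpol set)"
    by (auto simp: homogeneous_ideal_def irrelevant_ideal_def carrier_mpoly_ring)
qed (auto simp: irrelevant_ideal_def carrier_mpoly_ring)

text \<open>Among the homogeneous ideals above \<open>I\<close> of large growth, a maximal one is prime: if \<open>f g \<in> P\<close>,
  then \<open>P\<close> grows at most like \<open>P + (f)\<close> and \<open>P + (g)\<close> together.\<close>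

lemma prime_of_large_growth:
  assumes I: "homogeneous_ideal n (I :: 'k::field mpol set)" and large: "\<not> growth_at_most n I e"
  shows "\<exists>P. homogeneous_ideal n P \<and> I \<subseteq> P \<and> \<not> growth_at_most n P e \<and> 1 \<notin> P \<and>
    primeideal P (mpoly_ring n)"
proof -
  define \<A> where "\<A> = {J. homogeneous_ideal n J \<and> I \<subseteq> J \<and> \<not> growth_at_most n J e}"
  have "\<exists>P\<in>\<A>. \<forall>J\<in>\<A>. P \<subseteq> J \<longrightarrow> J = P"
  proof (rule subset_Zorn_nonempty)
    show "\<A> \<noteq> {}" using I large by (auto simp: \<A>_def)
    fix \<C> assume "\<C> \<noteq> {}" and \<C>: "subset.chain \<A> \<C>"
    have "\<Union>\<C> \<in> \<C>"
      by (rule homogeneous_ideal_chain[OF \<open>\<C> \<noteq> {}\<close>, of n])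
         (use \<C> in \<open>auto simp: subset_chain_def \<A>_def\<close>)
    then show "\<Union>\<C> \<in> \<A>" using \<C> by (auto simp: subset_chain_def)
  qed
  then obtain P where P: "homogeneous_ideal n P" "I \<subseteq> P" "\<not> growth_at_most n P e"
    and maximal: "\<forall>J\<in>\<A>. P \<subseteq> J \<longrightarrow> J = P"
    unfolding \<A>_def by blast
  have max: "growth_at_most n J e" if "homogeneous_ideal n J" "P \<subset> J" for J
  proof (rule ccontr)
    assume "\<not> growth_at_most n J e"
    then have "J \<in> \<A>" using that P(2) by (simp add: \<A>_def order.strict_iff_order order.trans[of I P J])
    then show False using maximal that(2) by blast
  qed
  have one: "1 \<notin> P"
  proof
    assume "1 \<in> P"
    then have "c \<in> P" if "c \<in> pols n" for c using homogeneous_idealD(4)[OF P(1), of 1 c] that by simp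
    then show False using P(3) growth_trivial[of P n e] homogeneous_idealD(2)[OF P(1)]
      by (auto simp: forms_def)
  qed
  have "f \<in> P \<or> g \<in> P" if fg: "f \<in> pols n" "g \<in> pols n" "homogeneous_of_degree a f"
    "homogeneous_of_degree b g" "f * g \<in> P" for a b f g
  proof (rule ccontr)
    assume neg: "\<not> (f \<in> P \<or> g \<in> P)"
    then have "f \<noteq> 0" using homogeneous_idealD(2)[OF P(1)] by auto
    then have "\<not> a < 0" using homogeneous_negative fg(3) by blast
    then have f: "f \<in> forms n (int (nat a))" using fg by (simp add: forms_def)
    have "growth_at_most n (adjoin n P f) e"
      by (rule max[OF adjoin_homogeneous_ideal[OF P(1) fg(1,3)]])
         (use adjoin_subset[of P n f] adjoin_mem[OF homogeneous_idealD(2)[OF P(1)], of f n] neg in blast)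
    moreover have "growth_at_most n (adjoin n P g) e"
      by (rule max[OF adjoin_homogeneous_ideal[OF P(1) fg(2,4)]])
         (use adjoin_subset[of P n g] adjoin_mem[OF homogeneous_idealD(2)[OF P(1)], of g n] neg in blast)
    ultimately show False using growth_product[OF P(1) f fg(2,5)] P(3) by blast
  qed
  then have "primeideal P (mpoly_ring n)" by (rule homogeneous_prime[OF P(1) one])
  then show ?thesis using P one by blast
qed

text \<open>A form \<open>f\<close> of positive degree outside a prime \<open>P\<close> lowers the growth exponent of \<open>S/P\<close> by at most
  one, so that a chain of primes above \<open>P + (f)\<close> can be extended by \<open>P\<close>.\<close>

lemma prime_chain_of_large_growth:
  "homogeneous_ideal n (I :: 'k::field mpol set) \<Longrightarrow> \<not> growth_at_most n I e \<Longrightarrow>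
    \<exists>P. (\<forall>i\<le>Suc e. primeideal (P i) (mpoly_ring n) \<and> I \<subseteq> P i) \<and> (\<forall>i<Suc e. P i \<subset> P (Suc i))"
proof (induction e arbitrary: I)
  case 0
  from prime_of_large_growth[OF 0] obtain P where P: "homogeneous_ideal n P" "I \<subseteq> P"
    "\<not> growth_at_most n P 0" "1 \<notin> P" "primeideal P (mpoly_ring n)"
    by (elim exE conjE) (rule that)
  obtain \<delta> f where f: "\<delta> \<ge> 1" "f \<in> forms n (int \<delta>)" "f \<notin> P"
    using growth_trivial[OF homogeneous_idealD(2)[OF P(1)]] P(3) by blast
  have "P \<subseteq> irrelevant_ideal n"
  proof
    fix p assume p: "p \<in> P"
    have "const_coeff p = 0"
    proof (rule ccontr)
      assume c: "const_coeff p \<noteq> 0"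
      have "hom_part 0 p = const_pol (const_coeff (hom_part 0 p))"
        by (rule homogeneous_degree_0) simp
      also have "const_coeff (hom_part 0 p) = const_coeff p" by (simp add: const_coeff_def coef_hom_part)
      finally have "const_pol (const_coeff p) \<in> P" using homogeneous_idealD(5)[OF P(1) p, of 0] by simp
      then have "const_pol (inverse (const_coeff p)) * const_pol (const_coeff p) \<in> P"
        by (rule homogeneous_idealD(4)[OF P(1)]) simp
      then show False using P(4) c by (simp add: const_pol_mult[symmetric])
    qed
    then show "p \<in> irrelevant_ideal n"
      using homogeneous_idealD(1)[OF P(1) p] by (simp add: irrelevant_ideal_def carrier_mpoly_ring)
  qed
  moreover have "f \<in> irrelevant_ideal n"
    using f homogeneous_const_coeff[of "int \<delta>" f]
    by (simp add: forms_def irrelevant_ideal_def carrier_mpoly_ring)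
  ultimately have "P \<subset> irrelevant_ideal n" using f(3) by blast
  then show ?case
    using P(2,5) irrelevant_ideal_prime
    by (intro exI[of _ "\<lambda>i. if i = 0 then P else irrelevant_ideal n"]) auto
next
  case (Suc e)
  from prime_of_large_growth[OF Suc.prems] obtain P where P: "homogeneous_ideal n P" "I \<subseteq> P"
    "\<not> growth_at_most n P (Suc e)" "1 \<notin> P" "primeideal P (mpoly_ring n)"
    by (elim exE conjE) (rule that)
  obtain \<delta> f where f: "\<delta> \<ge> 1" "f \<in> forms n (int \<delta>)" "f \<notin> P"
    using growth_trivial[OF homogeneous_idealD(2)[OF P(1)]] P(3) by blast
  have hI: "homogeneous_ideal n (adjoin n P f)"
    using f(2) by (auto simp: forms_def intro: adjoin_homogeneous_ideal[OF P(1)])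
  have "\<not> growth_at_most n (adjoin n P f) e"
    using growth_adjoin_form[OF P(1) f(2,1)] P(3) by blast
  from Suc.IH[OF hI this] obtain Q where Q:
    "\<And>i. i \<le> Suc e \<Longrightarrow> primeideal (Q i) (mpoly_ring n) \<and> adjoin n P f \<subseteq> Q i"
    "\<And>i. i < Suc e \<Longrightarrow> Q i \<subset> Q (Suc i)" by blast
  have PQ: "P \<subset> Q i" if "i \<le> Suc e" for i
    using Q(1)[OF that] adjoin_subset[of P n f] adjoin_mem[OF homogeneous_idealD(2)[OF P(1)], of f n] f(3)
    by blast
  show ?case
  proof (intro exI[of _ "\<lambda>i. case i of 0 \<Rightarrow> P | Suc i' \<Rightarrow> Q i'"] conjI allI impI)
    fix i assume i: "i \<le> Suc (Suc e)"
    show "primeideal (case i of 0 \<Rightarrow> P | Suc i' \<Rightarrow> Q i') (mpoly_ring n)"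
      using P(5) Q(1) i by (cases i) auto
    show "I \<subseteq> (case i of 0 \<Rightarrow> P | Suc i' \<Rightarrow> Q i')"
    proof (cases i)
      case (Suc i')
      then show ?thesis using PQ[of i'] P(2) i by auto
    qed (use P(2) in simp)
  next
    fix i assume i: "i < Suc (Suc e)"
    show "(case i of 0 \<Rightarrow> P | Suc i' \<Rightarrow> Q i') \<subset> (case Suc i of 0 \<Rightarrow> P | Suc i' \<Rightarrow> Q i')"
      using PQ Q(2) i by (cases i) auto
  qed
qed

context graded_mod
begin

lemma annihilator_homogeneous: "homogeneous_ideal n (annihilator (mpoly_ring n) N)"
proof -
  have hom: "hom_part b p \<odot>\<^bsub>N\<^esub> x = \<zero>\<^bsub>N\<^esub>"
    if p: "p \<in> pols n" "\<And>x. x \<in> carrier N \<Longrightarrow> p \<odot>\<^bsub>N\<^esub> x = \<zero>\<^bsub>N\<^esub>" and x: "x \<in> G j" for p b x j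
  proof -
    have v: "(\<lambda>l. if l = 0 then p else 0) \<in> vecs n {..<Suc 0}" using p by (auto simp: vecs_def)
    have "aug (Suc 0) (\<lambda>_. x) (\<lambda>l. if l = 0 then p else 0) = p \<odot>\<^bsub>N\<^esub> x"
      using act_closed[OF p(1) G_carrier[OF x]] by (simp add: aug_def lessThan_Suc)
    then have "aug (Suc 0) (\<lambda>_. x) (hvec (\<lambda>_. j) (b + j) (\<lambda>l. if l = 0 then p else 0)) = \<zero>\<^bsub>N\<^esub>"
      by (intro aug_hvec_zero[OF _ v]) (use x p(2) G_carrier[OF x] in auto)
    then show ?thesis
      using act_closed[OF hom_part_pols[OF p(1)] G_carrier[OF x]] by (simp add: aug_def hvec_def lessThan_Suc)
  qed
  have "hom_part b p \<odot>\<^bsub>N\<^esub> x = \<zero>\<^bsub>N\<^esub>"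
    if p: "p \<in> pols n" "\<And>x. x \<in> carrier N \<Longrightarrow> p \<odot>\<^bsub>N\<^esub> x = \<zero>\<^bsub>N\<^esub>" and x: "x \<in> carrier N" for p b x
  proof -
    obtain c where c: "\<And>j. c j \<in> G j" "finite {j. c j \<noteq> \<zero>\<^bsub>N\<^esub>}" "x = finsum N c {j. c j \<noteq> \<zero>\<^bsub>N\<^esub>}"
      using graded x unfolding graded_module_def by blast
    have "hom_part b p \<odot>\<^bsub>N\<^esub> x = finsum N (\<lambda>j. hom_part b p \<odot>\<^bsub>N\<^esub> c j) {j. c j \<noteq> \<zero>\<^bsub>N\<^esub>}"
      unfolding c(3) by (rule N.finsum_smult_ldistr)
        (use c(1,2) G_carrier hom_part_pols[OF p(1)] in \<open>auto simp: carrier_mpoly_ring\<close>)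
    also have "\<dots> = finsum N (\<lambda>j. \<zero>\<^bsub>N\<^esub>) {j. c j \<noteq> \<zero>\<^bsub>N\<^esub>}"
      by (rule N.finsum_cong') (use hom[OF p c(1)] in auto)
    finally show ?thesis by simp
  qed
  then show ?thesis
    by (auto simp: homogeneous_ideal_def annihilator_def carrier_mpoly_ring act_zero_left act_add_left
        act_mult act_zero_right)
qed

text \<open>If the growth were larger, there would be a chain of \<open>d + 2\<close> primes above the annihilator.\<close>

lemma growth_annihilator:
  assumes "module_dim (mpoly_ring n) N = enat d"
  shows "growth_at_most n (annihilator (mpoly_ring n) N) d"
proof (rule ccontr)
  assume "\<not> ?thesis"
  from prime_chain_of_large_growth[OF annihilator_homogeneous this] obtain P where
    "(\<forall>i\<le>Suc d. primeideal (P i) (mpoly_ring n) \<and> annihilator (mpoly_ring n) N \<subseteq> P i) \<and>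
     (\<forall>i<Suc d. P i \<subset> P (Suc i))" by blast
  then have "enat (Suc d) \<le> module_dim (mpoly_ring n) N"
    unfolding module_dim_def by (intro Sup_upper) blast
  then show False using assms by simp
qed

end

section \<open>The minimal part of a resolution\<close>

locale graded_resolution = graded_mod n N G
  for n :: nat and N :: "('k::field mpol, 'm) module" and G :: "int \<Rightarrow> 'm set" +
  fixes r :: "nat \<Rightarrow> nat" and a :: "nat \<Rightarrow> nat \<Rightarrow> int" and A :: "nat \<Rightarrow> nat \<Rightarrow> nat \<Rightarrow> 'k mpol"
    and g :: "nat \<Rightarrow> 'm"
  assumes A: "\<And>i. graded_matrix n (r i) (a i) (r (Suc i)) (a (Suc i)) (A i)"
    and kernel: "\<And>i. {v \<in> vecs n {..<r (Suc i)}. mmul (r i) (r (Suc i)) (A i) v = 0} =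
      mmul (r (Suc i)) (r (Suc (Suc i))) (A (Suc i)) ` vecs n {..<r (Suc (Suc i))}"
    and g: "\<And>k. k < r 0 \<Longrightarrow> g k \<in> G (a 0 k)"
    and aug_surj: "aug (r 0) g ` vecs n {..<r 0} = carrier N"
    and aug_ker: "{v \<in> vecs n {..<r 0}. aug (r 0) g v = \<zero>\<^bsub>N\<^esub>} = mmul (r 0) (r 1) (A 0) ` vecs n {..<r 1}"
begin

abbreviation F :: "nat \<Rightarrow> (nat \<Rightarrow> 'k mpol) set" where "F i \<equiv> vecs n {..<r i}"
abbreviation D :: "nat \<Rightarrow> (nat \<Rightarrow> 'k mpol) \<Rightarrow> nat \<Rightarrow> 'k mpol" where
  "D i \<equiv> mmul (r i) (r (Suc i)) (A i)"
abbreviation X :: "nat \<Rightarrow> int \<Rightarrow> nat set" where "X i j \<equiv> tor_index r a i j"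

lemma g_carrier: "k < r 0 \<Longrightarrow> g k \<in> carrier N"
  using g G_carrier by blast

lemma aug0_closed: "v \<in> vecs n J \<Longrightarrow> aug (r 0) g v \<in> carrier N"
  and aug0_add: "v \<in> vecs n J \<Longrightarrow> w \<in> vecs n J \<Longrightarrow>
    aug (r 0) g (v + w) = aug (r 0) g v \<oplus>\<^bsub>N\<^esub> aug (r 0) g w"
  and aug0_smul: "p \<in> pols n \<Longrightarrow> v \<in> vecs n J \<Longrightarrow>
    aug (r 0) g (smul p v) = p \<odot>\<^bsub>N\<^esub> aug (r 0) g v"
  and aug0_eq_imp_diff_zero: "v \<in> vecs n J \<Longrightarrow> w \<in> vecs n J \<Longrightarrow>
    aug (r 0) g v = aug (r 0) g w \<Longrightarrow> aug (r 0) g (v - w) = \<zero>\<^bsub>N\<^esub>"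
  by ((rule aug_closed aug_add aug_smul aug_eq_imp_diff_zero, rule g_carrier, assumption+)+)

lemma aug0_sum: "finite T \<Longrightarrow> (\<And>t. t \<in> T \<Longrightarrow> f t \<in> vecs n J) \<Longrightarrow>
    aug (r 0) g (sum f T) = finsum N (\<lambda>t. aug (r 0) g (f t)) T"
  by (rule aug_sum, rule g_carrier, assumption+)

lemma DD_zero: "v \<in> F (Suc (Suc i)) \<Longrightarrow> D i (D (Suc i) v) = 0"
proof -
  assume "v \<in> F (Suc (Suc i))"
  then have "D (Suc i) v \<in> {v \<in> F (Suc i). D i v = 0}" unfolding kernel by blast
  then show ?thesis by simp
qed

lemma D_exact: "v \<in> F (Suc i) \<Longrightarrow> D i v = 0 \<Longrightarrow> \<exists>w\<in>F (Suc (Suc i)). D (Suc i) w = v"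
proof -
  assume "v \<in> F (Suc i)" "D i v = 0"
  then have "v \<in> D (Suc i) ` F (Suc (Suc i))" unfolding kernel[symmetric] by blast
  then show ?thesis by blast
qed

lemma resolution: "free_resolution n (\<lambda>i. {..<r i}) D"
  by unfold_locales (use mmul_vecs[OF A] DD_zero D_exact in \<open>auto simp: mmul_add mmul_smul\<close>)

lemma seq_submodule_snoc:
  assumes gs: "set gs \<subseteq> pols n" and f: "f \<in> pols n"
  shows "seq_submodule N (gs @ [f]) =
    {x \<oplus>\<^bsub>N\<^esub> f \<odot>\<^bsub>N\<^esub> y | x y. x \<in> seq_submodule N gs \<and> y \<in> carrier N}"
proof -
  let ?m = "length gs"
  have gk: "gs ! k \<in> pols n" if "k < ?m" for k using gs that by (meson nth_mem subsetD)
  have split: "finsum N (\<lambda>k. (gs @ [f]) ! k \<odot>\<^bsub>N\<^esub> y k) {..<Suc ?m} =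
      finsum N (\<lambda>k. gs ! k \<odot>\<^bsub>N\<^esub> y k) {..<?m} \<oplus>\<^bsub>N\<^esub> f \<odot>\<^bsub>N\<^esub> y ?m"
    if y: "y \<in> {..<Suc ?m} \<rightarrow> carrier N" for y
  proof -
    have yk: "y k \<in> carrier N" if "k \<le> ?m" for k using y that by auto
    have fy: "f \<odot>\<^bsub>N\<^esub> y ?m \<in> carrier N" by (rule act_closed[OF f yk]) simp
    have gy: "gs ! k \<odot>\<^bsub>N\<^esub> y k \<in> carrier N" if "k < ?m" for k
      by (rule act_closed[OF gk[OF that] yk]) (use that in simp)
    have "finsum N (\<lambda>k. (gs @ [f]) ! k \<odot>\<^bsub>N\<^esub> y k) {..<Suc ?m} =
        f \<odot>\<^bsub>N\<^esub> y ?m \<oplus>\<^bsub>N\<^esub> finsum N (\<lambda>k. (gs @ [f]) ! k \<odot>\<^bsub>N\<^esub> y k) {..<?m}"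
      unfolding lessThan_Suc using gy fy by (subst N.finsum_insert) (auto simp: nth_append)
    also have "finsum N (\<lambda>k. (gs @ [f]) ! k \<odot>\<^bsub>N\<^esub> y k) {..<?m} = finsum N (\<lambda>k. gs ! k \<odot>\<^bsub>N\<^esub> y k) {..<?m}"
      by (rule N.finsum_cong') (use gy in \<open>auto simp: nth_append\<close>)
    finally show ?thesis using gy fy by (simp add: N.a_comm)
  qed
  show ?thesis
  proof (intro Set.equalityI subsetI)
    fix x assume "x \<in> seq_submodule N (gs @ [f])"
    then obtain y where y: "y \<in> {..<Suc ?m} \<rightarrow> carrier N"
      "x = finsum N (\<lambda>k. (gs @ [f]) ! k \<odot>\<^bsub>N\<^esub> y k) {..<Suc ?m}" by (auto simp: seq_submodule_def)
    have "finsum N (\<lambda>k. gs ! k \<odot>\<^bsub>N\<^esub> y k) {..<?m} \<in> seq_submodule N gs"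
      using y(1) unfolding seq_submodule_def by (intro CollectI exI[of _ y]) auto
    then show "x \<in> {x \<oplus>\<^bsub>N\<^esub> f \<odot>\<^bsub>N\<^esub> y | x y. x \<in> seq_submodule N gs \<and> y \<in> carrier N}"
      unfolding y(2) split[OF y(1)] using y(1) by blast
  next
    fix x assume "x \<in> {x \<oplus>\<^bsub>N\<^esub> f \<odot>\<^bsub>N\<^esub> y | x y. x \<in> seq_submodule N gs \<and> y \<in> carrier N}"
    then obtain y z where y: "y \<in> {..<?m} \<rightarrow> carrier N" and z: "z \<in> carrier N"
      and x: "x = finsum N (\<lambda>k. gs ! k \<odot>\<^bsub>N\<^esub> y k) {..<?m} \<oplus>\<^bsub>N\<^esub> f \<odot>\<^bsub>N\<^esub> z"
      by (auto simp: seq_submodule_def)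
    define w where "w k = (if k < ?m then y k else z)" for k
    have w: "w \<in> {..<Suc ?m} \<rightarrow> carrier N" using y z by (auto simp: w_def)
    have "finsum N (\<lambda>k. gs ! k \<odot>\<^bsub>N\<^esub> w k) {..<?m} = finsum N (\<lambda>k. gs ! k \<odot>\<^bsub>N\<^esub> y k) {..<?m}"
      by (rule N.finsum_cong') (use y gk act_closed in \<open>auto simp: w_def\<close>)
    then have "x = finsum N (\<lambda>k. (gs @ [f]) ! k \<odot>\<^bsub>N\<^esub> w k) {..<Suc ?m}"
      unfolding split[OF w] x by (simp add: w_def)
    then show "x \<in> seq_submodule N (gs @ [f])"
      unfolding seq_submodule_def using w by (intro CollectI exI[of _ w]) auto
  qed
qed

definition regular_steps :: "'k mpol list \<Rightarrow> bool" where
  "regular_steps fs \<longleftrightarrow> (\<forall>i<length fs. \<forall>x \<in> carrier N.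
     fs ! i \<odot>\<^bsub>N\<^esub> x \<in> seq_submodule N (take i fs) \<longrightarrow> x \<in> seq_submodule N (take i fs))"

text \<open>The submodules \<open>(f\<^sub>1, \<dots>, f\<^sub>i) N\<close> are pulled back to \<open>F\<^sub>0\<close> along the augmentation.\<close>

lemma weakly_regular_pullback:
  "set (gs @ fs) \<subseteq> pols n \<Longrightarrow> regular_steps (gs @ fs) \<Longrightarrow>
    weakly_regular n {..<r 0} {v \<in> F 0. aug (r 0) g v \<in> seq_submodule N gs} fs"
proof (induction fs arbitrary: gs)
  case (Cons f fs)
  let ?B = "{v \<in> F 0. aug (r 0) g v \<in> seq_submodule N gs}"
  have f: "f \<in> pols n" and gs: "set gs \<subseteq> pols n" using Cons.prems(1) by auto
  have reg: "x \<in> seq_submodule N gs" if "x \<in> carrier N" "f \<odot>\<^bsub>N\<^esub> x \<in> seq_submodule N gs" for x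
    using Cons.prems(2)[unfolded regular_steps_def, rule_format, of "length gs" x] that by simp
  have ac: "aug (r 0) g v \<in> carrier N" if "v \<in> F 0" for v using that by (rule aug0_closed)
  have step: "{b + smul f v | b v. b \<in> ?B \<and> v \<in> F 0} =
      {v \<in> F 0. aug (r 0) g v \<in> seq_submodule N (gs @ [f])}"
  proof (intro Set.equalityI subsetI)
    fix x assume "x \<in> {b + smul f v | b v. b \<in> ?B \<and> v \<in> F 0}"
    then obtain b v where x: "x = b + smul f v" and b: "b \<in> F 0" "aug (r 0) g b \<in> seq_submodule N gs"
      and v: "v \<in> F 0" by blast
    have "aug (r 0) g x = aug (r 0) g b \<oplus>\<^bsub>N\<^esub> f \<odot>\<^bsub>N\<^esub> aug (r 0) g v"
      unfolding x using aug0_add[OF b(1) vecs_smul[OF f v]] aug0_smul[OF f v] by simp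
    then show "x \<in> {v \<in> F 0. aug (r 0) g v \<in> seq_submodule N (gs @ [f])}"
      unfolding seq_submodule_snoc[OF gs f] using b v f ac[OF v] x by blast
  next
    fix x assume "x \<in> {v \<in> F 0. aug (r 0) g v \<in> seq_submodule N (gs @ [f])}"
    then obtain y z where x: "x \<in> F 0" and xyz: "aug (r 0) g x = y \<oplus>\<^bsub>N\<^esub> f \<odot>\<^bsub>N\<^esub> z"
      and y: "y \<in> seq_submodule N gs" and z: "z \<in> carrier N" unfolding seq_submodule_snoc[OF gs f] by blast
    obtain w where w: "w \<in> F 0" "z = aug (r 0) g w" using z aug_surj by blast
    have fw: "smul f w \<in> F 0" using f w by blast
    have d: "x - smul f w \<in> F 0" using x fw by blast
    have yc: "y \<in> carrier N"
      using y gs act_closed unfolding seq_submodule_def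
      by (auto intro!: N.finsum_closed) (meson PiE lessThan_iff nth_mem subsetD)
    have "aug (r 0) g (x - smul f w) \<oplus>\<^bsub>N\<^esub> f \<odot>\<^bsub>N\<^esub> z = aug (r 0) g ((x - smul f w) + smul f w)"
      using aug0_add[OF d fw] aug0_smul[OF f w(1)] w(2) by simp
    then have "aug (r 0) g (x - smul f w) \<oplus>\<^bsub>N\<^esub> f \<odot>\<^bsub>N\<^esub> z = y \<oplus>\<^bsub>N\<^esub> f \<odot>\<^bsub>N\<^esub> z"
      using xyz by simp
    then have "aug (r 0) g (x - smul f w) = y"
      by (subst (asm) N.add.right_cancel) (use ac[OF d] yc act_closed[OF f z] in auto)
    then show "x \<in> {b + smul f v | b v. b \<in> ?B \<and> v \<in> F 0}"
      using d y w(1) by (intro CollectI exI[of _ "x - smul f w"] exI[of _ w]) auto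
  qed
  have "weakly_regular n {..<r 0} {v \<in> F 0. aug (r 0) g v \<in> seq_submodule N (gs @ [f])} fs"
    using Cons.IH[of "gs @ [f]"] Cons.prems by simp
  moreover have "v \<in> ?B" if v: "v \<in> F 0" "smul f v \<in> ?B" for v
    using v reg[OF ac[OF v(1)]] aug0_smul[OF f v(1)] by simp
  ultimately show ?case unfolding weakly_regular.simps step by blast
qed simp

lemma regular_sequence_of_depth:
  assumes "depth I N = enat e"
  shows "\<exists>fs. length fs = e \<and> set fs \<subseteq> I \<and> regular_steps fs"
proof (cases "e = 0")
  case True
  then show ?thesis by (intro exI[of _ "[]"]) (simp add: regular_steps_def)
next
  case False
  let ?S = "{enat (length fs) | fs. set fs \<subseteq> I \<and> regular_sequence N fs}"
  have "Sup ?S = enat e" using assms by (simp add: depth_def)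
  then have ne: "?S \<noteq> {}" and fin: "finite ?S" and m: "Max ?S = enat e"
    using False by (auto simp: Sup_enat_def zero_enat_def split: if_splits)
  have "enat e \<in> ?S" using Max_in[OF fin ne] unfolding m .
  then show ?thesis by (auto simp: regular_sequence_def regular_steps_def)
qed

text \<open>A regular sequence that attains the depth is pulled back to \<open>F\<^sub>0\<close>.\<close>

lemma exact_modulo_variables_of_depth:
  assumes depth: "depth (irrelevant_ideal n) N = enat e" and i: "n \<le> i + e"
    and v: "v \<in> F (Suc i)" "D i v \<in> xvecs n n {..<r i}"
  shows "\<exists>w\<in>F (Suc (Suc i)). v - D (Suc i) w \<in> xvecs n n {..<r (Suc i)}"
proof -
  obtain fs where fs: "length fs = e" "set fs \<subseteq> irrelevant_ideal n" "regular_steps fs"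
    using regular_sequence_of_depth[OF depth] by blast
  have fs': "set fs \<subseteq> pols n" "\<And>f. f \<in> set fs \<Longrightarrow> const_coeff f = 0"
    using fs(2) by (auto simp: irrelevant_ideal_def carrier_mpoly_ring)
  have "weakly_regular n {..<r 0} {v \<in> F 0. aug (r 0) g v \<in> seq_submodule N []} fs"
    by (rule weakly_regular_pullback) (use fs fs' in auto)
  also have "seq_submodule N [] = {\<zero>\<^bsub>N\<^esub>}" by (auto simp: seq_submodule_def)
  finally have "weakly_regular n {..<r 0} (D 0 ` vecs n {..<r 1}) fs" using aug_ker by simp
  then show ?thesis
    by (rule regular_sequence_exactness[OF resolution _ fs'(1)]) (use fs' i fs(1) v in auto)
qed

end

subsection \<open>Tor in a fixed degree\<close>

definition lift :: "nat set \<Rightarrow> (nat \<Rightarrow> 'k::field) \<Rightarrow> nat \<Rightarrow> 'k mpol" where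
  "lift X c = (\<lambda>l. if l \<in> X then const_pol (c l) else 0)"

lemma lift_vecs: "X \<subseteq> J \<Longrightarrow> lift X c \<in> vecs n J"
  by (auto simp: lift_def vecs_def)

lemma const_coeff_lift [simp]: "const_coeff (lift X c l) = (if l \<in> X then c l else 0)"
  by (simp add: lift_def)

context graded_resolution
begin

lemma X_subset: "X i j \<subseteq> {..<r i}" and X_finite [simp]: "finite (X i j)"
  by (auto simp: tor_index_def)

text \<open>By homogeneity a matrix entry between basis elements of distinct degrees has no constant
  coefficient.\<close>

lemma const_coeff_D:
  assumes k: "k < r i"
  shows "const_coeff (D i v k) = (\<Sum>l\<in>X (Suc i) (a i k). const_coeff (A i k l) * const_coeff (v l))"
proof -
  have "const_coeff (A i k l) = 0" if "l < r (Suc i)" "a (Suc i) l \<noteq> a i k" for l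
    using A[of i] k that homogeneous_const_coeff[of "a (Suc i) l - a i k" "A i k l"]
    by (auto simp: graded_matrix_def)
  then have "(\<Sum>l<r (Suc i). const_coeff (A i k l) * const_coeff (v l)) =
      (\<Sum>l\<in>X (Suc i) (a i k). const_coeff (A i k l) * const_coeff (v l))"
    by (intro sum.mono_neutral_right) (auto simp: tor_index_def)
  then show ?thesis using k by (simp add: mmul_def)
qed

lemma tor_diff_eq:
  assumes k: "k \<in> X i j" and c: "\<And>l. l \<in> X (Suc i) j \<Longrightarrow> const_coeff (v l) = c l"
  shows "tor_diff r a A i j c k = const_coeff (D i v k)"
proof -
  have k': "k < r i" "a i k = j" using k by (auto simp: tor_index_def)
  show ?thesis using k c unfolding const_coeff_D[OF k'(1)] k'(2) by (simp add: tor_diff_def mat_map_def)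
qed

lemma tor_diff_cycle_lift:
  assumes c: "\<And>k. k \<in> X i j \<Longrightarrow> tor_diff r a A i j c k = 0"
  shows "D i (lift (X (Suc i) j) c) \<in> xvecs n n {..<r i}"
proof -
  have "const_coeff (D i (lift (X (Suc i) j) c) k) = 0" for k
  proof (cases "k < r i")
    case True
    show ?thesis
    proof (cases "a i k = j")
      case j: True
      then have "k \<in> X i j" using True by (simp add: tor_index_def)
      then show ?thesis using c tor_diff_eq[of k i j "lift (X (Suc i) j) c" c] by simp
    next
      case False
      then show ?thesis unfolding const_coeff_D[OF True]
        by (intro sum.neutral) (auto simp: tor_index_def)
    qed
  qed (simp add: mmul_def)
  moreover have "D i (lift (X (Suc i) j) c) \<in> F i" by (rule mmul_vecs[OF A lift_vecs[OF X_subset]])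
  ultimately show ?thesis by (simp add: xvecs_all)
qed

lemma tor_diff_tor_diff:
  "tor_diff r a A i j (tor_diff r a A (Suc i) j c) = (\<lambda>k\<in>X i j. 0)"
proof
  fix k
  show "tor_diff r a A i j (tor_diff r a A (Suc i) j c) k = (\<lambda>k\<in>X i j. 0) k"
  proof (cases "k \<in> X i j")
    case True
    let ?v = "lift (X (Suc (Suc i)) j) c"
    have "tor_diff r a A i j (tor_diff r a A (Suc i) j c) k = const_coeff (D i (D (Suc i) ?v) k)"
      by (rule tor_diff_eq[OF True], rule tor_diff_eq[symmetric]) auto
    then show ?thesis using True DD_zero[OF lift_vecs[OF X_subset]] by (simp add: zero_fun_apply)
  qed (simp add: tor_diff_def mat_map_def)
qed

lemma tor_diff_funcset: "tor_diff r a A i j c \<in> X i j \<rightarrow>\<^sub>E UNIV"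
  by (auto simp: tor_diff_def mat_map_def)

text \<open>A cycle is lifted to a vector of constants. By exactness modulo the variables it is a boundary up to a
  vector without constant coefficients.\<close>

lemma tor_dim_above_depth:
  assumes depth: "depth (irrelevant_ideal n) N = enat e" and i: "n \<le> i + e"
  shows "tor_dim r a A (Suc i) j = 0"
proof -
  have "tor_cycles r a A (Suc i) j = tor_boundaries r a A (Suc i) j"
  proof (intro Set.equalityI subsetI)
    fix c assume "c \<in> tor_cycles r a A (Suc i) j"
    then have c: "c \<in> X (Suc i) j \<rightarrow>\<^sub>E UNIV" "tor_diff r a A i j c = (\<lambda>k\<in>X i j. 0)"
      by (auto simp: tor_cycles_def tor_chains_def fspace_simps)
    let ?v = "lift (X (Suc i) j) c"
    have "D i ?v \<in> xvecs n n {..<r i}" by (rule tor_diff_cycle_lift) (simp add: c(2))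
    then obtain w where w: "?v - D (Suc i) w \<in> xvecs n n {..<r (Suc i)}"
      using exact_modulo_variables_of_depth[OF depth i lift_vecs[OF X_subset]] by blast
    let ?d = "\<lambda>l\<in>X (Suc (Suc i)) j. const_coeff (w l)"
    have "c k = tor_diff r a A (Suc i) j ?d k" if k: "k \<in> X (Suc i) j" for k
    proof -
      have "const_coeff ((?v - D (Suc i) w) k) = 0" using w by (simp add: xvecs_all)
      then have "c k = const_coeff (D (Suc i) w k)" using k by (simp add: minus_apply)
      also have "\<dots> = tor_diff r a A (Suc i) j ?d k" by (rule tor_diff_eq[OF k, symmetric]) simp
      finally show ?thesis .
    qed
    then have "c = tor_diff r a A (Suc i) j ?d"
      by (intro PiE_ext[OF c(1) tor_diff_funcset]) simp
    moreover have "?d \<in> X (Suc (Suc i)) j \<rightarrow>\<^sub>E UNIV" by auto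
    ultimately show "c \<in> tor_boundaries r a A (Suc i) j"
      unfolding tor_boundaries_def tor_chains_def fspace_simps by blast
  next
    fix c assume "c \<in> tor_boundaries r a A (Suc i) j"
    then obtain d where "c = tor_diff r a A (Suc i) j d" by (auto simp: tor_boundaries_def)
    then show "c \<in> tor_cycles r a A (Suc i) j"
      using tor_diff_tor_diff tor_diff_funcset by (simp add: tor_cycles_def tor_chains_def fspace_simps)
  qed
  then show ?thesis by (simp add: tor_dim_def)
qed

definition tor_rank :: "nat \<Rightarrow> int \<Rightarrow> nat" where
  "tor_rank i j = vectorspace.dim class_ring
     (fspace (X i j)\<lparr>carrier := tor_diff r a A i j ` carrier (fspace (X (Suc i) j))\<rparr>)"

lemma tor_rank_nullity:
  "tor_rank i j + vectorspace.dim class_ring (fspace (X (Suc i) j)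
     \<lparr>carrier := {v \<in> carrier (fspace (X (Suc i) j)). tor_diff r a A i j v = \<zero>\<^bsub>fspace (X i j)\<^esub>}\<rparr>) =
   card (X (Suc i) j)"
  unfolding tor_rank_def tor_diff_def by (rule mat_map_rank_nullity) simp

text \<open>In each position the two ranks and the Betti number add up to the number of basis elements of
  degree \<open>j\<close>.\<close>

lemma tor_dim_Suc: "tor_dim r a A (Suc i) j + tor_rank (Suc i) j + tor_rank i j = card (X (Suc i) j)"
proof -
  have "tor_rank (Suc i) j \<le> vectorspace.dim class_ring (fspace (X (Suc i) j)
     \<lparr>carrier := {v \<in> carrier (fspace (X (Suc i) j)). tor_diff r a A i j v = \<zero>\<^bsub>fspace (X i j)\<^esub>}\<rparr>)"
    unfolding tor_rank_def tor_diff_def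
    by (rule image_dim_le_kernel_dim)
       (use tor_diff_tor_diff in \<open>auto simp: tor_diff_def fspace_simps\<close>)
  then show ?thesis
    using tor_rank_nullity[of i j]
    by (simp add: tor_dim_def tor_cycles_def tor_boundaries_def tor_chains_def tor_rank_def)
qed

lemma tor_dim_0: "tor_dim r a A 0 j + tor_rank 0 j = card (X 0 j)"
proof -
  interpret B: linear_map class_ring "fspace (X (Suc 0) j)" "fspace (X 0 j)" "tor_diff r a A 0 j"
    unfolding tor_diff_def by (rule mat_map_linear)
  have "VectorSpace.subspace class_ring (tor_diff r a A 0 j ` carrier (fspace (X (Suc 0) j))) (fspace (X 0 j))"
    using B.imT_is_subspace by (simp add: B.im_def)
  from subspace_dim_le[OF fspace_vectorspace fspace_dim(1)[OF X_finite] this]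
  have "tor_rank 0 j \<le> card (X 0 j)" by (simp add: tor_rank_def fspace_dim(2))
  then show ?thesis
    by (simp add: tor_dim_def tor_cycles_def tor_boundaries_def tor_chains_def tor_rank_def fspace_dim(2))
qed

lemma tor_dim_le: "tor_dim r a A i j \<le> card (X i j)"
proof (cases i)
  case (Suc i')
  then show ?thesis using tor_dim_Suc[of i' j] by simp
qed (use tor_dim_0[of j] in simp)

text \<open>All ranks but the last cancel, since each occurs in two neighbouring positions.\<close>

lemma tor_alternating:
  "(\<Sum>i\<le>s. (-1) ^ i * int (tor_dim r a A i j)) =
    (\<Sum>i\<le>s. (-1) ^ i * int (card (X i j))) - (-1) ^ s * int (tor_rank s j)"
proof (induction s)
  case 0
  then show ?case using tor_dim_0[of j] by simp
next
  case (Suc s)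
  have "int (tor_dim r a A (Suc s) j) = int (card (X (Suc s) j)) - int (tor_rank (Suc s) j) - int (tor_rank s j)"
    using tor_dim_Suc[of s j] by linarith
  then show ?case unfolding sum.atMost_Suc Suc.IH by (simp add: right_diff_distrib)
qed

text \<open>The homogeneous parts of a preimage are separated by treating \<open>x\<close> as an additional generator.\<close>

lemma aug_surj_homogeneous:
  assumes x: "x \<in> G t"
  shows "\<exists>u\<in>gvecs n {..<r 0} (a 0) t. aug (r 0) g u = x"
proof -
  have xc: "x \<in> carrier N" using x by (rule G_carrier)
  have "x \<in> aug (r 0) g ` F 0" unfolding aug_surj by (rule xc)
  then obtain u where u: "u \<in> F 0" "aug (r 0) g u = x" by blast
  define g' where "g' k = (if k < r 0 then g k else x)" for k
  define a' where "a' k = (if k < r 0 then a 0 k else t)" for k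
  define v where "v = (\<lambda>k. if k < r 0 then u k else if k = r 0 then - 1 else 0)"
  have m1: "- 1 \<in> pols n" by (rule pols_uminus) simp
  have v: "v \<in> vecs n {..<Suc (r 0)}" using u(1) m1 by (auto simp: v_def vecs_def)
  have split: "aug (Suc (r 0)) g' w = (- 1) \<odot>\<^bsub>N\<^esub> x \<oplus>\<^bsub>N\<^esub> aug (r 0) g w'"
    if w: "\<And>k. k < r 0 \<Longrightarrow> w k = w' k" "w (r 0) = - 1" and w': "w' \<in> F 0" for w w'
  proof -
    have act: "w' k \<odot>\<^bsub>N\<^esub> g k \<in> carrier N" if "k < r 0" for k
      by (rule act_closed[OF _ G_carrier[OF g[OF that]]]) (use w' in \<open>simp add: vecs_def\<close>)
    have "finsum N (\<lambda>k. w k \<odot>\<^bsub>N\<^esub> g' k) (insert (r 0) {..<r 0}) =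
        w (r 0) \<odot>\<^bsub>N\<^esub> g' (r 0) \<oplus>\<^bsub>N\<^esub> finsum N (\<lambda>k. w k \<odot>\<^bsub>N\<^esub> g' k) {..<r 0}"
      by (rule N.finsum_insert) (use w act act_closed[OF m1 xc] in \<open>auto simp: g'_def\<close>)
    also have "finsum N (\<lambda>k. w k \<odot>\<^bsub>N\<^esub> g' k) {..<r 0} = finsum N (\<lambda>k. w' k \<odot>\<^bsub>N\<^esub> g k) {..<r 0}"
      by (rule N.finsum_cong') (use w act in \<open>auto simp: g'_def\<close>)
    finally show ?thesis using w(2) by (simp add: aug_def g'_def lessThan_Suc)
  qed
  have hu: "hvec (a 0) t u \<in> gvecs n {..<r 0} (a 0) t" by (rule hvec_gvecs[OF u(1)])
  have agc: "aug (r 0) g (hvec (a 0) t u) \<in> carrier N" by (rule aug0_closed[OF gvecs_vecs[OF hu]])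
  have "(1 + - 1) \<odot>\<^bsub>N\<^esub> x = 1 \<odot>\<^bsub>N\<^esub> x \<oplus>\<^bsub>N\<^esub> (- 1) \<odot>\<^bsub>N\<^esub> x"
    by (rule act_add_left[OF pols_one m1 xc])
  then have neg: "x \<oplus>\<^bsub>N\<^esub> (- 1) \<odot>\<^bsub>N\<^esub> x = \<zero>\<^bsub>N\<^esub>" by (simp add: act_one[OF xc] act_zero_left[OF xc])
  have "aug (Suc (r 0)) g' v = (- 1) \<odot>\<^bsub>N\<^esub> x \<oplus>\<^bsub>N\<^esub> aug (r 0) g u"
    by (rule split) (use u in \<open>auto simp: v_def\<close>)
  also have "\<dots> = \<zero>\<^bsub>N\<^esub>" using neg u(2) xc act_closed[OF m1 xc] by (simp add: N.a_comm)
  finally have "aug (Suc (r 0)) g' (hvec a' t v) = \<zero>\<^bsub>N\<^esub>"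
    by (intro aug_hvec_zero[OF _ v]) (use g x in \<open>auto simp: g'_def a'_def less_Suc_eq\<close>)
  moreover have "aug (Suc (r 0)) g' (hvec a' t v) =
      (- 1) \<odot>\<^bsub>N\<^esub> x \<oplus>\<^bsub>N\<^esub> aug (r 0) g (hvec (a 0) t u)"
    by (rule split)
       (use gvecs_vecs[OF hu] hom_part_homogeneous[OF homogeneous_uminus[OF homogeneous_one], of 0]
         in \<open>auto simp: hvec_def v_def a'_def\<close>)
  ultimately have z: "(- 1) \<odot>\<^bsub>N\<^esub> x \<oplus>\<^bsub>N\<^esub> aug (r 0) g (hvec (a 0) t u) = \<zero>\<^bsub>N\<^esub>" by simp
  have "aug (r 0) g (hvec (a 0) t u) = (x \<oplus>\<^bsub>N\<^esub> (- 1) \<odot>\<^bsub>N\<^esub> x) \<oplus>\<^bsub>N\<^esub> aug (r 0) g (hvec (a 0) t u)"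
    using neg agc by simp
  also have "\<dots> = x" using z xc agc act_closed[OF m1 xc] by (simp add: N.a_assoc)
  finally show ?thesis using hu by blast
qed

text \<open>A generator of degree \<open>j \<noteq> 0\<close> of \<open>F\<^sub>0\<close> agrees, modulo the kernel of the augmentation, with a vector
  that comes from generators of degree 0 and has no constant coefficients in degree \<open>j\<close>.\<close>

lemma tor_dim_0_generated:
  assumes fg: "finitely_generated (mpoly_ring n) N" and g0: "generated_in_degree n N G 0" and j: "j \<noteq> 0"
  shows "tor_dim r a A 0 j = 0"
proof -
  obtain r' h where h: "\<And>k. k < r' \<Longrightarrow> h k \<in> G 0" "aug r' h ` vecs n {..<r'} = carrier N"
    using degree_0_generators[OF fg g0] by blast
  have "\<exists>u\<in>gvecs n {..<r 0} (a 0) 0. aug (r 0) g u = h k" if "k < r'" for k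
    by (rule aug_surj_homogeneous[OF h(1)[OF that]])
  then obtain u where u: "\<And>k. k < r' \<Longrightarrow> u k \<in> gvecs n {..<r 0} (a 0) 0 \<and> aug (r 0) g (u k) = h k"
    by metis
  have "tor_cycles r a A 0 j = tor_boundaries r a A 0 j"
  proof (intro Set.equalityI subsetI)
    fix c assume "c \<in> tor_cycles r a A 0 j"
    then have c: "c \<in> X 0 j \<rightarrow>\<^sub>E UNIV" by (auto simp: tor_cycles_def tor_chains_def fspace_simps)
    let ?v = "lift (X 0 j) c"
    have v: "?v \<in> F 0" by (rule lift_vecs[OF X_subset])
    have "aug (r 0) g ?v \<in> aug r' h ` vecs n {..<r'}" unfolding h(2) by (rule aug0_closed[OF v])
    then obtain p where p: "p \<in> vecs n {..<r'}" "aug (r 0) g ?v = aug r' h p" by blast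
    have pk: "p k \<in> pols n" for k using p(1) by (simp add: vecs_def)
    have uF: "u k \<in> F 0" if "k < r'" for k using u[OF that] gvecs_vecs by blast
    let ?w = "\<Sum>k<r'. smul (p k) (u k)"
    have w: "?w \<in> F 0" using uF pk by (intro vecs_sum) auto
    have "aug (r 0) g ?w = finsum N (\<lambda>k. aug (r 0) g (smul (p k) (u k))) {..<r'}"
      by (rule aug0_sum) (use uF pk in auto)
    also have "\<dots> = aug r' h p"
      unfolding aug_def[of r' h p]
    proof (rule N.finsum_cong')
      show "aug (r 0) g (smul (p k) (u k)) = p k \<odot>\<^bsub>N\<^esub> h k" if "k \<in> {..<r'}" for k
        using aug0_smul[OF pk uF, of k k] u[of k] that by simp
    qed (use pk act_closed G_carrier[OF h(1)] in auto)
    finally have "aug (r 0) g (?v - ?w) = \<zero>\<^bsub>N\<^esub>" using aug0_eq_imp_diff_zero[OF v w] p(2) by simp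
    then have "?v - ?w \<in> D 0 ` vecs n {..<r 1}" unfolding One_nat_def[symmetric] aug_ker[symmetric] using v w by blast
    then obtain z where z: "?v - ?w = D 0 z" by blast
    have "c k = tor_diff r a A 0 j (\<lambda>l\<in>X 1 j. const_coeff (z l)) k" if k: "k \<in> X 0 j" for k
    proof -
      have "const_coeff (u l k) = 0" if "l < r'" for l
        using u[OF that] k j homogeneous_const_coeff[of "0 - a 0 k" "u l k"]
        by (auto simp: gvecs_def tor_index_def)
      then have "const_coeff (?w k) = 0" by (simp add: sum_vecs_apply smul_def)
      then have "c k = const_coeff ((?v - ?w) k)" using k by (simp add: minus_apply)
      also have "\<dots> = tor_diff r a A 0 j (\<lambda>l\<in>X 1 j. const_coeff (z l)) k"
        unfolding z by (rule tor_diff_eq[OF k, symmetric]) simp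
      finally show ?thesis .
    qed
    then have "c = tor_diff r a A 0 j (\<lambda>l\<in>X 1 j. const_coeff (z l))"
      by (intro PiE_ext[OF c tor_diff_funcset]) simp
    moreover have "(\<lambda>l\<in>X 1 j. const_coeff (z l)) \<in> X 1 j \<rightarrow>\<^sub>E UNIV" by auto
    ultimately show "c \<in> tor_boundaries r a A 0 j"
      unfolding tor_boundaries_def tor_chains_def fspace_simps One_nat_def by blast
  next
    fix c assume "c \<in> tor_boundaries r a A 0 j"
    then show "c \<in> tor_cycles r a A 0 j"
      using tor_diff_funcset by (auto simp: tor_cycles_def tor_boundaries_def tor_chains_def fspace_simps)
  qed
  then show ?thesis by (simp add: tor_dim_def)
qed

end

section \<open>The last syzygy module is free\<close>

lemma xvecs_hvec: "v \<in> xvecs n k J \<Longrightarrow> hvec a t v \<in> xvecs n k J"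
proof -
  assume v: "v \<in> xvecs n k J"
  then have "hvec a t v \<in> vecs n J" using gvecs_vecs[OF hvec_gvecs] xvecs_vecs by blast
  then show ?thesis
    using v by (auto simp: xvecs_def xpols_def hvec_def hom_part_def supp_restrict_supp)
qed

lemma hvec_smul:
  assumes "homogeneous_of_degree e p"
  shows "hvec a t (smul p v) = smul p (hvec a (t - e) v)"
proof
  fix l
  have "t - a l - e = t - e - a l" by simp
  then show "hvec a t (smul p v) l = smul p (hvec a (t - e) v) l"
    by (simp only: hvec_def smul_def hom_part_mult[OF assms])
qed

lemma coef_mult_lowest:
  assumes low: "\<And>u'. exp_degree u' < exp_degree u \<Longrightarrow> coef q u' = 0"
  shows "coef (p * q) u = const_coeff p * coef q u"
proof -
  let ?r = "p - const_pol (const_coeff p)"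
  have "coef (?r * q) u = 0"
  proof (rule ccontr)
    assume "coef (?r * q) u \<noteq> 0"
    then have "u \<in> supp (?r * q)" by (simp add: in_keys_iff)
    then obtain x y where xy: "x \<in> supp ?r" "y \<in> supp q" "u = x + y" using keys_mult[of ?r q] by blast
    have "coef ?r 0 = 0" unfolding const_coeff_def[symmetric] by simp
    then have "x \<noteq> 0" using xy(1) by (metis in_keys_iff)
    then have "exp_degree x \<noteq> 0" by simp
    then have "exp_degree y < exp_degree u" unfolding xy(3) exp_degree_add by linarith
    then show False using low xy(2) by (simp add: in_keys_iff)
  qed
  moreover have "p * q = const_pol (const_coeff p) * q + ?r * q" by (simp add: algebra_simps)
  ultimately show ?thesis by (metis add.right_neutral coef_const_mult lookup_add)
qed

lemma gvecs_const_coeff: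
  assumes "v \<in> gvecs n J a t" "a l \<noteq> t" shows "const_coeff (v l) = 0"
  using assms homogeneous_const_coeff[of "t - a l" "v l"] by (simp add: gvecs_def)

lemma lift_gvecs:
  assumes "Y \<subseteq> J" "\<And>l. l \<in> Y \<Longrightarrow> a l = t" shows "lift Y c \<in> gvecs n J a t"
  using lift_vecs[OF assms(1), of c n] assms(2) by (auto simp: gvecs_def lift_def)

lemma gvecs_mono: "v \<in> gvecs n J a t \<Longrightarrow> J \<subseteq> J' \<Longrightarrow> v \<in> gvecs n J' a t"
  by (auto simp: gvecs_def vecs_def)

lemma gvecs_below:
  assumes v: "v \<in> gvecs n J a t" and t: "\<And>l. l \<in> J \<Longrightarrow> t < a l"
  shows "v = 0"
proof
  fix l
  have "v l = 0" if "l \<in> J"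
    by (rule homogeneous_negative[of "t - a l"]) (use v t[OF that] in \<open>auto simp: gvecs_def\<close>)
  then show "v l = 0 l" using v by (cases "l \<in> J") (auto simp: gvecs_def vecs_def zero_fun_apply)
qed

context graded_resolution
begin

lemma const_coeff_A:
  "k < r i \<Longrightarrow> l < r (Suc i) \<Longrightarrow> a (Suc i) l \<noteq> a i k \<Longrightarrow> const_coeff (A i k l) = 0"
  using A[of i] homogeneous_const_coeff[of "a (Suc i) l - a i k" "A i k l"]
  by (auto simp: graded_matrix_def)

text \<open>Vectors on an independent set of columns of the constant part of the matrix: if one of them is
  in the kernel of \<open>D\<close>, then so is, for \<open>u\<close> of lowest degree, its vector of coefficients of \<open>x\<^sup>u\<close>,
  because only constant coefficients of the matrix contribute.\<close>

lemma independent_columns_injective: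
  assumes L: "L \<subseteq> {..<r (Suc i)}"
    and indep: "\<And>j c. (\<And>k. k \<in> X i j \<Longrightarrow> (\<Sum>x\<in>L \<inter> X (Suc i) j. const_coeff (A i k x) * c x) = 0) \<Longrightarrow>
      (\<And>x. x \<in> L \<inter> X (Suc i) j \<Longrightarrow> c x = 0)"
    and v: "v \<in> vecs n L" "D i v = 0"
  shows "v = 0"
proof (rule ccontr)
  assume "v \<noteq> 0"
  then obtain l0 where "v l0 \<noteq> 0" by (auto simp: fun_eq_iff zero_fun_apply)
  then obtain u0 where "coef (v l0) u0 \<noteq> 0" by (metis poly_mapping_eqI lookup_zero)
  then have ex: "\<exists>m l u. exp_degree u = m \<and> coef (v l) u \<noteq> 0" by blast
  define m where "m = (LEAST m. \<exists>l u. exp_degree u = m \<and> coef (v l) u \<noteq> 0)"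
  obtain l u where u: "exp_degree u = m" "coef (v l) u \<noteq> 0" using LeastI_ex[OF ex] unfolding m_def by blast
  have low: "coef (v l') u' = 0" if "exp_degree u' < exp_degree u" for l' u'
    using not_less_Least[of "exp_degree u'"] that unfolding u(1) m_def by blast
  have lL: "l \<in> L" using v(1) u(2) by (auto simp: vecs_def)
  let ?j = "a (Suc i) l"
  have "(\<Sum>x\<in>L \<inter> X (Suc i) ?j. const_coeff (A i k x) * coef (v x) u) = 0" if k: "k \<in> X i ?j" for k
  proof -
    have k': "k < r i" "a i k = ?j" using k by (auto simp: tor_index_def)
    have "0 = coef (D i v k) u" using v(2) by (simp add: zero_fun_apply)
    also have "\<dots> = (\<Sum>x<r (Suc i). const_coeff (A i k x) * coef (v x) u)"
      using k' by (simp add: mmul_def lookup_sum coef_mult_lowest[OF low])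
    also have "\<dots> = (\<Sum>x\<in>L \<inter> X (Suc i) ?j. const_coeff (A i k x) * coef (v x) u)"
      by (rule sum.mono_neutral_right)
         (use v(1) L k' const_coeff_A[OF k'(1)] in \<open>auto simp: vecs_def tor_index_def\<close>)
    finally show ?thesis by simp
  qed
  from indep[of ?j "\<lambda>x. coef (v x) u" l, OF this] show False
    using lL L u(2) by (auto simp: tor_index_def)
qed

text \<open>Nakayama: modulo the image of the columns in \<open>L\<close>, a vector of degree \<open>t\<close> can be changed into
  one without constant coefficients, whose coefficients of the variables have degree \<open>t - 1\<close>.\<close>

lemma spanning_columns_surjective:
  assumes L: "L \<subseteq> {..<r (Suc i)}"
    and span: "\<And>j x. x \<in> X (Suc i) j \<Longrightarrow> \<exists>c. \<forall>k\<in>X i j.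
      const_coeff (A i k x) = (\<Sum>y\<in>L \<inter> X (Suc i) j. const_coeff (A i k y) * c y)"
    and exact: "\<And>v. v \<in> F (Suc i) \<Longrightarrow> D i v \<in> xvecs n n {..<r i} \<Longrightarrow>
      \<exists>w\<in>F (Suc (Suc i)). v - D (Suc i) w \<in> xvecs n n {..<r (Suc i)}"
  shows "\<forall>v\<in>gvecs n {..<r (Suc i)} (a (Suc i)) t. \<exists>w\<in>gvecs n L (a (Suc i)) t. D i v = D i w"
proof -
  let ?a = "a (Suc i)" and ?R = "{..<r (Suc i)}"
  define B where "B = Min (insert 0 (?a ` ?R))"
  \<comment> \<open>The \<open>+ 1\<close> in the measure makes it decrease also from \<open>t = B\<close> to the trivial case \<open>t = B - 1\<close>.\<close>
  have B: "B \<le> ?a l" if "l < r (Suc i)" for l unfolding B_def using that by (intro Min_le) auto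
  show ?thesis
  proof (induction t rule: measure_induct_rule[where f = "\<lambda>t. nat (t - B + 1)"])
    case (less t)
    show ?case
    proof (cases "t < B")
      case True
      have "v = 0" if "v \<in> gvecs n ?R ?a t" for v :: "nat \<Rightarrow> 'k mpol"
        by (rule gvecs_below[OF that]) (use B True in fastforce)
      then show ?thesis by (metis gvecs_zero)
    next
      case False
      then have IH: "\<exists>w\<in>gvecs n L ?a (t - 1). D i v = D i w" if "v \<in> gvecs n ?R ?a (t - 1)" for v
        using less[of "t - 1"] that by auto
      have inner: "k \<le> n \<Longrightarrow> y \<in> gvecs n ?R ?a t \<Longrightarrow> y \<in> xvecs n k ?R \<Longrightarrow>
          \<exists>w\<in>gvecs n L ?a t. D i y = D i w" for k y
      proof (induction k arbitrary: y)
        case 0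
        then show ?case by (intro bexI[of _ 0]) (auto simp: xvecs_0)
      next
        case (Suc k)
        then have k: "k < n" by simp
        obtain x z where xz: "x \<in> xvecs n k ?R" "z \<in> vecs n ?R" "y = x + smul (var k) z"
          by (rule xvecs_split[OF Suc.prems(3) k])
        have hv: "homogeneous_of_degree 1 (var k :: 'k mpol)"
          using homogeneous_monom[of "monom_of k (Suc 0)" "1 :: 'k"] by simp
        have "y = hvec ?a t y" using hvec_homogeneous[OF Suc.prems(2), of t] by simp
        then have y: "y = hvec ?a t x + smul (var k) (hvec ?a (t - 1) z)"
          unfolding xz(3) hvec_add hvec_smul[OF hv] .
        obtain w1 where w1: "w1 \<in> gvecs n L ?a t" "D i (hvec ?a t x) = D i w1"
          using Suc.IH[of "hvec ?a t x"] k xvecs_hvec[OF xz(1)] hvec_gvecs[OF xvecs_vecs[OF xz(1)]] by auto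
        obtain w2 where w2: "w2 \<in> gvecs n L ?a (t - 1)" "D i (hvec ?a (t - 1) z) = D i w2"
          using IH[OF hvec_gvecs[OF xz(2)]] by blast
        have "smul (var k) w2 \<in> gvecs n L ?a (1 + (t - 1))"
          by (rule gvecs_smul[OF w2(1) var_pols[OF k] hv])
        then have "w1 + smul (var k) w2 \<in> gvecs n L ?a t" using gvecs_add[OF w1(1)] by simp
        moreover have "D i y = D i (w1 + smul (var k) w2)"
          by (subst y) (simp only: mmul_add mmul_smul w1(2) w2(2))
        ultimately show ?case by blast
      qed
      show ?thesis
      proof
        fix v :: "nat \<Rightarrow> 'k mpol" assume v: "v \<in> gvecs n ?R ?a t"
        let ?Y = "L \<inter> X (Suc i) t"
        have "\<forall>x\<in>X (Suc i) t. \<exists>c. \<forall>k\<in>X i t. const_coeff (A i k x) = (\<Sum>y\<in>?Y. const_coeff (A i k y) * c y)"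
          using span by blast
        from bchoice[OF this] obtain c where c: "\<And>x k. x \<in> X (Suc i) t \<Longrightarrow> k \<in> X i t \<Longrightarrow>
            const_coeff (A i k x) = (\<Sum>y\<in>?Y. const_coeff (A i k y) * c x y)"
          by blast
        define d where "d y = (\<Sum>x\<in>X (Suc i) t. const_coeff (v x) * c x y)" for y
        let ?l = "lift ?Y d"
        have lL: "?l \<in> gvecs n L ?a t" by (rule lift_gvecs) (auto simp: tor_index_def)
        have l: "?l \<in> gvecs n ?R ?a t" by (rule gvecs_mono[OF lL L])
        have vl: "v - ?l \<in> gvecs n ?R ?a t" by (rule gvecs_diff[OF v l])
        have "const_coeff (D i (v - ?l) k) = 0" for k
        proof (cases "k < r i")
          case k: True
          show ?thesis
          proof (cases "a i k = t")
            case True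
            then have kX: "k \<in> X i t" using k by (simp add: tor_index_def)
            have "(\<Sum>x\<in>X (Suc i) t. const_coeff (A i k x) * const_coeff (v x)) =
                (\<Sum>x\<in>X (Suc i) t. \<Sum>y\<in>?Y. const_coeff (A i k y) * c x y * const_coeff (v x))"
              by (rule sum.cong[OF refl]) (subst c[OF _ kX], assumption, rule sum_distrib_right)
            also have "\<dots> = (\<Sum>y\<in>?Y. \<Sum>x\<in>X (Suc i) t. const_coeff (A i k y) * c x y * const_coeff (v x))"
              by (rule sum.swap)
            also have "\<dots> = (\<Sum>y\<in>?Y. const_coeff (A i k y) * d y)"
              by (simp add: d_def sum_distrib_left mult.assoc mult.commute mult.left_commute)
            also have "\<dots> = (\<Sum>x\<in>X (Suc i) t. const_coeff (A i k x) * const_coeff (?l x))"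
              by (rule sum.mono_neutral_cong_left) auto
            finally show ?thesis
              unfolding const_coeff_D[OF k] True
              by (simp only: minus_apply const_coeff_diff right_diff_distrib sum_subtractf) simp
          next
            case False
            have "const_coeff ((v - ?l) x) = 0" if "x \<in> X (Suc i) (a i k)" for x
              using gvecs_const_coeff[OF vl, of x] that False by (simp add: tor_index_def)
            then show ?thesis unfolding const_coeff_D[OF k] by (intro sum.neutral) auto
          qed
        qed (simp add: mmul_def)
        moreover have "D i (v - ?l) \<in> F i" by (rule mmul_vecs[OF A gvecs_vecs[OF vl]])
        ultimately have "D i (v - ?l) \<in> xvecs n n {..<r i}" by (simp add: xvecs_all)
        then obtain z where z: "z \<in> F (Suc (Suc i))" "v - ?l - D (Suc i) z \<in> xvecs n n ?R"
          using exact[OF gvecs_vecs[OF vl]] by blast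
        let ?h = "hvec (a (Suc (Suc i))) t z"
        let ?y = "v - ?l - D (Suc i) ?h"
        have h: "?h \<in> gvecs n {..<r (Suc (Suc i))} (a (Suc (Suc i))) t" by (rule hvec_gvecs[OF z(1)])
        have y: "?y \<in> gvecs n ?R ?a t" by (rule gvecs_diff[OF vl mmul_gvecs[OF A h]])
        have "?y = hvec ?a t (v - ?l - D (Suc i) z)"
          using hvec_homogeneous[OF vl, of t] by (simp add: hvec_diff[of _ _ "v - ?l"] hvec_mmul[OF A z(1)])
        then have "?y \<in> xvecs n n ?R" using xvecs_hvec[OF z(2)] by simp
        then obtain w where w: "w \<in> gvecs n L ?a t" "D i ?y = D i w" using inner[OF order.refl y] by blast
        have "D i ?y = D i v - D i ?l" by (simp add: mmul_diff DD_zero[OF gvecs_vecs[OF h]])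
        then have "D i v = D i (?l + w)" using w(2) by (simp add: mmul_add algebra_simps)
        then show "\<exists>w\<in>gvecs n L ?a t. D i v = D i w" using gvecs_add[OF lL w(1)] by blast
      qed
    qed
  qed
qed

text \<open>The set \<open>L\<close> consists, for each degree, of a column basis of the constant part of the matrix in that
  degree.\<close>

lemma free_syzygies:
  assumes exact: "\<And>v. v \<in> F (Suc i) \<Longrightarrow> D i v \<in> xvecs n n {..<r i} \<Longrightarrow>
      \<exists>w\<in>F (Suc (Suc i)). v - D (Suc i) w \<in> xvecs n n {..<r (Suc i)}"
  shows "\<exists>L \<subseteq> {..<r (Suc i)}. (\<forall>j. card (L \<inter> X (Suc i) j) = tor_rank i j) \<and>
    (\<forall>v\<in>vecs n L. D i v = 0 \<longrightarrow> v = 0) \<and>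
    (\<forall>t. \<forall>v\<in>gvecs n {..<r (Suc i)} (a (Suc i)) t. \<exists>w\<in>gvecs n L (a (Suc i)) t. D i v = D i w)"
proof -
  let ?C = "\<lambda>k l. const_coeff (A i k l)"
  have "\<exists>L. L \<subseteq> X (Suc i) j \<and> card L = tor_rank i j \<and>
      (\<forall>c. (\<forall>k\<in>X i j. (\<Sum>x\<in>L. ?C k x * c x) = 0) \<longrightarrow> (\<forall>x\<in>L. c x = 0)) \<and>
      (\<forall>x\<in>X (Suc i) j. \<exists>c. \<forall>k\<in>X i j. ?C k x = (\<Sum>y\<in>L. ?C k y * c y))" for j
  proof (rule column_basis_exists[OF X_finite[of "Suc i" j], of "X i j" ?C])
    fix L assume L: "L \<subseteq> X (Suc i) j"
      "card L = vectorspace.dim class_ring (fspace (X i j)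
         \<lparr>carrier := mat_map (X i j) (X (Suc i) j) ?C ` carrier (fspace (X (Suc i) j))\<rparr>)"
      "\<And>c. (\<And>k. k \<in> X i j \<Longrightarrow> (\<Sum>x\<in>L. ?C k x * c x) = 0) \<Longrightarrow> (\<And>x. x \<in> L \<Longrightarrow> c x = 0)"
      "\<And>x. x \<in> X (Suc i) j \<Longrightarrow> \<exists>c. \<forall>k\<in>X i j. ?C k x = (\<Sum>y\<in>L. ?C k y * c y)"
    show "\<exists>L. L \<subseteq> X (Suc i) j \<and> card L = tor_rank i j \<and>
      (\<forall>c. (\<forall>k\<in>X i j. (\<Sum>x\<in>L. ?C k x * c x) = 0) \<longrightarrow> (\<forall>x\<in>L. c x = 0)) \<and>
      (\<forall>x\<in>X (Suc i) j. \<exists>c. \<forall>k\<in>X i j. ?C k x = (\<Sum>y\<in>L. ?C k y * c y))"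
    proof (rule exI[of _ L], intro conjI)
      show "card L = tor_rank i j" using L(2) by (simp add: tor_rank_def tor_diff_def)
      show "\<forall>c. (\<forall>k\<in>X i j. (\<Sum>x\<in>L. ?C k x * c x) = 0) \<longrightarrow> (\<forall>x\<in>L. c x = 0)"
      proof (intro allI impI ballI)
        fix c x assume "\<forall>k\<in>X i j. (\<Sum>x\<in>L. ?C k x * c x) = 0" "x \<in> L"
        then show "c x = 0" using L(3)[of c x] by blast
      qed
    qed (use L in blast)+
  qed
  then have "\<exists>L. \<forall>j. L j \<subseteq> X (Suc i) j \<and> card (L j) = tor_rank i j \<and>
      (\<forall>c. (\<forall>k\<in>X i j. (\<Sum>x\<in>L j. ?C k x * c x) = 0) \<longrightarrow> (\<forall>x\<in>L j. c x = 0)) \<and>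
      (\<forall>x\<in>X (Suc i) j. \<exists>c. \<forall>k\<in>X i j. ?C k x = (\<Sum>y\<in>L j. ?C k y * c y))"
    by (intro choice allI)
  then obtain Lj where "\<And>j. Lj j \<subseteq> X (Suc i) j \<and> card (Lj j) = tor_rank i j \<and>
      (\<forall>c. (\<forall>k\<in>X i j. (\<Sum>x\<in>Lj j. ?C k x * c x) = 0) \<longrightarrow> (\<forall>x\<in>Lj j. c x = 0)) \<and>
      (\<forall>x\<in>X (Suc i) j. \<exists>c. \<forall>k\<in>X i j. ?C k x = (\<Sum>y\<in>Lj j. ?C k y * c y))"
    by (elim exE) (rule that, elim allE)
  then have Lj: "\<And>j. Lj j \<subseteq> X (Suc i) j" "\<And>j. card (Lj j) = tor_rank i j"
    "\<And>j c. (\<forall>k\<in>X i j. (\<Sum>x\<in>Lj j. ?C k x * c x) = 0) \<Longrightarrow> (\<forall>x\<in>Lj j. c x = 0)"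
    "\<And>j x. x \<in> X (Suc i) j \<Longrightarrow> \<exists>c. \<forall>k\<in>X i j. ?C k x = (\<Sum>y\<in>Lj j. ?C k y * c y)"
    by simp_all
  define L where "L = (\<Union>j. Lj j)"
  have LX: "L \<inter> X (Suc i) j = Lj j" for j
    using Lj(1) by (fastforce simp: L_def tor_index_def)
  have LR: "L \<subseteq> {..<r (Suc i)}" using Lj(1) X_subset by (fastforce simp: L_def)
  have "v = 0" if "v \<in> vecs n L" "D i v = 0" for v
  proof (rule independent_columns_injective[OF LR _ that])
    fix j c x assume "\<And>k. k \<in> X i j \<Longrightarrow> (\<Sum>x\<in>L \<inter> X (Suc i) j. ?C k x * c x) = 0" "x \<in> L \<inter> X (Suc i) j"
    then show "c x = 0" using Lj(3)[of j c] unfolding LX by blast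
  qed
  moreover have "\<forall>v\<in>gvecs n {..<r (Suc i)} (a (Suc i)) t. \<exists>w\<in>gvecs n L (a (Suc i)) t. D i v = D i w" for t
    by (rule spanning_columns_surjective[OF LR _ exact]) (use Lj(4) in \<open>simp_all add: LX\<close>)
  ultimately show ?thesis using LR LX Lj(2) by (intro exI[of _ L]) auto
qed

end

section \<open>The Hilbert function\<close>

lemma class_vectorspaceI:
  fixes V :: "('k::field, 'v) module"
  assumes "abelian_group V"
    and "\<And>c x. x \<in> carrier V \<Longrightarrow> c \<odot>\<^bsub>V\<^esub> x \<in> carrier V"
    and "\<And>c d x. x \<in> carrier V \<Longrightarrow> (c + d) \<odot>\<^bsub>V\<^esub> x = c \<odot>\<^bsub>V\<^esub> x \<oplus>\<^bsub>V\<^esub> d \<odot>\<^bsub>V\<^esub> x"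
    and "\<And>c x y. x \<in> carrier V \<Longrightarrow> y \<in> carrier V \<Longrightarrow> c \<odot>\<^bsub>V\<^esub> (x \<oplus>\<^bsub>V\<^esub> y) = c \<odot>\<^bsub>V\<^esub> x \<oplus>\<^bsub>V\<^esub> c \<odot>\<^bsub>V\<^esub> y"
    and "\<And>c d x. x \<in> carrier V \<Longrightarrow> (c * d) \<odot>\<^bsub>V\<^esub> x = c \<odot>\<^bsub>V\<^esub> (d \<odot>\<^bsub>V\<^esub> x)"
    and "\<And>x. x \<in> carrier V \<Longrightarrow> 1 \<odot>\<^bsub>V\<^esub> x = x"
  shows "vectorspace class_ring V"
proof -
  have field: "field (class_ring :: 'k ring)" by (rule class_field)
  have "Module.module class_ring V"
    by (rule Module.moduleI[OF domain.axioms(1)[OF field.axioms(1)[OF field]] assms(1)]) (use assms(2-) in \<open>auto simp: class_ring_simps\<close>)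
  then show ?thesis unfolding vectorspace_def using field by simp
qed

definition gspace :: "nat \<Rightarrow> nat set \<Rightarrow> (nat \<Rightarrow> int) \<Rightarrow> int \<Rightarrow> ('k::field, nat \<Rightarrow> 'k mpol) module" where
  "gspace n J a t = \<lparr>carrier = gvecs n J a t, monoid.mult = undefined, one = undefined, zero = 0, add = (+),
     smult = (\<lambda>c. smul (const_pol c))\<rparr>"

lemma gspace_simps [simp]:
  "carrier (gspace n J a t) = gvecs n J a t" "zero (gspace n J a t) = 0"
  "add (gspace n J a t) = (+)" "c \<odot>\<^bsub>gspace n J a t\<^esub> v = smul (const_pol c) v"
  by (simp_all add: gspace_def)

lemma gvecs_const_smul: "(v :: nat \<Rightarrow> 'k::field mpol) \<in> gvecs n J a t \<Longrightarrow> smul (const_pol c) v \<in> gvecs n J a t"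
  using gvecs_smul[of v n J a t "const_pol c" 0] by simp

lemma gspace_vectorspace: "vectorspace class_ring (gspace n J a t :: ('k::field, nat \<Rightarrow> 'k mpol) module)"
proof (rule class_vectorspaceI)
  show "abelian_group (gspace n J a t :: ('k, nat \<Rightarrow> 'k mpol) module)"
  proof (rule abelian_groupI)
    fix v :: "nat \<Rightarrow> 'k mpol" assume "v \<in> carrier (gspace n J a t)"
    then have "0 - v \<in> gvecs n J a t" using gvecs_diff[OF gvecs_zero] by simp
    then show "\<exists>w\<in>carrier (gspace n J a t). w \<oplus>\<^bsub>gspace n J a t\<^esub> v = \<zero>\<^bsub>gspace n J a t\<^esub>"
      by (intro bexI[of _ "0 - v"]) simp_all
  qed (auto simp: gvecs_add add_ac)
qed (auto simp: gvecs_const_smul const_pol_add const_pol_mult add_smul smul_add smul_smul)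

definition exponents :: "nat \<Rightarrow> int \<Rightarrow> (nat \<Rightarrow>\<^sub>0 nat) set" where
  "exponents n e = {u. supp u \<subseteq> {..<n} \<and> int (exp_degree u) = e}"

lemma exponents_finite: "finite (exponents n e)"
proof (cases "e < 0")
  case False
  then have "exponents n e = {u. supp u \<subseteq> {..<n} \<and> exp_degree u = nat e}" by (auto simp: exponents_def)
  then show ?thesis by (simp add: finite_exponents)
next
  case True
  then have "exponents n e = {}" by (auto simp: exponents_def)
  then show ?thesis by simp
qed

lemma coef_sum_monoms: "finite M \<Longrightarrow> coef (\<Sum>u\<in>M. monom_of u (f u)) w = (if w \<in> M then f w else 0)"
  by (simp add: lookup_sum lookup_single when_def)

lemma gspace_dim:
  assumes J: "finite J"
  shows "vectorspace.fin_dim class_ring (gspace n J a t :: ('k::field, nat \<Rightarrow> 'k mpol) module)"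
    and "vectorspace.dim class_ring (gspace n J a t :: ('k::field, nat \<Rightarrow> 'k mpol) module) =
      (\<Sum>l\<in>J. card (exponents n (t - a l)))"
proof -
  let ?M = "\<lambda>l. exponents n (t - a l)"
  let ?X = "Sigma J ?M"
  let ?V = "gspace n J a t :: ('k, nat \<Rightarrow> 'k mpol) module"
  define S where "S v = (\<lambda>x\<in>?X. coef (v (fst x)) (snd x))" for v :: "nat \<Rightarrow> 'k mpol"
  define T where "T c = (\<lambda>l. if l \<in> J then \<Sum>u\<in>?M l. monom_of u (c (l, u)) else 0)"
    for c :: "nat \<times> (nat \<Rightarrow>\<^sub>0 nat) \<Rightarrow> 'k"
  have X: "finite ?X" using J exponents_finite by blast
  have hom: "coef (v l) u = 0" if "v \<in> gvecs n J a t" "u \<notin> ?M l" for v :: "nat \<Rightarrow> 'k mpol" and l u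
  proof (rule ccontr)
    assume "coef (v l) u \<noteq> 0"
    then have "u \<in> supp (v l)" by (simp add: in_keys_iff)
    then show False using that by (auto simp: gvecs_def vecs_def pols_def homogeneous_of_degree_def exponents_def)
  qed
  have bij: "bij_betw S (carrier ?V) (?X \<rightarrow>\<^sub>E UNIV)"
  proof (rule bij_betw_byWitness[where f' = T])
    show "\<forall>v\<in>carrier ?V. T (S v) = v"
    proof
      fix v assume v: "v \<in> carrier ?V"
      show "T (S v) = v"
      proof
        fix l
        show "T (S v) l = v l"
        proof (cases "l \<in> J")
          case True
          show ?thesis
            by (rule poly_mapping_eqI)
               (use True v hom[of v] in \<open>auto simp: T_def S_def coef_sum_monoms[OF exponents_finite]\<close>)
        next
          case False
          then show ?thesis using v by (auto simp: T_def gvecs_def vecs_def)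
        qed
      qed
    qed
    show "\<forall>c\<in>?X \<rightarrow>\<^sub>E UNIV. S (T c) = c"
    proof
      fix c assume c: "c \<in> ?X \<rightarrow>\<^sub>E (UNIV :: 'k set)"
      show "S (T c) = c"
      proof (rule PiE_ext[of _ ?X "\<lambda>_. UNIV"])
        show "S (T c) x = c x" if "x \<in> ?X" for x
          using that by (auto simp: S_def T_def coef_sum_monoms[OF exponents_finite])
      qed (use c in \<open>auto simp: S_def\<close>)
    qed
    show "S ` carrier ?V \<subseteq> ?X \<rightarrow>\<^sub>E UNIV"
      unfolding S_def by (intro image_subsetI restrict_PiE_iff[THEN iffD2]) simp
    have "T c l \<in> pols n" "homogeneous_of_degree (t - a l) (T c l)" for c l
      unfolding T_def
      by (auto simp: exponents_def intro!: pols_sum homogeneous_sum)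
         (metis homogeneous_monom)
    then show "T ` (?X \<rightarrow>\<^sub>E UNIV) \<subseteq> carrier ?V"
      by (auto simp: gvecs_def vecs_def) (simp add: T_def)
  qed
  note dim = dim_coordinates[OF gspace_vectorspace X bij]
  show "vectorspace.fin_dim class_ring ?V"
    by (rule dim(1)) (auto simp: S_def plus_fun_apply lookup_add smul_def)
  have "vectorspace.dim class_ring ?V = card ?X"
    by (rule dim(2)) (auto simp: S_def plus_fun_apply lookup_add smul_def)
  then show "vectorspace.dim class_ring ?V = (\<Sum>l\<in>J. card (?M l))"
    using J exponents_finite by simp
qed

lemma dim_zero_subspace:
  "vectorspace.dim class_ring (gspace n J a t\<lparr>carrier := {0}\<rparr> :: ('k::field, nat \<Rightarrow> 'k mpol) module) = 0"
proof -
  have "gvecs n {} a t = {0 :: nat \<Rightarrow> 'k mpol}"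
    by (auto simp: gvecs_def vecs_def fun_eq_iff zero_fun_apply)
  then have "(gspace n J a t\<lparr>carrier := {0}\<rparr> :: ('k, nat \<Rightarrow> 'k mpol) module) = gspace n {} a t"
    by (simp add: gspace_def)
  then show ?thesis using gspace_dim(2)[of "{}" n a t] by simp
qed

lemma (in graded_mod) component_vectorspace: "vectorspace class_ring (component_space N G t)"
proof (rule class_vectorspaceI)
  note cs = component_space_def
  show "abelian_group (component_space N G t)"
  proof (rule abelian_groupI)
    fix x assume x: "x \<in> carrier (component_space N G t)"
    then have xG: "x \<in> G t" by (simp add: cs)
    have "\<ominus>\<^bsub>N\<^esub> x \<in> G t" by (rule additive_subgroup.a_inv_closed[OF G_subgroup xG])
    then show "\<exists>y\<in>carrier (component_space N G t). y \<oplus>\<^bsub>component_space N G t\<^esub> x = \<zero>\<^bsub>component_space N G t\<^esub>"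
      using N.l_neg[OF G_carrier[OF xG]] by (auto simp: cs)
  qed (auto simp: cs G_add G_zero G_carrier N.a_ac)
  show "c \<odot>\<^bsub>component_space N G t\<^esub> x \<in> carrier (component_space N G t)"
    if "x \<in> carrier (component_space N G t)" for c x
    using G_act[of "const_pol c" 0 x t] that by (simp add: cs)
qed (auto simp: component_space_def const_pol_add const_pol_mult act_add_left act_add_right act_mult
      act_one G_carrier)

context graded_resolution
begin

lemma D_linear:
  assumes "L \<subseteq> {..<r (Suc i)}"
  shows "linear_map class_ring (gspace n L (a (Suc i)) t) (gspace n {..<r i} (a i) t) (D i)"
  by (rule linear_map_class_ringI[OF gspace_vectorspace gspace_vectorspace])
     (auto simp: mmul_add mmul_smul intro: mmul_gvecs[OF A])

lemma aug_linear: "linear_map class_ring (gspace n {..<r 0} (a 0) t) (component_space N G t) (aug (r 0) g)"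
  by (rule linear_map_class_ringI[OF gspace_vectorspace component_vectorspace])
     (auto simp: component_space_def aug0_add[OF gvecs_vecs gvecs_vecs] aug0_smul[OF pols_const gvecs_vecs]
       intro: aug_homogeneous[of "r 0" g "a 0", OF g])

lemma D_kernel_graded:
  "{v \<in> gvecs n {..<r (Suc i)} (a (Suc i)) t. D i v = 0} =
    D (Suc i) ` gvecs n {..<r (Suc (Suc i))} (a (Suc (Suc i))) t"
proof (intro Set.equalityI subsetI)
  fix v assume v: "v \<in> {v \<in> gvecs n {..<r (Suc i)} (a (Suc i)) t. D i v = 0}"
  then obtain w where w: "w \<in> F (Suc (Suc i))" "D (Suc i) w = v" using D_exact[of v i] gvecs_vecs by blast
  have "v = hvec (a (Suc i)) t v" using v hvec_homogeneous[of v n "{..<r (Suc i)}" "a (Suc i)" t t] by simp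
  also have "\<dots> = D (Suc i) (hvec (a (Suc (Suc i))) t w)" unfolding w(2)[symmetric] by (rule hvec_mmul[OF A w(1)])
  finally show "v \<in> D (Suc i) ` gvecs n {..<r (Suc (Suc i))} (a (Suc (Suc i))) t"
    using hvec_gvecs[OF w(1)] by blast
qed (use mmul_gvecs[OF A] DD_zero gvecs_vecs in blast)

lemma aug_kernel_graded:
  "{v \<in> gvecs n {..<r 0} (a 0) t. aug (r 0) g v = \<zero>\<^bsub>N\<^esub>} = D 0 ` gvecs n {..<r (Suc 0)} (a (Suc 0)) t"
proof (intro Set.equalityI subsetI)
  fix v assume v: "v \<in> {v \<in> gvecs n {..<r 0} (a 0) t. aug (r 0) g v = \<zero>\<^bsub>N\<^esub>}"
  then have "v \<in> {v \<in> F 0. aug (r 0) g v = \<zero>\<^bsub>N\<^esub>}" using gvecs_vecs by blast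
  then have "v \<in> D 0 ` F (Suc 0)" unfolding aug_ker One_nat_def .
  then obtain w where w: "w \<in> F (Suc 0)" "D 0 w = v" by blast
  have "v = hvec (a 0) t v" using v hvec_homogeneous[of v n "{..<r 0}" "a 0" t t] by simp
  also have "\<dots> = D 0 (hvec (a (Suc 0)) t w)" unfolding w(2)[symmetric] by (rule hvec_mmul[OF A w(1)])
  finally show "v \<in> D 0 ` gvecs n {..<r (Suc 0)} (a (Suc 0)) t" using hvec_gvecs[OF w(1)] by blast
next
  fix v assume v: "v \<in> D 0 ` gvecs n {..<r (Suc 0)} (a (Suc 0)) t"
  then have "v \<in> D 0 ` F (Suc 0)" using gvecs_vecs by blast
  then have "v \<in> {v \<in> F 0. aug (r 0) g v = \<zero>\<^bsub>N\<^esub>}" unfolding aug_ker One_nat_def .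
  then show "v \<in> {v \<in> gvecs n {..<r 0} (a 0) t. aug (r 0) g v = \<zero>\<^bsub>N\<^esub>}"
    using v mmul_gvecs[OF A] by auto
qed

definition syzygy_dim :: "nat \<Rightarrow> int \<Rightarrow> nat" where
  "syzygy_dim i t = vectorspace.dim class_ring
     (gspace n {..<r i} (a i) t\<lparr>carrier := D i ` gvecs n {..<r (Suc i)} (a (Suc i)) t\<rparr>)"

lemma syzygy_dim_Suc:
  "syzygy_dim i t + syzygy_dim (Suc i) t = (\<Sum>l<r (Suc i). card (exponents n (t - a (Suc i) l)))"
  using rank_nullity_dim[OF D_linear[OF order.refl, of i t] gspace_dim(1)]
  by (simp add: D_kernel_graded syzygy_dim_def gspace_dim(2))

lemma syzygy_dim_0:
  "vectorspace.dim class_ring (component_space N G t) + syzygy_dim 0 t =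
    (\<Sum>l<r 0. card (exponents n (t - a 0 l)))"
proof -
  have "aug (r 0) g ` gvecs n {..<r 0} (a 0) t = G t"
    using aug_surj_homogeneous[of _ t] aug_homogeneous[of "r 0" g "a 0", OF g] by blast
  then have "component_space N G t\<lparr>carrier := aug (r 0) g ` gvecs n {..<r 0} (a 0) t\<rparr> = component_space N G t"
    by (simp add: component_space_def)
  moreover have "\<zero>\<^bsub>component_space N G t\<^esub> = \<zero>\<^bsub>N\<^esub>" by (simp add: component_space_def)
  ultimately show ?thesis
    using rank_nullity_dim[OF aug_linear[of t] gspace_dim(1)]
    by (simp add: aug_kernel_graded syzygy_dim_def gspace_dim(2))
qed

lemma hilbert_function_syzygies:
  "int (vectorspace.dim class_ring (component_space N G t)) =
    (\<Sum>i\<le>s. (-1) ^ i * int (\<Sum>l<r i. card (exponents n (t - a i l)))) - (-1) ^ s * int (syzygy_dim s t)"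
proof (induction s)
  case 0
  then show ?case using arg_cong[OF syzygy_dim_0[of t], of int] by simp
next
  case (Suc s)
  have "int (\<Sum>l<r (Suc s). card (exponents n (t - a (Suc s) l))) =
      int (syzygy_dim s t) + int (syzygy_dim (Suc s) t)"
    using syzygy_dim_Suc[of s t] by linarith
  then show ?case unfolding sum.atMost_Suc Suc.IH by (simp only:) (simp add: algebra_simps)
qed

lemma sum_by_degree:
  fixes f :: "int \<Rightarrow> nat"
  assumes "finite J" "L \<subseteq> {..<r i}" "\<And>l. l \<in> L \<Longrightarrow> a i l \<in> J"
  shows "(\<Sum>l\<in>L. f (a i l)) = (\<Sum>j\<in>J. card (L \<inter> X i j) * f j)"
proof -
  have L: "finite L" using assms(2) finite_subset by blast
  have "(\<Sum>l\<in>L. f (a i l)) = (\<Sum>j\<in>J. \<Sum>l\<in>{l\<in>L. a i l = j}. f (a i l))"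
    by (rule sum.group[symmetric]) (use L assms in auto)
  also have "\<dots> = (\<Sum>j\<in>J. card (L \<inter> X i j) * f j)"
  proof (rule sum.cong[OF refl])
    fix j
    have "{l\<in>L. a i l = j} = L \<inter> X i j" using assms(2) by (auto simp: tor_index_def)
    then show "(\<Sum>l\<in>{l\<in>L. a i l = j}. f (a i l)) = card (L \<inter> X i j) * f j"
      by (simp add: tor_index_def)
  qed
  finally show ?thesis .
qed

text \<open>The sequence \<open>0 \<rightarrow> \<Oplus> S(- a l) \<rightarrow> F\<^sub>s \<rightarrow> \<dots> \<rightarrow> F\<^sub>0 \<rightarrow> N \<rightarrow> 0\<close>, with the sum over the columns \<open>l \<in> L\<close>, is
  exact. The number of columns of degree \<open>j\<close> is the rank by which the alternating sums of basis elements
  and of Betti numbers differ.\<close>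

theorem hilbert_function_betti:
  assumes depth: "depth (irrelevant_ideal n) N = enat e" and s: "n \<le> s + e"
    and J: "finite J" "\<And>i l. i \<le> Suc s \<Longrightarrow> l < r i \<Longrightarrow> a i l \<in> J"
  shows "int (vectorspace.dim class_ring (component_space N G t)) =
    (\<Sum>j\<in>J. (\<Sum>i\<le>s. (-1) ^ i * int (tor_dim r a A i j)) * int (card (exponents n (t - j))))"
proof -
  let ?m = "\<lambda>j. int (card (exponents n (t - j)))"
  from free_syzygies[OF exact_modulo_variables_of_depth[OF depth s]] obtain L where
    L: "L \<subseteq> {..<r (Suc s)}" and card: "\<And>j. card (L \<inter> X (Suc s) j) = tor_rank s j"
    and inj: "\<And>v. v \<in> vecs n L \<Longrightarrow> D s v = 0 \<Longrightarrow> v = 0"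
    and surj: "\<And>v. v \<in> gvecs n {..<r (Suc s)} (a (Suc s)) t \<Longrightarrow> \<exists>w\<in>gvecs n L (a (Suc s)) t. D s v = D s w"
    by blast
  have Lfin: "finite L" using L finite_subset by blast
  have img: "D s ` gvecs n L (a (Suc s)) t = D s ` gvecs n {..<r (Suc s)} (a (Suc s)) t"
    using surj gvecs_mono[OF _ L] by blast
  have ker: "{v \<in> gvecs n L (a (Suc s)) t. D s v = 0} = {0}" using inj[OF gvecs_vecs] by auto
  have "syzygy_dim s t = (\<Sum>l\<in>L. card (exponents n (t - a (Suc s) l)))"
    using rank_nullity_dim[OF D_linear[OF L, of t] gspace_dim(1)[OF Lfin]]
    by (simp add: img ker dim_zero_subspace syzygy_dim_def gspace_dim(2)[OF Lfin])
  also have "\<dots> = (\<Sum>j\<in>J. tor_rank s j * card (exponents n (t - j)))"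
    unfolding card[symmetric]
    by (rule sum_by_degree[OF J(1) L, where f = "\<lambda>j. card (exponents n (t - j))"]) (use J(2) L in auto)
  finally have z: "int (syzygy_dim s t) = (\<Sum>j\<in>J. int (tor_rank s j) * ?m j)" by simp
  have f: "int (\<Sum>l<r i. card (exponents n (t - a i l))) = (\<Sum>j\<in>J. int (card (X i j)) * ?m j)" if "i \<le> s" for i
  proof -
    have "(\<Sum>l<r i. card (exponents n (t - a i l))) = (\<Sum>j\<in>J. card ({..<r i} \<inter> X i j) * card (exponents n (t - j)))"
      by (rule sum_by_degree[OF J(1), where f = "\<lambda>j. card (exponents n (t - j))"]) (use J(2) that in auto)
    moreover have "{..<r i} \<inter> X i j = X i j" for j by (auto simp: tor_index_def)
    ultimately show ?thesis by simp
  qed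
  have "(\<Sum>i\<le>s. (-1) ^ i * int (\<Sum>l<r i. card (exponents n (t - a i l)))) =
      (\<Sum>i\<le>s. \<Sum>j\<in>J. (-1) ^ i * int (card (X i j)) * ?m j)"
    by (rule sum.cong[OF refl]) (simp only: f atMost_iff sum_distrib_left mult.assoc)
  also have "\<dots> = (\<Sum>j\<in>J. \<Sum>i\<le>s. (-1) ^ i * int (card (X i j)) * ?m j)" by (rule sum.swap)
  also have "\<dots> = (\<Sum>j\<in>J. (\<Sum>i\<le>s. (-1) ^ i * int (card (X i j))) * ?m j)" by (simp only: sum_distrib_right)
  finally have F: "(\<Sum>i\<le>s. (-1) ^ i * int (\<Sum>l<r i. card (exponents n (t - a i l)))) =
      (\<Sum>j\<in>J. (\<Sum>i\<le>s. (-1) ^ i * int (card (X i j))) * ?m j)" .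
  show ?thesis
    unfolding hilbert_function_syzygies[of t s] F z tor_alternating
    by (simp only: left_diff_distrib sum_subtractf sum_distrib_left mult.assoc)
qed

lemma component_below:
  assumes "\<And>l. l < r 0 \<Longrightarrow> t < a 0 l"
  shows "G t = {\<zero>\<^bsub>N\<^esub>}"
proof -
  have "x = \<zero>\<^bsub>N\<^esub>" if x: "x \<in> G t" for x
  proof -
    obtain u where u: "u \<in> gvecs n {..<r 0} (a 0) t" "aug (r 0) g u = x" using aug_surj_homogeneous[OF x] by blast
    have "u = 0" by (rule gvecs_below[OF u(1)]) (use assms in auto)
    then show ?thesis using u(2) aug_zero[of "r 0" g, OF g_carrier] by simp
  qed
  then show ?thesis using G_zero by blast
qed

end

section \<open>Hilbert coefficients and moments of the Betti diagram\<close>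

definition exponents_upto :: "nat \<Rightarrow> nat \<Rightarrow> (nat \<Rightarrow>\<^sub>0 nat) set" where
  "exponents_upto n m = {u. supp u \<subseteq> {..<n} \<and> exp_degree u \<le> m}"

lemma exponents_upto_finite: "finite (exponents_upto n m)"
proof -
  have "exponents_upto n m = (\<Union>d\<le>m. {u. supp u \<subseteq> {..<n} \<and> exp_degree u = d})"
    by (auto simp: exponents_upto_def)
  then show ?thesis by (simp add: finite_exponents)
qed

text \<open>Pascal's recursion: an exponent vector either avoids the last variable or is divisible by it.\<close>

lemma exponents_upto_Suc:
  "exponents_upto (Suc n) (Suc m) =
    exponents_upto n (Suc m) \<union> (\<lambda>u. monom_of n 1 + u) ` exponents_upto (Suc n) m"
proof (intro Set.equalityI subsetI)
  fix u assume u: "u \<in> exponents_upto (Suc n) (Suc m)"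
  show "u \<in> exponents_upto n (Suc m) \<union> (\<lambda>u. monom_of n 1 + u) ` exponents_upto (Suc n) m"
  proof (cases "n \<in> supp u")
    case False
    then have "supp u \<subseteq> {..<n}" using u by (force simp: exponents_upto_def less_Suc_eq)
    then show ?thesis using u by (simp add: exponents_upto_def)
  next
    case True
    let ?w = "u - monom_of n 1"
    have uw: "u = monom_of n 1 + ?w"
      by (rule poly_mapping_eqI)
         (use True in \<open>auto simp: lookup_add lookup_minus lookup_single when_def in_keys_iff\<close>)
    have "exp_degree u = 1 + exp_degree ?w" by (subst uw) (simp only: exp_degree_add exp_degree_single)
    moreover have "supp ?w \<subseteq> {..<Suc n}"
    proof -
      have "supp ?w \<subseteq> supp u" by (auto simp: in_keys_iff lookup_minus)
      then show ?thesis using u by (auto simp: exponents_upto_def)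
    qed
    ultimately have "?w \<in> exponents_upto (Suc n) m" using u by (simp add: exponents_upto_def)
    then show ?thesis using uw by blast
  qed
next
  fix u assume "u \<in> exponents_upto n (Suc m) \<union> (\<lambda>u. monom_of n 1 + u) ` exponents_upto (Suc n) m"
  then show "u \<in> exponents_upto (Suc n) (Suc m)"
    by (auto simp: exponents_upto_def exp_degree_add supp_exp_add)
qed

lemma card_exponents_upto: "card (exponents_upto n m) = (m + n) choose n"
proof (induction "m + n" arbitrary: n m rule: less_induct)
  case less
  show ?case
  proof (cases n)
    case 0
    have "exponents_upto n m = {0}" unfolding 0 by (auto simp: exponents_upto_def)
    then show ?thesis using 0 by simp
  next
    case n: (Suc n')
    show ?thesis
    proof (cases m)
      case 0
      have "exponents_upto n m = {0}" unfolding 0 by (auto simp: exponents_upto_def)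
      then show ?thesis using 0 by simp
    next
      case m: (Suc m')
      have "exponents_upto n' m \<inter> (\<lambda>u. monom_of n' 1 + u) ` exponents_upto n m' = {}"
        by (auto simp: exponents_upto_def supp_exp_add)
      then have "card (exponents_upto n m) =
          card (exponents_upto n' m) + card ((\<lambda>u. monom_of n' 1 + u) ` exponents_upto n m')"
        unfolding n m exponents_upto_Suc by (intro card_Un_disjoint) (auto simp: exponents_upto_finite)
      also have "card ((\<lambda>u. monom_of n' 1 + u) ` exponents_upto n m') = card (exponents_upto n m')"
        by (rule card_image) (simp add: inj_on_def)
      finally show ?thesis using less[of m n'] less[of m' n] unfolding n m by simp
    qed
  qed
qed

lemma sum_card_exponents:
  assumes B: "B \<le> j" and T: "j \<le> T"
  shows "(\<Sum>t=B..T. card (exponents n (t - j))) = (nat (T - j) + n) choose n"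
proof -
  have "exponents_upto n (nat (T - j)) = (\<Union>t\<in>{B..T}. exponents n (t - j))"
  proof (intro Set.equalityI subsetI)
    fix u assume "u \<in> exponents_upto n (nat (T - j))"
    then have "j + int (exp_degree u) \<in> {B..T}" "u \<in> exponents n (j + int (exp_degree u) - j)"
      using B T by (auto simp: exponents_upto_def exponents_def)
    then show "u \<in> (\<Union>t\<in>{B..T}. exponents n (t - j))" by blast
  qed (auto simp: exponents_upto_def exponents_def)
  moreover have "card (\<Union>t\<in>{B..T}. exponents n (t - j)) = (\<Sum>t=B..T. card (exponents n (t - j)))"
    by (rule card_UN_disjoint) (auto simp: exponents_finite, auto simp: exponents_def)
  ultimately show ?thesis using card_exponents_upto[of n "nat (T - j)"] by simp
qed

lemma poly_eq_of_eventually_eq: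
  fixes P Q :: "rat poly"
  assumes "\<And>i::int. i \<ge> i0 \<Longrightarrow> poly P (of_int i) = poly Q (of_int i)"
  shows "P = Q"
proof (rule ccontr)
  assume "P \<noteq> Q"
  then have "finite {x. poly (P - Q) x = 0}" by (intro poly_roots_finite) simp
  moreover have "(of_int ` {i0..} :: rat set) \<subseteq> {x. poly (P - Q) x = 0}" using assms by auto
  ultimately have "finite (of_int ` {i0..} :: rat set)" by (rule rev_finite_subset)
  then have "finite {i0..}" by (rule finite_imageD) (simp add: inj_on_def)
  then show False by (simp add: infinite_Ici)
qed

lemma gchoose_of_int_Ints: "((of_int j :: rat) gchoose k) \<in> \<int>"
proof (cases "j \<ge> 0")
  case True
  then have "((of_int j :: rat) gchoose k) = of_nat (nat j choose k)" by (simp add: binomial_gbinomial)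
  then show ?thesis by simp
next
  case False
  then obtain m where m: "j = - int (Suc m)" by (metis not_le negD)
  have "((of_int j :: rat) gchoose k) = (- 1) ^ k * ((of_nat (Suc m) + of_nat k - 1) gchoose k)"
    unfolding m using gbinomial_minus[of "of_nat (Suc m) :: rat" k] by simp
  also have "(of_nat (Suc m) + of_nat k - 1 :: rat) = of_nat (m + k)" by simp
  also have "((of_nat (m + k) :: rat) gchoose k) = of_nat ((m + k) choose k)" by (simp add: binomial_gbinomial)
  finally show ?thesis by simp
qed

context graded_resolution
begin

text \<open>A homogeneous element of degree \<open>t\<close> is a combination of the generators with coefficients from
  \<open>S / Ann N\<close>, which bounds the Hilbert function of \<open>N\<close> by that of \<open>S / Ann N\<close>.\<close>

lemma component_dim_le:
  "vectorspace.dim class_ring (component_space N G t) \<le>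
    (\<Sum>l<r 0. if a 0 l \<le> t then quotient_dim n (annihilator (mpoly_ring n) N) (t - a 0 l) else 0)"
proof -
  let ?I = "annihilator (mpoly_ring n) N"
  define q where "q l = (if a 0 l \<le> t then quotient_dim n ?I (t - a 0 l) else 0)" for l
  have I0: "0 \<in> ?I" by (rule homogeneous_idealD(2)[OF annihilator_homogeneous])
  have "\<exists>b. (\<forall>k<q l. b k \<in> forms n (t - a 0 l)) \<and>
      (\<forall>p\<in>forms n (t - a 0 l). \<exists>c. p - (\<Sum>k<q l. const_pol (c k) * b k) \<in> ?I)" for l
  proof (cases "a 0 l \<le> t")
    case True
    then have e: "t - a 0 l = int (nat (t - a 0 l))" by simp
    obtain b where "spans_mod n ?I (int (nat (t - a 0 l))) (quotient_dim n ?I (int (nat (t - a 0 l)))) b"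
      by (rule quotient_dim_spans[OF I0])
    then show ?thesis using True unfolding e[symmetric] spans_mod_def q_def by auto
  next
    case False
    then have "p = 0" if "p \<in> forms n (t - a 0 l)" for p :: "'k mpol"
      using that homogeneous_negative[of "t - a 0 l" p] by (simp add: forms_def)
    then show ?thesis using False I0 by (auto simp: q_def)
  qed
  then have "\<forall>l. \<exists>b. (\<forall>k<q l. b k \<in> forms n (t - a 0 l)) \<and>
      (\<forall>p\<in>forms n (t - a 0 l). \<exists>c. p - (\<Sum>k<q l. const_pol (c k) * b k) \<in> ?I)" by blast
  from choice[OF this] obtain b where
    b: "\<And>l k. k < q l \<Longrightarrow> b l k \<in> forms n (t - a 0 l)"
    and span: "\<And>l p. p \<in> forms n (t - a 0 l) \<Longrightarrow> \<exists>c. p - (\<Sum>k<q l. const_pol (c k) * b l k) \<in> ?I"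
    by blast
  let ?X = "Sigma {..<r 0} (\<lambda>l. {..<q l})"
  define W where "W c = (\<lambda>l. if l < r 0 then \<Sum>k<q l. const_pol (c (l, k)) * b l k else 0)"
    for c :: "nat \<times> nat \<Rightarrow> 'k"
  have W: "W c \<in> gvecs n {..<r 0} (a 0) t" for c
  proof -
    have "const_pol (c (l, k)) * b l k \<in> forms n (t - a 0 l)" if "k < q l" for l k
      using b[OF that] homogeneous_mult[OF homogeneous_const, of "t - a 0 l" "b l k" "c (l, k)"]
      by (auto simp: forms_def)
    then have "(\<Sum>k<q l. const_pol (c (l, k)) * b l k) \<in> forms n (t - a 0 l)" for l
      unfolding forms_def by (auto intro!: pols_sum homogeneous_sum)
    then show ?thesis by (auto simp: W_def gvecs_def vecs_def forms_def)
  qed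
  have WF: "W c \<in> F 0" for c by (rule gvecs_vecs[OF W])
  have add: "W (\<lambda>x\<in>?X. c x + c' x) = W c + W c'" for c c'
    by (rule ext) (simp add: W_def plus_fun_apply const_pol_add distrib_right sum.distrib)
  have scale: "W (\<lambda>x\<in>?X. k * c x) = smul (const_pol k) (W c)" for k c
    by (rule ext) (simp add: W_def smul_def const_pol_mult sum_distrib_left mult.assoc)
  have lin: "linear_map class_ring (fspace ?X) (component_space N G t) (\<lambda>c. aug (r 0) g (W c))"
  proof (rule linear_map_class_ringI[OF fspace_vectorspace component_vectorspace])
    show "aug (r 0) g (W c) \<in> carrier (component_space N G t)" for c
      using aug_homogeneous[of "r 0" g "a 0", OF g W] by (simp add: component_space_def)
    show "aug (r 0) g (W (c \<oplus>\<^bsub>fspace ?X\<^esub> c')) =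
        aug (r 0) g (W c) \<oplus>\<^bsub>component_space N G t\<^esub> aug (r 0) g (W c')" for c c'
      unfolding fspace_simps add by (simp add: component_space_def aug0_add[OF WF WF])
    show "aug (r 0) g (W (k \<odot>\<^bsub>fspace ?X\<^esub> c)) = k \<odot>\<^bsub>component_space N G t\<^esub> aug (r 0) g (W c)" for k c
      unfolding fspace_simps scale by (simp add: component_space_def aug0_smul[OF pols_const WF])
  qed
  have "(\<lambda>c. aug (r 0) g (W c)) ` carrier (fspace ?X) = G t"
  proof (intro Set.equalityI subsetI)
    fix x assume "x \<in> G t"
    then obtain u where u: "u \<in> gvecs n {..<r 0} (a 0) t" "aug (r 0) g u = x"
      using aug_surj_homogeneous by blast
    have "\<forall>l. \<exists>c. u l - (\<Sum>k<q l. const_pol (c k) * b l k) \<in> ?I"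
      using span u(1) by (simp add: gvecs_def vecs_def forms_def)
    from choice[OF this] obtain c where c: "\<And>l. u l - (\<Sum>k<q l. const_pol (c l k) * b l k) \<in> ?I" by blast
    let ?c = "\<lambda>x\<in>?X. c (fst x) (snd x)"
    have diff: "(u - W ?c) l \<in> ?I" if "l < r 0" for l
      using c[of l] that by (simp add: minus_apply W_def)
    have "aug (r 0) g (u - W ?c) = finsum N (\<lambda>l. \<zero>\<^bsub>N\<^esub>) {..<r 0}"
      unfolding aug_def
      by (rule N.finsum_cong') (use diff g_carrier in \<open>auto simp: annihilator_def\<close>)
    then have z: "aug (r 0) g (u - W ?c) = \<zero>\<^bsub>N\<^esub>" by simp
    have "aug (r 0) g u = aug (r 0) g ((u - W ?c) + W ?c)" by simp
    also have "\<dots> = aug (r 0) g (u - W ?c) \<oplus>\<^bsub>N\<^esub> aug (r 0) g (W ?c)"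
      by (rule aug0_add[OF vecs_diff[OF gvecs_vecs[OF u(1)] WF] WF])
    also have "\<dots> = aug (r 0) g (W ?c)" using z aug0_closed[OF WF] by simp
    finally have "x = aug (r 0) g (W ?c)" using u(2) by simp
    moreover have "?c \<in> carrier (fspace ?X)" by (simp add: fspace_simps)
    ultimately show "x \<in> (\<lambda>c. aug (r 0) g (W c)) ` carrier (fspace ?X)" by (rule image_eqI)
  qed (use aug_homogeneous[of "r 0" g "a 0", OF g W] in auto)
  then have "component_space N G t\<lparr>carrier := (\<lambda>c. aug (r 0) g (W c)) ` carrier (fspace ?X)\<rparr> =
      component_space N G t" by (simp add: component_space_def)
  moreover have "vectorspace.dim class_ring
      (component_space N G t\<lparr>carrier := (\<lambda>c. aug (r 0) g (W c)) ` carrier (fspace ?X)\<rparr>) \<le> card ?X"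
    using rank_nullity_dim[OF lin fspace_dim(1)] fspace_dim(2)[of ?X, where 'k = 'k] by simp
  ultimately show ?thesis by (simp add: q_def)
qed

lemma dim_zero_component: "G t = {\<zero>\<^bsub>N\<^esub>} \<Longrightarrow> vectorspace.dim class_ring (component_space N G t) = 0"
  using dim_coordinates(2)[OF component_vectorspace, of "{}" "\<lambda>_ _. undefined" t]
  by (simp add: bij_betw_def component_space_def)

lemma cumulative_hilbert_sum:
  assumes B: "\<And>l. l < r 0 \<Longrightarrow> B \<le> a 0 l"
  shows "cumulative_hilbert N G T = (\<Sum>t=B..T. vectorspace.dim class_ring (component_space N G t))"
  unfolding cumulative_hilbert_def
proof (rule sum.mono_neutral_left)
  show "{j. j \<le> T \<and> G j \<noteq> {\<zero>\<^bsub>N\<^esub>}} \<subseteq> {B..T}"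
  proof
    fix j assume j: "j \<in> {j. j \<le> T \<and> G j \<noteq> {\<zero>\<^bsub>N\<^esub>}}"
    have "\<not> j < B"
    proof
      assume "j < B"
      then have "G j = {\<zero>\<^bsub>N\<^esub>}" by (intro component_below) (use B in force)
      then show False using j by simp
    qed
    then show "j \<in> {B..T}" using j by simp
  qed
qed (use dim_zero_component in auto)

lemma cumulative_hilbert_growth:
  assumes dim: "module_dim (mpoly_ring n) N = enat d"
  shows "\<exists>C. \<forall>T. cumulative_hilbert N G (int T) \<le> C * (T + 1) ^ d"
proof -
  let ?I = "annihilator (mpoly_ring n) N"
  obtain C where C: "\<And>T. cumulative_dim n ?I T \<le> C * (T + 1) ^ d"
    using growth_annihilator[OF dim] by (auto simp: growth_at_most_def)
  define B where "B = Min (insert 0 (a 0 ` {..<r 0}))"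
  have B: "B \<le> a 0 l" if "l < r 0" for l unfolding B_def using that by (intro Min_le) auto
  have B0: "B \<le> 0" unfolding B_def by (intro Min_le) auto
  have shifted: "(\<Sum>t=B..T. if b \<le> t then quotient_dim n ?I (t - b) else 0) \<le> cumulative_dim n ?I (nat (T - B))"
    if b: "B \<le> b" for b T
  proof -
    have "(\<Sum>t=B..T. if b \<le> t then quotient_dim n ?I (t - b) else 0) = (\<Sum>t=b..T. quotient_dim n ?I (t - b))"
      by (rule sum.mono_neutral_cong_right) (use b in auto)
    also have "\<dots> \<le> cumulative_dim n ?I (nat (T - B))"
    proof (cases "b \<le> T")
      case True
      have "{b..T} = (\<lambda>u. b + int u) ` {..nat (T - b)}"
      proof (intro Set.equalityI subsetI)
        fix t assume "t \<in> {b..T}"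
        then show "t \<in> (\<lambda>u. b + int u) ` {..nat (T - b)}" by (intro image_eqI[of _ _ "nat (t - b)"]) auto
      qed (use True in auto)
      moreover have "inj_on (\<lambda>u. b + int u) {..nat (T - b)}" by (simp add: inj_on_def)
      ultimately have "(\<Sum>t=b..T. quotient_dim n ?I (t - b)) = cumulative_dim n ?I (nat (T - b))"
        by (simp add: sum.reindex cumulative_dim_def)
      moreover have "nat (T - b) \<le> nat (T - B)" using b by (intro nat_mono) simp
      ultimately show ?thesis by (simp add: cumulative_dim_mono)
    qed simp
    finally show ?thesis .
  qed
  \<comment> \<open>The factor accounts for \<open>T - B + 1 \<le> (1 - B) (T + 1)\<close>, where \<open>B \<le> 0\<close>.\<close>
  let ?C = "r 0 * C * (nat (- B) + 1) ^ d"
  have "cumulative_hilbert N G (int T) \<le> ?C * (T + 1) ^ d" for T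
  proof -
    have "cumulative_hilbert N G (int T) =
        (\<Sum>t=B..int T. vectorspace.dim class_ring (component_space N G t))"
      by (rule cumulative_hilbert_sum) (rule B)
    also have "\<dots> \<le> (\<Sum>t=B..int T. \<Sum>l<r 0. if a 0 l \<le> t then quotient_dim n ?I (t - a 0 l) else 0)"
      by (rule sum_mono) (rule component_dim_le)
    also have "\<dots> = (\<Sum>l<r 0. \<Sum>t=B..int T. if a 0 l \<le> t then quotient_dim n ?I (t - a 0 l) else 0)"
      by (rule sum.swap)
    also have "\<dots> \<le> (\<Sum>l<r 0. C * ((nat (- B) + 1) * (T + 1)) ^ d)"
    proof (rule sum_mono)
      fix l assume l: "l \<in> {..<r 0}"
      have "nat (int T - B) + 1 \<le> (nat (- B) + 1) * (T + 1)" using B0 by (simp add: algebra_simps nat_diff_distrib')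
      then have "C * (nat (int T - B) + 1) ^ d \<le> C * ((nat (- B) + 1) * (T + 1)) ^ d"
        by (intro mult_left_mono power_mono) auto
      then show "(\<Sum>t=B..int T. if a 0 l \<le> t then quotient_dim n ?I (t - a 0 l) else 0) \<le>
          C * ((nat (- B) + 1) * (T + 1)) ^ d"
        using shifted[of "a 0 l" "int T"] B[of l] l C[of "nat (int T - B)"] by (meson lessThan_iff order.trans)
    qed
    also have "\<dots> = ?C * (T + 1) ^ d"
      by (simp only: sum_constant card_lessThan power_mult_distrib of_nat_id mult.assoc)
    finally show ?thesis .
  qed
  then show ?thesis by blast
qed

abbreviation moment :: "nat \<Rightarrow> int set \<Rightarrow> nat \<Rightarrow> rat" where
  "moment s J k \<equiv> binomial_moment s (\<lambda>i j. of_nat (tor_dim r a A i j)) J k"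

context
  fixes d s :: nat and J :: "int set"
  assumes depth: "depth (irrelevant_ideal n) N = enat d"
    and dim: "module_dim (mpoly_ring n) N = enat d"
    and ds: "d + s = n"
    and J: "finite J" "\<And>i l. i \<le> Suc s \<Longrightarrow> l < r i \<Longrightarrow> a i l \<in> J"
begin

definition hilbert_expansion :: "rat poly" where
  "hilbert_expansion = (\<Sum>k\<le>n. Polynomial.smult ((-1) ^ k * moment s J k) (binom_poly (n - k)))"

lemma moment_alt:
  "moment s J k = (\<Sum>j\<in>J. of_int (\<Sum>i\<le>s. (-1) ^ i * int (tor_dim r a A i j)) * (of_int j gchoose k))"
proof -
  have "moment s J k = (\<Sum>j\<in>J. \<Sum>i\<le>s. (-1) ^ i * of_nat (tor_dim r a A i j) * (of_int j gchoose k))"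
    unfolding binomial_moment_def by (rule sum.swap)
  then show ?thesis by (simp add: sum_distrib_right)
qed

lemma moment_Ints: "moment s J k \<in> \<int>"
  unfolding moment_alt using gchoose_of_int_Ints by (intro Ints_sum Ints_mult) auto

text \<open>For \<open>T \<ge> j\<close> the cumulative Hilbert function of \<open>S(- j)\<close> is \<open>T - j + n choose n\<close>, which
  \<open>gchoose_shift_expansion\<close> expands into the binomial polynomials of \<open>T\<close>.\<close>

lemma poly_hilbert_expansion:
  assumes T: "\<And>j. j \<in> J \<Longrightarrow> j \<le> T"
  shows "poly hilbert_expansion (of_int T) = of_nat (cumulative_hilbert N G T)"
proof -
  let ?\<chi> = "\<lambda>j. \<Sum>i\<le>s. (-1) ^ i * int (tor_dim r a A i j)"
  define B where "B = Min (insert 0 J)"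
  have B: "B \<le> j" if "j \<in> J" for j unfolding B_def using J(1) that by (intro Min_le) auto
  have "int (cumulative_hilbert N G T) =
      (\<Sum>t=B..T. \<Sum>j\<in>J. ?\<chi> j * int (card (exponents n (t - j))))"
  proof -
    have "int (vectorspace.dim class_ring (component_space N G t)) =
        (\<Sum>j\<in>J. ?\<chi> j * int (card (exponents n (t - j))))" for t
      by (rule hilbert_function_betti[OF depth _ J(1)]) (use ds J(2) in auto)
    moreover have "cumulative_hilbert N G T = (\<Sum>t=B..T. vectorspace.dim class_ring (component_space N G t))"
      by (rule cumulative_hilbert_sum) (use B J(2) in auto)
    ultimately show ?thesis by simp
  qed
  also have "\<dots> = (\<Sum>j\<in>J. \<Sum>t=B..T. ?\<chi> j * int (card (exponents n (t - j))))" by (rule sum.swap)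
  also have "\<dots> = (\<Sum>j\<in>J. ?\<chi> j * int (\<Sum>t=B..T. card (exponents n (t - j))))"
    by (simp add: sum_distrib_left)
  also have "\<dots> = (\<Sum>j\<in>J. ?\<chi> j * int ((nat (T - j) + n) choose n))"
    by (rule sum.cong[OF refl]) (simp only: sum_card_exponents[OF B T])
  finally have "(of_nat (cumulative_hilbert N G T) :: rat) =
      of_int (\<Sum>j\<in>J. ?\<chi> j * int ((nat (T - j) + n) choose n))" by (metis of_int_of_nat_eq)
  also have "\<dots> = (\<Sum>j\<in>J. of_int (?\<chi> j) * of_nat ((nat (T - j) + n) choose n))" by simp
  also have "\<dots> = (\<Sum>j\<in>J. of_int (?\<chi> j) * ((of_int T - of_int j + of_nat n) gchoose n))"
  proof (rule sum.cong[OF refl])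
    fix j assume "j \<in> J"
    then have "(of_nat (nat (T - j) + n) :: rat) = of_int T - of_int j + of_nat n" using T[of j] by simp
    then show "of_int (?\<chi> j) * (of_nat ((nat (T - j) + n) choose n) :: rat) =
        of_int (?\<chi> j) * ((of_int T - of_int j + of_nat n) gchoose n)"
      by (simp only: binomial_gbinomial)
  qed
  also have "\<dots> = (\<Sum>j\<in>J. \<Sum>k\<le>n. of_int (?\<chi> j) *
      ((- 1) ^ k * (of_int j gchoose k) * ((of_int T + of_nat (n - k)) gchoose (n - k))))"
    by (simp only: gchoose_shift_expansion sum_distrib_left)
  also have "\<dots> = (\<Sum>k\<le>n. \<Sum>j\<in>J. of_int (?\<chi> j) *
      ((- 1) ^ k * (of_int j gchoose k) * ((of_int T + of_nat (n - k)) gchoose (n - k))))" by (rule sum.swap)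
  also have "\<dots> = poly hilbert_expansion (of_int T)"
    unfolding hilbert_expansion_def moment_alt
    by (simp add: poly_sum poly_binom_poly sum_distrib_left sum_distrib_right mult_ac del: of_int_sum)
  finally show ?thesis by simp
qed

lemma eventually_above_J: "\<exists>T0::nat. \<forall>j\<in>J. j \<le> int T0"
proof -
  have "j \<le> int (nat (Max (insert 0 J)))" if "j \<in> J" for j
    using Max_ge[of "insert 0 J" j] Max_ge[of "insert 0 J" 0] J(1) that by auto
  then show ?thesis by blast
qed

lemma hilbert_poly_eq: "hilbert_poly N G = hilbert_expansion"
proof -
  obtain T0 :: nat where T0: "\<forall>j\<in>J. j \<le> int T0" using eventually_above_J by blast
  have ev: "poly hilbert_expansion (of_int T) = of_nat (cumulative_hilbert N G T)" if "T \<ge> int T0" for T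
    by (rule poly_hilbert_expansion) (use T0 that in force)
  show ?thesis
    unfolding hilbert_poly_def
  proof (rule the_equality)
    show "\<exists>i0. \<forall>i\<ge>i0. poly hilbert_expansion (of_int i) = of_nat (cumulative_hilbert N G i)" using ev by blast
    fix P :: "rat poly" assume "\<exists>i0. \<forall>i\<ge>i0. poly P (of_int i) = of_nat (cumulative_hilbert N G i)"
    then obtain i0 where i0: "\<And>i. i \<ge> i0 \<Longrightarrow> poly P (of_int i) = of_nat (cumulative_hilbert N G i)" by blast
    show "P = hilbert_expansion"
      by (rule poly_eq_of_eventually_eq[of "max i0 (int T0)"]) (simp add: i0 ev)
  qed
qed

text \<open>These are the coefficients of the binomial polynomials of degree above \<open>d\<close>, while the cumulative
  Hilbert function grows with exponent at most \<open>d\<close>.\<close>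

lemma moment_zero:
  assumes k: "k < s"
  shows "moment s J k = 0"
proof -
  obtain T0 :: nat where T0: "\<forall>j\<in>J. j \<le> int T0" using eventually_above_J by blast
  have ev: "poly hilbert_expansion (of_nat T) = of_nat (cumulative_hilbert N G (int T))" if "T \<ge> T0" for T
    using poly_hilbert_expansion[of "int T"] T0 that by force
  obtain C where C: "\<And>T. cumulative_hilbert N G (int T) \<le> C * (T + 1) ^ d"
    using cumulative_hilbert_growth[OF dim] by blast
  have "degree hilbert_expansion \<le> d"
  proof (rule degree_le_if_growth)
    fix T assume T: "T0 \<le> T"
    show "0 \<le> poly hilbert_expansion (of_nat T)" using ev[OF T] by simp
    have "(of_nat (cumulative_hilbert N G (int T)) :: rat) \<le> of_nat (C * (T + 1) ^ d)"
      using C[of T] by (simp only: of_nat_le_iff)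
    then show "poly hilbert_expansion (of_nat T) \<le> of_nat C * (of_nat T + 1) ^ d"
      unfolding ev[OF T] by (simp add: algebra_simps)
  qed
  then have "(-1) ^ k * moment s J k = 0"
    by (intro binom_poly_sum_high_coeffs_zero[OF hilbert_expansion_def, of "Suc d" k])
       (use k ds in \<open>auto intro: coeff_eq_0\<close>)
  then show ?thesis by simp
qed

text \<open>The expansion into binomial polynomials is unique, and its terms of degree above \<open>d\<close> vanish.\<close>

theorem hilbert_coeff_moment:
  assumes i: "i \<le> d"
  shows "of_int (hilbert_coeff n N G i) = (-1) ^ s * moment s J (s + i)"
proof -
  let ?M = "moment s J"
  have "\<exists>e. \<forall>k. ?M k = of_int (e k)" using moment_Ints by (intro choice) (auto elim: Ints_cases)
  then obtain M where M: "\<And>k. ?M k = of_int (M k)" by blast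
  define e where "e k = (if k \<le> d then (-1) ^ s * M (s + k) else 0)" for k
  have expand: "poly hilbert_expansion x =
      (\<Sum>i\<le>d. (-1) ^ i * of_int (e i) * ((x + of_nat (d - i)) gchoose (d - i)))" for x
  proof -
    have "poly hilbert_expansion x = (\<Sum>k\<le>n. (-1) ^ k * ?M k * ((x + of_nat (n - k)) gchoose (n - k)))"
      by (simp add: hilbert_expansion_def poly_sum poly_binom_poly)
    also have "\<dots> = (\<Sum>k\<in>(+) s ` {..d}. (-1) ^ k * ?M k * ((x + of_nat (n - k)) gchoose (n - k)))"
    proof (rule sum.mono_neutral_right)
      show "\<forall>k\<in>{..n} - (+) s ` {..d}. (-1) ^ k * ?M k * ((x + of_nat (n - k)) gchoose (n - k)) = 0"
      proof
        fix k assume k: "k \<in> {..n} - (+) s ` {..d}"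
        have "k < s"
        proof (rule ccontr)
          assume "\<not> k < s"
          then have "k = s + (k - s)" "k - s \<in> {..d}" using k ds by auto
          then show False using k by blast
        qed
        then show "(-1) ^ k * ?M k * ((x + of_nat (n - k)) gchoose (n - k)) = 0" by (simp add: moment_zero)
      qed
    qed (use ds in auto)
    also have "\<dots> = (\<Sum>i\<le>d. (-1) ^ (s + i) * ?M (s + i) * ((x + of_nat (n - (s + i))) gchoose (n - (s + i))))"
      by (subst sum.reindex) (simp_all add: inj_on_def)
    also have "\<dots> = (\<Sum>i\<le>d. (-1) ^ i * of_int (e i) * ((x + of_nat (d - i)) gchoose (d - i)))"
    proof (rule sum.cong[OF refl])
      fix i assume i: "i \<in> {..d}"
      have "n - (s + i) = d - i" using ds by simp
      then show "(-1) ^ (s + i) * ?M (s + i) * ((x + of_nat (n - (s + i))) gchoose (n - (s + i))) =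
          (-1) ^ i * of_int (e i) * ((x + of_nat (d - i)) gchoose (d - i))"
        using i by (simp add: e_def M power_add)
    qed
    finally show ?thesis .
  qed
  have "hilbert_coeff n N G = e"
    unfolding hilbert_coeff_def dim the_enat.simps Let_def hilbert_poly_eq
  proof (rule the_equality)
    show "(\<forall>i>d. e i = 0) \<and> (\<forall>x. poly hilbert_expansion x =
        (\<Sum>i\<le>d. (-1) ^ i * of_int (e i) * ((x + of_nat (d - i)) gchoose (d - i))))"
      using expand by (simp add: e_def)
    fix e' assume e': "(\<forall>i>d. e' i = 0) \<and> (\<forall>x. poly hilbert_expansion x =
        (\<Sum>i\<le>d. (-1) ^ i * of_int (e' i) * ((x + of_nat (d - i)) gchoose (d - i))))"
    show "e' = e"
    proof
      fix i
      show "e' i = e i"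
      proof (cases "i \<le> d")
        case True
        let ?c = "\<lambda>i. (-1) ^ i * (of_int (e' i) - of_int (e i)) :: rat"
        have "poly (\<Sum>i\<le>d. Polynomial.smult (?c i) (binom_poly (d - i))) x = poly 0 x" for x
        proof -
          have "poly (\<Sum>i\<le>d. Polynomial.smult (?c i) (binom_poly (d - i))) x =
              (\<Sum>i\<le>d. (-1) ^ i * of_int (e' i) * ((x + of_nat (d - i)) gchoose (d - i))) -
              (\<Sum>i\<le>d. (-1) ^ i * of_int (e i) * ((x + of_nat (d - i)) gchoose (d - i)))"
            by (simp add: poly_sum poly_binom_poly sum_subtractf[symmetric] algebra_simps)
          then show ?thesis using e' expand[of x] by simp
        qed
        then have "0 = (\<Sum>i\<le>d. Polynomial.smult (?c i) (binom_poly (d - i)))" by (intro poly_eq_poly_eq_iff[THEN iffD1] ext) simp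
        then have "?c i = 0" by (rule binom_poly_sum_high_coeffs_zero[of _ _ _ 0]) (use True in auto)
        then show ?thesis by simp
      qed (use e' in \<open>simp add: e_def\<close>)
    qed
  qed
  then show ?thesis using i by (simp add: e_def M)
qed

end

end

section \<open>The bounds\<close>

text \<open>In a rational convex combination of pure diagrams all entries are nonnegative, so nothing cancels:
  every pure diagram that occurs has its shifts in the support of the diagram. This also shows that
  the extremal shifts of the diagram increase strictly.\<close>

lemma convex_combination_bounds:
  fixes D :: diagram
  assumes hull: "normalize_diagram D \<in> rat_convex_hull (pure_diagrams s m M)"
    and nonneg: "\<And>i j. D i j \<ge> 0" and D0: "\<And>j. j \<noteq> 0 \<Longrightarrow> D 0 j = 0"
    and J: "finite J" "\<And>i j. i \<le> s \<Longrightarrow> D i j \<noteq> 0 \<Longrightarrow> j \<in> J"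
  defines "lo \<equiv> \<lambda>i. Min {j. D i j \<noteq> 0}" and "hi \<equiv> \<lambda>i. Max {j. D i j \<noteq> 0}"
  shows "D 0 0 * ((\<Prod>k=1..s. of_int (lo k)) / fact (s + i)) * of_int (h_poly s lo i)
      \<le> (-1) ^ s * binomial_moment s D J (s + i)"
    and "(-1) ^ s * binomial_moment s D J (s + i)
      \<le> D 0 0 * ((\<Prod>k=1..s. of_int (hi k)) / fact (s + i)) * of_int (h_poly s hi i)"
proof -
  let ?bound = "\<lambda>d. (\<Prod>k=1..s. of_int (d k)) / fact (s + i) * of_int (h_poly s d i) :: rat"
  obtain P c where P: "finite P" "P \<subseteq> pure_diagrams s m M" and c: "\<And>p. p \<in> P \<Longrightarrow> c p \<ge> (0::rat)"
    "(\<Sum>p\<in>P. c p) = 1" and comb: "normalize_diagram D = (\<lambda>i j. \<Sum>p\<in>P. c p * p i j)"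
    using hull by (auto simp: rat_convex_hull_def)
  have "\<exists>d. strict_mono_on {0..s} d \<and> p = pure_diagram s d" if "p \<in> P" for p
    using P(2) that by (auto simp: pure_diagrams_def)
  then obtain d where d: "\<And>p. p \<in> P \<Longrightarrow> strict_mono_on {0..s} (d p)" "\<And>p. p \<in> P \<Longrightarrow> p = pure_diagram s (d p)"
    by metis
  have entry: "p k j = (if j = d p k then p k (d p k) else 0)" if "p \<in> P" for p k j
    using arg_cong[OF d(2)[OF that], of "\<lambda>q. q k j"] arg_cong[OF d(2)[OF that], of "\<lambda>q. q k (d p k)"]
    by (simp add: pure_diagram_def)
  have pos: "p k (d p k) > 0" if "p \<in> P" "k \<le> s" for p k
    by (subst d(2)[OF that(1)]) (rule pure_diagram_pos[OF d(1)[OF that(1)] that(2)])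
  have p_nonneg: "p k j \<ge> 0" if "p \<in> P" "k \<le> s" for p k j
    using entry[OF that(1), of k j] pos[OF that] by (cases "j = d p k") auto
  have b0: "(\<Sum>j' | D 0 j' \<noteq> 0. D 0 j') = D 0 0"
  proof (cases "D 0 0 = 0")
    case True
    then have "D 0 j = 0" for j using D0 by (cases "j = 0") auto
    then show ?thesis by simp
  next
    case False
    then have "{j. D 0 j \<noteq> 0} = {0}" using D0 by force
    then show ?thesis by simp
  qed
  have nD: "D k j / D 0 0 = (\<Sum>p\<in>P. c p * p k j)" for k j
    using fun_cong[OF fun_cong[OF comb, of k], of j] by (simp add: normalize_diagram_def b0)
  have supp: "D k (d p k) \<noteq> 0" if "p \<in> P" "c p \<noteq> 0" "k \<le> s" for p k
  proof -
    have "0 < c p * p k (d p k)" using c(1)[OF that(1)] that pos[OF that(1,3)] by simp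
    also have "\<dots> \<le> (\<Sum>q\<in>P. c q * q k (d p k))"
      using that c(1) p_nonneg P(1)
      by (intro member_le_sum[where f = "\<lambda>q. c q * q k (d p k)"]) auto
    also have "\<dots> = D k (d p k) / D 0 0" by (rule nD[symmetric])
    finally show ?thesis by auto
  qed
  obtain p0 where p0: "p0 \<in> P" "c p0 \<noteq> 0" using c(2) by (metis sum.neutral zero_neq_one)
  have D00: "D 0 0 > 0"
    using supp[OF p0, of 0] D0 nonneg[of 0 0] by (cases "d p0 0 = 0") (auto simp: less_le)
  have d0: "d p 0 = 0" if "p \<in> P" "c p \<noteq> 0" for p using supp[OF that, of 0] D0 by force
  let ?S = "\<lambda>k. {j. D k j \<noteq> 0}"
  have S: "finite (?S k)" "?S k \<noteq> {}" if "k \<le> s" for k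
    using J(2)[OF that] finite_subset[OF _ J(1), of "?S k"] supp[OF p0 that] by auto
  have attained: "\<exists>p\<in>P. c p \<noteq> 0 \<and> d p k = j" if "D k j \<noteq> 0" for k j
  proof (rule ccontr)
    assume "\<not> ?thesis"
    then have "c p * p k j = 0" if "p \<in> P" for p
      using entry[OF that, of k j] that by (cases "j = d p k") auto
    then have "(\<Sum>p\<in>P. c p * p k j) = 0" by (intro sum.neutral) blast
    then show False using that D00 nD[of k j] by simp
  qed
  have lo_le: "lo k \<le> d p k" and le_hi: "d p k \<le> hi k" if "p \<in> P" "c p \<noteq> 0" "k \<le> s" for p k
    using S(1)[OF that(3)] supp[OF that] by (auto simp: lo_def hi_def)
  have lo: "strict_mono_on {0..s} lo"
  proof (rule strict_mono_onI)
    fix k l assume kl: "k \<in> {0..s}" "l \<in> {0..s}" "k < l"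
    have "lo l \<in> ?S l" unfolding lo_def by (rule Min_in) (use S[of l] kl in auto)
    then obtain p where p: "p \<in> P" "c p \<noteq> 0" "d p l = lo l" using attained by blast
    have "lo k \<le> d p k" using lo_le[OF p(1,2)] kl by simp
    also have "\<dots> < d p l" by (rule strict_mono_onD[OF d(1)[OF p(1)] kl])
    finally show "lo k < lo l" using p(3) by simp
  qed
  have hi: "strict_mono_on {0..s} hi"
  proof (rule strict_mono_onI)
    fix k l assume kl: "k \<in> {0..s}" "l \<in> {0..s}" "k < l"
    have "hi k \<in> ?S k" unfolding hi_def by (rule Max_in) (use S[of k] kl in auto)
    then obtain p where p: "p \<in> P" "c p \<noteq> 0" "d p k = hi k" using attained by blast
    have "hi k < d p l" using strict_mono_onD[OF d(1)[OF p(1)] kl] p(3) by simp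
    also have "\<dots> \<le> hi l" using le_hi[OF p(1,2)] kl by simp
    finally show "hi k < hi l" .
  qed
  have "?S 0 = {0}" using D0 D00 by force
  then have lo0: "lo 0 = 0" and hi0: "hi 0 = 0" by (simp_all add: lo_def hi_def)
  have "binomial_moment s D J (s + i) = (\<Sum>k\<le>s. \<Sum>j\<in>J. (-1) ^ k * (D 0 0 * (\<Sum>p\<in>P. c p * p k j)) * (of_int j gchoose (s + i)))"
    unfolding binomial_moment_def nD[symmetric] using D00 by simp
  also have "\<dots> = (\<Sum>k\<le>s. \<Sum>j\<in>J. \<Sum>p\<in>P. D 0 0 * (c p * ((-1) ^ k * p k j * (of_int j gchoose (s + i)))))"
    by (simp add: sum_distrib_left sum_distrib_right mult_ac)
  also have "\<dots> = (\<Sum>k\<le>s. \<Sum>p\<in>P. \<Sum>j\<in>J. D 0 0 * (c p * ((-1) ^ k * p k j * (of_int j gchoose (s + i)))))"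
    by (rule sum.cong[OF refl], rule sum.swap)
  also have "\<dots> = (\<Sum>p\<in>P. \<Sum>k\<le>s. \<Sum>j\<in>J. D 0 0 * (c p * ((-1) ^ k * p k j * (of_int j gchoose (s + i)))))"
    by (rule sum.swap)
  also have "\<dots> = D 0 0 * (\<Sum>p\<in>P. c p * binomial_moment s p J (s + i))"
    by (simp add: binomial_moment_def sum_distrib_left)
  also have "(\<Sum>p\<in>P. c p * binomial_moment s p J (s + i)) = (\<Sum>p\<in>P. c p * ((-1) ^ s * ?bound (d p)))"
  proof (rule sum.cong[OF refl])
    fix p assume p: "p \<in> P"
    show "c p * binomial_moment s p J (s + i) = c p * ((-1) ^ s * ?bound (d p))"
    proof (cases "c p = 0")
      case False
      have "d p ` {..s} \<subseteq> J" using supp[OF p False] J(2) by auto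
      then show ?thesis
        using binomial_moment_pure[OF d(1)[OF p] d0[OF p False] J(1), of i] d(2)[OF p] by simp
    qed simp
  qed
  finally have "(-1) ^ s * binomial_moment s D J (s + i) =
      ((-1) ^ s * (-1) ^ s) * (D 0 0 * (\<Sum>p\<in>P. c p * ?bound (d p)))"
    by (simp add: sum_distrib_left mult_ac)
  also have "(-1) ^ s * (-1) ^ s = (1 :: rat)" by (simp add: power_add[symmetric])
  finally have moment: "(-1) ^ s * binomial_moment s D J (s + i) = D 0 0 * (\<Sum>p\<in>P. c p * ?bound (d p))" by simp
  have "c p * ?bound lo \<le> c p * ?bound (d p)" "c p * ?bound (d p) \<le> c p * ?bound hi" if p: "p \<in> P" for p
  proof -
    have "?bound lo \<le> ?bound (d p) \<and> ?bound (d p) \<le> ?bound hi" if cp: "c p \<noteq> 0"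
      using shift_bound_mono[OF lo lo0 d(1)[OF p] d0[OF p cp], of i]
        shift_bound_mono[OF d(1)[OF p] d0[OF p cp] hi hi0, of i] lo_le[OF p cp] le_hi[OF p cp] by simp
    then show "c p * ?bound lo \<le> c p * ?bound (d p)" "c p * ?bound (d p) \<le> c p * ?bound hi"
      by (cases "c p = 0"; simp only: mult_left_mono c(1)[OF p] mult_zero_left order.refl simp_thms)+
  qed
  then have "(\<Sum>p\<in>P. c p * ?bound lo) \<le> (\<Sum>p\<in>P. c p * ?bound (d p))"
    "(\<Sum>p\<in>P. c p * ?bound (d p)) \<le> (\<Sum>p\<in>P. c p * ?bound hi)" by (auto intro: sum_mono)
  then have "?bound lo \<le> (\<Sum>p\<in>P. c p * ?bound (d p))" "(\<Sum>p\<in>P. c p * ?bound (d p)) \<le> ?bound hi"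
    by (simp_all only: sum_distrib_right[symmetric] c(2) mult_1)
  then show "D 0 0 * ((\<Prod>k=1..s. of_int (lo k)) / fact (s + i)) * of_int (h_poly s lo i)
      \<le> (-1) ^ s * binomial_moment s D J (s + i)"
    "(-1) ^ s * binomial_moment s D J (s + i)
      \<le> D 0 0 * ((\<Prod>k=1..s. of_int (hi k)) / fact (s + i)) * of_int (h_poly s hi i)"
    unfolding moment mult.assoc[of "D 0 0"] using D00 by (simp_all only: mult_left_mono less_imp_le)
qed

lemma (in graded_mod) betti_resolution:
  assumes "finitely_generated (mpoly_ring n) N" "generated_in_degree n N G 0"
  shows "\<exists>r a A g. graded_resolution n N G r a A g \<and> betti n N G = tor_dim r a A"
proof -
  obtain r0 g0 where g0: "\<And>k. k < r0 \<Longrightarrow> g0 k \<in> G 0" "aug r0 g0 ` vecs n {..<r0} = carrier N"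
    using degree_0_generators[OF assms] by blast
  have "\<exists>r a A. graded_free_resolution n N G r a A"
    by (rule graded_free_resolution_exists[of r0 g0 "\<lambda>_. 0"]) (use g0 in auto)
  then have ex: "\<exists>x. case x of (r, a, A) \<Rightarrow> graded_free_resolution n N G r a A" by auto
  obtain r a A where x: "(SOME (r, a, A). graded_free_resolution n N G r a A) = (r, a, A)"
    using prod_cases3 by blast
  have res: "graded_free_resolution n N G r a A" using someI_ex[OF ex] unfolding x by simp
  have betti: "betti n N G = tor_dim r a A" unfolding betti_def x by simp
  from res[unfolded graded_free_resolution_iff] obtain g where
    A: "\<forall>i. graded_matrix n (r i) (a i) (r (Suc i)) (a (Suc i)) (A i)"
    and kernel: "\<forall>i. {v \<in> vecs n {..<r (Suc i)}. mmul (r i) (r (Suc i)) (A i) v = 0} =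
      mmul (r (Suc i)) (r (Suc (Suc i))) (A (Suc i)) ` vecs n {..<r (Suc (Suc i))}"
    and g: "\<forall>k<r 0. g k \<in> G (a 0 k)" "aug (r 0) g ` vecs n {..<r 0} = carrier N"
    "{v \<in> vecs n {..<r 0}. aug (r 0) g v = \<zero>\<^bsub>N\<^esub>} = mmul (r 0) (r 1) (A 0) ` vecs n {..<r 1}"
    by (elim exE conjE) (rule that)
  have "graded_resolution n N G r a A g"
    by unfold_locales (rule A[rule_format] kernel[rule_format] g(1)[rule_format] g(2,3), assumption?)+
  then show ?thesis using betti by blast
qed

theorem proposition2p3:
  fixes n s :: nat
    and N :: "('k::field mpol, 'm) module"
    and G :: "int \<Rightarrow> 'm set"
  assumes boij_soederberg:
    "\<forall>r\<le>n. \<forall>(m :: nat \<Rightarrow> int) (M :: nat \<Rightarrow> int).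
       strict_mono_on {0..r} m \<longrightarrow> strict_mono_on {0..r} M \<longrightarrow>
       normalized_betti_diagrams TYPE('k) n r m M = rat_convex_hull (pure_diagrams r m M)"
    and "graded_CM_module n s N G"
    and "generated_in_degree n N G 0"
  shows "\<forall>i\<le>n - s.
    of_nat (betti0 n N G) * ((\<Prod>k=1..s. of_int (min_shift n N G k)) / fact (s + i))
        * of_int (h_poly s (min_shift n N G) i) \<le> (of_int (hilbert_coeff n N G i) :: rat) \<and>
    (of_int (hilbert_coeff n N G i) :: rat)
      \<le> of_nat (betti0 n N G) * ((\<Prod>k=1..s. of_int (max_shift n N G k)) / fact (s + i))
        * of_int (h_poly s (max_shift n N G) i)"
proof -
  have gr: "graded_module n N G" and fg: "finitely_generated (mpoly_ring n) N"
    and cm: "cohen_macaulay n N" and codim: "has_codim n N s"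
    using assms(2) by (auto simp: graded_CM_module_def)
  interpret gm: graded_mod n N G by unfold_locales (rule gr)
  obtain r a A g where res: "graded_resolution n N G r a A g" and betti: "betti n N G = tor_dim r a A"
    using gm.betti_resolution[OF fg assms(3)] by blast
  interpret graded_resolution n N G r a A g by (rule res)
  obtain d where dim: "module_dim (mpoly_ring n) N = enat d" and ds: "d + s = n"
    using codim unfolding has_codim_def by (cases "module_dim (mpoly_ring n) N") auto
  have depth: "depth (irrelevant_ideal n) N = enat d" using cm dim by (simp add: cohen_macaulay_def)
  define J where "J = (\<Union>i\<le>Suc s. a i ` {..<r i})"
  have J: "finite J" "\<And>i l. i \<le> Suc s \<Longrightarrow> l < r i \<Longrightarrow> a i l \<in> J" by (auto simp: J_def)
  define D :: diagram where "D = (\<lambda>i j. of_nat (betti n N G i j))"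
  have D_tor: "D = (\<lambda>i j. of_nat (tor_dim r a A i j))" by (simp add: D_def betti)
  have DJ: "j \<in> J" if "i \<le> s" "D i j \<noteq> 0" for i j
  proof -
    have "X i j \<noteq> {}" using that(2) tor_dim_le[of i j] by (auto simp: D_tor)
    then show ?thesis using J(2) that(1) by (fastforce simp: tor_index_def)
  qed
  have Ds: "D i j = 0" if i: "i > s" for i j
  proof -
    obtain i' where "i = Suc i'" "n \<le> i' + d" using i ds by (cases i) auto
    then show ?thesis using tor_dim_above_depth[OF depth] by (simp add: D_tor)
  qed
  have D0: "D 0 j = 0" if "j \<noteq> 0" for j
    using tor_dim_0_generated[OF fg assms(3) that] by (simp add: D_tor)
  \<comment> \<open>A wide window suffices: the pure diagrams that occur are confined by the support of \<open>D\<close>.\<close>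
  obtain C where C: "\<And>j. j \<in> J \<Longrightarrow> \<bar>j\<bar> \<le> C"
    using Max_ge[of "abs ` J"] J(1) by (metis finite_imageI imageI)
  define m M where "m i = int i - int s - C" and "M i = int i + C" for i
  have window: "m i \<le> j" "j \<le> M i" if "i \<le> s" "j \<in> J" for i j
    using C[OF that(2)] that(1) by (auto simp: m_def M_def)
  have space: "D \<in> diagram_space s m M"
    unfolding diagram_space_def
  proof (intro CollectI conjI allI impI)
    fix t assume t: "t < s"
    have "(\<Sum>j=m i..M i. (-1) ^ i * of_int j ^ t * D i j) = (\<Sum>j\<in>J. (-1) ^ i * of_int j ^ t * D i j)"
      if "i \<le> s" for i
      by (rule sum.mono_neutral_right) (use window[OF that] DJ[OF that] in force)+
    then have "(\<Sum>i\<le>s. \<Sum>j=m i..M i. (-1) ^ i * of_int j ^ t * D i j) =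
        (\<Sum>i\<le>s. \<Sum>j\<in>J. (-1) ^ i * of_int j ^ t * D i j)" by simp
    also have "\<dots> = 0"
      by (rule power_moment_zero[OF _ t]) (use moment_zero[OF depth dim ds J] in \<open>simp add: D_tor\<close>)
    finally show "(\<Sum>i\<le>s. \<Sum>j=m i..M i. (-1) ^ i * of_int j ^ t * D i j) = 0" .
  next
    fix i j assume "i > s \<or> j < m i \<or> j > M i"
    then show "D i j = 0" using Ds window DJ by (meson not_le)
  qed
  \<comment> \<open>A copy of \<open>N\<close> whose elements are sets of vectors: an element is replaced by its fibre in \<open>F\<^sub>0\<close>.\<close>
  define \<phi> where "\<phi> x = {v \<in> F 0. gm.aug (r 0) g v = x}" for x :: 'm
  have inj: "inj_on \<phi> (carrier N)"
  proof (rule inj_onI)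
    fix x y assume x: "x \<in> carrier N" and eq: "\<phi> x = \<phi> y"
    have "x \<in> gm.aug (r 0) g ` F 0" unfolding aug_surj by (rule x)
    then obtain v where "v \<in> \<phi> x" "gm.aug (r 0) g v = x" by (auto simp: \<phi>_def)
    then show "x = y" unfolding eq by (simp add: \<phi>_def)
  qed
  have "D \<in> betti_diagrams TYPE('k) n s m M"
    unfolding betti_diagrams_def
    using space transported_graded_CM_module[OF assms(2) inj] transported_betti[OF gr inj] D_def
    by (intro CollectI conjI exI[of _ "transported \<phi> N"] exI[of _ "\<lambda>j. \<phi> ` G j"]) simp_all
  then have "normalize_diagram D \<in> normalized_betti_diagrams TYPE('k) n s m M"
    unfolding normalized_betti_diagrams_def by (rule imageI)
  moreover have "strict_mono_on {0..s} m" "strict_mono_on {0..s} M"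
    by (auto simp: m_def M_def intro!: strict_mono_onI)
  ultimately have hull: "normalize_diagram D \<in> rat_convex_hull (pure_diagrams s m M)"
    using boij_soederberg ds by simp
  have nonneg: "D i j \<ge> 0" for i j by (simp add: D_def)
  have bounds: "D 0 0 * ((\<Prod>k=1..s. of_int (Min {j. D k j \<noteq> 0})) / fact (s + i)) *
        of_int (h_poly s (\<lambda>k. Min {j. D k j \<noteq> 0}) i) \<le> (-1) ^ s * binomial_moment s D J (s + i)"
    "(-1) ^ s * binomial_moment s D J (s + i) \<le> D 0 0 * ((\<Prod>k=1..s. of_int (Max {j. D k j \<noteq> 0})) /
        fact (s + i)) * of_int (h_poly s (\<lambda>k. Max {j. D k j \<noteq> 0}) i)" for i
    by (rule convex_combination_bounds[OF hull nonneg D0 J(1)]; use DJ in blast)+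
  have supp: "{j. D i j \<noteq> 0} = {j. betti n N G i j \<noteq> 0}" for i by (simp add: D_def)
  have shifts: "Min {j. D i j \<noteq> 0} = min_shift n N G i" "Max {j. D i j \<noteq> 0} = max_shift n N G i" for i
    by (simp_all add: supp min_shift_def max_shift_def)
  have "betti0 n N G = betti n N G 0 0"
  proof -
    have "{j. betti n N G 0 j \<noteq> 0} \<subseteq> {0}" using D0 by (force simp: D_def)
    then have "betti0 n N G = (\<Sum>j\<in>{0}. betti n N G 0 j)"
      unfolding betti0_def by (intro sum.mono_neutral_left) auto
    then show ?thesis by simp
  qed
  then have D00: "D 0 0 = of_nat (betti0 n N G)" by (simp add: D_def)
  have e: "of_int (hilbert_coeff n N G i) = (-1) ^ s * binomial_moment s D J (s + i)" if "i \<le> n - s" for i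
    unfolding D_tor by (rule hilbert_coeff_moment[OF depth dim ds J]) (use that ds in auto)
  show ?thesis
  proof (intro allI impI)
    fix i assume "i \<le> n - s"
    then show "of_nat (betti0 n N G) * ((\<Prod>k=1..s. of_int (min_shift n N G k)) / fact (s + i))
        * of_int (h_poly s (min_shift n N G) i) \<le> (of_int (hilbert_coeff n N G i) :: rat) \<and>
      (of_int (hilbert_coeff n N G i) :: rat)
        \<le> of_nat (betti0 n N G) * ((\<Prod>k=1..s. of_int (max_shift n N G k)) / fact (s + i))
        * of_int (h_poly s (max_shift n N G) i)"
      using bounds[of i] unfolding shifts D00 e[OF \<open>i \<le> n - s\<close>] by blast
  qed
qed

end
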